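(* Let $n\ge 3$ and $r\ge 1$ be integers, and let $\pi=\Pi^+(\mathsf{E}^{\otimes r})$ be the set of dominant weights of the $r$th tensor power of the natural representation $\mathsf{E}$ of the simple Lie algebra $\mathfrak{g}=\mathfrak{so}_{2n}$ of type $D_n$. Over $\mathbb{Q}$, the generalized Schur algebra $S(\pi)$ of type $D_n$ (which coincides with the Schur algebra $\mathsf{S}(r)$) is isomorphic with the associative algebra (with $1$) on generators $e_i, f_i, H_i$ ($1\le i\le n$) and with relations (for all $i,j$, except where restricted) \begin{enumerate} \item[(D1)] $H_iH_j=H_jH_i$; \item[(D2)] $e_if_j-f_je_i=\delta_{ij}(H_i-H_{i+1})$ if $i<n$, and $e_if_j-f_je_i=\delta_{ij}(H_{n-1}+H_n)$ if $i=n$; \item[(D3)] $H_ie_j-e_jH_i=(\varepsilon_i,\alpha_j)e_j$ and $H_if_j-f_jH_i=-(\varepsilon_i,\alpha_j)f_j$; \item[(D4)] $\sum_{s=0}^{1-a_{ij}}(-1)^s\binom{1-a_{ij}}{s}e_i^{1-a_{ij}-s}e_je_i^s=0$ for $i\ne j$; \item[(D5)] $\sum_{s=0}^{1-a_{ij}}(-1)^s\binom{1-a_{ij}}{s}f_i^{1-a_{ij}-s}f_jf_i^s=0$ for $i\ne j$; \item[(D6)] $(H_i+r)(H_i+r-1)(H_i+r-2)\cdots(H_i-r)=0$; \item[(D7)] $(J+r)(J+r-2)(J+r-4)\cdots(J-r+2)(J-r)=0$, \end{enumerate} where $J=\pm H_1\pm H_2\pm\cdots\pm H_n$ varies over all possible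 sign choices.
   Context: Everything is over $\mathbb{Q}$. Let $m=2n$ and let $\mathfrak{g}=\mathfrak{so}_{2n}\subset\mathfrak{gl}_m$ be the Lie algebra preserving the bilinear form on $\mathsf{E}=\mathbb{Q}^m$ with block matrix $\begin{pmatrix} 0 & I \\ I & 0 \end{pmatrix}$ ($I$ the $n\times n$ identity). $\mathsf{E}$ is the natural representation. The diagonal Cartan subalgebra $\mathfrak{h}$ has basis $H_i=e_{i,i}-e_{n+i,n+i}$ ($1\le i\le n$, where $e_{i,j}$ are matrix units); $\varepsilon_1,\dots,\varepsilon_n$ is the dual basis of $\mathfrak{h}^*$, and $(\ ,\ )$ is the bilinear form on $\mathfrak{h}^*$ with $(\varepsilon_i,\varepsilon_j)=\delta_{ij}$. The simple roots are $\alpha_i=\varepsilon_i-\varepsilon_{i+1}$ for $i<n$ and $\alpha_n=\varepsilon_{n-1}+\varepsilon_n$; the Cartan matrix is $a_{ij}=2(\alpha_i,\alpha_j)/(\alpha_i,\alpha_i)$. The dominance order on integral weights is: $\lambda\le\mu$ iff $\mu-\lambda\in\mathbb{N}\alpha_1+\cdots+\mathbb{N}\alpha_n$. A set $\pi$ of dominant integral weights is saturated if $\lambda\in\pi$, $\mu$ dominant and $\mu\le\lambda$ imply $\mu\in\pi$. For a finite saturated set $\pi$, the generalized Schur algebra is $S(\pi)=\mathfrak{U}(\mathfrak{g})/\mathcal{I}$, where $\mathfrak{U}(\mathfrak{g})$ is the universal enveloping algebra and $\mathcal{I}$ is the ideal of all elements annihilating every simple $\mathfrak{U}(\mathfrak{g})$-module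 of highest weight belonging to $\pi$. The set $\Pi^+(\mathsf{E}^{\otimes r})$ of all dominant weights occurring in $\mathsf{E}^{\otimes r}$ is saturated. The (classical) Schur algebra $\mathsf{S}(r)$ is the image of the representation $\mathfrak{U}(\mathfrak{g})\to\operatorname{End}(\mathsf{E}^{\otimes r})$; that it coincides with $S(\pi)$ means that the kernel of this representation equals $\mathcal{I}$. *)

theory Defs
  imports
    "HOL-Library.Poly_Mapping"
    "HOL-Algebra.QuotRing"
    "HOL-Algebra.Module"
    "Jordan_Normal_Form.Matrix"
begin

section \<open>Algebras over the rationals by generators and relations\<close>

datatype 'a free_monoid = Word (letters: "'a list")

instantiation free_monoid :: (type) monoid_add
begin

definition zero_free_monoid :: "'a free_monoid" where
  "0 = Word []"

definition plus_free_monoid :: "'a free_monoid \<Rightarrow> 'a free_monoid \<Rightarrow> 'a free_monoid" where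
  "v + w = Word (letters v @ letters w)"

instance
  by standard (simp_all add: zero_free_monoid_def plus_free_monoid_def)

end

text \<open>With concatenation written additively, the finitely supported functions
  \<^typ>\<open>'a free_monoid \<Rightarrow>\<^sub>0 rat\<close> with the convolution product of
  \<^theory>\<open>HOL-Library.Poly_Mapping\<close> form the monoid algebra of the free monoid, that is, the
  free associative unital algebra.  Records of type \<^typ>\<open>(rat, 'a) module\<close>
  carry a ring structure together with multiplication by rational scalars.\<close>

definition const :: "rat \<Rightarrow> ('a free_monoid \<Rightarrow>\<^sub>0 rat)" where
  "const c = Poly_Mapping.single 0 c"

definition var :: "'a \<Rightarrow> ('a free_monoid \<Rightarrow>\<^sub>0 rat)" where
  "var x = Poly_Mapping.single (Word [x]) 1"

definition free_algebra :: "'a set \<Rightarrow> (rat, 'a free_monoid \<Rightarrow>\<^sub>0 rat) module" where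
  "free_algebra S =
    \<lparr>carrier = {p. \<forall>w\<in>Poly_Mapping.keys p. set (letters w) \<subseteq> S},
     monoid.mult = (*), one = 1, zero = 0, add = (+), smult = (\<lambda>c p. const c * p)\<rparr>"

definition quot_alg :: "('k, 'a) module \<Rightarrow> 'a set \<Rightarrow> ('k, 'a set) module" where
  "quot_alg A I =
    \<lparr>carrier = carrier (A Quot I), monoid.mult = monoid.mult (A Quot I), one = one (A Quot I),
     zero = zero (A Quot I), add = add (A Quot I),
     smult = (\<lambda>c X. \<Union>x\<in>X. I +>\<^bsub>A\<^esub> (c \<odot>\<^bsub>A\<^esub> x))\<rparr>"

definition presented_algebra ::
    "'a set \<Rightarrow> ('a free_monoid \<Rightarrow>\<^sub>0 rat) set \<Rightarrow> (rat, ('a free_monoid \<Rightarrow>\<^sub>0 rat) set) module" where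
  "presented_algebra S R = quot_alg (free_algebra S) (Idl\<^bsub>free_algebra S\<^esub> R)"

definition alg_iso :: "(rat, 'a) module \<Rightarrow> (rat, 'b) module \<Rightarrow> ('a \<Rightarrow> 'b) set" where
  "alg_iso A B =
    {h \<in> ring_iso A B. \<forall>c. \<forall>x\<in>carrier A. h (c \<odot>\<^bsub>A\<^esub> x) = c \<odot>\<^bsub>B\<^esub> h x}"


section \<open>Left modules over a noncommutative ring\<close>

text \<open>The locale \<^locale>\<open>module\<close> requires a commutative base ring; the laws are the same.\<close>

locale left_module = R?: ring + M?: abelian_group M for M (structure) +
  assumes smult_closed [simp, intro]:
      "\<lbrakk>a \<in> carrier R; x \<in> carrier M\<rbrakk> \<Longrightarrow> a \<odot>\<^bsub>M\<^esub> x \<in> carrier M"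
    and smult_l_distr:
      "\<lbrakk>a \<in> carrier R; b \<in> carrier R; x \<in> carrier M\<rbrakk> \<Longrightarrow>
        (a \<oplus> b) \<odot>\<^bsub>M\<^esub> x = a \<odot>\<^bsub>M\<^esub> x \<oplus>\<^bsub>M\<^esub> b \<odot>\<^bsub>M\<^esub> x"
    and smult_r_distr:
      "\<lbrakk>a \<in> carrier R; x \<in> carrier M; y \<in> carrier M\<rbrakk> \<Longrightarrow>
        a \<odot>\<^bsub>M\<^esub> (x \<oplus>\<^bsub>M\<^esub> y) = a \<odot>\<^bsub>M\<^esub> x \<oplus>\<^bsub>M\<^esub> a \<odot>\<^bsub>M\<^esub> y"
    and smult_assoc1:
      "\<lbrakk>a \<in> carrier R; b \<in> carrier R; x \<in> carrier M\<rbrakk> \<Longrightarrow>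
        (a \<otimes> b) \<odot>\<^bsub>M\<^esub> x = a \<odot>\<^bsub>M\<^esub> (b \<odot>\<^bsub>M\<^esub> x)"
    and smult_one [simp]:
      "x \<in> carrier M \<Longrightarrow> \<one> \<odot>\<^bsub>M\<^esub> x = x"

definition simple_module :: "('r, 'k) ring_scheme \<Rightarrow> ('r, 'v) module \<Rightarrow> bool" where
  "simple_module R M \<longleftrightarrow>
     left_module R M \<and> carrier M \<noteq> {\<zero>\<^bsub>M\<^esub>} \<and>
     (\<forall>N. submodule N R M \<longrightarrow> N = {\<zero>\<^bsub>M\<^esub>} \<or> N = carrier M)"

text \<open>This is the kernel of the representation of \<open>R\<close> by endomorphisms of \<open>M\<close>.\<close>

definition rep_kernel :: "('r, 'k) ring_scheme \<Rightarrow> ('r, 'v) module \<Rightarrow> 'r set" where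
  "rep_kernel R M = {u \<in> carrier R. \<forall>x\<in>carrier M. u \<odot>\<^bsub>M\<^esub> x = \<zero>\<^bsub>M\<^esub>}"


section \<open>The Lie algebra and its weights\<close>

text \<open>All indices start at 0: \<open>e\<^sub>i, f\<^sub>i, H\<^sub>i, \<epsilon>\<^sub>i, \<alpha>\<^sub>i\<close> have \<open>i < n\<close>, and
  rows and columns of matrices are numbered by \<open>{..<2 * n}\<close>.\<close>

definition so_form :: "nat \<Rightarrow> rat mat" where
  "so_form n = four_block_mat (0\<^sub>m n n) (1\<^sub>m n) (1\<^sub>m n) (0\<^sub>m n n)"

definition so_even :: "nat \<Rightarrow> rat mat set" where
  "so_even n = {X \<in> carrier_mat (2 * n) (2 * n).
     \<forall>v\<in>carrier_vec (2 * n). \<forall>w\<in>carrier_vec (2 * n).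
       (X *\<^sub>v v) \<bullet> (so_form n *\<^sub>v w) + v \<bullet> (so_form n *\<^sub>v (X *\<^sub>v w)) = 0}"

definition mat_unit :: "nat \<Rightarrow> nat \<Rightarrow> nat \<Rightarrow> rat mat" where
  "mat_unit m i j = mat m m (\<lambda>(a, b). if a = i \<and> b = j then 1 else 0)"

definition cartan_H :: "nat \<Rightarrow> nat \<Rightarrow> rat mat" where
  "cartan_H n i = mat_unit (2 * n) i i - mat_unit (2 * n) (n + i) (n + i)"

text \<open>A weight \<open>\<lambda> = \<Sum>\<^sub>i \<lambda>\<^sub>i \<epsilon>\<^sub>i\<close> is a vector in \<^term>\<open>carrier_vec n :: rat vec set\<close>, with
  \<open>\<lambda>(H\<^sub>i) = \<lambda> $ i\<close>; the form on weights is the dot product \<^const>\<open>scalar_prod\<close>.\<close>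

definition simple_root :: "nat \<Rightarrow> nat \<Rightarrow> rat vec" where
  "simple_root n i =
    (if i + 1 < n then unit_vec n i - unit_vec n (i + 1)
     else unit_vec n (n - 2) + unit_vec n (n - 1))"

definition cartan_entry :: "nat \<Rightarrow> nat \<Rightarrow> nat \<Rightarrow> rat" where
  "cartan_entry n i j =
     2 * (simple_root n i \<bullet> simple_root n j) / (simple_root n i \<bullet> simple_root n i)"

definition dominance_le :: "nat \<Rightarrow> rat vec \<Rightarrow> rat vec \<Rightarrow> bool" where
  "dominance_le n \<mu> \<nu> \<longleftrightarrow>
     (\<exists>c :: nat \<Rightarrow> nat. \<forall>k<n. \<nu> $ k - \<mu> $ k = (\<Sum>i<n. of_nat (c i) * simple_root n i $ k))"

definition dominant_integral :: "nat \<Rightarrow> rat vec \<Rightarrow> bool" where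
  "dominant_integral n \<mu> \<longleftrightarrow>
     \<mu> \<in> carrier_vec n \<and>
     (\<forall>i<n. 2 * (\<mu> \<bullet> simple_root n i) / (simple_root n i \<bullet> simple_root n i) \<in> \<nat>)"

definition root_space :: "nat \<Rightarrow> rat vec \<Rightarrow> rat mat set" where
  "root_space n \<beta> =
     {X \<in> so_even n. \<forall>i<n. cartan_H n i * X - X * cartan_H n i = \<beta> $ i \<cdot>\<^sub>m X}"

text \<open>The root spaces of positive roots: the nonzero nonnegative combinations of the simple roots
  that are not roots contribute only the zero matrix.\<close>

definition positive_root_vectors :: "nat \<Rightarrow> rat mat set" where
  "positive_root_vectors n =
     (\<Union>\<beta>\<in>{\<beta> \<in> carrier_vec n. \<beta> \<noteq> 0\<^sub>v n \<and> dominance_le n (0\<^sub>v n) \<beta>}. root_space n \<beta>)"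


section \<open>The universal enveloping algebra\<close>

text \<open>The tensor algebra of a vector space \<open>L\<close> of matrices is the free algebra on the set
  \<open>L\<close> modulo linearity of \<^const>\<open>var\<close>; imposing also the commutator relations gives the
  universal enveloping algebra.\<close>

definition uea_rels :: "rat mat set \<Rightarrow> (rat mat free_monoid \<Rightarrow>\<^sub>0 rat) set" where
  "uea_rels L =
     {var (X + Y) - (var X + var Y) | X Y. X \<in> L \<and> Y \<in> L} \<union>
     {var (c \<cdot>\<^sub>m X) - const c * var X | c X. X \<in> L} \<union>
     {var X * var Y - var Y * var X - var (X * Y - Y * X) | X Y. X \<in> L \<and> Y \<in> L}"

type_synonym uea_elem = "(rat mat free_monoid \<Rightarrow>\<^sub>0 rat) set"

definition uea :: "nat \<Rightarrow> (rat, uea_elem) module" where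
  "uea n = presented_algebra (so_even n) (uea_rels (so_even n))"

definition uea_incl :: "nat \<Rightarrow> rat mat \<Rightarrow> uea_elem" where
  "uea_incl n X =
     (Idl\<^bsub>free_algebra (so_even n)\<^esub> (uea_rels (so_even n))) +>\<^bsub>free_algebra (so_even n)\<^esub> var X"


section \<open>Weights of modules and generalized Schur algebras\<close>

definition weight_vector :: "nat \<Rightarrow> (uea_elem, 'v) module \<Rightarrow> rat vec \<Rightarrow> 'v \<Rightarrow> bool" where
  "weight_vector n M \<mu> v \<longleftrightarrow>
     v \<in> carrier M \<and> v \<noteq> \<zero>\<^bsub>M\<^esub> \<and>
     (\<forall>i<n. uea_incl n (cartan_H n i) \<odot>\<^bsub>M\<^esub> v = ((\<mu> $ i) \<odot>\<^bsub>uea n\<^esub> \<one>\<^bsub>uea n\<^esub>) \<odot>\<^bsub>M\<^esub> v)"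

definition simple_of_highest_weight :: "nat \<Rightarrow> (uea_elem, 'v) module \<Rightarrow> rat vec \<Rightarrow> bool" where
  "simple_of_highest_weight n M \<mu> \<longleftrightarrow>
     simple_module (uea n) M \<and>
     (\<exists>v. weight_vector n M \<mu> v \<and>
          (\<forall>X\<in>positive_root_vectors n. uea_incl n X \<odot>\<^bsub>M\<^esub> v = \<zero>\<^bsub>M\<^esub>))"

text \<open>A bound variable has a fixed type, so the modules range over those whose carrier consists
  of sets of elements of the enveloping algebra.  Every simple module is a quotient of the
  enveloping algebra by a left ideal, hence isomorphic to one of these; lemma
  \<open>schur_ideal_annihilates\<close> below shows that the definition does not depend on this choice.\<close>

definition schur_ideal :: "nat \<Rightarrow> rat vec set \<Rightarrow> uea_elem set" where
  "schur_ideal n \<pi> =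
     {u \<in> carrier (uea n). \<forall>(M :: (uea_elem, uea_elem set) module) \<mu>.
        \<mu> \<in> \<pi> \<longrightarrow> simple_of_highest_weight n M \<mu> \<longrightarrow> u \<in> rep_kernel (uea n) M}"

definition gen_schur_algebra :: "nat \<Rightarrow> rat vec set \<Rightarrow> (rat, uea_elem set) module" where
  "gen_schur_algebra n \<pi> = quot_alg (uea n) (schur_ideal n \<pi>)"


section \<open>Tensor powers of the natural representation\<close>

text \<open>An element of the tensor power is the family of its coordinates with respect to the basis
  \<open>e\<^sub>w = e\<^bsub>w ! 0\<^esub> \<otimes> \<dots> \<otimes> e\<^bsub>w ! (r - 1)\<^esub>\<close>.\<close>

definition tensor_index :: "nat \<Rightarrow> nat \<Rightarrow> nat list set" where
  "tensor_index n r = {w. length w = r \<and> set w \<subseteq> {..<2 * n}}"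

text \<open>The coordinate form of \<open>X (v\<^sub>1 \<otimes> \<dots> \<otimes> v\<^sub>r) = \<Sum>\<^sub>k v\<^sub>1 \<otimes> \<dots> \<otimes> X v\<^sub>k \<otimes> \<dots> \<otimes> v\<^sub>r\<close>.\<close>

definition tensor_act :: "nat \<Rightarrow> nat \<Rightarrow> rat mat \<Rightarrow> (nat list \<Rightarrow> rat) \<Rightarrow> (nat list \<Rightarrow> rat)" where
  "tensor_act n r X t =
     (\<lambda>w. if w \<in> tensor_index n r
          then \<Sum>k<r. \<Sum>j<2 * n. X $$ (w ! k, j) * t (w[k := j]) else 0)"

definition free_tensor_act ::
    "nat \<Rightarrow> nat \<Rightarrow> (rat mat free_monoid \<Rightarrow>\<^sub>0 rat) \<Rightarrow> (nat list \<Rightarrow> rat) \<Rightarrow> (nat list \<Rightarrow> rat)" where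
  "free_tensor_act n r p t =
     (\<lambda>w. \<Sum>W\<in>Poly_Mapping.keys p.
        Poly_Mapping.lookup p W * foldr (tensor_act n r) (letters W) t w)"

text \<open>An element of the enveloping algebra is a coset; all its representatives act in the same
  way, as shown in \<open>free_tensor_act_coset\<close> below.\<close>

definition tensor_power :: "nat \<Rightarrow> nat \<Rightarrow> (uea_elem, nat list \<Rightarrow> rat) module" where
  "tensor_power n r =
    \<lparr>carrier = {t. \<forall>w. t w \<noteq> 0 \<longrightarrow> w \<in> tensor_index n r},
     monoid.mult = undefined, one = undefined,
     zero = (\<lambda>_. 0), add = (\<lambda>s t w. s w + t w),
     smult = (\<lambda>u t. the_elem ((\<lambda>p. free_tensor_act n r p t) ` u))\<rparr>"

definition tensor_dominant_weights :: "nat \<Rightarrow> nat \<Rightarrow> rat vec set" where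
  "tensor_dominant_weights n r =
     {\<mu>. dominant_integral n \<mu> \<and> (\<exists>t. weight_vector n (tensor_power n r) \<mu> t)}"


section \<open>The presentation\<close>

datatype chevalley_gen = Gen_e nat | Gen_f nat | Gen_H nat

type_synonym free_elem = "chevalley_gen free_monoid \<Rightarrow>\<^sub>0 rat"

definition chevalley_gens :: "nat \<Rightarrow> chevalley_gen set" where
  "chevalley_gens n = Gen_e ` {..<n} \<union> Gen_f ` {..<n} \<union> Gen_H ` {..<n}"

abbreviation ge :: "nat \<Rightarrow> free_elem" where "ge i \<equiv> var (Gen_e i)"
abbreviation gf :: "nat \<Rightarrow> free_elem" where "gf i \<equiv> var (Gen_f i)"
abbreviation gH :: "nat \<Rightarrow> free_elem" where "gH i \<equiv> var (Gen_H i)"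

definition rels_D1 :: "nat \<Rightarrow> free_elem set" where
  "rels_D1 n = {gH i * gH j - gH j * gH i | i j. i < n \<and> j < n}"

definition rels_D2 :: "nat \<Rightarrow> free_elem set" where
  "rels_D2 n =
    {ge i * gf j - gf j * ge i - (if i = j then gH i - gH (i + 1) else 0) | i j.
       i < n - 1 \<and> j < n} \<union>
    {ge i * gf j - gf j * ge i - (if i = j then gH (n - 2) + gH (n - 1) else 0) | i j.
       i = n - 1 \<and> j < n}"

definition rels_D3 :: "nat \<Rightarrow> free_elem set" where
  "rels_D3 n =
    {gH i * ge j - ge j * gH i - const (unit_vec n i \<bullet> simple_root n j) * ge j | i j.
       i < n \<and> j < n} \<union>
    {gH i * gf j - gf j * gH i + const (unit_vec n i \<bullet> simple_root n j) * gf j | i j.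
       i < n \<and> j < n}"

definition serre :: "nat \<Rightarrow> (nat \<Rightarrow> free_elem) \<Rightarrow> nat \<Rightarrow> nat \<Rightarrow> free_elem" where
  "serre n x i j =
     (let m = nat \<lfloor>1 - cartan_entry n i j\<rfloor>
      in \<Sum>s=0..m. (-1) ^ s * of_nat (m choose s) * x i ^ (m - s) * x j * x i ^ s)"

definition rels_D4 :: "nat \<Rightarrow> free_elem set" where
  "rels_D4 n = {serre n ge i j | i j. i < n \<and> j < n \<and> i \<noteq> j}"

definition rels_D5 :: "nat \<Rightarrow> free_elem set" where
  "rels_D5 n = {serre n gf i j | i j. i < n \<and> j < n \<and> i \<noteq> j}"

definition rels_D6 :: "nat \<Rightarrow> nat \<Rightarrow> free_elem set" where
  "rels_D6 n r =
    {prod_list (map (\<lambda>k. gH i + of_int (int r - int k)) [0..<2 * r + 1]) | i. i < n}"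

definition rels_D7 :: "nat \<Rightarrow> nat \<Rightarrow> free_elem set" where
  "rels_D7 n r =
    {prod_list (map (\<lambda>k. J + of_int (int r - 2 * int k)) [0..<r + 1]) | J.
       \<exists>\<sigma> :: nat \<Rightarrow> int. (\<forall>i<n. \<sigma> i \<in> {1, -1}) \<and> J = (\<Sum>i<n. of_int (\<sigma> i) * gH i)}"

definition type_D_presentation ::
    "nat \<Rightarrow> nat \<Rightarrow> (rat, free_elem set) module" where
  "type_D_presentation n r =
     presented_algebra (chevalley_gens n)
       (rels_D1 n \<union> rels_D2 n \<union> rels_D3 n \<union> rels_D4 n \<union> rels_D5 n \<union> rels_D6 n r \<union> rels_D7 n r)"

section \<open>Well-definedness of the constructions\<close>


lemma ring_free_algebra: "ring (free_algebra S)"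
proof (rule ringI)
  show "abelian_group (free_algebra S)"
  proof (rule abelian_groupI)
    fix p q assume "p \<in> carrier (free_algebra S)" "q \<in> carrier (free_algebra S)"
    then show "p \<oplus>\<^bsub>free_algebra S\<^esub> q \<in> carrier (free_algebra S)"
      using keys_add[of p q] by (auto simp: free_algebra_def)
  next
    fix p assume "p \<in> carrier (free_algebra S)"
    then show "\<exists>q\<in>carrier (free_algebra S). q \<oplus>\<^bsub>free_algebra S\<^esub> p = \<zero>\<^bsub>free_algebra S\<^esub>"
      by (intro bexI[of _ "- p"]) (auto simp: free_algebra_def)
  qed (auto simp: free_algebra_def algebra_simps)
  show "Group.monoid (free_algebra S)"
  proof (rule monoidI)
    fix p q assume "p \<in> carrier (free_algebra S)" "q \<in> carrier (free_algebra S)"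
    then show "p \<otimes>\<^bsub>free_algebra S\<^esub> q \<in> carrier (free_algebra S)"
      using keys_mult[of p q] by (fastforce simp: free_algebra_def plus_free_monoid_def)
  qed (auto simp: free_algebra_def algebra_simps zero_free_monoid_def)
qed (auto simp: free_algebra_def algebra_simps)

lemma free_algebra_ops:
  "p \<oplus>\<^bsub>free_algebra S\<^esub> q = p + q" "p \<otimes>\<^bsub>free_algebra S\<^esub> q = p * q"
  "\<zero>\<^bsub>free_algebra S\<^esub> = 0" "\<one>\<^bsub>free_algebra S\<^esub> = 1" "c \<odot>\<^bsub>free_algebra S\<^esub> p = const c * p"
  by (simp_all add: free_algebra_def)

lemma var_carrier: "x \<in> S \<Longrightarrow> var x \<in> carrier (free_algebra S)"
  by (auto simp: var_def free_algebra_def)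

lemma const_carrier: "const c \<in> carrier (free_algebra S)"
  by (auto simp: const_def free_algebra_def zero_free_monoid_def)

definition tensors :: "nat \<Rightarrow> nat \<Rightarrow> (nat list \<Rightarrow> rat) set" where
  "tensors n r = {t. \<forall>w. t w \<noteq> 0 \<longrightarrow> w \<in> tensor_index n r}"

lemma tensors_carrier: "carrier (tensor_power n r) = tensors n r"
  by (simp add: tensors_def tensor_power_def)

lemma tensor_act_closed: "tensor_act n r X t \<in> tensors n r"
  by (auto simp: tensor_act_def tensors_def)

lemma tensor_act_lin:
  "tensor_act n r X (\<lambda>w. \<Sum>i\<in>I. c i * t i w) = (\<lambda>w. \<Sum>i\<in>I. c i * tensor_act n r X (t i) w)"
proof
  fix w
  have "(\<Sum>k<r. \<Sum>j<2 * n. X $$ (w ! k, j) * (\<Sum>i\<in>I. c i * t i (w[k := j])))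
      = (\<Sum>k<r. \<Sum>j<2 * n. \<Sum>i\<in>I. c i * (X $$ (w ! k, j) * t i (w[k := j])))"
    by (simp add: sum_distrib_left mult_ac)
  also have "\<dots> = (\<Sum>i\<in>I. \<Sum>k<r. \<Sum>j<2 * n. c i * (X $$ (w ! k, j) * t i (w[k := j])))"
    by (simp add: sum.swap[of _ I])
  finally show "tensor_act n r X (\<lambda>w. \<Sum>i\<in>I. c i * t i w) w
      = (\<Sum>i\<in>I. c i * tensor_act n r X (t i) w)"
    by (simp add: tensor_act_def sum_distrib_left)
qed

lemma foldr_closed: "t \<in> tensors n r \<Longrightarrow> foldr (tensor_act n r) xs t \<in> tensors n r"
  by (induction xs) (auto simp: tensor_act_closed)

lemma foldr_lin:
  "foldr (tensor_act n r) xs (\<lambda>w. \<Sum>i\<in>I. c i * t i w)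
     = (\<lambda>w. \<Sum>i\<in>I. c i * foldr (tensor_act n r) xs (t i) w)"
  by (induction xs) (simp_all add: tensor_act_lin)

lemma foldr_add:
  "foldr (tensor_act n r) xs (\<lambda>w. s w + t w)
     = (\<lambda>w. foldr (tensor_act n r) xs s w + foldr (tensor_act n r) xs t w)"
  using foldr_lin[of n r xs "\<lambda>_. 1" "\<lambda>b. if b then s else t" UNIV]
  by (simp add: UNIV_bool add.commute)

lemma fta_superset:
  assumes "finite K" "Poly_Mapping.keys p \<subseteq> K"
  shows "free_tensor_act n r p t
     = (\<lambda>w. \<Sum>W\<in>K. Poly_Mapping.lookup p W * foldr (tensor_act n r) (letters W) t w)"
  unfolding free_tensor_act_def
  by (intro ext sum.mono_neutral_left) (use assms in \<open>auto simp: in_keys_iff\<close>)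

lemma fta_closed:
  assumes "t \<in> tensors n r" shows "free_tensor_act n r p t \<in> tensors n r"
proof -
  have "foldr (tensor_act n r) xs t w = 0" if "w \<notin> tensor_index n r" for xs w
    using foldr_closed[OF assms, of xs] that by (auto simp: tensors_def)
  then show ?thesis
    by (force simp: tensors_def free_tensor_act_def intro: sum.neutral)
qed

lemma fta_add:
  "free_tensor_act n r (p + q) t = (\<lambda>w. free_tensor_act n r p t w + free_tensor_act n r q t w)"
  using keys_add[of p q]
  by (simp add: fta_superset[of "Poly_Mapping.keys p \<union> Poly_Mapping.keys q"]
      lookup_add distrib_right sum.distrib)

lemma fta_uminus: "free_tensor_act n r (- p) t = (\<lambda>w. - free_tensor_act n r p t w)"
  by (simp add: free_tensor_act_def sum_negf)

lemma fta_diff: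
  "free_tensor_act n r (p - q) t = (\<lambda>w. free_tensor_act n r p t w - free_tensor_act n r q t w)"
  using fta_add[of n r p "- q" t] by (simp add: fta_uminus)

lemma fta_zero: "free_tensor_act n r 0 t = (\<lambda>_. 0)"
  by (simp add: free_tensor_act_def)

lemma fta_single:
  "free_tensor_act n r (Poly_Mapping.single W c) t
     = (\<lambda>w. c * foldr (tensor_act n r) (letters W) t w)"
  using fta_superset[of "{W}" "Poly_Mapping.single W c" n r t] by auto

lemma fta_add_right:
  "free_tensor_act n r p (\<lambda>w. s w + t w)
     = (\<lambda>w. free_tensor_act n r p s w + free_tensor_act n r p t w)"
  by (simp add: free_tensor_act_def foldr_add distrib_left sum.distrib)

lemma fta_zero_right: "free_tensor_act n r p (\<lambda>_. 0) = (\<lambda>_. 0)"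
  using fta_add_right[of n r p "\<lambda>_. 0" "\<lambda>_. 0"] by (simp add: fun_eq_iff)

lemma poly_mapping_add_induct:
  fixes p :: "'a \<Rightarrow>\<^sub>0 'b :: comm_monoid_add"
  assumes "P 0" "\<And>W c. P (Poly_Mapping.single W c)" "\<And>p q. P p \<Longrightarrow> P q \<Longrightarrow> P (p + q)"
  shows "P p"
proof (induction p rule: update_induct)
  case const
  show ?case by (fact assms)
next
  case (update f a b)
  have "Poly_Mapping.update a b f = f + Poly_Mapping.single a b"
    by (rule poly_mapping_eqI)
      (use update in \<open>auto simp: lookup_update lookup_add lookup_single in_keys_iff when_def\<close>)
  with update assms show ?case by metis
qed

lemma fta_mult:
  "free_tensor_act n r (p * q) t = free_tensor_act n r p (free_tensor_act n r q t)"
proof (induction p rule: poly_mapping_add_induct)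
  case 1
  then show ?case by (simp add: fta_zero)
next
  case (3 p1 p2)
  then show ?case by (simp add: fta_add distrib_right)
next
  case (2 W c)
  show ?case
  proof (induction q rule: poly_mapping_add_induct)
    case 1
    then show ?case by (simp add: fta_zero fta_zero_right)
  next
    case (3 q1 q2)
    then show ?case by (simp add: fta_add distrib_left fta_add_right)
  next
    case (2 V d)
    show ?case
      using foldr_lin[of n r "letters W" "\<lambda>_. d" "\<lambda>_. foldr (tensor_act n r) (letters V) t" "{()}"]
      by (simp add: fta_single mult_single plus_free_monoid_def mult.assoc)
  qed
qed

lemma fta_var: "free_tensor_act n r (var X) t = tensor_act n r X t"
  by (simp add: var_def fta_single)

lemma fta_const: "free_tensor_act n r (const c) t = (\<lambda>w. c * t w)"
  by (simp add: const_def fta_single zero_free_monoid_def)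

lemma fta_one: "free_tensor_act n r 1 t = t"
  using fta_const[of n r 1 t] by (simp add: const_def)

lemma tensor_act_commutator:
  assumes X: "X \<in> carrier_mat (2 * n) (2 * n)" and Y: "Y \<in> carrier_mat (2 * n) (2 * n)"
  shows "tensor_act n r X (tensor_act n r Y t) w - tensor_act n r Y (tensor_act n r X t) w
       = tensor_act n r (X * Y - Y * X) t w"
proof (cases "w \<in> tensor_index n r")
  case False
  then show ?thesis by (simp add: tensor_act_def)
next
  case True
  then have len: "length w = r" and w: "\<And>k. k < r \<Longrightarrow> w ! k < 2 * n"
    unfolding tensor_index_def using nth_mem by fastforce+
  have upd: "w[k := j] \<in> tensor_index n r" if "j < 2 * n" for k j
    using True set_update_subset_insert[of w k j] that by (auto simp: tensor_index_def)
  define D where "D Z k = (\<Sum>m<2 * n. Z $$ (w ! k, m) * t (w[k := m]))" for Z :: "rat mat" and k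
  define G where "G X Y k l =
      (\<Sum>j<2 * n. \<Sum>m<2 * n. X $$ (w ! k, j) * Y $$ (w ! l, m) * t (w[k := j, l := m]))"
    for X Y :: "rat mat" and k l
  have G_sym: "G X Y k l = G Y X l k" if "k \<noteq> l" for X Y k l
    unfolding G_def using that
    by (subst sum.swap) (simp add: mult_ac list_update_swap)
  have main: "tensor_act n r X (tensor_act n r Y t) w
      = (\<Sum>k<r. \<Sum>l<r. if l = k then D (X * Y) k else G X Y k l)"
    if X: "X \<in> carrier_mat (2 * n) (2 * n)" and Y: "Y \<in> carrier_mat (2 * n) (2 * n)" for X Y
  proof -
    have "tensor_act n r X (tensor_act n r Y t) w
      = (\<Sum>k<r. \<Sum>j<2 * n. \<Sum>l<r. \<Sum>m<2 * n.
            X $$ (w ! k, j) * (Y $$ (w[k := j] ! l, m) * t (w[k := j, l := m])))"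
      using True upd by (simp add: tensor_act_def sum_distrib_left)
    also have "\<dots> = (\<Sum>k<r. \<Sum>l<r. \<Sum>j<2 * n. \<Sum>m<2 * n.
            X $$ (w ! k, j) * (Y $$ (w[k := j] ! l, m) * t (w[k := j, l := m])))"
      by (intro sum.cong refl sum.swap)
    also have "\<dots> = (\<Sum>k<r. \<Sum>l<r. if l = k then D (X * Y) k else G X Y k l)"
    proof (intro sum.cong refl)
      fix k l assume kl: "k \<in> {..<r}" "l \<in> {..<r}"
      show "(\<Sum>j<2 * n. \<Sum>m<2 * n.
            X $$ (w ! k, j) * (Y $$ (w[k := j] ! l, m) * t (w[k := j, l := m])))
          = (if l = k then D (X * Y) k else G X Y k l)"
      proof (cases "l = k")
        case False
        then show ?thesis by (simp add: G_def mult_ac)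
      next
        case True
        have "(\<Sum>j<2 * n. \<Sum>m<2 * n.
            X $$ (w ! k, j) * (Y $$ (w[k := j] ! l, m) * t (w[k := j, l := m])))
          = (\<Sum>m<2 * n. \<Sum>j<2 * n. X $$ (w ! k, j) * (Y $$ (j, m) * t (w[k := m])))"
          using True kl len by (subst sum.swap) simp
        also have "\<dots> = D (X * Y) k"
          unfolding D_def
        proof (intro sum.cong refl)
          fix m assume "m \<in> {..<2 * n}"
          then have "(X * Y) $$ (w ! k, m) = (\<Sum>j<2 * n. X $$ (w ! k, j) * Y $$ (j, m))"
            using X Y w[of k] kl by (simp add: scalar_prod_def lessThan_atLeast0)
          then show "(\<Sum>j<2 * n. X $$ (w ! k, j) * (Y $$ (j, m) * t (w[k := m])))
              = (X * Y) $$ (w ! k, m) * t (w[k := m])"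
            by (simp add: sum_distrib_right mult.assoc)
        qed
        finally show ?thesis using True by simp
      qed
    qed
    finally show ?thesis .
  qed
  have swap: "(\<Sum>k<r. \<Sum>l<r. if l = k then D (Y * X) k else G Y X k l)
      = (\<Sum>k<r. \<Sum>l<r. if l = k then D (Y * X) k else G X Y k l)"
    by (subst sum.swap) (intro sum.cong refl, use G_sym in auto)
  have "tensor_act n r X (tensor_act n r Y t) w - tensor_act n r Y (tensor_act n r X t) w
      = (\<Sum>k<r. \<Sum>l<r. if l = k then D (X * Y) k - D (Y * X) k else 0)"
    unfolding main[OF X Y] main[OF Y X] swap sum_subtractf[symmetric]
    by (intro sum.cong refl) auto
  also have "\<dots> = (\<Sum>k<r. D (X * Y) k - D (Y * X) k)"
    by simp
  also have "\<dots> = (\<Sum>k<r. D (X * Y - Y * X) k)"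
    unfolding D_def sum_subtractf[symmetric] using X Y w
    by (intro sum.cong refl) (simp add: left_diff_distrib)
  also have "\<dots> = tensor_act n r (X * Y - Y * X) t w"
    using True by (simp add: tensor_act_def D_def)
  finally show ?thesis .
qed

lemma tensor_act_add:
  assumes "X \<in> carrier_mat (2 * n) (2 * n)" "Y \<in> carrier_mat (2 * n) (2 * n)"
  shows "tensor_act n r (X + Y) t = (\<lambda>w. tensor_act n r X t w + tensor_act n r Y t w)"
proof
  fix w
  show "tensor_act n r (X + Y) t w = tensor_act n r X t w + tensor_act n r Y t w"
  proof (cases "w \<in> tensor_index n r")
    case True
    then have "\<And>k. k < r \<Longrightarrow> w ! k < 2 * n"
      unfolding tensor_index_def using nth_mem by fastforce
    then show ?thesis using assms
      by (simp add: tensor_act_def distrib_right sum.distrib)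
  qed (simp add: tensor_act_def)
qed

lemma tensor_act_scale:
  assumes "X \<in> carrier_mat (2 * n) (2 * n)"
  shows "tensor_act n r (c \<cdot>\<^sub>m X) t = (\<lambda>w. c * tensor_act n r X t w)"
proof
  fix w
  show "tensor_act n r (c \<cdot>\<^sub>m X) t w = c * tensor_act n r X t w"
  proof (cases "w \<in> tensor_index n r")
    case True
    then have "\<And>k. k < r \<Longrightarrow> w ! k < 2 * n"
      unfolding tensor_index_def using nth_mem by fastforce
    then show ?thesis using assms
      by (simp add: tensor_act_def sum_distrib_left mult.assoc)
  qed (simp add: tensor_act_def)
qed

definition free_kernel :: "nat \<Rightarrow> nat \<Rightarrow> (rat mat free_monoid \<Rightarrow>\<^sub>0 rat) set" where
  "free_kernel n r = {p \<in> carrier (free_algebra (so_even n)).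
     \<forall>t\<in>tensors n r. free_tensor_act n r p t = (\<lambda>_. 0)}"

lemma so_even_closed:
  assumes "X \<in> so_even n" "Y \<in> so_even n"
  shows "X + Y \<in> so_even n" "c \<cdot>\<^sub>m X \<in> so_even n" "X * Y - Y * X \<in> so_even n"
proof -
  let ?V = "carrier_vec (2 * n) :: rat vec set"
  let ?b = "\<lambda>v w. v \<bullet> (so_form n *\<^sub>v w)"
  have J: "so_form n \<in> carrier_mat (2 * n) (2 * n)"
    unfolding so_form_def mult_2 by (rule four_block_carrier_mat) auto
  have X: "X \<in> carrier_mat (2 * n) (2 * n)" and Y: "Y \<in> carrier_mat (2 * n) (2 * n)"
    using assms by (auto simp: so_even_def)
  have Xv: "X *\<^sub>v v \<in> ?V" and Yv: "Y *\<^sub>v v \<in> ?V" and Jv: "so_form n *\<^sub>v v \<in> ?V"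
    if "v \<in> ?V" for v using X Y J that by auto
  have bX: "?b (X *\<^sub>v v) w = - ?b v (X *\<^sub>v w)" and bY: "?b (Y *\<^sub>v v) w = - ?b v (Y *\<^sub>v w)"
    if "v \<in> ?V" "w \<in> ?V" for v w
    using assms that by (auto simp: so_even_def eq_neg_iff_add_eq_0)
  have add_l: "?b (u + v) w = ?b u w + ?b v w" and add_r: "?b w (u + v) = ?b w u + ?b w v"
    and sub_l: "?b (u - v) w = ?b u w - ?b v w" and sub_r: "?b w (u - v) = ?b w u - ?b w v"
    if "u \<in> ?V" "v \<in> ?V" "w \<in> ?V" for u v w
    using that J Jv
    by (auto simp: mult_add_distrib_mat_vec mult_minus_distrib_mat_vec
        add_scalar_prod_distrib scalar_prod_add_distrib minus_scalar_prod_distrib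
        scalar_prod_minus_distrib)
  have sc_l: "?b (c \<cdot>\<^sub>v u) w = c * ?b u w" and sc_r: "?b w (c \<cdot>\<^sub>v u) = c * ?b w u"
    if "u \<in> ?V" "w \<in> ?V" for u w
    using that J Jv[OF that(1)] Jv[OF that(2)] by (auto simp: mult_mat_vec)
  show "X + Y \<in> so_even n"
    using X Y Xv Yv bX bY
    by (auto simp: so_even_def add_mult_distrib_mat_vec[OF X Y] add_l add_r)
  have sc: "(c \<cdot>\<^sub>m X) *\<^sub>v v = c \<cdot>\<^sub>v (X *\<^sub>v v)" if "v \<in> ?V" for v
    using X that by (intro eq_vecI) (auto simp: scalar_prod_def sum_distrib_left mult.assoc)
  show "c \<cdot>\<^sub>m X \<in> so_even n"
    using X Xv bX by (auto simp: so_even_def sc sc_l sc_r)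
  have XY: "X * Y \<in> carrier_mat (2 * n) (2 * n)" and YX: "Y * X \<in> carrier_mat (2 * n) (2 * n)"
    using X Y by auto
  have "(X * Y - Y * X) *\<^sub>v v = X *\<^sub>v (Y *\<^sub>v v) - Y *\<^sub>v (X *\<^sub>v v)" if "v \<in> ?V" for v
    using minus_mult_distrib_mat_vec[OF XY YX that] assoc_mult_mat_vec[OF X Y that]
      assoc_mult_mat_vec[OF Y X that] by simp
  then show "X * Y - Y * X \<in> so_even n"
    using minus_carrier_mat[OF YX, of "X * Y"] Xv Yv bX bY by (auto simp: so_even_def sub_l sub_r)
qed

lemma uea_rels_carrier: "uea_rels (so_even n) \<subseteq> carrier (free_algebra (so_even n))"
proof -
  interpret ring "free_algebra (so_even n)" by (rule ring_free_algebra)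
  have [simp]: "p + q \<in> carrier (free_algebra (so_even n))"
    "p * q \<in> carrier (free_algebra (so_even n))"
    if "p \<in> carrier (free_algebra (so_even n))" "q \<in> carrier (free_algebra (so_even n))" for p q
    using a_closed[OF that] m_closed[OF that] by (simp_all add: free_algebra_def)
  have [simp]: "p - q \<in> carrier (free_algebra (so_even n))"
    if "p \<in> carrier (free_algebra (so_even n))" "q \<in> carrier (free_algebra (so_even n))" for p q
  proof -
    have "- q \<in> carrier (free_algebra (so_even n))"
      using that by (simp add: free_algebra_def)
    then have "p + - q \<in> carrier (free_algebra (so_even n))"
      using \<open>\<And>q p. \<lbrakk>p \<in> _; q \<in> _\<rbrakk> \<Longrightarrow> p + q \<in> _\<close> that by blast
    then show ?thesis by simp
  qed
  show ?thesis
    by (auto simp: uea_rels_def var_carrier const_carrier so_even_closed)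
qed

lemma free_kernel_ideal: "ideal (free_kernel n r) (free_algebra (so_even n))"
proof (rule idealI)
  interpret ring "free_algebra (so_even n)" by (rule ring_free_algebra)
  show "ring (free_algebra (so_even n))" by (rule ring_free_algebra)
  show "subgroup (free_kernel n r) (add_monoid (free_algebra (so_even n)))"
  proof (rule group.subgroupI)
    show "Group.group (add_monoid (free_algebra (so_even n)))"
      by (rule a_group)
    show "free_kernel n r \<noteq> {}"
      using zero_closed by (auto simp: free_kernel_def free_algebra_def fta_zero intro!: exI[of _ 0])
    fix p assume p: "p \<in> free_kernel n r"
    then have "- p = \<ominus>\<^bsub>free_algebra (so_even n)\<^esub> p"
      by (intro minus_equality[symmetric]) (auto simp: free_kernel_def free_algebra_def)
    moreover have "- p \<in> free_kernel n r"
      using p by (auto simp: free_kernel_def free_algebra_def fta_uminus)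
    ultimately show "inv\<^bsub>add_monoid (free_algebra (so_even n))\<^esub> p \<in> free_kernel n r"
      by (simp add: a_inv_def)
  next
    fix p q assume "p \<in> free_kernel n r" "q \<in> free_kernel n r"
    then show "p \<otimes>\<^bsub>add_monoid (free_algebra (so_even n))\<^esub> q \<in> free_kernel n r"
      using a_closed[of p q] by (auto simp: free_kernel_def free_algebra_def fta_add)
  qed (auto simp: free_kernel_def)
next
  interpret ring "free_algebra (so_even n)" by (rule ring_free_algebra)
  fix p q assume "p \<in> free_kernel n r" and "q \<in> carrier (free_algebra (so_even n))"
  then show "q \<otimes>\<^bsub>free_algebra (so_even n)\<^esub> p \<in> free_kernel n r"
    and "p \<otimes>\<^bsub>free_algebra (so_even n)\<^esub> q \<in> free_kernel n r"
    using m_closed[of p q] m_closed[of q p]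
    by (auto simp: free_kernel_def free_algebra_def fta_mult fta_zero_right
        dest: fta_closed[of _ n r q])
qed

lemma uea_ideal_kernel:
  "Idl\<^bsub>free_algebra (so_even n)\<^esub> (uea_rels (so_even n)) \<subseteq> free_kernel n r"
proof (rule ring.genideal_minimal[OF ring_free_algebra free_kernel_ideal], rule subsetI)
  fix p assume p: "p \<in> uea_rels (so_even n)"
  have c: "X \<in> carrier_mat (2 * n) (2 * n)" if "X \<in> so_even n" for X
    using that by (simp add: so_even_def)
  have "free_tensor_act n r p t = (\<lambda>_. 0)" for t
    using p by (auto simp: uea_rels_def fta_diff fta_add fta_mult fta_var fta_const c
        tensor_act_add tensor_act_scale tensor_act_commutator)
  then show "p \<in> free_kernel n r"
    using p uea_rels_carrier by (auto simp: free_kernel_def)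
qed

lemma uea_ideal: "ideal (Idl\<^bsub>free_algebra (so_even n)\<^esub> (uea_rels (so_even n))) (free_algebra (so_even n))"
  by (rule ring.genideal_ideal[OF ring_free_algebra uea_rels_carrier])

lemma ring_quot_alg:
  assumes "ideal I A" shows "ring (quot_alg A I)"
proof -
  have "id \<in> ring_iso (A Quot I) (quot_alg A I)"
    by (auto intro!: ring_iso_memI simp: quot_alg_def)
  then have "ring ((quot_alg A I)\<lparr>zero := id \<zero>\<^bsub>A Quot I\<^esub>\<rparr>)"
    by (rule ring.ring_iso_imp_img_ring[OF ideal.quotient_is_ring[OF assms]])
  moreover have "(quot_alg A I)\<lparr>zero := id \<zero>\<^bsub>A Quot I\<^esub>\<rparr> = quot_alg A I"
    by (simp add: quot_alg_def)
  ultimately show ?thesis by simp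
qed

lemma ring_uea: "ring (uea n)"
  unfolding uea_def presented_algebra_def by (rule ring_quot_alg[OF uea_ideal])

lemma free_tensor_act_coset:
  assumes "u \<in> carrier (uea n)" "p \<in> u" "q \<in> u" "t \<in> carrier (tensor_power n r)"
  shows "free_tensor_act n r p t = free_tensor_act n r q t"
proof -
  let ?A = "free_algebra (so_even n)"
  let ?I = "Idl\<^bsub>?A\<^esub> (uea_rels (so_even n))"
  interpret ideal ?I ?A by (rule uea_ideal)
  obtain a where a: "a \<in> carrier ?A" "u = ?I +>\<^bsub>?A\<^esub> a"
    using assms(1)
    by (auto simp: uea_def presented_algebra_def quot_alg_def FactRing_def A_RCOSETS_def')
  have "free_tensor_act n r x t = free_tensor_act n r a t" if x: "x \<in> u" for x
  proof -
    obtain i where i: "i \<in> ?I" "x = i + a"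
      using x a by (auto simp: a_r_coset_def' free_algebra_ops)
    then have "free_tensor_act n r i t = (\<lambda>_. 0)"
      using uea_ideal_kernel[of n r] assms(4) by (auto simp: free_kernel_def tensors_carrier)
    then show ?thesis using i by (simp add: fta_add)
  qed
  then show ?thesis using assms by metis
qed

lemma tensor_power_left_module: "left_module (uea n) (tensor_power n r)"
proof -
  let ?A = "free_algebra (so_even n)"
  let ?I = "Idl\<^bsub>?A\<^esub> (uea_rels (so_even n))"
  interpret I: ideal ?I ?A by (rule uea_ideal)
  have carr: "\<exists>a\<in>carrier ?A. u = ?I +>\<^bsub>?A\<^esub> a" if "u \<in> carrier (uea n)" for u
    using that by (auto simp: uea_def presented_algebra_def quot_alg_def FactRing_def A_RCOSETS_def')
  have coset: "?I +>\<^bsub>?A\<^esub> a \<in> carrier (uea n)" if "a \<in> carrier ?A" for a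
    using that by (auto simp: uea_def presented_algebra_def quot_alg_def FactRing_def A_RCOSETS_def')
  have act: "(?I +>\<^bsub>?A\<^esub> a) \<odot>\<^bsub>tensor_power n r\<^esub> t = free_tensor_act n r a t"
    if "a \<in> carrier ?A" "t \<in> carrier (tensor_power n r)" for a t
  proof -
    have "a \<in> ?I +>\<^bsub>?A\<^esub> a" using that I.a_rcos_self by blast
    then have "(\<lambda>p. free_tensor_act n r p t) ` (?I +>\<^bsub>?A\<^esub> a) = {free_tensor_act n r a t}"
      using free_tensor_act_coset[OF coset[OF that(1)] _ _ that(2)] by blast
    then show ?thesis by (simp add: tensor_power_def)
  qed
  have abel: "abelian_group (tensor_power n r)"
  proof (rule abelian_groupI)
    fix t assume "t \<in> carrier (tensor_power n r)"
    then show "\<exists>s\<in>carrier (tensor_power n r). s \<oplus>\<^bsub>tensor_power n r\<^esub> t = \<zero>\<^bsub>tensor_power n r\<^esub>"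
      by (intro bexI[of _ "\<lambda>w. - t w"]) (auto simp: tensor_power_def)
  next
    fix s t assume st: "s \<in> carrier (tensor_power n r)" "t \<in> carrier (tensor_power n r)"
    show "s \<oplus>\<^bsub>tensor_power n r\<^esub> t \<in> carrier (tensor_power n r)"
      using st by (auto simp: tensor_power_def) (metis add_0)
  qed (auto simp: tensor_power_def algebra_simps)
  have sum_coset: "(?I +>\<^bsub>?A\<^esub> a) \<oplus>\<^bsub>uea n\<^esub> (?I +>\<^bsub>?A\<^esub> b) = ?I +>\<^bsub>?A\<^esub> (a + b)"
    and mult_coset: "(?I +>\<^bsub>?A\<^esub> a) \<otimes>\<^bsub>uea n\<^esub> (?I +>\<^bsub>?A\<^esub> b) = ?I +>\<^bsub>?A\<^esub> (a * b)"
    and sum_mem: "a + b \<in> carrier ?A" and mult_mem: "a * b \<in> carrier ?A"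
    if "a \<in> carrier ?A" "b \<in> carrier ?A" for a b
    using I.a_rcos_sum[OF that] I.rcoset_mult_add[OF that] I.a_closed[OF that] I.m_closed[OF that]
    by (simp_all add: uea_def presented_algebra_def quot_alg_def FactRing_def free_algebra_ops)
  have one_coset: "\<one>\<^bsub>uea n\<^esub> = ?I +>\<^bsub>?A\<^esub> 1" and one_mem: "1 \<in> carrier ?A"
    using I.one_closed
    by (simp_all only: uea_def presented_algebra_def quot_alg_def FactRing_def free_algebra_ops
        monoid.simps ring.simps module.simps)
  note clos = fta_closed[folded tensors_carrier]
  have add: "s \<oplus>\<^bsub>tensor_power n r\<^esub> t = (\<lambda>w. s w + t w)" for s t
    by (simp add: tensor_power_def)
  show ?thesis
  proof (intro left_module.intro ring_uea abel left_module_axioms.intro)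
    fix u t assume u: "u \<in> carrier (uea n)" and t: "t \<in> carrier (tensor_power n r)"
    obtain a where a: "a \<in> carrier ?A" "u = ?I +>\<^bsub>?A\<^esub> a" using carr[OF u] by blast
    show "u \<odot>\<^bsub>tensor_power n r\<^esub> t \<in> carrier (tensor_power n r)"
      using a t act clos by metis
    fix s assume s: "s \<in> carrier (tensor_power n r)"
    have "t \<oplus>\<^bsub>tensor_power n r\<^esub> s \<in> carrier (tensor_power n r)"
      using abelian_groupE(1)[OF abel t s] .
    then show "u \<odot>\<^bsub>tensor_power n r\<^esub> (t \<oplus>\<^bsub>tensor_power n r\<^esub> s) =
        u \<odot>\<^bsub>tensor_power n r\<^esub> t \<oplus>\<^bsub>tensor_power n r\<^esub> u \<odot>\<^bsub>tensor_power n r\<^esub> s"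
      using a s t act by (simp add: add fta_add_right)
  next
    fix u v t assume u: "u \<in> carrier (uea n)" and v: "v \<in> carrier (uea n)"
      and t: "t \<in> carrier (tensor_power n r)"
    obtain a where a: "a \<in> carrier ?A" "u = ?I +>\<^bsub>?A\<^esub> a" using carr[OF u] by blast
    obtain b where b: "b \<in> carrier ?A" "v = ?I +>\<^bsub>?A\<^esub> b" using carr[OF v] by blast
    show "(u \<oplus>\<^bsub>uea n\<^esub> v) \<odot>\<^bsub>tensor_power n r\<^esub> t =
        u \<odot>\<^bsub>tensor_power n r\<^esub> t \<oplus>\<^bsub>tensor_power n r\<^esub> v \<odot>\<^bsub>tensor_power n r\<^esub> t"
      using a b t act sum_mem[OF a(1) b(1)] by (simp add: sum_coset add fta_add)
    show "(u \<otimes>\<^bsub>uea n\<^esub> v) \<odot>\<^bsub>tensor_power n r\<^esub> t =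
        u \<odot>\<^bsub>tensor_power n r\<^esub> (v \<odot>\<^bsub>tensor_power n r\<^esub> t)"
      using a b t act mult_mem[OF a(1) b(1)] clos[OF t]
      by (simp add: mult_coset fta_mult)
  next
    fix t assume t: "t \<in> carrier (tensor_power n r)"
    show "\<one>\<^bsub>uea n\<^esub> \<odot>\<^bsub>tensor_power n r\<^esub> t = t"
      using act[OF one_mem t] by (simp add: one_coset fta_one)
  qed
qed

lemma schur_ideal_annihilates:
  fixes M :: "(uea_elem, 'v) module"
  assumes u: "u \<in> schur_ideal n \<pi>" and \<mu>: "\<mu> \<in> \<pi>" and M: "simple_of_highest_weight n M \<mu>"
  shows "u \<in> rep_kernel (uea n) M"
proof -
  let ?U = "uea n"
  have simp_M: "simple_module ?U M" using M by (simp add: simple_of_highest_weight_def)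
  then interpret left_module ?U M by (simp add: simple_module_def)
  obtain v where v: "weight_vector n M \<mu> v"
    and pos: "\<And>X. X \<in> positive_root_vectors n \<Longrightarrow> uea_incl n X \<odot>\<^bsub>M\<^esub> v = \<zero>\<^bsub>M\<^esub>"
    using M by (auto simp: simple_of_highest_weight_def)
  have vM: "v \<in> carrier M" "v \<noteq> \<zero>\<^bsub>M\<^esub>" using v by (auto simp: weight_vector_def)
  have z: "\<zero>\<^bsub>?U\<^esub> \<odot>\<^bsub>M\<^esub> x = \<zero>\<^bsub>M\<^esub>" if "x \<in> carrier M" for x
    using smult_l_distr[of "\<zero>\<^bsub>?U\<^esub>" "\<zero>\<^bsub>?U\<^esub>" x] that by simp
  have neg: "(\<ominus>\<^bsub>?U\<^esub> a) \<odot>\<^bsub>M\<^esub> x = \<ominus>\<^bsub>M\<^esub> (a \<odot>\<^bsub>M\<^esub> x)"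
    if "a \<in> carrier ?U" "x \<in> carrier M" for a x
    using smult_l_distr[of "\<ominus>\<^bsub>?U\<^esub> a" a x] that z[of x] R.l_neg[of a]
    by (intro M.minus_equality[symmetric]) auto
  define f where "f x = {a \<in> carrier ?U. a \<odot>\<^bsub>M\<^esub> v = x}" for x
  have "submodule ((\<lambda>a. a \<odot>\<^bsub>M\<^esub> v) ` carrier ?U) ?U M"
  proof (intro submodule.intro submodule_axioms.intro group.subgroupI)
    show "Group.group (add_monoid M)" by (rule M.a_group)
    show "(\<lambda>a. a \<odot>\<^bsub>M\<^esub> v) ` carrier ?U \<noteq> {}" by auto
    show "(\<lambda>a. a \<odot>\<^bsub>M\<^esub> v) ` carrier ?U \<subseteq> carrier (add_monoid M)" using vM by auto
    show "inv\<^bsub>add_monoid M\<^esub> x \<in> (\<lambda>a. a \<odot>\<^bsub>M\<^esub> v) ` carrier ?U"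
      if "x \<in> (\<lambda>a. a \<odot>\<^bsub>M\<^esub> v) ` carrier ?U" for x
      using that vM by (auto simp flip: a_inv_def neg)
    show "x \<otimes>\<^bsub>add_monoid M\<^esub> y \<in> (\<lambda>a. a \<odot>\<^bsub>M\<^esub> v) ` carrier ?U"
      if "x \<in> (\<lambda>a. a \<odot>\<^bsub>M\<^esub> v) ` carrier ?U" "y \<in> (\<lambda>a. a \<odot>\<^bsub>M\<^esub> v) ` carrier ?U" for x y
      using that vM by (auto simp flip: smult_l_distr)
    show "b \<odot>\<^bsub>M\<^esub> x \<in> (\<lambda>a. a \<odot>\<^bsub>M\<^esub> v) ` carrier ?U"
      if "b \<in> carrier ?U" "x \<in> (\<lambda>a. a \<odot>\<^bsub>M\<^esub> v) ` carrier ?U" for b x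
      using that vM by (auto simp flip: smult_assoc1)
  qed
  moreover have "v \<in> (\<lambda>a. a \<odot>\<^bsub>M\<^esub> v) ` carrier ?U"
    using vM by (intro image_eqI[of _ _ "\<one>\<^bsub>?U\<^esub>"]) auto
  ultimately have gen: "(\<lambda>a. a \<odot>\<^bsub>M\<^esub> v) ` carrier ?U = carrier M"
    using simp_M vM by (auto simp: simple_module_def)
  have ne: "f x \<noteq> {}" if "x \<in> carrier M" for x
  proof -
    have "x \<in> (\<lambda>a. a \<odot>\<^bsub>M\<^esub> v) ` carrier ?U" using that gen by simp
    then show ?thesis by (auto simp: f_def)
  qed
  then have inj: "inj_on f (carrier M)"
    by (intro inj_onI) (auto simp: f_def)
  define g where "g = inv_into (carrier M) f"
  have g [simp]: "g (f x) = x" if "x \<in> carrier M" for x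
    using inj that by (simp add: g_def)
  define N :: "(uea_elem, uea_elem set) module" where
    "N = \<lparr>carrier = f ` carrier M, monoid.mult = undefined, one = undefined,
          zero = f \<zero>\<^bsub>M\<^esub>, add = (\<lambda>x y. f (g x \<oplus>\<^bsub>M\<^esub> g y)), smult = (\<lambda>a x. f (a \<odot>\<^bsub>M\<^esub> g x))\<rparr>"
  have N [simp]: "carrier N = f ` carrier M" "\<zero>\<^bsub>N\<^esub> = f \<zero>\<^bsub>M\<^esub>"
    "\<And>x y. x \<oplus>\<^bsub>N\<^esub> y = f (g x \<oplus>\<^bsub>M\<^esub> g y)" "\<And>a x. a \<odot>\<^bsub>N\<^esub> x = f (a \<odot>\<^bsub>M\<^esub> g x)"
    by (simp_all add: N_def)
  have f_eq [simp]: "f x = f y \<longleftrightarrow> x = y" if "x \<in> carrier M" "y \<in> carrier M" for x y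
    using inj that by (auto simp: inj_on_def)
  have N_abel: "abelian_group N"
  proof (rule abelian_groupI)
    fix x assume "x \<in> carrier N"
    then obtain y where y: "y \<in> carrier M" "x = f y" by auto
    then show "\<exists>y\<in>carrier N. y \<oplus>\<^bsub>N\<^esub> x = \<zero>\<^bsub>N\<^esub>"
      by (intro bexI[of _ "f (\<ominus>\<^bsub>M\<^esub> y)"]) (auto simp: M.l_neg)
  qed (auto simp: M.a_ac)
  have N_mod: "left_module ?U N"
    by (intro left_module.intro N_abel R.ring_axioms left_module_axioms.intro)
      (auto simp: smult_l_distr smult_r_distr smult_assoc1)
  have inv_N: "\<ominus>\<^bsub>N\<^esub> (f x) = f (\<ominus>\<^bsub>M\<^esub> x)" if "x \<in> carrier M" for x
    using that by (intro abelian_group.minus_equality[OF N_abel]) (auto simp: M.l_neg)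
  have N_simple: "simple_module ?U N"
    unfolding simple_module_def
  proof (intro conjI allI impI N_mod)
    have "f v \<in> carrier N" "f v \<noteq> \<zero>\<^bsub>N\<^esub>" using vM by auto
    then show "carrier N \<noteq> {\<zero>\<^bsub>N\<^esub>}" by blast
    fix S assume S: "submodule S ?U N"
    interpret S: submodule S ?U N by (fact S)
    have sub: "S \<subseteq> f ` carrier M" using S.subset by simp
    define T where "T = {x \<in> carrier M. f x \<in> S}"
    have ST: "S = f ` T" using sub by (auto simp: T_def)
    have "submodule T ?U M"
    proof (intro submodule.intro submodule_axioms.intro group.subgroupI)
      show "Group.group (add_monoid M)" by (rule M.a_group)
      show "T \<subseteq> carrier (add_monoid M)" by (auto simp: T_def)
      show "T \<noteq> {}" using S.one_closed by (auto simp: T_def intro!: exI[of _ "\<zero>\<^bsub>M\<^esub>"])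
      show "inv\<^bsub>add_monoid M\<^esub> x \<in> T" if "x \<in> T" for x
        using that S.m_inv_closed[of "f x", folded a_inv_def] inv_N[of x] by (auto simp: T_def simp flip: a_inv_def)
      show "x \<otimes>\<^bsub>add_monoid M\<^esub> y \<in> T" if "x \<in> T" "y \<in> T" for x y
        using that S.m_closed[of "f x" "f y"] by (auto simp: T_def)
      show "a \<odot>\<^bsub>M\<^esub> x \<in> T" if "a \<in> carrier ?U" "x \<in> T" for a x
        using that S.smult_closed[of a "f x"] by (auto simp: T_def)
    qed
    then have "T = {\<zero>\<^bsub>M\<^esub>} \<or> T = carrier M"
      using simp_M by (auto simp: simple_module_def)
    then show "S = {\<zero>\<^bsub>N\<^esub>} \<or> S = carrier N" using ST by auto
  qed
  have "weight_vector n N \<mu> (f v)"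
    using v vM by (auto simp: weight_vector_def)
  moreover have "uea_incl n X \<odot>\<^bsub>N\<^esub> f v = \<zero>\<^bsub>N\<^esub>" if "X \<in> positive_root_vectors n" for X
    using pos[OF that] vM by simp
  ultimately have "simple_of_highest_weight n N \<mu>"
    using N_simple by (auto simp: simple_of_highest_weight_def)
  then have "u \<in> rep_kernel ?U N"
    using u \<mu> by (auto simp: schur_ideal_def)
  then show ?thesis
    by (auto simp: rep_kernel_def)
qed

end

theory Submission
  imports Defs "Jordan_Normal_Form.Determinant"
begin

text \<open>Relations (D6) and (D7) force the \<open>H\<^sub>i\<close> to act diagonalizably on every module of the presented
  algebra \<open>A\<close>, with weights among those of \<open>\<^bold>E\<^sup>\<otimes>\<^sup>r\<close>.  As these are finitely many, the root vectors of
  \<open>so\<^sub>2\<^sub>n\<close> can be lifted to \<open>A\<close>, and the Casimir element formed from them separates comparable dominant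
  weights.  Hence the left regular module of \<open>A\<close> is a sum of submodules generated by highest weight
  vectors, and each of these is simple.  Every dominant weight of \<open>\<^bold>E\<^sup>\<otimes>\<^sup>r\<close> is the weight of a highest
  weight vector in \<open>\<^bold>E\<^sup>\<otimes>\<^sup>r\<close>: multiply volume forms of isotropic subspaces, and copies of the invariant
  quadratic tensor.  In simple modules, highest weight vectors of the same weight have the same
  annihilator.  So an element of the free algebra that kills \<open>\<^bold>E\<^sup>\<otimes>\<^sup>r\<close> also kills the highest weight
  vectors of \<open>A\<close>, that is, \<open>A\<close> acts faithfully, and the annihilators of \<open>\<^bold>E\<^sup>\<otimes>\<^sup>r\<close> and of the simple
  modules with highest weight in \<open>\<pi>\<close> coincide.\<close>

section \<open>Weight decompositions\<close>

text \<open>Everything is compared inside the free algebra on the Chevalley generators. It maps onto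
  the enveloping algebra, because brackets of the matrices of the generators span
  \<open>so_even n\<close>; so both algebras of the theorem are quotients of it, and what has to be
  proved is an equality of kernels.

  The hard point is that an element killing all tensors lies in the ideal of the relations. At that
  stage no bound on the dimension of the presented algebra is known, so neither composition series
  nor Weyl's theorem for finite dimensional modules is at hand. Finiteness comes only from the
  bounds on weights: long words in the \<open>e i\<close> vanish, and the \<open>f i\<close> as well
  as the commutators with \<open>e i\<close> and \<open>f i\<close> are nilpotent. For the same
  reason weight decompositions appear as induction principles and no direct sums are formed.

  Two modules with a common highest weight are compared without Verma modules. A polynomial in one
  grading element of the Cartan part cuts out the coefficient of the highest weight vector, and the
  polynomial and the coefficient can be chosen once for all modules of that highest weight.\<close>

locale rat_scalars =
  fixes sc :: "rat \<Rightarrow> 'a :: ring_1"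
  assumes sc_add: "sc (a + b) = sc a + sc b"
    and sc_mult: "sc (a * b) = sc a * sc b"
    and sc_one [simp]: "sc 1 = 1"
    and sc_comm: "sc a * x = x * sc a"
begin

lemma sc_zero [simp]: "sc 0 = 0"
  using sc_add[of 0 0] by simp

lemma sc_minus: "sc (- a) = - sc a"
  using sc_add[of a "- a"] by (simp add: eq_neg_iff_add_eq_0 add.commute)

lemma sc_diff: "sc (a - b) = sc a - sc b"
  using sc_add[of a "- b"] by (simp add: sc_minus)

lemma sc_left: "x * (sc a * y) = sc a * (x * y)"
  by (metis mult.assoc sc_comm)

lemma sc_sc: "sc a * (sc b * x) = sc (a * b) * x"
  by (simp add: sc_mult mult.assoc)

lemma sc_of_nat: "sc (of_nat k) = of_nat k"
  by (induction k) (simp_all add: sc_add)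

lemma sc_of_int: "sc (of_int k) = of_int k"
  by (cases k rule: int_cases2) (simp_all add: sc_of_nat sc_minus)

lemma sc_sum: "sc (\<Sum>i\<in>I. c i) = (\<Sum>i\<in>I. sc (c i))"
  by (induction I rule: infinite_finite_induct) (simp_all add: sc_add)

lemma sc_cancel: "sc c * x = 0 \<Longrightarrow> c \<noteq> 0 \<Longrightarrow> x = 0"
  using sc_sc[of "inverse c" c x] by simp

lemma sc_eq_cancel: "sc c * x = sc d * x \<Longrightarrow> c \<noteq> d \<Longrightarrow> x = 0"
  using sc_cancel[of "c - d" x] by (simp add: sc_diff left_diff_distrib)

text \<open>Scalars enter through a central homomorphism \<open>sc\<close> and not through a vector
  space type class, since the results are used both for the free algebra, with \<open>const\<close>,
  and for the presented algebra, with \<open>psc\<close>.\<close>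

definition subsp :: "'a set \<Rightarrow> bool" where
  "subsp C \<longleftrightarrow> 0 \<in> C \<and> (\<forall>x\<in>C. \<forall>y\<in>C. x + y \<in> C) \<and> (\<forall>c. \<forall>x\<in>C. sc c * x \<in> C)"

lemma subspI:
  assumes "0 \<in> C" "\<And>x y. x \<in> C \<Longrightarrow> y \<in> C \<Longrightarrow> x + y \<in> C" "\<And>c x. x \<in> C \<Longrightarrow> sc c * x \<in> C"
  shows "subsp C"
  using assms by (simp add: subsp_def)

lemma subspD:
  assumes "subsp C"
  shows subsp_zero: "0 \<in> C" and subsp_add: "x \<in> C \<Longrightarrow> y \<in> C \<Longrightarrow> x + y \<in> C"
    and subsp_sc: "x \<in> C \<Longrightarrow> sc c * x \<in> C"
    and subsp_uminus: "x \<in> C \<Longrightarrow> - x \<in> C"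
    and subsp_diff: "x \<in> C \<Longrightarrow> y \<in> C \<Longrightarrow> x - y \<in> C"
proof -
  show "0 \<in> C" and a: "\<And>x y. x \<in> C \<Longrightarrow> y \<in> C \<Longrightarrow> x + y \<in> C" and s: "\<And>x c. x \<in> C \<Longrightarrow> sc c * x \<in> C"
    using assms by (auto simp: subsp_def)
  show u: "- x \<in> C" if "x \<in> C" for x using s[OF that, of "- 1"] by (simp add: sc_minus)
  show "x - y \<in> C" if "x \<in> C" "y \<in> C" for x y using a[OF that(1) u[OF that(2)]] by simp
qed

lemma subsp_sum: "subsp C \<Longrightarrow> (\<And>i. i \<in> I \<Longrightarrow> f i \<in> C) \<Longrightarrow> (\<Sum>i\<in>I. f i) \<in> C"
  by (induction I rule: infinite_finite_induct) (auto intro: subspD)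

lemma subsp_cong_mod:
  assumes "subsp C" "x - y \<in> C" shows "x \<in> C \<longleftrightarrow> y \<in> C"
  using subspD[OF assms(1)] assms(2) by (metis add_diff_cancel_left' diff_add_cancel diff_diff_eq2)

definition lin :: "('a \<Rightarrow> 'a) \<Rightarrow> bool" where
  "lin T \<longleftrightarrow> (\<forall>x y. T (x + y) = T x + T y) \<and> (\<forall>c x. T (sc c * x) = sc c * T x)"

lemma linD:
  assumes "lin T"
  shows lin_add: "T (x + y) = T x + T y" and lin_sc: "T (sc c * x) = sc c * T x"
    and lin_zero: "T 0 = 0" and lin_uminus: "T (- x) = - T x" and lin_diff: "T (x - y) = T x - T y"
proof -
  show a: "\<And>x y. T (x + y) = T x + T y" and s: "\<And>c x. T (sc c * x) = sc c * T x"
    using assms by (auto simp: lin_def)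
  show z: "T 0 = 0" using s[of 0 0] by simp
  show u: "T (- x) = - T x" for x using s[of "- 1" x] by (simp add: sc_minus)
  show "T (x - y) = T x - T y" using a[of x "- y"] by (simp add: u)
qed

lemma lin_mult: "lin (\<lambda>x. a * x)"
  by (simp add: lin_def distrib_left sc_left)

lemma lin_ad: "lin (\<lambda>x. a * x - x * a)"
  by (simp add: lin_def algebra_simps sc_left)

text \<open>An operator killed by a product of distinct linear factors is diagonalizable on every
  invariant subspace.  Phrasing this as an induction principle avoids carrying the
  eigencomponents around.\<close>

lemma eigen_induct:
  assumes "lin T" "subsp C" "\<And>y. y \<in> C \<Longrightarrow> T y \<in> C"
    and "0 \<in> D" "\<And>y z. y \<in> D \<Longrightarrow> z \<in> D \<Longrightarrow> y + z \<in> D"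
    and "\<And>k y. k \<in> set S \<Longrightarrow> y \<in> C \<Longrightarrow> T y = sc k * y \<Longrightarrow> y \<in> D"
    and "distinct S" "x \<in> C" "fold (\<lambda>k y. T y - sc k * y) S x = 0"
  shows "x \<in> D"
  using assms(4-9)
proof (induction S arbitrary: D x)
  case Nil
  then show ?case by simp
next
  case (Cons a S)
  \<comment> \<open>The factor \<open>T - a\<close> is peeled off: the induction hypothesis applies
    to the image of \<open>C \<inter> D\<close> under it and yields an \<open>x'\<close> in
    \<open>D\<close> with the same image as \<open>x\<close>. Then \<open>x - x'\<close> is an
    eigenvector for \<open>a\<close>.\<close>
  define D' where "D' = {y. \<exists>x'\<in>C \<inter> D. T x' - sc a * x' = y}"
  have "T x - sc a * x \<in> D'"
  proof (rule Cons.IH)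
    show "0 \<in> D'"
      unfolding D'_def using Cons.prems(1) subsp_zero[OF assms(2)] lin_zero[OF assms(1)]
      by (auto intro!: bexI[of _ 0])
    show "y + z \<in> D'" if yz: "y \<in> D'" "z \<in> D'" for y z
    proof -
      obtain y' z' where "y' \<in> C \<inter> D" "T y' - sc a * y' = y" "z' \<in> C \<inter> D" "T z' - sc a * z' = z"
        using yz by (auto simp: D'_def)
      then show ?thesis unfolding D'_def
        using Cons.prems(2) subsp_add[OF assms(2)] lin_add[OF assms(1)]
        by (auto simp: algebra_simps intro!: bexI[of _ "y' + z'"])
    qed
    show "distinct S" using Cons.prems by simp
    show "T x - sc a * x \<in> C"
      by (intro subsp_diff[OF assms(2)] subsp_sc[OF assms(2)] assms(3) Cons.prems(5))
    show "fold (\<lambda>k y. T y - sc k * y) S (T x - sc a * x) = 0" using Cons.prems(6) by simp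
    fix k y assume k: "k \<in> set S" and y: "y \<in> C" "T y = sc k * y"
    have ka: "k \<noteq> a" using k Cons.prems(4) by auto
    \<comment> \<open>\<open>T - a\<close> multiplies an eigenvector for \<open>k\<close> by
      \<open>k - a\<close>, so division by this number gives a preimage.\<close>
    let ?x = "sc (inverse (k - a)) * y"
    have eig: "T ?x = sc k * ?x" using y lin_sc[OF assms(1)] by (simp add: sc_sc mult.commute)
    have C: "?x \<in> C" using y subsp_sc[OF assms(2)] by blast
    have "?x \<in> D" using Cons.prems(3)[of k ?x] k eig C by simp
    moreover have "T ?x - sc a * ?x = sc ((k - a) * inverse (k - a)) * y"
      unfolding eig by (simp add: sc_sc left_diff_distrib sc_diff)
    ultimately show "y \<in> D'" using C ka by (auto simp: D'_def)
  qed
  then obtain x' where x': "x' \<in> C" "x' \<in> D" "T x' - sc a * x' = T x - sc a * x"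
    by (auto simp: D'_def)
  have "T (x - x') = sc a * (x - x')"
    unfolding lin_diff[OF assms(1)] using x'(3) by (simp add: algebra_simps)
  moreover have "x - x' \<in> C" using x' Cons.prems(5) by (intro subsp_diff[OF assms(2)])
  ultimately have "x - x' \<in> D" using Cons.prems(3)[of a] by simp
  then show ?case using Cons.prems(2)[of x' "x - x'"] x' by simp
qed

text \<open>The commuting operators are diagonalized one after the other: a joint eigenspace of the
  first ones is invariant under the next, so \<open>eigen_induct\<close> applies inside it.\<close>

lemma weight_induct:
  fixes T :: "nat \<Rightarrow> 'a \<Rightarrow> 'a"
  assumes "\<And>i. i < m \<Longrightarrow> lin (T i)"
    and "\<And>i j x. i < m \<Longrightarrow> j < m \<Longrightarrow> T i (T j x) = T j (T i x)"
    and "\<And>i x. i < m \<Longrightarrow> fold (\<lambda>k y. T i y - sc k * y) S x = 0" "distinct S"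
    and "subsp C" "\<And>i y. i < m \<Longrightarrow> y \<in> C \<Longrightarrow> T i y \<in> C"
    and "0 \<in> D" "\<And>y z. y \<in> D \<Longrightarrow> z \<in> D \<Longrightarrow> y + z \<in> D"
    and "\<And>\<nu> y. y \<in> C \<Longrightarrow> (\<And>i. i < m \<Longrightarrow> T i y = sc (\<nu> i) * y) \<Longrightarrow> y \<in> D"
    and "x \<in> C"
  shows "x \<in> D"
  using assms
proof (induction m arbitrary: x)
  case 0
  then show ?case by auto
next
  case (Suc m)
  show ?case
  proof (rule Suc.IH)
    fix \<nu> y assume y: "y \<in> C" and \<nu>: "\<And>i. i < m \<Longrightarrow> T i y = sc (\<nu> i) * y"
    define C' where "C' = {y \<in> C. \<forall>i<m. T i y = sc (\<nu> i) * y}"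
    have lin: "lin (T i)" if "i < m" for i using Suc.prems(1) that by simp
    show "y \<in> D"
    proof (rule eigen_induct[of "T m" C' D S])
      show "lin (T m)" using Suc.prems(1) by simp
      show "subsp C'"
        using subspD[OF Suc.prems(5)] linD[OF lin]
        by (intro subspI) (auto simp: C'_def algebra_simps sc_sc)
      show "T m y \<in> C'" if "y \<in> C'" for y
        using that Suc.prems(6)[of m] Suc.prems(2)[of _ m] lin_sc[OF Suc.prems(1)[of m]]
        by (auto simp: C'_def)
      show "y \<in> D" if k: "k \<in> set S" "y \<in> C'" "T m y = sc k * y" for k y
        using that by (intro Suc.prems(9)[of y "\<nu>(m := k)"]) (auto simp: C'_def less_Suc_eq)
      show "fold (\<lambda>k y. T m y - sc k * y) S y = 0" using Suc.prems(3)[of m] by simp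
      show "y \<in> C'" using y \<nu> by (simp add: C'_def)
    qed (use Suc.prems(4,7,8) in auto)
  qed (use Suc.prems in auto)
qed

lemma fold_eigenvector:
  assumes "lin T" "T y = sc k * y"
  shows "fold (\<lambda>k y. T y - sc k * y) S y = sc (\<Prod>j\<leftarrow>S. k - j) * y"
proof -
  have "fold (\<lambda>k y. T y - sc k * y) S (sc c * y) = sc (c * (\<Prod>j\<leftarrow>S. k - j)) * y" for c
  proof (induction S arbitrary: c)
    case (Cons a S)
    have "T (sc c * y) - sc a * (sc c * y) = sc (c * (k - a)) * y"
      using assms lin_sc[OF assms(1)] by (simp add: sc_sc right_diff_distrib sc_diff left_diff_distrib mult.commute)
    then show ?case using Cons.IH by (simp add: mult.assoc)
  qed simp
  from this[of 1] show ?thesis by simp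
qed

lemma eigenvalue_mem:
  assumes "lin T" "T y = sc k * y" "fold (\<lambda>k y. T y - sc k * y) S y = 0" "y \<noteq> 0"
  shows "k \<in> set S"
proof (rule ccontr)
  assume "k \<notin> set S"
  then have "(\<Prod>j\<leftarrow>S. k - j) \<noteq> 0" by (induction S) auto
  then show False using assms fold_eigenvector[OF assms(1,2), of S] sc_cancel by auto
qed

text \<open>The sl2 computation carried out modulo \<open>N\<close>: \<open>E\<close> sends the
  power \<open>k + 1\<close> of \<open>F\<close> at \<open>v\<close> to
  \<open>(k + 1) * (m - k)\<close> times the power \<open>k\<close>. For negative \<open>m\<close>
  this factor never vanishes, so from \<open>(F ^^ p) v\<close> in \<open>N\<close> one descends to
  \<open>v\<close>. The form modulo \<open>N\<close> is needed for vectors that become highest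
  weight vectors only in a quotient.\<close>

lemma sl2_lower:
  assumes lin: "lin E" "lin F" "lin K"
    and EF: "\<And>x. E (F x) = F (E x) + K x" and KF: "\<And>x. K (F x) = F (K x) - sc 2 * F x"
    and N: "subsp N" "\<And>x. x \<in> N \<Longrightarrow> E x \<in> N" "\<And>x. x \<in> N \<Longrightarrow> F x \<in> N"
    and v: "K v = sc m * v" "E v \<in> N" "(F ^^ p) v \<in> N" and m: "m < 0"
  shows "v \<in> N"
proof -
  have K: "K ((F ^^ k) v) = sc (m - 2 * of_nat k) * (F ^^ k) v" for k
  proof (induction k)
    case (Suc k)
    then show ?case
      by (simp add: KF linD[OF lin(2)] flip: left_diff_distrib sc_diff) (simp add: algebra_simps)
  qed (simp add: v)
  have E: "E ((F ^^ Suc k) v) - sc (of_nat (k + 1) * (m - of_nat k)) * (F ^^ k) v \<in> N" for k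
  proof (induction k)
    case 0
    then show ?case using v N(3) by (simp add: EF)
  next
    case (Suc k)
    define y where "y = (F ^^ Suc k) v"
    have "E (F y) - sc (of_nat (Suc k + 1) * (m - of_nat (Suc k))) * y
        = F (E y - sc (of_nat (k + 1) * (m - of_nat k)) * (F ^^ k) v)
          + (sc (of_nat (k + 1) * (m - of_nat k)) + sc (m - 2 * of_nat (Suc k))
             - sc (of_nat (Suc k + 1) * (m - of_nat (Suc k)))) * y"
      unfolding EF lin_diff[OF lin(2)] lin_sc[OF lin(2)]
      using K[of "Suc k"] by (simp add: y_def algebra_simps)
    also have "sc (of_nat (k + 1) * (m - of_nat k)) + sc (m - 2 * of_nat (Suc k))
             - sc (of_nat (Suc k + 1) * (m - of_nat (Suc k))) = sc 0"
      unfolding sc_add[symmetric] sc_diff[symmetric] by (simp add: algebra_simps)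
    finally show ?case using N(3)[OF Suc] by (simp add: y_def)
  qed
  have "(F ^^ k) v \<in> N \<Longrightarrow> v \<in> N" for k
  proof (induction k)
    case (Suc k)
    let ?c = "of_nat (k + 1) * (m - of_nat k)"
    have "?c \<noteq> 0" using m by auto
    have "sc ?c * (F ^^ k) v \<in> N"
      using E[of k] N(2)[OF Suc.prems] subsp_cong_mod[OF N(1)] by blast
    moreover have "inverse ?c * ?c = 1" using \<open>?c \<noteq> 0\<close> by (rule left_inverse)
    ultimately have "(F ^^ k) v \<in> N"
      using subsp_sc[OF N(1), of "sc ?c * (F ^^ k) v" "inverse ?c"] by (simp only: sc_sc) simp
    then show ?case by (rule Suc.IH)
  qed simp
  then show ?thesis using v by blast
qed

end

section \<open>Even orthogonal matrices\<close>

text \<open>Plain functions of two indices make bilinearity and the Jacobi identity hold without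
  side conditions on dimensions; \<open>MT\<close> later cuts them down to the matrices of the
  statement.\<close>

type_synonym fmat = "nat \<Rightarrow> nat \<Rightarrow> rat"

definition fmul :: "nat \<Rightarrow> fmat \<Rightarrow> fmat \<Rightarrow> fmat" where
  "fmul m X Y = (\<lambda>p q. \<Sum>s<m. X p s * Y s q)"

definition fadd :: "fmat \<Rightarrow> fmat \<Rightarrow> fmat" where
  "fadd X Y = (\<lambda>p q. X p q + Y p q)"

definition fscale :: "rat \<Rightarrow> fmat \<Rightarrow> fmat" where
  "fscale c X = (\<lambda>p q. c * X p q)"

definition fbr :: "nat \<Rightarrow> fmat \<Rightarrow> fmat \<Rightarrow> fmat" where
  "fbr m X Y = (\<lambda>p q. fmul m X Y p q - fmul m Y X p q)"

lemma fmul_assoc: "fmul m (fmul m X Y) Z = fmul m X (fmul m Y Z)"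
proof (intro ext)
  fix p q
  have "fmul m (fmul m X Y) Z p q = (\<Sum>s<m. \<Sum>t<m. X p t * (Y t s * Z s q))"
    by (simp add: fmul_def sum_distrib_right mult.assoc)
  also have "\<dots> = (\<Sum>t<m. \<Sum>s<m. X p t * (Y t s * Z s q))"
    by (rule sum.swap)
  finally show "fmul m (fmul m X Y) Z p q = fmul m X (fmul m Y Z) p q"
    by (simp add: fmul_def sum_distrib_left)
qed

lemma fmul_lin:
  "fmul m (fadd X Y) Z = fadd (fmul m X Z) (fmul m Y Z)"
  "fmul m X (fadd Y Z) = fadd (fmul m X Y) (fmul m X Z)"
  "fmul m (fscale c X) Y = fscale c (fmul m X Y)"
  "fmul m X (fscale c Y) = fscale c (fmul m X Y)"
  by (simp_all add: fmul_def fadd_def fscale_def algebra_simps sum.distrib sum_distrib_left)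

lemma fbr_eq: "fbr m X Y = fadd (fmul m X Y) (fscale (-1) (fmul m Y X))"
  by (simp add: fbr_def fadd_def fscale_def)

lemma fbr_lin:
  "fbr m (fadd X Y) Z = fadd (fbr m X Z) (fbr m Y Z)"
  "fbr m X (fadd Y Z) = fadd (fbr m X Y) (fbr m X Z)"
  "fbr m (fscale c X) Y = fscale c (fbr m X Y)"
  "fbr m X (fscale c Y) = fscale c (fbr m X Y)"
  unfolding fbr_eq fmul_lin by (simp_all add: fadd_def fscale_def algebra_simps)

lemma fbr_jacobi: "fbr m X (fbr m Y Z) = fadd (fbr m (fbr m X Y) Z) (fbr m Y (fbr m X Z))"
  unfolding fbr_eq fmul_lin fmul_assoc by (simp add: fadd_def fscale_def algebra_simps)

lemma fbr_skew: "fbr m Y X = fscale (-1) (fbr m X Y)"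
  by (simp add: fbr_def fscale_def)

definition fzero :: fmat where "fzero = (\<lambda>p q. 0)"

lemma fscale_zero: "fscale 0 X = fzero" and fscale_fzero: "fscale c fzero = fzero"
  and fadd_fzero [simp]: "fadd X fzero = X" "fadd fzero X = X"
  and fbr_fzero: "fbr m X fzero = fzero" "fbr m fzero X = fzero"
  and fscale_one [simp]: "fscale 1 X = X"
  by (simp_all add: fscale_def fzero_def fadd_def fbr_def fmul_def)

definition dl :: "nat \<Rightarrow> nat \<Rightarrow> rat" where "dl p q = (if p = q then 1 else 0)"

text \<open>The index \<open>bar n a\<close> is the partner of \<open>a\<close> under the bilinear form, so that the
  matrices \<open>Gm n a b\<close> span \<open>so\<^sub>2\<^sub>n\<close>.\<close>

definition bar :: "nat \<Rightarrow> nat \<Rightarrow> nat" where "bar n a = (if a < n then a + n else a - n)"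

definition Gm :: "nat \<Rightarrow> nat \<Rightarrow> nat \<Rightarrow> fmat" where
  "Gm n a b = (\<lambda>p q. dl p a * dl q b - dl p (bar n b) * dl q (bar n a))"

lemma bar_lt: "a < 2 * n \<Longrightarrow> bar n a < 2 * n"
  and bar_bar: "a < 2 * n \<Longrightarrow> bar n (bar n a) = a"
  and bar_eq_iff: "a < 2 * n \<Longrightarrow> b < 2 * n \<Longrightarrow> bar n a = bar n b \<longleftrightarrow> a = b"
  by (auto simp: bar_def)

lemma bar_swap: "a < 2 * n \<Longrightarrow> b < 2 * n \<Longrightarrow> bar n a = b \<longleftrightarrow> a = bar n b"
  by (auto simp: bar_def)

lemma Gm_bar: "a < 2 * n \<Longrightarrow> b < 2 * n \<Longrightarrow> Gm n (bar n b) (bar n a) = fscale (-1) (Gm n a b)"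
  by (simp add: Gm_def fscale_def bar_bar)

lemma Gm_self_bar: "a < 2 * n \<Longrightarrow> Gm n a (bar n a) = fzero"
  by (simp add: Gm_def fzero_def bar_bar)

lemma sum_dl: "b < m \<Longrightarrow> (\<Sum>s<m. dl s b * x s) = x b"
  and sum_dl': "b < m \<Longrightarrow> (\<Sum>s<m. dl b s * x s) = x b"
  by (simp_all add: dl_def if_distrib[of "\<lambda>c. c * _"] cong: if_cong)

lemma fmul_Gm:
  assumes "a < 2 * n" "b < 2 * n" "c < 2 * n" "d < 2 * n"
  shows "fmul (2 * n) (Gm n a b) (Gm n c d) p q =
    dl b c * (dl p a * dl q d) - dl c (bar n a) * (dl p (bar n b) * dl q d)
    - dl d (bar n b) * (dl p a * dl q (bar n c)) + dl a d * (dl p (bar n b) * dl q (bar n c))"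
proof -
  have s: "dl x y = dl y x" for x y by (simp add: dl_def)
  have "fmul (2 * n) (Gm n a b) (Gm n c d) p q =
    (\<Sum>s<2 * n. dl s b * (dl p a * (dl s c * dl q d - dl s (bar n d) * dl q (bar n c))))
    - (\<Sum>s<2 * n. dl s (bar n a) * (dl p (bar n b) * (dl s c * dl q d - dl s (bar n d) * dl q (bar n c))))"
    unfolding fmul_def Gm_def sum_subtractf[symmetric] by (intro sum.cong refl) (simp add: algebra_simps)
  also have "\<dots> = dl p a * (dl b c * dl q d - dl b (bar n d) * dl q (bar n c))
    - dl p (bar n b) * (dl (bar n a) c * dl q d - dl (bar n a) (bar n d) * dl q (bar n c))"
    using assms by (simp only: sum_dl bar_lt)
  also have "dl (bar n a) (bar n d) = dl a d" using assms by (simp add: dl_def bar_eq_iff)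
  also have "dl b (bar n d) = dl d (bar n b)" using assms bar_swap[of b n d] by (auto simp: dl_def)
  finally show ?thesis by (simp add: algebra_simps s[of "bar n a" c])
qed

text \<open>The structure constants of the Lie algebra in a redundant spanning family. Writing them
  with Kronecker deltas lets the same formula be transported to the presented algebra and lets sums
  over indices collapse in the Casimir computation.\<close>

lemma fbr_Gm:
  assumes "a < 2 * n" "b < 2 * n" "c < 2 * n" "d < 2 * n"
  shows "fbr (2 * n) (Gm n a b) (Gm n c d) =
    fadd (fadd (fscale (dl c b) (Gm n a d)) (fscale (- dl c (bar n a)) (Gm n (bar n b) d)))
         (fadd (fscale (- dl d a) (Gm n c b)) (fscale (dl d (bar n b)) (Gm n c (bar n a))))"
proof -
  have "dl b c = dl c b" "dl a d = dl d a" "dl a (bar n c) = dl c (bar n a)" "dl b (bar n d) = dl d (bar n b)"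
    using bar_swap[of a n c] bar_swap[of b n d] assms by (auto simp: dl_def)
  then show ?thesis
    unfolding fbr_def fmul_Gm[OF assms] fmul_Gm[OF assms(3,4,1,2)]
    unfolding fadd_def fscale_def Gm_def bar_bar[OF assms(1)] bar_bar[OF assms(2)]
    by (intro ext) (simp add: algebra_simps)
qed

text \<open>Transposition reverses brackets and exchanges \<open>emat\<close> with
  \<open>fmatr\<close>, so facts on negative root vectors follow from those on positive
  ones.\<close>

definition ftr :: "fmat \<Rightarrow> fmat" where "ftr X = (\<lambda>p q. X q p)"

lemma ftr: "ftr (ftr X) = X" "ftr (fadd X Y) = fadd (ftr X) (ftr Y)" "ftr (fscale c X) = fscale c (ftr X)"
  "ftr (fbr m X Y) = fbr m (ftr Y) (ftr X)" "ftr fzero = fzero" "ftr (Gm n a b) = Gm n b a"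
  by (simp_all add: ftr_def fadd_def fscale_def fbr_def fmul_def fzero_def Gm_def mult.commute fun_eq_iff)

text \<open>The degree of the basis vector \<open>a\<close> for the grading by half the sum of the
  positive roots, so that \<open>Gm n a b\<close> has degree \<open>ht n a - ht n b\<close>, the
  height of its root. The partners \<open>n - 1\<close> and \<open>2 * n - 1\<close> both have
  degree 0, and this is the only coincidence.\<close>

definition ht :: "nat \<Rightarrow> nat \<Rightarrow> int" where
  "ht n a = (if a < n then int n - 1 - int a else int a - (2 * int n - 1))"

text \<open>The last simple root is the sum of the last two coordinates. Its root vector carries the
  basis vector \<open>2 * n - 1\<close>, the partner of \<open>n - 1\<close>, to
  \<open>n - 2\<close>.\<close>

definition emat :: "nat \<Rightarrow> nat \<Rightarrow> fmat" where
  "emat n i = (if i + 1 < n then Gm n i (i + 1) else Gm n (n - 2) (2 * n - 1))"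

definition fmatr :: "nat \<Rightarrow> nat \<Rightarrow> fmat" where
  "fmatr n i = (if i + 1 < n then Gm n (i + 1) i else Gm n (2 * n - 1) (n - 2))"

definition hmat :: "nat \<Rightarrow> nat \<Rightarrow> fmat" where
  "hmat n i = Gm n i i"

lemma ht_bar: "a < 2 * n \<Longrightarrow> ht n (bar n a) = - ht n a"
  by (auto simp: ht_def bar_def)

lemma ht_eq: "a < 2 * n \<Longrightarrow> b < 2 * n \<Longrightarrow> ht n a = ht n b \<longleftrightarrow> a = b \<or> (b = bar n a \<and> ht n a = 0)"
  by (cases "a < n"; cases "b < n") (auto simp: ht_def bar_def)

lemma fbr_Gm_simple:
  assumes "a < 2 * n" "b < 2 * n" "d < 2 * n" "d \<noteq> a" "b \<noteq> bar n a" "d \<noteq> bar n b"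
  shows "fbr (2 * n) (Gm n a b) (Gm n b d) = Gm n a d"
  using assms by (subst fbr_Gm) (auto simp: dl_def fscale_zero)

text \<open>Every positive root vector is an iterated bracket of simple ones. The predicate
  \<open>L\<close> is arbitrary so that this single induction serves for lifting root vectors, for
  surjectivity onto the enveloping algebra and for showing that root vectors kill a highest weight
  vector.\<close>

lemma positive_closure:
  fixes L :: "int \<Rightarrow> fmat \<Rightarrow> bool"
  assumes n: "n \<ge> 2"
    and e: "\<And>i. i < n \<Longrightarrow> L 1 (emat n i)"
    and br: "\<And>k l X Y. L k X \<Longrightarrow> L l Y \<Longrightarrow> L (k + l) (fbr (2 * n) X Y)"
    and sc: "\<And>k c X. L k X \<Longrightarrow> L k (fscale c X)"
    and zero: "\<And>k. L k fzero"
    and ab: "a < 2 * n" "b < 2 * n" "ht n b < ht n a"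
  shows "L (ht n a - ht n b) (Gm n a b)"
proof -
  \<comment> \<open>The roots \<epsilon>_i - \<epsilon>_j, by chaining neighbouring indices.\<close>
  have upper: "L (int j - int i) (Gm n i j)" if "i < j" "j < n" for i j
    using that
  proof (induction j)
    case (Suc j)
    have s: "L 1 (Gm n j (Suc j))" using e[of j] Suc.prems by (simp add: emat_def)
    show ?case
    proof (cases "i = j")
      case False
      then have "L (int j - int i + 1) (fbr (2 * n) (Gm n i j) (Gm n j (Suc j)))"
        using Suc s by (intro br) auto
      then show ?thesis
        using Suc.prems False by (subst (asm) fbr_Gm_simple) (auto simp: bar_def algebra_simps)
    qed (use s in simp)
  qed simp
  define z where "z = 2 * n - 1"
  have z: "bar n (n - 1) = z" "bar n z = n - 1" "z < 2 * n" "z = n - 1 + n" "\<not> z < n"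
    using n by (auto simp: bar_def z_def)
  have base: "L 1 (Gm n (n - 2) z)" using e[of "n - 1"] n by (simp add: emat_def z_def)
  \<comment> \<open>The roots \<epsilon>_i + \<epsilon>_j with \<open>j = n - 1\<close>: the last
    simple root is extended to the left.\<close>
  have last: "L (int n - 1 - int i) (Gm n i z)" if i: "i < n - 1" for i
  proof (cases "i = n - 2")
    case True
    then show ?thesis using base n by (simp add: of_nat_diff)
  next
    case False
    then have "L (int (n - 2) - int i + 1) (fbr (2 * n) (Gm n i (n - 2)) (Gm n (n - 2) z))"
      using i n by (intro br upper base) auto
    moreover have "fbr (2 * n) (Gm n i (n - 2)) (Gm n (n - 2) z) = Gm n i z"
      using i n False z by (intro fbr_Gm_simple) (auto simp: bar_def)
    moreover have "int (n - 2) - int i + 1 = int n - 1 - int i" using n by (simp add: of_nat_diff)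
    ultimately show ?thesis by metis
  qed
  \<comment> \<open>The family is redundant: up to sign the partner pair gives the same matrix,
    which moves the upper left block to the lower right one.\<close>
  have neg: "L k (Gm n (bar n b) (bar n a))" if "L k (Gm n a b)" "a < 2 * n" "b < 2 * n" for k a b
    using sc[OF that(1), of "-1"] Gm_bar[OF that(2,3)] by simp
  \<comment> \<open>The general roots \<epsilon>_i + \<epsilon>_j are reached by passing through the
    index \<open>z\<close> of degree 0.\<close>
  have corner: "L (ht n i - ht n (j + n)) (Gm n i (j + n))" if ij: "i < n" "j < n" "i \<noteq> j" for i j
  proof -
    have h: "ht n i - ht n (j + n) = (int n - 1 - int i) + (int n - 1 - int j)"
      using ij by (simp add: ht_def)
    consider "j = n - 1" | "i = n - 1" | "i < n - 1" "j < n - 1" using ij by linarith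
    then show ?thesis
    proof cases
      case 1
      then have "j + n = z" "int n - 1 - int j = 0" "i < n - 1" using z(4) n ij by auto
      then show ?thesis using h last[of i] by simp
    next
      case 2
      then have "bar n j = j + n" "int n - 1 - int i = 0" "j < n - 1" using ij n by (auto simp: bar_def)
      then show ?thesis using h neg[OF last[of j]] z 2 ij by simp
    next
      case 3
      have "L (int (n - 1) - int j) (Gm n (bar n (n - 1)) (bar n j))"
        using 3 ij by (intro neg upper) auto
      moreover have "int (n - 1) = int n - 1" "bar n j = j + n" using n ij by (auto simp: bar_def)
      ultimately have "L (int n - 1 - int j) (Gm n z (j + n))" using z by simp
      from br[OF last[OF 3(1)] this] have "L (ht n i - ht n (j + n)) (fbr (2 * n) (Gm n i z) (Gm n z (j + n)))"
        using h by simp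
      moreover have "fbr (2 * n) (Gm n i z) (Gm n z (j + n)) = Gm n i (j + n)"
        using 3 ij z by (intro fbr_Gm_simple) (auto simp: bar_def)
      ultimately show ?thesis by simp
    qed
  qed
  have "a \<ge> n \<Longrightarrow> b \<ge> n" using ab by (auto simp: ht_def split: if_splits)
  then consider (tl) "a < n" "b < n" | (tr) i j where "a = i" "b = j + n" "i < n" "j < n" "i \<noteq> j"
    | (dg) i where "a = i" "b = i + n" "i < n"
    | (br) i j where "a = i + n" "b = j + n" "i < n" "j < n"
  proof -
    consider "a < n" "b < n" | "a < n" "b \<ge> n" | "a \<ge> n" "b \<ge> n"
      using \<open>a \<ge> n \<Longrightarrow> b \<ge> n\<close> by linarith
    then show ?thesis
    proof cases
      case 2
      then have "b = (b - n) + n" "b - n < n" using ab by auto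
      then show ?thesis using that(2)[of a "b - n"] that(3)[of a] 2 by metis
    next
      case 3
      then have "a = (a - n) + n" "a - n < n" "b = (b - n) + n" "b - n < n" using ab by auto
      then show ?thesis using that(4) by blast
    qed (use that in blast)
  qed
  then show ?thesis
  proof cases
    case tl
    then show ?thesis using upper[of a b] ab by (simp add: ht_def)
  next
    case tr
    then show ?thesis using corner by simp
  next
    case dg
    then have "Gm n a b = fzero" using Gm_self_bar[of a n] by (simp add: bar_def)
    then show ?thesis using zero by simp
  next
    case (br i j)
    then have "L (int i - int j) (Gm n (bar n i) (bar n j))"
      using ab by (intro neg upper) (auto simp: ht_def)
    then show ?thesis using br by (simp add: ht_def bar_def)
  qed
qed

text \<open>Negative degrees are reduced to positive ones by transposing. In degree 0 only the
  diagonal matrices and the zero matrices \<open>Gm n a (bar n a)\<close> are left.\<close>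

lemma lie_closure:
  fixes L :: "int \<Rightarrow> fmat \<Rightarrow> bool"
  assumes n: "n \<ge> 2"
    and e: "\<And>i. i < n \<Longrightarrow> L 1 (emat n i)"
    and f: "\<And>i. i < n \<Longrightarrow> L (-1) (fmatr n i)"
    and h: "\<And>i. i < n \<Longrightarrow> L 0 (hmat n i)"
    and br: "\<And>k l X Y. L k X \<Longrightarrow> L l Y \<Longrightarrow> L (k + l) (fbr (2 * n) X Y)"
    and sc: "\<And>k c X. L k X \<Longrightarrow> L k (fscale c X)"
    and zero: "\<And>k. L k fzero"
    and ab: "a < 2 * n" "b < 2 * n"
  shows "L (ht n a - ht n b) (Gm n a b)"
proof -
  consider "ht n b < ht n a" | "ht n a < ht n b" | "ht n a = ht n b" by linarith
  then show ?thesis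
  proof cases
    case 1
    show ?thesis using 1 ab by (intro positive_closure[where L = L, OF n e br sc zero])
  next
    case 2
    have "(\<lambda>k X. L (- k) (ftr X)) (ht n b - ht n a) (Gm n b a)"
    proof (rule positive_closure[OF n])
      show "L (- 1) (ftr (emat n i))" if "i < n" for i
        using f[OF that] by (cases "Suc i < n") (simp_all add: emat_def fmatr_def ftr)
      show "L (- (k + l)) (ftr (fbr (2 * n) X Y))" if "L (- k) (ftr X)" "L (- l) (ftr Y)" for k l X Y
        by (subst ftr(4)) (use br[OF that(2,1)] in \<open>simp add: add.commute\<close>)
    qed (use sc zero ab 2 in \<open>auto simp: ftr\<close>)
    then show ?thesis by (simp add: ftr)
  next
    case 3
    then consider "a = b" | "b = bar n a" using ht_eq[OF ab] by auto
    then show ?thesis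
    proof cases
      case 1
      show ?thesis
      proof (cases "a < n")
        case True
        then show ?thesis using h[of a] 1 3 by (simp add: hmat_def)
      next
        case False
        then have "a - n < n" using ab by simp
        then have "Gm n a a = fscale (-1) (hmat n (a - n))"
          using Gm_bar[of "a - n" n "a - n"] False by (simp add: bar_def hmat_def)
        then show ?thesis using sc[OF h[of "a - n"], of "-1"] 1 3 False ab by simp
      qed
    next
      case 2
      then show ?thesis using Gm_self_bar[of a n] ab zero by simp
    qed
  qed
qed

section \<open>Weights and Chevalley relations\<close>

definition rootc :: "nat \<Rightarrow> nat \<Rightarrow> nat \<Rightarrow> rat" where
  "rootc n j k = (if j + 1 < n then dl k j - dl k (j + 1) else dl k (n - 2) + dl k (n - 1))"

text \<open>The value of \<nu> on a simple coroot. All roots have square length 2, so it is also the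
  inner product with the simple root, as \<open>copair_sum\<close> states.\<close>

definition copair :: "nat \<Rightarrow> (nat \<Rightarrow> rat) \<Rightarrow> nat \<Rightarrow> rat" where
  "copair n \<nu> i = (if i + 1 < n then \<nu> i - \<nu> (i + 1) else \<nu> (n - 2) + \<nu> (n - 1))"

definition dom_wt :: "nat \<Rightarrow> (nat \<Rightarrow> rat) \<Rightarrow> bool" where
  "dom_wt n \<nu> \<longleftrightarrow> (\<forall>i<n. copair n \<nu> i \<ge> 0)"

definition asum :: "nat \<Rightarrow> nat list \<Rightarrow> nat \<Rightarrow> rat" where
  "asum n ws k = (\<Sum>j\<leftarrow>ws. rootc n j k)"

text \<open>The inner product with half the sum of the positive roots, whose coordinates are
  \<open>n - 1, ..., 0\<close>; on each simple root it equals 1.\<close>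

definition height :: "nat \<Rightarrow> (nat \<Rightarrow> rat) \<Rightarrow> rat" where
  "height n \<nu> = (\<Sum>k<n. of_nat (n - 1 - k) * \<nu> k)"

text \<open>Twice the usual Casimir eigenvalue (\<nu>, \<nu> + 2 rho), where rho is half the sum of
  the positive roots: \<open>casimir\<close> runs over all pairs of indices and so meets every root
  vector twice.\<close>

definition cas :: "nat \<Rightarrow> (nat \<Rightarrow> rat) \<Rightarrow> rat" where
  "cas n \<nu> = 2 * (\<Sum>k<n. \<nu> k * \<nu> k) + 4 * height n \<nu>"

lemma asum_simps [simp]:
  "asum n [] k = 0" "asum n (j # ws) k = rootc n j k + asum n ws k"
  by (simp_all add: asum_def)

lemma copair_sum:
  assumes "i < n" "2 \<le> n" shows "(\<Sum>k<n. \<nu> k * rootc n i k) = copair n \<nu> i"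
proof -
  have d: "(\<Sum>k<n. \<nu> k * dl k b) = \<nu> b" if "b < n" for b
    using sum_dl[OF that, of \<nu>] by (simp add: mult.commute)
  show ?thesis
    using assms by (auto simp: rootc_def copair_def algebra_simps sum.distrib sum_subtractf d)
qed

lemma copair_cong: "(\<And>k. k < n \<Longrightarrow> \<nu> k = \<mu> k) \<Longrightarrow> i < n \<Longrightarrow> copair n \<nu> i = copair n \<mu> i"
  by (auto simp: copair_def)

lemma copair_root: "i < n \<Longrightarrow> 2 \<le> n \<Longrightarrow> copair n (rootc n i) i = 2"
  by (auto simp: copair_def rootc_def dl_def)

lemma height_root: "i < n \<Longrightarrow> 2 \<le> n \<Longrightarrow> height n (rootc n i) = 1"
  unfolding height_def by (subst copair_sum) (auto simp: copair_def of_nat_diff)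

lemma height_add: "height n (\<lambda>k. \<nu> k + \<mu> k) = height n \<nu> + height n \<mu>"
  by (simp add: height_def distrib_left sum.distrib)

lemma height_asum: "set ws \<subseteq> {..<n} \<Longrightarrow> 2 \<le> n \<Longrightarrow> height n (asum n ws) = of_nat (length ws)"
proof (induction ws)
  case (Cons j ws)
  have "asum n (j # ws) = (\<lambda>k. rootc n j k + asum n ws k)" by (simp add: fun_eq_iff)
  then show ?case using Cons by (simp add: height_add height_root)
qed (simp add: height_def)

lemma sum_asum:
  assumes "set ws \<subseteq> {..<n}" "2 \<le> n"
  shows "(\<Sum>k<n. \<nu> k * asum n ws k) = (\<Sum>j\<leftarrow>ws. copair n \<nu> j)"
  using assms(1) by (induction ws) (simp_all add: distrib_left sum.distrib copair_sum assms(2))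

text \<open>For \<open>\<kappa> = \<nu> + \<beta>\<close> the difference of the Casimir eigenvalues is
  \<open>(\<beta>, 2 (\<kappa> + \<nu>) + 4 \<rho>)\<close>.\<close>

lemma cas_strict:
  assumes "dom_wt n \<kappa>" "dom_wt n \<nu>" "\<And>k. k < n \<Longrightarrow> \<kappa> k = \<nu> k + asum n ws k"
    and "set ws \<subseteq> {..<n}" "2 \<le> n" "cas n \<kappa> = cas n \<nu>"
  shows "ws = []"
proof -
  have "cas n \<kappa> - cas n \<nu> = (\<Sum>k<n. (2 * (\<kappa> k + \<nu> k)) * asum n ws k) + 4 * height n (asum n ws)"
  proof -
    have "height n \<kappa> = height n \<nu> + height n (asum n ws)"
      using assms(3) unfolding height_add[symmetric] by (simp add: height_def)
    moreover have "(\<Sum>k<n. \<kappa> k * \<kappa> k) = (\<Sum>k<n. \<nu> k * \<nu> k) + (\<Sum>k<n. (\<kappa> k + \<nu> k) * asum n ws k)"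
      unfolding sum.distrib[symmetric] by (intro sum.cong) (auto simp: assms(3) algebra_simps)
    ultimately show ?thesis by (simp add: cas_def algebra_simps sum_distrib_left sum.distrib)
  qed
  also have "\<dots> = (\<Sum>j\<leftarrow>ws. copair n (\<lambda>k. 2 * (\<kappa> k + \<nu> k)) j) + 4 * of_nat (length ws)"
    using assms(4,5) by (simp only: sum_asum height_asum)
  finally have "(\<Sum>j\<leftarrow>ws. copair n (\<lambda>k. 2 * (\<kappa> k + \<nu> k)) j) + 4 * of_nat (length ws) = 0"
    using assms by simp
  moreover have "(\<Sum>j\<leftarrow>ws. copair n (\<lambda>k. 2 * (\<kappa> k + \<nu> k)) j) \<ge> 0"
  proof (rule sum_list_nonneg)
    fix x assume "x \<in> set (map (copair n (\<lambda>k. 2 * (\<kappa> k + \<nu> k))) ws)"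
    then obtain j where "j < n" "x = copair n (\<lambda>k. 2 * (\<kappa> k + \<nu> k)) j"
      using assms(4) by auto
    moreover have "copair n (\<lambda>k. 2 * (\<kappa> k + \<nu> k)) j = 2 * (copair n \<kappa> j + copair n \<nu> j)"
      by (simp add: copair_def)
    ultimately show "0 \<le> x" using assms(1,2) by (simp add: dom_wt_def)
  qed
  ultimately have "of_nat (length ws) \<le> (0 :: rat)" by linarith
  then show ?thesis by simp
qed

text \<open>The last two inequalities add up to \<beta> (n - 2) \<le> 0, and the others carry this
  down to all smaller indices. Coordinate \<open>n - 1\<close>, whose sign is open, enters the
  height with coefficient 0.\<close>

lemma height_antidominant:
  assumes "2 \<le> n" "\<And>i. i < n \<Longrightarrow> copair n \<beta> i \<le> 0"
  shows "height n \<beta> \<le> 0"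
  unfolding height_def
proof (rule sum_nonpos)
  have b: "\<beta> (n - 2) \<le> 0"
    using assms(2)[of "n - 1"] assms(2)[of "n - 2"] assms(1) by (auto simp: copair_def numeral_2_eq_2 Suc_diff_Suc)
  have "k \<le> n - 2 \<Longrightarrow> \<beta> k \<le> 0" for k
  proof (induction rule: inc_induct)
    case (step k)
    then have "Suc k < n" by simp
    then show ?case using assms(2)[of k] step by (simp add: copair_def)
  qed (fact b)
  then show "of_nat (n - 1 - k) * \<beta> k \<le> 0" if "k \<in> {..<n}" for k
    using that by (cases "k = n - 1") (auto simp: mult_nonneg_nonpos)
qed

lemma dl_simps: "dl p p = 1" "p \<noteq> q \<Longrightarrow> dl p q = 0"
  by (simp_all add: dl_def)

lemma fbr_hmat_Gm:
  assumes "i < n" "c < 2 * n" "d < 2 * n"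
  shows "fbr (2 * n) (hmat n i) (Gm n c d) =
    fscale (dl c i - dl c (i + n) - dl d i + dl d (i + n)) (Gm n c d)"
proof -
  have i: "i < 2 * n" "bar n i = i + n" using assms by (auto simp: bar_def)
  have "dl c x * Gm n x d p q = dl c x * Gm n c d p q" "dl d x * Gm n c x p q = dl d x * Gm n c d p q"
    for x p q by (auto simp: dl_def)
  note e = this(1)[of i] this(1)[of "i + n"] this(2)[of i] this(2)[of "i + n"]
  show ?thesis
    unfolding hmat_def fbr_Gm[OF i(1) i(1) assms(2,3)] i(2) fadd_def fscale_def
    by (intro ext) (simp add: left_diff_distrib distrib_right e)
qed

lemma fbr_hh: "i < n \<Longrightarrow> j < n \<Longrightarrow> fbr (2 * n) (hmat n i) (hmat n j) = fzero"
  unfolding hmat_def[of n j] by (simp add: fbr_hmat_Gm fscale_zero)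

lemma dl_last:
  assumes "i < n" "3 \<le> n"
  shows "dl (n - 2) (i + n) = 0" "dl (2 * n - 1) i = 0" "dl (2 * n - 1) (i + n) = dl i (n - 1)"
    "dl (n - 2) i = dl i (n - 2)"
proof -
  have "n - 2 \<noteq> i + n" "2 * n - 1 \<noteq> i" "2 * n - 1 = i + n \<longleftrightarrow> i = n - 1" "n - 2 = i \<longleftrightarrow> i = n - 2"
    using assms by linarith+
  then show "dl (n - 2) (i + n) = 0" "dl (2 * n - 1) i = 0" "dl (2 * n - 1) (i + n) = dl i (n - 1)"
    "dl (n - 2) i = dl i (n - 2)" unfolding dl_def by simp_all
qed

lemma fbr_he:
  assumes "i < n" "j < n" "3 \<le> n"
  shows "fbr (2 * n) (hmat n i) (emat n j) = fscale (rootc n j i) (emat n j)"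
proof (cases "j + 1 < n")
  case True
  then have "dl j i - dl j (i + n) - dl (j + 1) i + dl (j + 1) (i + n) = rootc n j i"
    using assms by (simp add: rootc_def) (simp add: dl_def)
  then show ?thesis using True assms fbr_hmat_Gm[of i n j "j + 1"] by (simp add: emat_def)
next
  case False
  then have "dl (n - 2) i - dl (n - 2) (i + n) - dl (2 * n - 1) i + dl (2 * n - 1) (i + n) = rootc n j i"
    unfolding dl_last[OF assms(1,3)] by (simp add: rootc_def)
  then show ?thesis using False assms fbr_hmat_Gm[of i n "n - 2" "2 * n - 1"] by (simp add: emat_def)
qed

lemma fbr_hf:
  assumes "i < n" "j < n" "3 \<le> n"
  shows "fbr (2 * n) (hmat n i) (fmatr n j) = fscale (- rootc n j i) (fmatr n j)"
proof (cases "j + 1 < n")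
  case True
  then have "dl (j + 1) i - dl (j + 1) (i + n) - dl j i + dl j (i + n) = - rootc n j i"
    using assms by (simp add: rootc_def) (simp add: dl_def)
  then show ?thesis using True assms fbr_hmat_Gm[of i n "j + 1" j] by (simp add: fmatr_def)
next
  case False
  then have "dl (2 * n - 1) i - dl (2 * n - 1) (i + n) - dl (n - 2) i + dl (n - 2) (i + n) = - rootc n j i"
    unfolding dl_last[OF assms(1,3)] by (simp add: rootc_def)
  then show ?thesis using False assms fbr_hmat_Gm[of i n "2 * n - 1" "n - 2"] by (simp add: fmatr_def)
qed

definition hhmat :: "nat \<Rightarrow> nat \<Rightarrow> fmat" where
  "hhmat n i = (if i + 1 < n then fadd (hmat n i) (fscale (-1) (hmat n (i + 1)))
     else fadd (hmat n (n - 2)) (hmat n (n - 1)))"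

lemma fbr_ef:
  assumes "i < n" "j < n" "3 \<le> n"
  shows "fbr (2 * n) (emat n i) (fmatr n j) = (if i = j then hhmat n i else fzero)"
proof -
  have b: "bar n (n - 2) = 2 * n - 2" "bar n (n - 1) = 2 * n - 1" "bar n (2 * n - 1) = n - 1"
    using assms(3) by (auto simp: bar_def)
  have z: "Gm n (n - 1) (2 * n - 1) = fzero" "Gm n (2 * n - 1) (n - 1) = fzero"
    using Gm_self_bar[of "n - 1" n] Gm_self_bar[of "2 * n - 1" n] b assms(3) by auto
  have m: "Gm n (2 * n - 1) (2 * n - 1) = fscale (-1) (Gm n (n - 1) (n - 1))"
    using Gm_bar[of "n - 1" n "n - 1"] b assms(3) by simp
  consider (a) "i + 1 < n" "j + 1 < n" | (b) "i + 1 < n" "j = n - 1" | (c) "i = n - 1" "j + 1 < n"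
    | (d) "i = n - 1" "j = n - 1" using assms by linarith
  then show ?thesis
  proof cases
    case a
    then have "fbr (2 * n) (emat n i) (fmatr n j) =
        fadd (fscale (dl j i) (Gm n i j)) (fscale (- dl j i) (Gm n (j + 1) (i + 1)))"
      unfolding emat_def fmatr_def using a
      by (simp add: fbr_Gm bar_def fscale_zero dl_simps) (simp add: dl_def)
    then show ?thesis
      using a by (cases "i = j") (auto simp: dl_simps fscale_zero hhmat_def hmat_def)
  next
    case b
    then have "fbr (2 * n) (emat n i) (fmatr n j) = fscale (- dl (n - 2) i) (Gm n (2 * n - 1) (i + 1))"
      unfolding emat_def fmatr_def using assms(3)
      by (simp add: fbr_Gm bar_def fscale_zero dl_simps)
    \<comment> \<open>For \<open>i = n - 2\<close> the two roots differ by twice a coordinate, which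
      is not a root in type D: the remaining matrix pairs an index with its partner and
      vanishes.\<close>
    also have "\<dots> = fzero"
    proof (cases "i = n - 2")
      case True
      then have "i + 1 = n - 1" using assms(3) by simp
      then show ?thesis using z by (simp add: fscale_fzero del: One_nat_def)
    qed (simp add: dl_simps fscale_zero)
    finally show ?thesis using b by auto
  next
    case c
    then have "fbr (2 * n) (emat n i) (fmatr n j) = fscale (- dl j (n - 2)) (Gm n (j + 1) (2 * n - 1))"
      unfolding emat_def fmatr_def using assms(3)
      by (simp add: fbr_Gm b[unfolded One_nat_def] fscale_zero dl_simps)
    also have "\<dots> = fzero"
    proof (cases "j = n - 2")
      case True
      then have "j + 1 = n - 1" using assms(3) by simp
      then show ?thesis using z by (simp add: fscale_fzero del: One_nat_def)
    qed (simp add: dl_simps fscale_zero)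
    finally show ?thesis using c by auto
  next
    case d
    have "fbr (2 * n) (Gm n (n - 2) (2 * n - 1)) (Gm n (2 * n - 1) (n - 2)) =
        fadd (Gm n (n - 2) (n - 2)) (fscale (- 1) (Gm n (2 * n - 1) (2 * n - 1)))"
      using assms(3) by (subst fbr_Gm) (auto simp: b[unfolded One_nat_def] fscale_zero dl_simps)
    then show ?thesis
      using d assms(3) by (simp add: emat_def fmatr_def hhmat_def hmat_def m[unfolded One_nat_def]) (simp add: fscale_def)
  qed
qed

section \<open>Commutators, and weights for left multiplication and for commutation\<close>

definition cm :: "'a::ring \<Rightarrow> 'a \<Rightarrow> 'a" where "cm a b = a * b - b * a"

lemma cm_add: "cm (a + b) c = cm a c + cm b c" "cm c (a + b) = cm c a + cm c b"
  and cm_diff: "cm (a - b) c = cm a c - cm b c" "cm c (a - b) = cm c a - cm c b"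
  and cm_minus: "cm (- a) c = - cm a c" "cm c (- a) = - cm c a"
  and cm_zero [simp]: "cm 0 c = 0" "cm c 0 = 0"
  and cm_skew: "cm b a = - cm a b"
  and cm_jacobi: "cm a (cm b c) = cm (cm a b) c + cm b (cm a c)"
  by (simp_all add: cm_def algebra_simps)

lemma cm_sum: "cm (\<Sum>i\<in>I. g i) c = (\<Sum>i\<in>I. cm (g i) c)"
  by (simp add: cm_def sum_distrib_left sum_distrib_right sum_subtractf)

context rat_scalars
begin

lemma cm_sc: "cm (sc c * a) b = sc c * cm a b" "cm a (sc c * b) = sc c * cm a b"
  by (simp_all add: cm_def right_diff_distrib sc_left mult.assoc)

lemma lin_cm: "lin (cm a)"
  using lin_ad[of a] by (simp add: cm_def[abs_def])

text \<open>The adjoint form of \<open>sl2_lower\<close> with the zero space as \<open>N\<close>: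
  nilpotency of \<open>cm b\<close> excludes highest weight vectors of negative weight.\<close>

lemma ad_sl2_zero:
  assumes "cm a b = h" "cm h b = - (sc 2 * b)"
    and "cm h y = sc m * y" "cm a y = 0" "(cm b ^^ p) y = 0" "m < 0"
  shows "y = 0"
proof -
  have "y \<in> {0}"
  proof (rule sl2_lower[OF lin_cm[of a] lin_cm[of b] lin_cm[of h]])
    show "cm a (cm b x) = cm b (cm a x) + cm h x" for x
      using cm_jacobi[of a b x] assms(1) by simp
    show "cm h (cm b x) = cm b (cm h x) - sc 2 * cm b x" for x
      using cm_jacobi[of h b x] assms(2) by (simp add: cm_minus cm_sc)
    show "subsp {0}" by (rule subspI) auto
  qed (use assms in auto)
  then show ?thesis by simp
qed

lemma lin_fold: "lin T \<Longrightarrow> lin (\<lambda>x. fold (\<lambda>k y. T y - sc k * y) S x)"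
proof (induction S)
  case (Cons a S)
  note l = linD[OF Cons.IH[OF Cons.prems]] and t = linD[OF Cons.prems]
  show ?case
    unfolding lin_def
  proof (intro conjI allI)
    fix x y c
    have 1: "T (x + y) - sc a * (x + y) = (T x - sc a * x) + (T y - sc a * y)"
      by (simp add: t algebra_simps)
    have 2: "T (sc c * x) - sc a * (sc c * x) = sc c * (T x - sc a * x)"
      by (simp add: t right_diff_distrib sc_sc mult.commute)
    show "fold (\<lambda>k y. T y - sc k * y) (a # S) (x + y) =
        fold (\<lambda>k y. T y - sc k * y) (a # S) x + fold (\<lambda>k y. T y - sc k * y) (a # S) y"
      by (simp only: fold_simps 1 l)
    show "fold (\<lambda>k y. T y - sc k * y) (a # S) (sc c * x) = sc c * fold (\<lambda>k y. T y - sc k * y) (a # S) x"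
      by (simp only: fold_simps 2 l)
  qed
qed (simp add: lin_def)

end

locale chevalley = rat_scalars sc for sc :: "rat \<Rightarrow> 'a :: ring_1" +
  fixes n :: nat and e f H :: "nat \<Rightarrow> 'a"
  assumes n3: "3 \<le> n"
    and D1: "i < n \<Longrightarrow> j < n \<Longrightarrow> H i * H j = H j * H i"
    and D2: "i < n \<Longrightarrow> j < n \<Longrightarrow> e i * f j - f j * e i =
      (if i = j then if i + 1 < n then H i - H (i + 1) else H (n - 2) + H (n - 1) else 0)"
    and D3e: "i < n \<Longrightarrow> j < n \<Longrightarrow> H i * e j - e j * H i = sc (rootc n j i) * e j"
    and D3f: "i < n \<Longrightarrow> j < n \<Longrightarrow> H i * f j - f j * H i = - (sc (rootc n j i) * f j)"
begin

lemma n2: "2 \<le> n" using n3 by simp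

definition hh :: "nat \<Rightarrow> 'a" where
  "hh i = (if i + 1 < n then H i - H (i + 1) else H (n - 2) + H (n - 1))"

lemma cm_ef: "i < n \<Longrightarrow> j < n \<Longrightarrow> cm (e i) (f j) = (if i = j then hh i else 0)"
  and cm_HH: "i < n \<Longrightarrow> j < n \<Longrightarrow> cm (H i) (H j) = 0"
  and cm_He: "i < n \<Longrightarrow> j < n \<Longrightarrow> cm (H i) (e j) = sc (rootc n j i) * e j"
  and cm_Hf: "i < n \<Longrightarrow> j < n \<Longrightarrow> cm (H i) (f j) = - (sc (rootc n j i) * f j)"
  using D1 D2 D3e D3f by (auto simp: cm_def hh_def)

lemma cm_hhe: "i < n \<Longrightarrow> j < n \<Longrightarrow> cm (hh i) (e j) = sc (copair n (rootc n j) i) * e j"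
  and cm_hhf: "i < n \<Longrightarrow> j < n \<Longrightarrow> cm (hh i) (f j) = - (sc (copair n (rootc n j) i) * f j)"
  using n2 by (auto simp: hh_def cm_diff cm_add cm_He cm_Hf copair_def sc_diff sc_add algebra_simps)

text \<open>Weights under left multiplication; \<open>awt\<close> is the analogue for commutators.
  The zero element has every weight, so nonvanishing is always a separate assumption.\<close>

definition wt :: "(nat \<Rightarrow> rat) \<Rightarrow> 'a \<Rightarrow> bool" where
  "wt \<nu> x \<longleftrightarrow> (\<forall>i<n. H i * x = sc (\<nu> i) * x)"

definition awt :: "(nat \<Rightarrow> rat) \<Rightarrow> 'a \<Rightarrow> bool" where
  "awt \<beta> y \<longleftrightarrow> (\<forall>i<n. cm (H i) y = sc (\<beta> i) * y)"

definition ew :: "nat list \<Rightarrow> 'a" where "ew ws = prod_list (map e ws)"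
definition fw :: "nat list \<Rightarrow> 'a" where "fw ws = prod_list (map f ws)"

lemma ew_simps [simp]: "ew [] = 1" "ew (j # ws) = e j * ew ws"
  and fw_simps [simp]: "fw [] = 1" "fw (j # ws) = f j * fw ws"
  by (simp_all add: ew_def fw_def)

lemma wt_cong: "wt \<nu> x \<Longrightarrow> (\<And>k. k < n \<Longrightarrow> \<nu> k = \<mu> k) \<Longrightarrow> wt \<mu> x"
  by (auto simp: wt_def)

lemma wt_e: "wt \<nu> x \<Longrightarrow> j < n \<Longrightarrow> wt (\<lambda>k. \<nu> k + rootc n j k) (e j * x)"
  unfolding wt_def
proof (intro allI impI)
  fix i assume w: "\<forall>i<n. H i * x = sc (\<nu> i) * x" and ij: "j < n" "i < n"
  have "H i * e j = e j * H i + sc (rootc n j i) * e j" using D3e[of i j] ij by (simp add: algebra_simps)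
  then have "H i * (e j * x) = e j * (H i * x) + sc (rootc n j i) * (e j * x)"
    by (metis (no_types) distrib_right mult.assoc)
  then show "H i * (e j * x) = sc (\<nu> i + rootc n j i) * (e j * x)"
    using w ij by (simp add: sc_left sc_add algebra_simps)
qed

lemma wt_f: "wt \<nu> x \<Longrightarrow> j < n \<Longrightarrow> wt (\<lambda>k. \<nu> k - rootc n j k) (f j * x)"
  unfolding wt_def
proof (intro allI impI)
  fix i assume w: "\<forall>i<n. H i * x = sc (\<nu> i) * x" and ij: "j < n" "i < n"
  have "H i * f j = f j * H i - sc (rootc n j i) * f j" using D3f[of i j] ij by (simp add: algebra_simps)
  then have "H i * (f j * x) = f j * (H i * x) - sc (rootc n j i) * (f j * x)"
    by (metis (no_types) left_diff_distrib mult.assoc)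
  then show "H i * (f j * x) = sc (\<nu> i - rootc n j i) * (f j * x)"
    using w ij by (simp add: sc_left sc_diff algebra_simps)
qed

lemma wt_ew: "wt \<nu> x \<Longrightarrow> set ws \<subseteq> {..<n} \<Longrightarrow> wt (\<lambda>k. \<nu> k + asum n ws k) (ew ws * x)"
proof (induction ws)
  case (Cons j ws)
  then have "wt (\<lambda>k. \<nu> k + asum n ws k + rootc n j k) (e j * (ew ws * x))" by (intro wt_e) auto
  from wt_cong[OF this, of "\<lambda>k. \<nu> k + asum n (j # ws) k"] show ?case by (simp add: mult.assoc)
qed simp

lemma wt_fw: "wt \<nu> x \<Longrightarrow> set ws \<subseteq> {..<n} \<Longrightarrow> wt (\<lambda>k. \<nu> k - asum n ws k) (fw ws * x)"
proof (induction ws)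
  case (Cons j ws)
  then have "wt (\<lambda>k. \<nu> k - asum n ws k - rootc n j k) (f j * (fw ws * x))" by (intro wt_f) auto
  from wt_cong[OF this, of "\<lambda>k. \<nu> k - asum n (j # ws) k"] show ?case by (simp add: mult.assoc)
qed simp

lemma wt_hh: "wt \<nu> x \<Longrightarrow> i < n \<Longrightarrow> hh i * x = sc (copair n \<nu> i) * x"
  using n2 by (auto simp: wt_def hh_def copair_def sc_add sc_diff algebra_simps)

lemma wt_right: "wt \<nu> x \<Longrightarrow> wt \<nu> (x * y)"
  by (simp add: wt_def mult.assoc[symmetric])

lemma awt_hh: "awt \<beta> x \<Longrightarrow> i < n \<Longrightarrow> cm (hh i) x = sc (copair n \<beta> i) * x"
  using n2 by (auto simp: awt_def hh_def copair_def sc_add sc_diff cm_add cm_diff algebra_simps)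

lemma awt_e: "awt \<beta> x \<Longrightarrow> j < n \<Longrightarrow> awt (\<lambda>k. \<beta> k + rootc n j k) (cm (e j) x)"
  unfolding awt_def
proof (intro allI impI)
  fix i assume a: "\<forall>i<n. cm (H i) x = sc (\<beta> i) * x" and ij: "j < n" "i < n"
  have "cm (H i) (cm (e j) x) = cm (cm (H i) (e j)) x + cm (e j) (cm (H i) x)" by (rule cm_jacobi)
  then show "cm (H i) (cm (e j) x) = sc (\<beta> i + rootc n j i) * cm (e j) x"
    using a ij by (simp add: cm_He cm_sc sc_add distrib_right add.commute)
qed

lemma awt_f: "awt \<beta> x \<Longrightarrow> j < n \<Longrightarrow> awt (\<lambda>k. \<beta> k - rootc n j k) (cm (f j) x)"
  unfolding awt_def
proof (intro allI impI)
  fix i assume a: "\<forall>i<n. cm (H i) x = sc (\<beta> i) * x" and ij: "j < n" "i < n"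
  have "cm (H i) (cm (f j) x) = cm (cm (H i) (f j)) x + cm (f j) (cm (H i) x)" by (rule cm_jacobi)
  then show "cm (H i) (cm (f j) x) = sc (\<beta> i - rootc n j i) * cm (f j) x"
    using a ij by (simp add: cm_Hf cm_sc cm_minus sc_diff left_diff_distrib)
qed

lemma awt_e_pow: "awt \<beta> x \<Longrightarrow> j < n \<Longrightarrow> awt (\<lambda>k. \<beta> k + of_nat p * rootc n j k) ((cm (e j) ^^ p) x)"
proof (induction p)
  case (Suc p)
  then have "awt (\<lambda>k. \<beta> k + of_nat p * rootc n j k + rootc n j k) (cm (e j) ((cm (e j) ^^ p) x))"
    by (intro awt_e) auto
  then show ?case by (simp add: algebra_simps)
qed simp

lemma awt_f_pow: "awt \<beta> x \<Longrightarrow> j < n \<Longrightarrow> awt (\<lambda>k. \<beta> k - of_nat p * rootc n j k) ((cm (f j) ^^ p) x)"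
proof (induction p)
  case (Suc p)
  then have "awt (\<lambda>k. \<beta> k - of_nat p * rootc n j k - rootc n j k) (cm (f j) ((cm (f j) ^^ p) x))"
    by (intro awt_f) auto
  then show ?case by (simp add: algebra_simps)
qed simp

lemma wt_f_pow: "wt \<nu> x \<Longrightarrow> j < n \<Longrightarrow> wt (\<lambda>k. \<nu> k - of_nat p * rootc n j k) (((*) (f j) ^^ p) x)"
proof (induction p)
  case (Suc p)
  then have "wt (\<lambda>k. \<nu> k - of_nat p * rootc n j k - rootc n j k) (f j * (((*) (f j) ^^ p) x))"
    by (intro wt_f) auto
  then show ?case by (simp add: algebra_simps)
qed simp

end

section \<open>Weights of the presented algebra\<close>

text \<open>The list is reversed because \<open>fold\<close> multiplies on the left by one factor
  after the other: in this order the resulting product has its factors arranged as in (D6).\<close>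

definition wt_list :: "nat \<Rightarrow> rat list" where
  "wt_list r = rev (map (\<lambda>k. of_int (int k - int r)) [0..<2 * r + 1])"

lemma wt_list_mem: "c \<in> set (wt_list r) \<longleftrightarrow> c \<in> \<int> \<and> \<bar>c\<bar> \<le> of_nat r"
proof
  assume "c \<in> set (wt_list r)"
  then show "c \<in> \<int> \<and> \<bar>c\<bar> \<le> of_nat r"
    by (auto simp: wt_list_def abs_le_iff)
next
  assume c: "c \<in> \<int> \<and> \<bar>c\<bar> \<le> of_nat r"
  then obtain z where z: "c = of_int z" by (auto elim: Ints_cases)
  with c have "\<bar>z\<bar> \<le> int r" by linarith
  then have "nat (z + int r) \<in> {0..<2 * r + 1}" "c = of_int (int (nat (z + int r)) - int r)"
    using z by auto
  then show "c \<in> set (wt_list r)"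
    unfolding wt_list_def set_rev set_map set_upt by (intro image_eqI)
qed

lemma distinct_wt_list: "distinct (wt_list r)"
  by (auto simp: wt_list_def distinct_map inj_on_def)

lemma fold_left_mult:
  "fold (\<lambda>k y. a * y - c k * y) S x = prod_list (map (\<lambda>k. a - c k) (rev S)) * (x :: 'a :: ring_1)"
  by (induction S arbitrary: x) (simp_all add: algebra_simps)

lemma fold_right_mult:
  "fold (\<lambda>k y. y * a - y * c k) S x = (x :: 'a :: ring_1) * prod_list (map (\<lambda>k. a - c k) S)"
  by (induction S arbitrary: x) (simp_all add: algebra_simps)

text \<open>The conditions that (D6) and (D7) impose on a weight.\<close>

definition tensor_wt :: "nat \<Rightarrow> nat \<Rightarrow> (nat \<Rightarrow> rat) \<Rightarrow> bool" where
  "tensor_wt n r \<nu> \<longleftrightarrow> (\<forall>i<n. \<nu> i \<in> set (wt_list r)) \<and>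
    (\<forall>\<sigma> :: nat \<Rightarrow> int. (\<forall>i<n. \<sigma> i \<in> {1, - 1}) \<longrightarrow>
       (\<exists>k\<le>r. (\<Sum>i<n. of_int (\<sigma> i) * \<nu> i) = 2 * of_nat k - of_nat r))"

text \<open>The assumption \<open>generated\<close> expresses, as an induction principle, that
  scalars and left multiplications by the generators reach the whole ring from 1.\<close>

locale schur_presentation = chevalley sc n e f H
  for sc :: "rat \<Rightarrow> 'a :: ring_1" and n e f H +
  fixes r :: nat
  assumes D6: "i < n \<Longrightarrow> prod_list (map (\<lambda>k. H i + of_int (int r - int k)) [0..<2 * r + 1]) = 0"
    and D7: "(\<And>i. i < n \<Longrightarrow> \<sigma> i \<in> {1, - 1}) \<Longrightarrow>
      prod_list (map (\<lambda>k. (\<Sum>i<n. of_int (\<sigma> i) * H i) + of_int (int r - 2 * int k)) [0..<r + 1]) = 0"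
    and generated: "1 \<in> D \<Longrightarrow> subsp D \<Longrightarrow>
      (\<And>i x. i < n \<Longrightarrow> x \<in> D \<Longrightarrow> e i * x \<in> D \<and> f i * x \<in> D \<and> H i * x \<in> D) \<Longrightarrow> x \<in> D"
begin

lemma D6_prod: "i < n \<Longrightarrow> prod_list (map (\<lambda>k. H i - sc k) (rev (wt_list r))) = 0"
proof -
  assume i: "i < n"
  have "map (\<lambda>k. H i - sc k) (rev (wt_list r)) = map (\<lambda>k. H i + of_int (int r - int k)) [0..<2 * r + 1]"
    unfolding wt_list_def rev_rev_ident map_map
    by (intro map_cong refl) (simp only: o_def sc_of_int, simp)
  then show ?thesis using D6[OF i] by simp
qed

lemma left_fold: "i < n \<Longrightarrow> fold (\<lambda>k y. H i * y - sc k * y) (wt_list r) x = 0"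
  by (simp add: fold_left_mult D6_prod)

lemma right_fold: "i < n \<Longrightarrow> fold (\<lambda>k y. y * H i - sc k * y) (rev (wt_list r)) x = 0"
  unfolding sc_comm fold_right_mult D6_prod by simp

lemma lin_right: "lin (\<lambda>y. y * a)"
  by (simp add: lin_def distrib_right mult.assoc)

text \<open>Decompose \<open>x\<close> under left multiplication by \<open>H i\<close>, then under
  right multiplication. On a two-sided eigenvector with eigenvalues \<open>k\<close> and
  \<open>j\<close> the commutator is the scalar \<open>k - j\<close>, which lies between -2r and
  2r.\<close>

lemma ad_fold:
  assumes i: "i < n"
  shows "fold (\<lambda>k y. cm (H i) y - sc k * y) (wt_list (2 * r)) x = 0"
proof -
  let ?D = "{x. fold (\<lambda>k y. cm (H i) y - sc k * y) (wt_list (2 * r)) x = 0}"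
  note l = linD[OF lin_fold[OF lin_cm[of "H i"], of "wt_list (2 * r)"]]
  have D: "0 \<in> ?D" "\<And>y z. y \<in> ?D \<Longrightarrow> z \<in> ?D \<Longrightarrow> y + z \<in> ?D" using l by auto
  have "x \<in> ?D"
  proof (rule eigen_induct[OF lin_mult, of UNIV "H i" ?D "wt_list r"])
    fix k y assume k: "k \<in> set (wt_list r)" and y: "H i * y = sc k * y"
    let ?C = "{y. H i * y = sc k * y}"
    show "y \<in> ?D"
    proof (rule eigen_induct[OF lin_right, of ?C "H i" ?D "rev (wt_list r)"])
      show "subsp ?C" by (intro subspI) (auto simp: distrib_left sc_left[of "H i"] sc_sc mult.commute)
      show "z * H i \<in> ?C" if "z \<in> ?C" for z using that by (simp flip: mult.assoc)
      fix j z assume j: "j \<in> set (rev (wt_list r))" and z: "z \<in> ?C" "z * H i = sc j * z"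
      have "cm (H i) z = sc (k - j) * z" using z by (simp add: cm_def sc_diff left_diff_distrib)
      moreover have "k - j \<in> set (wt_list (2 * r))"
        using k j by (auto simp: wt_list_mem)
      then have "(\<Prod>l\<leftarrow>wt_list (2 * r). k - j - l) = 0"
        by (force simp: prod_list_zero_iff)
      ultimately show "z \<in> ?D"
        using fold_eigenvector[OF lin_cm, of "H i" z "k - j"] by (simp del: prod_list_zero_iff)
    qed (use D y distinct_wt_list right_fold[OF i] in auto)
  qed (use D distinct_wt_list left_fold[OF i] in \<open>auto intro: subspI\<close>)
  then show ?thesis by simp
qed

lemma wt_induct:
  assumes "subsp C" "\<And>i y. i < n \<Longrightarrow> y \<in> C \<Longrightarrow> H i * y \<in> C"
    and "0 \<in> D" "\<And>y z. y \<in> D \<Longrightarrow> z \<in> D \<Longrightarrow> y + z \<in> D"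
    and "\<And>\<nu> y. y \<in> C \<Longrightarrow> wt \<nu> y \<Longrightarrow> y \<in> D" and "x \<in> C"
  shows "x \<in> D"
proof (rule weight_induct[of n "\<lambda>i x. H i * x" "wt_list r" C D])
  show "H i * (H j * y) = H j * (H i * y)" if "i < n" "j < n" for i j y
    using D1[OF that] by (metis mult.assoc)
  show "y \<in> D" if "y \<in> C" "\<And>i. i < n \<Longrightarrow> H i * y = sc (\<nu> i) * y" for \<nu> y
    using assms(5)[of y \<nu>] that by (auto simp: wt_def)
qed (use assms distinct_wt_list left_fold lin_mult in auto)

lemma awt_induct:
  assumes "subsp C" "\<And>i y. i < n \<Longrightarrow> y \<in> C \<Longrightarrow> cm (H i) y \<in> C"
    and "0 \<in> D" "\<And>y z. y \<in> D \<Longrightarrow> z \<in> D \<Longrightarrow> y + z \<in> D"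
    and "\<And>\<nu> y. y \<in> C \<Longrightarrow> awt \<nu> y \<Longrightarrow> y \<in> D" and "x \<in> C"
  shows "x \<in> D"
proof (rule weight_induct[of n "\<lambda>i. cm (H i)" "wt_list (2 * r)" C D])
  show "cm (H i) (cm (H j) y) = cm (H j) (cm (H i) y)" if "i < n" "j < n" for i j y
    using cm_jacobi[of "H i" "H j" y] cm_HH[OF that] by simp
  show "y \<in> D" if "y \<in> C" "\<And>i. i < n \<Longrightarrow> cm (H i) y = sc (\<nu> i) * y" for \<nu> y
    using assms(5)[of y \<nu>] that by (auto simp: awt_def)
qed (use assms distinct_wt_list ad_fold lin_cm in auto)

lemma wt_range: "wt \<nu> x \<Longrightarrow> x \<noteq> 0 \<Longrightarrow> i < n \<Longrightarrow> \<nu> i \<in> set (wt_list r)"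
  using eigenvalue_mem[OF lin_mult, of "H i" x "\<nu> i"] left_fold[of i x] by (auto simp: wt_def)

lemma awt_range: "awt \<nu> x \<Longrightarrow> x \<noteq> 0 \<Longrightarrow> i < n \<Longrightarrow> \<nu> i \<in> set (wt_list (2 * r))"
  using eigenvalue_mem[OF lin_cm, of "H i" x "\<nu> i"] ad_fold[of i x] by (auto simp: awt_def)

text \<open>On a weight vector \<open>J\<close> is the signed sum of the coordinates, so each
  relation (D7) turns into an equation between numbers, one factor of which must vanish.\<close>

lemma wt_tensor_wt:
  assumes x: "wt \<nu> x" "x \<noteq> 0"
  shows "tensor_wt n r \<nu>"
  unfolding tensor_wt_def
proof (intro conjI allI impI)
  show "\<nu> i \<in> set (wt_list r)" if "i < n" for i by (rule wt_range[OF x that])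
  fix \<sigma> :: "nat \<Rightarrow> int" assume \<sigma>: "\<forall>i<n. \<sigma> i \<in> {1, - 1}"
  define J s where "J = (\<Sum>i<n. of_int (\<sigma> i) * H i)" and "s = (\<Sum>i<n. of_int (\<sigma> i) * \<nu> i)"
  have "of_int (\<sigma> i) * H i * x = sc (of_int (\<sigma> i) * \<nu> i) * x" if "i < n" for i
    using x(1) that by (simp add: wt_def mult.assoc sc_mult sc_of_int)
  then have J: "J * x = sc s * x"
    by (simp add: sum_distrib_right sc_sum J_def s_def)
  have step: "(J + of_int c) * (sc d * x) = sc ((s + of_int c) * d) * x" for c d
  proof -
    have "(J + of_int c) * (sc d * x) = sc d * (J * x) + sc d * (of_int c * x)"
      by (simp only: distrib_right distrib_left sc_left)
    also have "\<dots> = sc ((s + of_int c) * d) * x"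
      unfolding J sc_of_int[symmetric] sc_sc by (simp add: algebra_simps sc_add)
    finally show ?thesis .
  qed
  have "prod_list (map (\<lambda>k. J + of_int (c k)) L) * x = sc (\<Prod>k\<leftarrow>L. s + of_int (c k)) * x" for c and L :: "nat list"
    by (induction L) (simp_all add: mult.assoc step)
  from this[of "\<lambda>k. int r - 2 * int k" "[0..<r + 1]"]
  have "sc (\<Prod>k\<leftarrow>[0..<r + 1]. s + of_int (int r - 2 * int k)) * x = 0"
    using D7[of \<sigma>, folded J_def] \<sigma> by (simp only:) simp
  then have "(\<Prod>k\<leftarrow>[0..<r + 1]. s + of_int (int r - 2 * int k)) = 0"
    using sc_cancel x(2) by blast
  then obtain k where "k \<le> r" "s + of_int (int r - 2 * int k) = 0"
    by (auto simp: prod_list_zero_iff simp del: upt_Suc)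
  then show "\<exists>k\<le>r. (\<Sum>i<n. of_int (\<sigma> i) * \<nu> i) = 2 * of_nat k - of_nat r"
    by (intro exI[of _ k]) (auto simp: s_def)
qed

text \<open>The projection to a weight space is the component of 1 of that weight. That it is a
  polynomial in the \<open>H i\<close> is expressed by commutation with everything that commutes
  with all \<open>H i\<close>, in particular with central elements.\<close>

lemma weight_projection:
  "\<exists>z. wt \<nu> z \<and> (\<forall>y. (\<forall>i<n. H i * y = y * H i) \<longrightarrow> z * y = y * z) \<and> (\<forall>x. wt \<nu> x \<longrightarrow> z * x = x)"
proof -
  define C where "C = {z. \<forall>y. (\<forall>i<n. H i * y = y * H i) \<longrightarrow> z * y = y * z}"
  \<comment> \<open>The elements that act on vectors of weight \<nu> like some admissible
    \<open>z\<close>; the goal is to show that 1 is one of them.\<close>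
  define D where "D = {y. \<exists>z\<in>C. wt \<nu> z \<and> (\<forall>x. wt \<nu> x \<longrightarrow> z * x = y * x)}"
  have C: "subsp C"
    by (intro subspI) (auto simp: C_def distrib_left distrib_right mult.assoc sc_left)
  have "1 \<in> D"
  proof (rule wt_induct[OF C])
    show "H i * y \<in> C" if "i < n" "y \<in> C" for i y
      using that unfolding C_def by (auto simp: mult.assoc) (metis mult.assoc)
    show "0 \<in> D" using subsp_zero[OF C] by (auto simp: D_def wt_def intro!: bexI[of _ 0])
    show "y + z \<in> D" if "y \<in> D" "z \<in> D" for y z
    proof -
      obtain y' where "y' \<in> C" "wt \<nu> y'" "\<forall>x. wt \<nu> x \<longrightarrow> y' * x = y * x"
        using \<open>y \<in> D\<close> unfolding D_def by blast
      moreover obtain z' where "z' \<in> C" "wt \<nu> z'" "\<forall>x. wt \<nu> x \<longrightarrow> z' * x = z * x"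
        using \<open>z \<in> D\<close> unfolding D_def by blast
      ultimately show ?thesis using subsp_add[OF C] unfolding D_def
        by (auto simp: wt_def distrib_left distrib_right intro!: bexI[of _ "y' + z'"])
    qed
    show "1 \<in> C" by (simp add: C_def)
    fix \<mu> y assume y: "y \<in> C" "wt \<mu> y"
    show "y \<in> D"
    proof (cases "\<forall>i<n. \<mu> i = \<nu> i")
      case True
      then have "wt \<nu> y" using y(2) wt_cong by blast
      then show ?thesis using y(1) by (auto simp: D_def)
    next
      case False
      then obtain i where i: "i < n" "\<mu> i \<noteq> \<nu> i" by auto
      \<comment> \<open>As \<open>y\<close> commutes with \<open>H i\<close>, this element acts on
        \<open>y * x\<close> both by \<mu> i and by \<nu> i.\<close>
      have "y * x = 0" if "wt \<nu> x" for x
      proof -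
        have "sc (\<mu> i) * (y * x) = (H i * y) * x" using y i by (simp add: wt_def mult.assoc)
        also have "H i * y = y * H i" using y(1) D1 i by (auto simp: C_def)
        also have "y * H i * x = sc (\<nu> i) * (y * x)" using that i by (simp add: wt_def mult.assoc sc_left)
        finally show ?thesis using sc_eq_cancel i by blast
      qed
      then show ?thesis using subsp_zero[OF C] by (auto simp: D_def wt_def intro!: bexI[of _ 0])
    qed
  qed
  then show ?thesis by (auto simp: D_def C_def)
qed

text \<open>Every root has a coefficient \<open>1\<close>, so repeated root translations leave the bounded set of
  weights.\<close>

lemma root_coeff: "j < n \<Longrightarrow> \<exists>k<n. rootc n j k = 1"
  using n3 by (intro exI[of _ "if j + 1 < n then j else n - 1"]) (auto simp: rootc_def dl_def)

lemma f_nilpotent: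
  assumes j: "j < n"
  shows "((*) (f j) ^^ (2 * r + 1)) x = 0"
proof -
  let ?D = "{x. ((*) (f j) ^^ (2 * r + 1)) x = 0}"
  have pw: "((*) (f j) ^^ p) x = f j ^ p * x" for p x by (induction p) (simp_all add: mult.assoc)
  have "x \<in> ?D"
  proof (rule wt_induct[of UNIV ?D])
    show "y \<in> ?D" if y: "wt \<nu> y" for \<nu> y
    proof (rule ccontr)
      let ?y = "((*) (f j) ^^ (2 * r + 1)) y"
      assume "y \<notin> ?D"
      then have ne: "?y \<noteq> 0" "y \<noteq> 0" unfolding pw by auto
      \<comment> \<open>Coordinate \<open>k\<close> drops by 1 with each factor \<open>f j\<close>,
        but only the 2r + 1 values from -r to r are allowed.\<close>
      obtain k where k: "k < n" "rootc n j k = 1" using root_coeff[OF j] by blast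
      have "\<nu> k \<in> set (wt_list r)" "\<nu> k - of_nat (2 * r + 1) * rootc n j k \<in> set (wt_list r)"
        using wt_range[OF y ne(2) k(1)] wt_range[OF wt_f_pow[OF y j] ne(1) k(1)] by auto
      then show False using k(2) by (auto simp: wt_list_mem abs_le_iff)
    qed
  qed (auto simp: pw distrib_left intro: subspI)
  then show ?thesis by simp
qed

lemma lin_cm_pow: "lin (cm a ^^ p)"
  by (induction p) (auto simp: lin_def cm_add cm_sc)

lemma ad_nilpotent:
  assumes j: "j < n"
  shows "(cm (e j) ^^ (4 * r + 1)) x = 0" "(cm (f j) ^^ (4 * r + 1)) x = 0"
proof -
  \<comment> \<open>Weights for commutators have coordinates between -2r and 2r, whence this
    exponent.\<close>
  define p where "p = 4 * r + 1"
  note l = linD(1,3)[OF lin_cm_pow]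
  obtain k where k: "k < n" "rootc n j k = 1" using root_coeff[OF j] by blast
  have "x \<in> {x. (cm (e j) ^^ p) x = 0}"
  proof (rule awt_induct[of UNIV])
    show "y \<in> {x. (cm (e j) ^^ p) x = 0}" if y: "awt \<nu> y" for \<nu> y
    proof (rule ccontr)
      assume "\<not> ?thesis"
      then have ne: "(cm (e j) ^^ p) y \<noteq> 0" "y \<noteq> 0" by (auto simp: l)
      have "\<nu> k \<in> set (wt_list (2 * r))" "\<nu> k + of_nat p * rootc n j k \<in> set (wt_list (2 * r))"
        using awt_range[OF y ne(2) k(1)] awt_range[OF awt_e_pow[OF y j] ne(1) k(1)] by auto
      then show False using k(2) by (auto simp: wt_list_mem abs_le_iff p_def)
    qed
  qed (auto simp: l intro: subspI)
  then show "(cm (e j) ^^ (4 * r + 1)) x = 0" by (simp add: p_def)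
  have "x \<in> {x. (cm (f j) ^^ p) x = 0}"
  proof (rule awt_induct[of UNIV])
    show "y \<in> {x. (cm (f j) ^^ p) x = 0}" if y: "awt \<nu> y" for \<nu> y
    proof (rule ccontr)
      assume "\<not> ?thesis"
      then have ne: "(cm (f j) ^^ p) y \<noteq> 0" "y \<noteq> 0" by (auto simp: l)
      have "\<nu> k \<in> set (wt_list (2 * r))" "\<nu> k - of_nat p * rootc n j k \<in> set (wt_list (2 * r))"
        using awt_range[OF y ne(2) k(1)] awt_range[OF awt_f_pow[OF y j] ne(1) k(1)] by auto
      then show False using k(2) by (auto simp: wt_list_mem abs_le_iff p_def)
    qed
  qed (auto simp: l intro: subspI)
  then show "(cm (f j) ^^ (4 * r + 1)) x = 0" by (simp add: p_def)
qed

text \<open>The sl2 argument with \<open>e m\<close> and \<open>f m\<close> exchanged and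
  \<open>hh m\<close> replaced by its negative: a lowest weight vector cannot have positive
  weight.\<close>

lemma ad_lowest_zero:
  assumes "awt \<beta> y" "m < n" "cm (f m) y = 0" "copair n \<beta> m > 0"
  shows "y = 0"
proof (rule ad_sl2_zero[where a = "f m" and b = "e m" and h = "- hh m" and m = "- copair n \<beta> m"])
  show "cm (f m) (e m) = - hh m" using cm_ef[of m m] assms(2) cm_skew[of "f m" "e m"] by simp
  show "cm (- hh m) (e m) = - (sc 2 * e m)"
    using cm_hhe[of m m] assms(2) n2 by (simp add: cm_minus copair_root)
  show "cm (- hh m) y = sc (- copair n \<beta> m) * y"
    using awt_hh[OF assms(1,2)] by (simp add: cm_minus sc_minus)
  show "(cm (e m) ^^ (4 * r + 1)) y = 0" by (rule ad_nilpotent[OF assms(2)])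
qed (use assms in auto)

lemma ad_highest_zero:
  assumes "awt \<beta> y" "m < n" "cm (e m) y = 0" "copair n \<beta> m < 0"
  shows "y = 0"
proof (rule ad_sl2_zero[where a = "e m" and b = "f m" and h = "hh m" and m = "copair n \<beta> m"])
  show "cm (e m) (f m) = hh m" using cm_ef[of m m] assms(2) by simp
  show "cm (hh m) (f m) = - (sc 2 * f m)"
    using cm_hhf[of m m] assms(2) n2 by (simp add: copair_root)
  show "cm (hh m) y = sc (copair n \<beta> m) * y" by (rule awt_hh[OF assms(1,2)])
  show "(cm (f m) ^^ (4 * r + 1)) y = 0" by (rule ad_nilpotent[OF assms(2)])
qed (use assms in auto)

definition left_ideal :: "'a set \<Rightarrow> bool" where
  "left_ideal N \<longleftrightarrow> 0 \<in> N \<and> (\<forall>x\<in>N. \<forall>y\<in>N. x + y \<in> N) \<and> (\<forall>a. \<forall>x\<in>N. a * x \<in> N)"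

lemma left_ideal_subsp: "left_ideal N \<Longrightarrow> subsp N"
  by (auto simp: left_ideal_def subsp_def)

lemma left_ideal_mult: "left_ideal N \<Longrightarrow> x \<in> N \<Longrightarrow> a * x \<in> N"
  by (auto simp: left_ideal_def)

text \<open>Modulo \<open>N\<close> the element \<open>v\<close> is a highest weight vector for the
  sl2 of index \<open>i\<close>; nilpotency of \<open>f i\<close> rules out a negative weight unless
  \<open>v\<close> is 0 modulo \<open>N\<close>.\<close>

lemma nondominant_mem:
  assumes N: "left_ideal N" and v: "wt \<nu> v" "i < n" "e i * v \<in> N" "copair n \<nu> i < 0"
  shows "v \<in> N"
proof (rule sl2_lower[OF lin_mult[of "e i"] lin_mult[of "f i"] lin_mult[of "hh i"]])
  have "e i * f i = f i * e i + hh i" "hh i * f i = f i * hh i - sc 2 * f i"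
    using cm_ef[of i i] cm_hhf[of i i] v(2) n2 by (auto simp: cm_def copair_root algebra_simps)
  then show "e i * (f i * x) = f i * (e i * x) + hh i * x"
    "hh i * (f i * x) = f i * (hh i * x) - sc 2 * (f i * x)" for x
    by (metis distrib_right mult.assoc, metis left_diff_distrib mult.assoc)
  show "((*) (f i) ^^ (2 * r + 1)) v \<in> N"
    using f_nilpotent[OF v(2)] left_ideal_subsp[OF N] by (simp add: subsp_def)
  show "hh i * v = sc (copair n \<nu> i) * v" by (rule wt_hh[OF v(1,2)])
qed (use N v left_ideal_subsp left_ideal_mult in auto)

text \<open>Each letter raises the height by 1, while the height of a weight is a sum of
  \<open>n\<close> terms, each at most \<open>n * r\<close> in absolute value.\<close>

lemma e_word_nilpotent:
  assumes ws: "set ws \<subseteq> {..<n}" "length ws > 2 * (n * (n * r))"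
  shows "ew ws * x = 0"
proof -
  have bound: "\<bar>height n \<nu>\<bar> \<le> of_nat (n * (n * r))" if "wt \<nu> y" "y \<noteq> 0" for \<nu> y
  proof -
    have "\<bar>height n \<nu>\<bar> \<le> (\<Sum>k<n. \<bar>of_nat (n - 1 - k) * \<nu> k\<bar>)"
      unfolding height_def by (rule sum_abs)
    also have "\<dots> \<le> (\<Sum>k<n. of_nat (n * r))"
    proof (rule sum_mono)
      fix k assume "k \<in> {..<n}"
      then have "\<bar>\<nu> k\<bar> \<le> of_nat r" using wt_range[OF that, of k] by (simp add: wt_list_mem)
      then have "of_nat (n - 1 - k) * \<bar>\<nu> k\<bar> \<le> (of_nat n * of_nat r :: rat)"
        by (intro mult_mono) auto
      then show "\<bar>of_nat (n - 1 - k) * \<nu> k\<bar> \<le> of_nat (n * r)" by (simp add: abs_mult)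
    qed
    finally show ?thesis by simp
  qed
  let ?D = "{x. ew ws * x = 0}"
  have "x \<in> ?D"
  proof (rule wt_induct[of UNIV ?D])
    show "y \<in> ?D" if y: "wt \<nu> y" for \<nu> y
    proof (rule ccontr)
      assume "y \<notin> ?D"
      then have "ew ws * y \<noteq> 0" "y \<noteq> 0" by auto
      then have "\<bar>height n \<nu>\<bar> \<le> of_nat (n * (n * r))"
        "\<bar>height n \<nu> + of_nat (length ws)\<bar> \<le> of_nat (n * (n * r))"
        using bound[OF y] bound[OF wt_ew[OF y ws(1)]] height_add[of n \<nu> "asum n ws"] height_asum[OF ws(1) n2]
        by auto
      moreover have "of_nat (length ws) > (2 * of_nat (n * (n * r)) :: rat)"
        using ws(2) by (metis of_nat_less_iff of_nat_mult of_nat_numeral)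
      ultimately show False by (simp add: abs_le_iff)
    qed
  qed (auto simp: distrib_left intro: subspI)
  then show ?thesis by simp
qed

end

section \<open>Lifting the root vectors\<close>

context schur_presentation
begin

text \<open>The Lie subalgebra of \<open>'a \<times> so\<^sub>2\<^sub>n\<close> generated by the pairs of Chevalley generators, graded by
  height.  It is the graph of a map on \<open>so\<^sub>2\<^sub>n\<close>: an element \<open>(y, 0)\<close> of least positive height would
  be a lowest weight vector of positive height for the adjoint action on a module with finitely many
  weights.  So the root vectors of \<open>so\<^sub>2\<^sub>n\<close> can be lifted.\<close>

inductive graph :: "int \<Rightarrow> 'a \<Rightarrow> fmat \<Rightarrow> bool" where
  graph_H: "i < n \<Longrightarrow> graph 0 (H i) (hmat n i)"
| graph_e: "i < n \<Longrightarrow> graph 1 (e i) (emat n i)"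
| graph_f: "i < n \<Longrightarrow> graph (-1) (f i) (fmatr n i)"
| graph_zero: "graph l 0 fzero"
| graph_add: "graph l y X \<Longrightarrow> graph l z Y \<Longrightarrow> graph l (y + z) (fadd X Y)"
| graph_scale: "graph l y X \<Longrightarrow> graph l (sc c * y) (fscale c X)"
| graph_up: "graph l y X \<Longrightarrow> l \<ge> 1 \<Longrightarrow> i < n \<Longrightarrow> graph (l + 1) (cm (e i) y) (fbr (2 * n) (emat n i) X)"
| graph_down: "graph l y X \<Longrightarrow> l \<le> -1 \<Longrightarrow> i < n \<Longrightarrow> graph (l - 1) (cm (f i) y) (fbr (2 * n) (fmatr n i) X)"

lemma graph_neg: "graph l y X \<Longrightarrow> graph l (- y) (fscale (-1) X)"
  using graph_scale[of l y X "-1"] by (simp add: sc_minus)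

text \<open>Closure of \<open>graph\<close> under brackets is established first for brackets with
  single generators. The \<open>H i\<close> come first because the bracket of \<open>e i\<close> and
  \<open>f i\<close> produces them.\<close>

lemma graph_cm_H:
  assumes "graph l y X" "i < n"
  shows "graph l (cm (H i) y) (fbr (2 * n) (hmat n i) X)"
  using assms
proof (induction rule: graph.induct)
  case (graph_H j)
  then show ?case by (simp add: cm_HH fbr_hh graph_zero)
next
  case (graph_e j)
  then show ?case by (simp add: cm_He fbr_he n3 graph_scale graph.graph_e)
next
  case (graph_f j)
  then have "graph (-1) (sc (- rootc n j i) * f j) (fscale (- rootc n j i) (fmatr n j))"
    by (intro graph_scale graph.graph_f)
  then show ?case using graph_f by (simp add: cm_Hf fbr_hf n3 sc_minus)
next
  case (graph_zero l)
  then show ?case by (simp add: fbr_fzero graph.graph_zero)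
next
  case (graph_add l y X z Y)
  then show ?case by (simp add: cm_add fbr_lin graph.graph_add)
next
  case (graph_scale l y X c)
  then show ?case by (simp add: cm_sc fbr_lin graph.graph_scale)
next
  case (graph_up l y X j)
  have "graph (l + 1) (sc (rootc n j i) * cm (e j) y + cm (e j) (cm (H i) y))
      (fadd (fscale (rootc n j i) (fbr (2 * n) (emat n j) X)) (fbr (2 * n) (emat n j) (fbr (2 * n) (hmat n i) X)))"
    using graph_up by (intro graph.graph_add graph.graph_scale graph.graph_up) auto
  then show ?case
    using graph_up by (simp add: cm_jacobi[of "H i" "e j" y] fbr_jacobi[of _ "hmat n i" "emat n j"] cm_He fbr_he n3 cm_sc fbr_lin)
next
  case (graph_down l y X j)
  have "graph (l - 1) (sc (- rootc n j i) * cm (f j) y + cm (f j) (cm (H i) y))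
      (fadd (fscale (- rootc n j i) (fbr (2 * n) (fmatr n j) X)) (fbr (2 * n) (fmatr n j) (fbr (2 * n) (hmat n i) X)))"
    using graph_down by (intro graph.graph_add graph.graph_scale graph.graph_down) auto
  then show ?case
    using graph_down by (simp add: cm_jacobi[of "H i" "f j" y] fbr_jacobi[of _ "hmat n i" "fmatr n j"] cm_Hf fbr_hf n3 cm_sc cm_minus sc_minus fbr_lin)
qed

lemma graph_hh: "i < n \<Longrightarrow> graph 0 (hh i) (hhmat n i)"
proof -
  assume i: "i < n"
  show ?thesis
  proof (cases "i + 1 < n")
    case True
    then have "graph 0 (H i + - H (i + 1)) (fadd (hmat n i) (fscale (-1) (hmat n (i + 1))))"
      using i by (intro graph_add graph_neg graph_H)
    then show ?thesis using True by (simp add: hh_def hhmat_def)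
  next
    case False
    then show ?thesis using n3 by (auto simp: hh_def hhmat_def intro!: graph_add graph_H)
  qed
qed

lemma graph_cm_hh:
  assumes "graph l y X" "i < n"
  shows "graph l (cm (hh i) y) (fbr (2 * n) (hhmat n i) X)"
proof (cases "i + 1 < n")
  case True
  then have "graph l (cm (H i) y + - cm (H (i + 1)) y)
      (fadd (fbr (2 * n) (hmat n i) X) (fscale (-1) (fbr (2 * n) (hmat n (i + 1)) X)))"
    using assms by (intro graph_add graph_neg graph_cm_H)
  then show ?thesis using True by (simp add: hh_def hhmat_def cm_diff fbr_lin)
next
  case False
  then have "graph l (cm (H (n - 2)) y + cm (H (n - 1)) y)
      (fadd (fbr (2 * n) (hmat n (n - 2)) X) (fbr (2 * n) (hmat n (n - 1)) X))"
    using assms n3 by (intro graph_add graph_cm_H) auto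
  then show ?thesis using False by (simp add: hh_def hhmat_def cm_add fbr_lin)
qed

text \<open>The rules \<open>graph_up\<close> and \<open>graph_down\<close> lead away from degree 0,
  so the part of degree 0 is the span of the \<open>H i\<close> by construction. The price is that
  closure under all brackets is a theorem, \<open>graph_cm\<close>.\<close>

lemma graph_zero_form:
  assumes "graph l y X" "l = 0"
  shows "\<exists>c. y = (\<Sum>i<n. sc (c i) * H i) \<and> X = (\<lambda>p q. \<Sum>i<n. c i * hmat n i p q)"
  using assms
proof (induction rule: graph.induct)
  case (graph_H i)
  have s: "(\<Sum>j<n. dl j i * g j) = g i" for g using sum_dl[OF graph_H(1)] .
  have t: "(\<Sum>j<n. sc (dl j i) * g j) = g i" for g
    using graph_H(1) by (simp add: dl_def if_distrib[of sc] if_distrib[of "\<lambda>c. c * _"] cong: if_cong)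
  show ?case by (intro exI[of _ "\<lambda>j. dl j i"]) (simp add: s t)
next
  case (graph_zero l)
  then show ?case by (intro exI[of _ "\<lambda>_. 0"]) (simp add: fzero_def)
next
  case (graph_add l y X z Y)
  then obtain c d where "y = (\<Sum>i<n. sc (c i) * H i)" "X = (\<lambda>p q. \<Sum>i<n. c i * hmat n i p q)"
    "z = (\<Sum>i<n. sc (d i) * H i)" "Y = (\<lambda>p q. \<Sum>i<n. d i * hmat n i p q)" by auto
  then show ?case
    by (intro exI[of _ "\<lambda>i. c i + d i"]) (simp add: sc_add distrib_right sum.distrib fadd_def)
next
  case (graph_scale l y X a)
  then obtain c where "y = (\<Sum>i<n. sc (c i) * H i)" "X = (\<lambda>p q. \<Sum>i<n. c i * hmat n i p q)" by auto
  then show ?case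
    by (intro exI[of _ "\<lambda>i. a * c i"]) (simp add: sc_mult sum_distrib_left fscale_def mult.assoc)
qed auto

text \<open>Degree 0 needs its own argument, since \<open>graph_up\<close> starts from degree
  1.\<close>

lemma graph_cm_e0:
  assumes "graph l y X" "l = 0" "i < n"
  shows "graph 1 (cm (e i) y) (fbr (2 * n) (emat n i) X)"
  using assms
proof (induction rule: graph.induct)
  case (graph_H j)
  then have "graph 1 (sc (- rootc n i j) * e i) (fscale (- rootc n i j) (emat n i))"
    by (intro graph_scale graph_e)
  moreover have "cm (e i) (H j) = sc (- rootc n i j) * e i"
    using cm_He[of j i] cm_skew[of "e i" "H j"] graph_H by (simp add: sc_minus)
  moreover have "fbr (2 * n) (emat n i) (hmat n j) = fscale (- rootc n i j) (emat n i)"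
    using fbr_he[of j n i] fbr_skew[of "2 * n" "emat n i" "hmat n j"] graph_H n3 by (simp add: fscale_def)
  ultimately show ?case by simp
next
  case (graph_zero l)
  then show ?case by (simp add: fbr_fzero graph.graph_zero)
next
  case (graph_add l y X z Y)
  then show ?case by (simp add: cm_add fbr_lin graph.graph_add)
next
  case (graph_scale l y X c)
  then show ?case by (simp add: cm_sc fbr_lin graph.graph_scale)
qed auto

lemma graph_cm_f0:
  assumes "graph l y X" "l = 0" "i < n"
  shows "graph (-1) (cm (f i) y) (fbr (2 * n) (fmatr n i) X)"
  using assms
proof (induction rule: graph.induct)
  case (graph_H j)
  then have "graph (-1) (sc (rootc n i j) * f i) (fscale (rootc n i j) (fmatr n i))"
    by (intro graph_scale graph_f)
  moreover have "cm (f i) (H j) = sc (rootc n i j) * f i"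
    using cm_Hf[of j i] cm_skew[of "f i" "H j"] graph_H by simp
  moreover have "fbr (2 * n) (fmatr n i) (hmat n j) = fscale (rootc n i j) (fmatr n i)"
    using fbr_hf[of j n i] fbr_skew[of "2 * n" "fmatr n i" "hmat n j"] graph_H n3 by (simp add: fscale_def)
  ultimately show ?case by simp
next
  case (graph_zero l)
  then show ?case by (simp add: fbr_fzero graph.graph_zero)
next
  case (graph_add l y X z Y)
  then show ?case by (simp add: cm_add fbr_lin graph.graph_add)
next
  case (graph_scale l y X c)
  then show ?case by (simp add: cm_sc fbr_lin graph.graph_scale)
qed auto

text \<open>Only negative degrees require work: by the Jacobi identity \<open>e i\<close> is moved
  past the outermost \<open>f j\<close>, at the cost of a bracket with \<open>hh i\<close> or
  0.\<close>

lemma graph_cm_e: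
  assumes "graph l y X" "i < n"
  shows "graph (l + 1) (cm (e i) y) (fbr (2 * n) (emat n i) X)"
  using assms
proof (induction rule: graph.induct)
  case (graph_H j)
  then show ?case using graph_cm_e0[OF graph.graph_H[of j]] by simp
next
  case (graph_e j)
  then show ?case using graph.graph_up[OF graph.graph_e[of j]] by simp
next
  case (graph_f j)
  then show ?case by (cases "i = j") (simp_all add: cm_ef fbr_ef n3 graph_hh graph_zero)
next
  case (graph_zero l)
  then show ?case by (simp add: fbr_fzero graph.graph_zero)
next
  case (graph_add l y X z Y)
  then show ?case by (simp add: cm_add fbr_lin graph.graph_add)
next
  case (graph_scale l y X c)
  then show ?case by (simp add: cm_sc fbr_lin graph.graph_scale)
next
  case (graph_up l y X j)
  then show ?case by (intro graph.graph_up) auto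
next
  case (graph_down l y X j)
  have 1: "graph l (cm (cm (e i) (f j)) y) (fbr (2 * n) (fbr (2 * n) (emat n i) (fmatr n j)) X)"
    using graph_cm_hh[of l y X i] graph_down
    by (cases "i = j") (simp_all add: cm_ef fbr_ef n3 fbr_fzero graph.graph_zero)
  \<comment> \<open>If \<open>y\<close> has degree -1, its bracket with \<open>e i\<close> has
    degree 0, where \<open>graph_down\<close> does not apply.\<close>
  have 2: "graph l (cm (f j) (cm (e i) y)) (fbr (2 * n) (fmatr n j) (fbr (2 * n) (emat n i) X))"
  proof (cases "l = -1")
    case True
    then show ?thesis using graph_cm_f0[of "l + 1"] graph_down by simp
  next
    case False
    then show ?thesis using graph.graph_down[of "l + 1"] graph_down by simp
  qed
  from graph.graph_add[OF 1 2] show ?case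
    by (simp add: cm_jacobi[of "e i" "f j" y] fbr_jacobi[of _ "emat n i" "fmatr n j"])
qed

lemma graph_cm_f:
  assumes "graph l y X" "i < n"
  shows "graph (l - 1) (cm (f i) y) (fbr (2 * n) (fmatr n i) X)"
  using assms
proof (induction rule: graph.induct)
  case (graph_H j)
  then show ?case using graph_cm_f0[OF graph.graph_H[of j]] by simp
next
  case (graph_f j)
  then show ?case using graph.graph_down[OF graph.graph_f[of j]] by simp
next
  case (graph_e j)
  have "cm (f i) (e j) = - cm (e j) (f i)" "fbr (2 * n) (fmatr n i) (emat n j) = fscale (-1) (fbr (2 * n) (emat n j) (fmatr n i))"
    by (rule cm_skew, rule fbr_skew)
  then show ?case using graph_e by (cases "i = j") (simp_all add: cm_ef fbr_ef n3 graph_neg graph_hh graph_zero fscale_fzero)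
next
  case (graph_zero l)
  then show ?case by (simp add: fbr_fzero graph.graph_zero)
next
  case (graph_add l y X z Y)
  then show ?case by (simp add: cm_add fbr_lin graph.graph_add)
next
  case (graph_scale l y X c)
  then show ?case by (simp add: cm_sc fbr_lin graph.graph_scale)
next
  case (graph_down l y X j)
  then show ?case by (intro graph.graph_down) auto
next
  case (graph_up l y X j)
  have 1: "graph l (cm (cm (f i) (e j)) y) (fbr (2 * n) (fbr (2 * n) (fmatr n i) (emat n j)) X)"
  proof -
    have "cm (cm (f i) (e j)) y = - cm (cm (e j) (f i)) y"
      using cm_skew[of "f i" "e j"] by (simp add: cm_minus)
    moreover have "fbr (2 * n) (fbr (2 * n) (fmatr n i) (emat n j)) X =
        fscale (-1) (fbr (2 * n) (fbr (2 * n) (emat n j) (fmatr n i)) X)"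
      using fbr_skew[of "2 * n" "fmatr n i" "emat n j"] by (simp add: fbr_lin)
    ultimately show ?thesis
      using graph_cm_hh[of l y X i] graph_up
      by (cases "i = j") (simp_all add: cm_ef fbr_ef n3 fbr_fzero fscale_fzero graph.graph_zero graph_neg)
  qed
  have 2: "graph l (cm (e j) (cm (f i) y)) (fbr (2 * n) (emat n j) (fbr (2 * n) (fmatr n i) X))"
  proof (cases "l = 1")
    case True
    then show ?thesis using graph_cm_e0[of "l - 1"] graph_up by simp
  next
    case False
    then show ?thesis using graph.graph_up[of "l - 1"] graph_up by simp
  qed
  from graph.graph_add[OF 1 2] show ?case
    by (simp add: cm_jacobi[of "f i" "e j" y] fbr_jacobi[of _ "fmatr n i" "emat n j"])
qed

lemma fbr_assoc_left:
  "fbr m (fbr m X Y) Z = fadd (fbr m X (fbr m Y Z)) (fscale (-1) (fbr m Y (fbr m X Z)))"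
  unfolding fbr_jacobi[of m X Y Z] by (simp add: fadd_def fscale_def)

text \<open>Induction on the construction of the first argument: by the Jacobi identity a bracket
  with \<open>cm (e i) x\<close> is a combination of brackets with \<open>e i\<close> and with
  \<open>x\<close>.\<close>

lemma graph_cm:
  assumes "graph k x W" "graph l y X"
  shows "graph (k + l) (cm x y) (fbr (2 * n) W X)"
  using assms
proof (induction arbitrary: l y X rule: graph.induct)
  case (graph_H i)
  then show ?case using graph_cm_H by simp
next
  case (graph_e i)
  then show ?case using graph_cm_e[of l y X i] by (simp add: add.commute)
next
  case (graph_f i)
  then show ?case using graph_cm_f[of l y X i] by simp
next
  case (graph_zero k)
  then show ?case by (simp add: fbr_fzero graph.graph_zero)
next
  case (graph_add k y X z Y)
  then show ?case by (simp add: cm_add fbr_lin graph.graph_add)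
next
  case (graph_scale k y X c)
  then show ?case by (simp add: cm_sc fbr_lin graph.graph_scale)
next
  case (graph_up k x W i)
  have 1: "graph (k + 1 + l) (cm (e i) (cm x y)) (fbr (2 * n) (emat n i) (fbr (2 * n) W X))"
    using graph_cm_e[OF graph_up(4)[OF graph_up.prems] graph_up(3)] by (simp add: ac_simps)
  have 2: "graph (k + 1 + l) (cm x (cm (e i) y)) (fbr (2 * n) W (fbr (2 * n) (emat n i) X))"
    using graph_up(4)[OF graph_cm_e[OF graph_up.prems graph_up(3)]] by (simp add: ac_simps)
  have "cm (cm (e i) x) y = cm (e i) (cm x y) + - cm x (cm (e i) y)" by (simp add: cm_jacobi[of "e i" x y])
  then show ?case unfolding fbr_assoc_left using graph.graph_add[OF 1 graph_neg[OF 2]] by simp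
next
  case (graph_down k x W i)
  have 1: "graph (k - 1 + l) (cm (f i) (cm x y)) (fbr (2 * n) (fmatr n i) (fbr (2 * n) W X))"
    using graph_cm_f[OF graph_down(4)[OF graph_down.prems] graph_down(3)] by (simp add: algebra_simps)
  have 2: "graph (k - 1 + l) (cm x (cm (f i) y)) (fbr (2 * n) W (fbr (2 * n) (fmatr n i) X))"
    using graph_down(4)[OF graph_cm_f[OF graph_down.prems graph_down(3)]] by (simp add: algebra_simps)
  have "cm (cm (f i) x) y = cm (f i) (cm x y) + - cm x (cm (f i) y)" by (simp add: cm_jacobi[of "f i" x y])
  then show ?case unfolding fbr_assoc_left using graph.graph_add[OF 1 graph_neg[OF 2]] by simp
qed

text \<open>The grading element: by \<open>graph_rho\<close>, commutation with it multiplies an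
  element of \<open>graph\<close> by its degree.\<close>

definition rho :: 'a where "rho = (\<Sum>k<n. sc (of_nat (n - 1 - k)) * H k)"

lemma cm_rho_awt: "awt \<beta> y \<Longrightarrow> cm rho y = sc (height n \<beta>) * y"
  by (simp add: rho_def cm_sum cm_sc awt_def height_def sc_sum sum_distrib_right sc_sc)

lemma graph_rho: "graph l y X \<Longrightarrow> cm rho y = sc (of_int l) * y"
proof (induction rule: graph.induct)
  case (graph_H i)
  then have "awt (\<lambda>_. 0) (H i)" by (simp add: awt_def cm_HH)
  from cm_rho_awt[OF this] show ?case by (simp add: height_def)
next
  case (graph_e i)
  then have "awt (rootc n i) (e i)" by (simp add: awt_def cm_He)
  from cm_rho_awt[OF this] graph_e show ?case by (simp add: height_root n2)
next
  case (graph_f i)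
  then have "awt (\<lambda>k. - rootc n i k) (f i)" by (simp add: awt_def cm_Hf sc_minus)
  moreover have "height n (\<lambda>k. - rootc n i k) = - 1"
    using height_root[of i n] graph_f n2 by (simp add: height_def sum_negf)
  ultimately show ?case using cm_rho_awt by fastforce
next
  case (graph_up l y X i)
  then have "awt (rootc n i) (e i)" by (simp add: awt_def cm_He)
  then have "cm rho (e i) = e i" using cm_rho_awt[of "rootc n i" "e i"] graph_up by (simp add: height_root n2)
  then show ?case using graph_up by (simp add: cm_jacobi[of rho] cm_sc sc_add distrib_right add.commute)
next
  case (graph_down l y X i)
  then have "awt (\<lambda>k. - rootc n i k) (f i)" by (simp add: awt_def cm_Hf sc_minus)
  moreover have "height n (\<lambda>k. - rootc n i k) = - 1"
    using height_root[of i n] graph_down n2 by (simp add: height_def sum_negf)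
  ultimately have "cm rho (f i) = - f i" using cm_rho_awt[of "\<lambda>k. - rootc n i k" "f i"] by (simp add: sc_minus)
  then show ?case using graph_down by (simp add: cm_jacobi[of rho] cm_sc cm_minus sc_diff left_diff_distrib)
qed (auto simp: cm_add cm_sc distrib_left sc_sc mult.commute)

text \<open>The coefficients of the \<open>H i\<close> can be read off the diagonal entries of the
  matrix.\<close>

lemma graph_kernel_zero:
  assumes "graph 0 y fzero" shows "y = 0"
proof -
  obtain c where c: "y = (\<Sum>i<n. sc (c i) * H i)" "fzero = (\<lambda>p q. \<Sum>i<n. c i * hmat n i p q)"
    using graph_zero_form[OF assms] by auto
  have "c k = 0" if k: "k < n" for k
  proof -
    have "hmat n i k k = dl k i" if "i < n" for i
      using that k by (auto simp: hmat_def Gm_def dl_def bar_def)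
    then have "(\<Sum>i<n. c i * hmat n i k k) = (\<Sum>i<n. dl k i * c i)" by (intro sum.cong) auto
    also have "\<dots> = c k" by (rule sum_dl'[OF k])
    finally show ?thesis using fun_cong[OF fun_cong[OF c(2)], of k k] by (simp add: fzero_def)
  qed
  then show ?thesis using c(1) by simp
qed

lemma graph_kernel_pos: "graph (int l) y fzero \<Longrightarrow> y = 0"
proof (induction l arbitrary: y)
  case 0
  then show ?case using graph_kernel_zero by simp
next
  case (Suc l)
  have low: "cm (f m) y = 0" if "m < n" for m
    using Suc.IH[of "cm (f m) y"] graph_cm_f[OF Suc.prems that] by (simp add: fbr_fzero)
  \<comment> \<open>The weight components of \<open>y\<close> have to inherit both properties of
    \<open>y\<close>, so the weight decomposition takes place inside this subspace.\<close>
  let ?C = "{y. (\<forall>m<n. cm (f m) y = 0) \<and> cm rho y = sc (of_int (int (Suc l))) * y}"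
  have "y \<in> {0}"
  proof (rule awt_induct[of ?C])
    show "subsp ?C" by (intro subspI) (auto simp: cm_add cm_sc distrib_left sc_sc mult.commute)
    show "cm (H i) z \<in> ?C" if i: "i < n" and z: "z \<in> ?C" for i z
    proof -
      have "cm (f m) (cm (H i) z) = 0" if m: "m < n" for m
      proof -
        have "cm (f m) (H i) = sc (rootc n m i) * f m" using cm_Hf[OF i m] cm_skew[of "f m" "H i"] by simp
        then show ?thesis using z m by (simp add: cm_jacobi[of "f m" "H i" z] cm_sc)
      qed
      moreover have "cm rho (H i) = 0"
        using i by (simp add: rho_def cm_sum cm_sc cm_HH)
      ultimately show ?thesis using z by (simp add: cm_jacobi[of rho "H i" z] cm_sc)
    qed
    show "y \<in> ?C" using low graph_rho[OF Suc.prems] by simp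
    fix \<nu> z assume z: "z \<in> ?C" "awt \<nu> z"
    show "z \<in> {0}"
    proof (rule ccontr)
      assume "z \<notin> {0}"
      then have "height n \<nu> = of_int (int (Suc l))"
        using sc_eq_cancel[of "height n \<nu>" z "of_int (int (Suc l))"] z cm_rho_awt[OF z(2)] by auto
      moreover have "copair n \<nu> m \<le> 0" if "m < n" for m
        using ad_lowest_zero[OF z(2) that] z(1) that \<open>z \<notin> {0}\<close> by force
      then have "height n \<nu> \<le> 0" by (rule height_antidominant[OF n2])
      ultimately show False by simp
    qed
  qed auto
  then show ?case by simp
qed

lemma graph_kernel_neg: "graph (- int l) y fzero \<Longrightarrow> y = 0"
proof (induction l arbitrary: y)
  case 0
  then show ?case using graph_kernel_zero by simp
next
  case (Suc l)
  have low: "cm (e m) y = 0" if "m < n" for m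
    using Suc.IH[of "cm (e m) y"] graph_cm_e[OF Suc.prems that] by (simp add: fbr_fzero)
  let ?C = "{y. (\<forall>m<n. cm (e m) y = 0) \<and> cm rho y = sc (of_int (- int (Suc l))) * y}"
  have "y \<in> {0}"
  proof (rule awt_induct[of ?C])
    show "subsp ?C" by (intro subspI) (auto simp: cm_add cm_sc distrib_left sc_sc mult.commute)
    show "cm (H i) z \<in> ?C" if i: "i < n" and z: "z \<in> ?C" for i z
    proof -
      have "cm (e m) (cm (H i) z) = 0" if m: "m < n" for m
      proof -
        have "cm (e m) (H i) = - (sc (rootc n m i) * e m)" using cm_He[OF i m] cm_skew[of "e m" "H i"] by simp
        then show ?thesis using z m by (simp add: cm_jacobi[of "e m" "H i" z] cm_sc cm_minus)
      qed
      moreover have "cm rho (H i) = 0"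
        using i by (simp add: rho_def cm_sum cm_sc cm_HH)
      ultimately show ?thesis using z by (simp add: cm_jacobi[of rho "H i" z] cm_sc)
    qed
    show "y \<in> ?C" using low graph_rho[OF Suc.prems] by simp
    fix \<nu> z assume z: "z \<in> ?C" "awt \<nu> z"
    show "z \<in> {0}"
    proof (rule ccontr)
      assume "z \<notin> {0}"
      then have h: "height n \<nu> = of_int (- int (Suc l))"
        using sc_eq_cancel[of "height n \<nu>" z "of_int (- int (Suc l))"] z cm_rho_awt[OF z(2)] by auto
      have "copair n (\<lambda>k. - \<nu> k) m \<le> 0" if "m < n" for m
        using ad_highest_zero[OF z(2) that] z(1) that \<open>z \<notin> {0}\<close> by (force simp: copair_def split: if_splits)
      then have "height n (\<lambda>k. - \<nu> k) \<le> 0" by (rule height_antidominant[OF n2])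
      then show False using h by (simp add: height_def sum_negf)
    qed
  qed auto
  then show ?case by simp
qed

lemma graph_unique:
  assumes "graph l y X" "graph l z X" shows "y = z"
proof -
  have "graph l (y + - z) (fadd X (fscale (-1) X))" using assms by (intro graph_add graph_neg)
  moreover have "fadd X (fscale (-1) X) = fzero" by (simp add: fadd_def fscale_def fzero_def)
  ultimately have "graph l (y - z) fzero" by simp
  then have "y - z = 0"
    using graph_kernel_pos[of "nat l" "y - z"] graph_kernel_neg[of "nat (- l)" "y - z"]
    by (cases "l \<ge> 0") auto
  then show ?thesis by simp
qed

definition root_vec :: "nat \<Rightarrow> nat \<Rightarrow> 'a" where
  "root_vec a b = (SOME y. graph (ht n a - ht n b) y (Gm n a b))"

lemma graph_root_vec:
  assumes "a < 2 * n" "b < 2 * n"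
  shows "graph (ht n a - ht n b) (root_vec a b) (Gm n a b)"
proof -
  have "\<exists>y. graph (ht n a - ht n b) y (Gm n a b)"
    by (rule lie_closure[where L = "\<lambda>l X. \<exists>y. graph l y X", OF n2 _ _ _ _ _ _ assms])
       (blast intro: graph.intros graph_cm)+
  then show ?thesis unfolding root_vec_def by (rule someI_ex)
qed

lemma root_vec_eq:
  assumes "a < 2 * n" "b < 2 * n" "graph (ht n a - ht n b) y (Gm n a b)"
  shows "root_vec a b = y"
  using graph_unique graph_root_vec assms by blast

lemma root_vec_e: "i < n \<Longrightarrow> e i = (if i + 1 < n then root_vec i (i + 1) else root_vec (n - 2) (2 * n - 1))"
proof -
  assume i: "i < n"
  have "ht n (n - 2) - ht n (2 * n - 1) = 1" "i + 1 < n \<Longrightarrow> ht n i - ht n (i + 1) = 1"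
    using n3 by (auto simp: ht_def of_nat_diff)
  moreover have "i + 1 < n \<or> i = n - 1" using i by linarith
  ultimately show ?thesis
    using root_vec_eq[of i "i + 1" "e i"] root_vec_eq[of "n - 2" "2 * n - 1" "e i"] graph_e[OF i] n3
    by (auto simp: emat_def)
qed

lemma root_vec_f: "i < n \<Longrightarrow> f i = (if i + 1 < n then root_vec (i + 1) i else root_vec (2 * n - 1) (n - 2))"
proof -
  assume i: "i < n"
  have "ht n (2 * n - 1) - ht n (n - 2) = -1" "i + 1 < n \<Longrightarrow> ht n (i + 1) - ht n i = -1"
    using n3 by (auto simp: ht_def of_nat_diff)
  moreover have "i + 1 < n \<or> i = n - 1" using i by linarith
  ultimately show ?thesis
    using root_vec_eq[of "i + 1" i "f i"] root_vec_eq[of "2 * n - 1" "n - 2" "f i"] graph_f[OF i] n3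
    by (auto simp: fmatr_def)
qed

lemma root_vec_H: "i < n \<Longrightarrow> root_vec i i = H i"
  using root_vec_eq[of i i "H i"] graph_H[of i] by (simp add: hmat_def)

lemma root_vec_bar:
  assumes "a < 2 * n" "b < 2 * n"
  shows "root_vec (bar n b) (bar n a) = - root_vec a b"
  using graph_neg[OF graph_root_vec[OF assms]] assms
  by (intro root_vec_eq) (auto simp: bar_lt ht_bar Gm_bar)

lemma root_vec_self_bar: "a < 2 * n \<Longrightarrow> root_vec a (bar n a) = 0"
  by (intro root_vec_eq) (auto simp: bar_lt Gm_self_bar graph_zero)

text \<open>Both sides lift the bracket of \<open>Gm n a b\<close> and \<open>Gm n c d\<close> in
  one and the same degree, and such a lift is unique.\<close>

lemma cm_root_vec:
  assumes "a < 2 * n" "b < 2 * n" "c < 2 * n" "d < 2 * n"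
  shows "cm (root_vec a b) (root_vec c d) =
    sc (dl c b) * root_vec a d + sc (- dl c (bar n a)) * root_vec (bar n b) d
    + (sc (- dl d a) * root_vec c b + sc (dl d (bar n b)) * root_vec c (bar n a))"
proof (rule graph_unique)
  let ?l = "ht n a - ht n b + (ht n c - ht n d)"
  show "graph ?l (cm (root_vec a b) (root_vec c d)) (fbr (2 * n) (Gm n a b) (Gm n c d))"
    by (intro graph_cm graph_root_vec assms)
  \<comment> \<open>A term with coefficient 0 may come from a matrix of another degree; it is then
    lifted by 0, which belongs to every degree.\<close>
  have g: "graph ?l (sc x * root_vec p q) (fscale x (Gm n p q))"
    if "x = 0 \<or> ht n p - ht n q = ?l" "p < 2 * n" "q < 2 * n" for x p q
    using that graph_scale[OF graph_root_vec[OF that(2,3)], of x] by (auto simp: fscale_zero graph_zero)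
  show "graph ?l (sc (dl c b) * root_vec a d + sc (- dl c (bar n a)) * root_vec (bar n b) d
    + (sc (- dl d a) * root_vec c b + sc (dl d (bar n b)) * root_vec c (bar n a)))
    (fbr (2 * n) (Gm n a b) (Gm n c d))"
    unfolding fbr_Gm[OF assms]
    by (intro graph_add g) (use assms in \<open>auto simp: dl_def ht_bar bar_lt\<close>)
qed

end

section \<open>The Casimir element and complete reducibility\<close>

lemma sum_double: "(\<Sum>a<2 * n. g a) = (\<Sum>i<n. g i) + (\<Sum>i<n. g (i + n))"
  for g :: "nat \<Rightarrow> 'b :: comm_monoid_add"
proof -
  have "(\<Sum>a<2 * n. g a) = sum g {0..<n} + sum g {n..<2 * n}"
    by (simp add: lessThan_atLeast0 sum.atLeastLessThan_concat)
  also have "sum g {n..<2 * n} = (\<Sum>i=0..<n. g (i + n))"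
    using sum.shift_bounds_nat_ivl[of g 0 n n] by (simp add: mult_2)
  finally show ?thesis by (simp add: lessThan_atLeast0)
qed

text \<open>The eigenvalue of \<open>root_vec a a\<close>: on a partner index this element is the
  negative of an \<open>H i\<close>.\<close>

definition ext_wt :: "nat \<Rightarrow> (nat \<Rightarrow> rat) \<Rightarrow> nat \<Rightarrow> rat" where
  "ext_wt n \<nu> a = (if a < n then \<nu> a else - \<nu> (a - n))"

text \<open>The scalar by which \<open>root_vec a b * root_vec b a\<close> acts on a highest weight vector.\<close>

definition cas_term :: "nat \<Rightarrow> (nat \<Rightarrow> rat) \<Rightarrow> nat \<Rightarrow> nat \<Rightarrow> rat" where
  "cas_term n \<nu> a b = (if a = b then ext_wt n \<nu> a * ext_wt n \<nu> a
     else if ht n b < ht n a \<and> b \<noteq> bar n a then ext_wt n \<nu> a - ext_wt n \<nu> b else 0)"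

lemma cas_term_sum: "(\<Sum>a<2 * n. \<Sum>b<2 * n. cas_term n \<nu> a b) = cas n \<nu>"
proof -
  \<comment> \<open>\<open>?d\<close> is the Cartan part, while \<open>?m\<close> and
    \<open>?p\<close> stand for the roots \<epsilon>_i - \<epsilon>_j and \<epsilon>_i +
    \<epsilon>_j.\<close>
  let ?d = "\<lambda>i j. if i = j then \<nu> i * \<nu> i else 0"
  let ?m = "\<lambda>i j. if i < j then \<nu> i - \<nu> j else 0" and ?p = "\<lambda>i j. if i < j then \<nu> i + \<nu> j else 0"
  have "(\<Sum>a<2 * n. \<Sum>b<2 * n. cas_term n \<nu> a b) =
    (\<Sum>i<n. \<Sum>j<n. cas_term n \<nu> i j + cas_term n \<nu> i (j + n) + cas_term n \<nu> (i + n) j + cas_term n \<nu> (i + n) (j + n))"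
    unfolding sum_double sum.distrib by simp
  also have "\<dots> = (\<Sum>i<n. \<Sum>j<n. 2 * ?d i j + ?m i j + ?m j i + ?p i j + ?p j i)"
  proof (intro sum.cong refl)
    fix i j assume "i \<in> {..<n}" "j \<in> {..<n}"
    then have "cas_term n \<nu> i j = ?d i j + ?m i j" "cas_term n \<nu> i (j + n) = ?p i j + ?p j i"
      "cas_term n \<nu> (i + n) j = 0" "cas_term n \<nu> (i + n) (j + n) = ?d i j + ?m j i"
      by (auto simp: cas_term_def ext_wt_def ht_def bar_def)
    then show "cas_term n \<nu> i j + cas_term n \<nu> i (j + n) + cas_term n \<nu> (i + n) j + cas_term n \<nu> (i + n) (j + n) =
        2 * ?d i j + ?m i j + ?m j i + ?p i j + ?p j i" by simp
  qed
  also have "\<dots> = 2 * (\<Sum>i<n. \<Sum>j<n. ?d i j) + ((\<Sum>i<n. \<Sum>j<n. ?m i j) + (\<Sum>i<n. \<Sum>j<n. ?m j i))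
      + ((\<Sum>i<n. \<Sum>j<n. ?p i j) + (\<Sum>i<n. \<Sum>j<n. ?p j i))"
    by (simp only: sum.distrib sum_distrib_left add.assoc)
  also have "(\<Sum>i<n. \<Sum>j<n. ?m j i) = (\<Sum>i<n. \<Sum>j<n. ?m i j)" by (rule sum.swap)
  also have "(\<Sum>i<n. \<Sum>j<n. ?p j i) = (\<Sum>i<n. \<Sum>j<n. ?p i j)" by (rule sum.swap)
  also have "2 * (\<Sum>i<n. \<Sum>j<n. ?d i j) + ((\<Sum>i<n. \<Sum>j<n. ?m i j) + (\<Sum>i<n. \<Sum>j<n. ?m i j))
      + ((\<Sum>i<n. \<Sum>j<n. ?p i j) + (\<Sum>i<n. \<Sum>j<n. ?p i j)) =
      2 * (\<Sum>i<n. \<Sum>j<n. ?d i j) + 4 * (\<Sum>i<n. \<Sum>j<n. if i < j then \<nu> i else 0)"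
  proof -
    \<comment> \<open>Between the two kinds of roots the terms with \<nu> j cancel, and those with
      \<nu> i double.\<close>
    have "(\<Sum>i<n. \<Sum>j<n. ?m i j) + (\<Sum>i<n. \<Sum>j<n. ?p i j) = (\<Sum>i<n. \<Sum>j<n. 2 * (if i < j then \<nu> i else 0))"
      unfolding sum.distrib[symmetric] by (intro sum.cong refl) auto
    then show ?thesis by (simp add: sum_distrib_left[symmetric])
  qed
  also have "(\<Sum>i<n. \<Sum>j<n. if i < j then \<nu> i else 0) = height n \<nu>"
    unfolding height_def
  proof (intro sum.cong refl)
    fix i assume "i \<in> {..<n}"
    have "(\<Sum>j<n. if i < j then \<nu> i else 0) = (\<Sum>j\<in>{..<n} \<inter> {j. i < j}. \<nu> i)"
      by (subst sum.inter_restrict) auto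
    also have "{..<n} \<inter> {j. i < j} = {i<..<n}" by auto
    finally show "(\<Sum>j<n. if i < j then \<nu> i else 0) = of_nat (n - 1 - i) * \<nu> i" by simp
  qed
  also have "(\<Sum>i<n. \<Sum>j<n. ?d i j) = (\<Sum>i<n. \<nu> i * \<nu> i)" by simp
  finally show ?thesis by (simp add: cas_def)
qed

context schur_presentation
begin

definition casimir :: 'a where
  "casimir = (\<Sum>a<2 * n. \<Sum>b<2 * n. root_vec a b * root_vec b a)"

lemma sum_sc_dl: "b < m \<Longrightarrow> (\<Sum>s<m. sc (dl s b) * x s) = x b"
  by (simp add: dl_def if_distrib[of sc] if_distrib[of "\<lambda>c. c * _"] cong: if_cong)

lemma cm_mult: "cm x (y * z) = cm x y * z + y * cm x z" for x y z :: 'a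
  by (simp add: cm_def algebra_simps)

lemma cm_sum_right: "cm x (\<Sum>i\<in>I. g i) = (\<Sum>i\<in>I. cm x (g i))" for x :: 'a
  by (simp add: cm_def sum_distrib_left sum_distrib_right sum_subtractf)

text \<open>By the Leibniz rule there are two double sums. The deltas in the structure constants
  collapse each to four simple sums, and the four from one factor cancel the four from the
  other.\<close>

lemma casimir_root_vec:
  assumes xy: "x < 2 * n" "y < 2 * n"
  shows "cm (root_vec x y) casimir = 0"
proof -
  let ?g = root_vec and ?N = "2 * n"
  have b: "bar n x < ?N" "bar n y < ?N" using xy bar_lt by auto
  have 1: "(\<Sum>c<?N. \<Sum>d<?N. cm (?g x y) (?g c d) * ?g d c) =
      (\<Sum>d<?N. ?g x d * ?g d y) - (\<Sum>d<?N. ?g (bar n y) d * ?g d (bar n x))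
      - (\<Sum>c<?N. ?g c y * ?g x c) + (\<Sum>c<?N. ?g c (bar n x) * ?g (bar n y) c)"
  proof -
    have "(\<Sum>c<?N. \<Sum>d<?N. cm (?g x y) (?g c d) * ?g d c) =
        (\<Sum>c<?N. sc (dl c y) * (\<Sum>d<?N. ?g x d * ?g d c))
        - (\<Sum>c<?N. sc (dl c (bar n x)) * (\<Sum>d<?N. ?g (bar n y) d * ?g d c))
        - (\<Sum>c<?N. \<Sum>d<?N. sc (dl d x) * (?g c y * ?g d c))
        + (\<Sum>c<?N. \<Sum>d<?N. sc (dl d (bar n y)) * (?g c (bar n x) * ?g d c))"
      unfolding sum_distrib_left sum.distrib[symmetric] sum_subtractf[symmetric]
      by (intro sum.cong refl) (use xy in \<open>simp add: cm_root_vec sc_minus algebra_simps\<close>)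
    then show ?thesis using xy b by (simp only: sum_sc_dl)
  qed
  have 2: "(\<Sum>c<?N. \<Sum>d<?N. ?g c d * cm (?g x y) (?g d c)) =
      (\<Sum>c<?N. ?g c y * ?g x c) - (\<Sum>c<?N. ?g c (bar n x) * ?g (bar n y) c)
      - (\<Sum>d<?N. ?g x d * ?g d y) + (\<Sum>d<?N. ?g (bar n y) d * ?g d (bar n x))"
  proof -
    have "(\<Sum>c<?N. \<Sum>d<?N. ?g c d * cm (?g x y) (?g d c)) =
        (\<Sum>c<?N. \<Sum>d<?N. sc (dl d y) * (?g c d * ?g x c))
        - (\<Sum>c<?N. \<Sum>d<?N. sc (dl d (bar n x)) * (?g c d * ?g (bar n y) c))
        - (\<Sum>c<?N. sc (dl c x) * (\<Sum>d<?N. ?g c d * ?g d y))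
        + (\<Sum>c<?N. sc (dl c (bar n y)) * (\<Sum>d<?N. ?g c d * ?g d (bar n x)))"
      unfolding sum_distrib_left sum.distrib[symmetric] sum_subtractf[symmetric]
      by (intro sum.cong refl)
         (use xy in \<open>simp add: cm_root_vec sc_minus sc_left[of "root_vec _ _"] algebra_simps\<close>)
    then show ?thesis using xy b by (simp only: sum_sc_dl)
  qed
  show ?thesis
    unfolding casimir_def cm_sum_right cm_mult sum.distrib 1 2 by simp
qed

lemma casimir_central: "casimir * x = x * casimir"
proof -
  have g: "cm (e i) casimir = 0" "cm (f i) casimir = 0" "cm (H i) casimir = 0" if "i < n" for i
    using root_vec_e[OF that] root_vec_f[OF that] root_vec_H[OF that] that n3
      casimir_root_vec[of i "i + 1"] casimir_root_vec[of "i + 1" i] casimir_root_vec[of i i]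
      casimir_root_vec[of "n - 2" "2 * n - 1"] casimir_root_vec[of "2 * n - 1" "n - 2"]
    by (auto split: if_splits)
  have "x \<in> {x. casimir * x = x * casimir}"
  proof (rule generated)
    show "subsp {x. casimir * x = x * casimir}"
      by (intro subspI) (auto simp: distrib_left distrib_right sc_left[of casimir] mult.assoc)
    fix i x assume "i < n" "x \<in> {x. casimir * x = x * casimir}"
    then have x: "casimir * x = x * casimir" and
      c: "casimir * e i = e i * casimir" "casimir * f i = f i * casimir" "casimir * H i = H i * casimir"
      using g[of i] by (auto simp: cm_def)
    have "casimir * (y * x) = y * x * casimir" if "casimir * y = y * casimir" for y
      using x that by (metis mult.assoc)
    then show "e i * x \<in> {x. casimir * x = x * casimir} \<and> f i * x \<in> {x. casimir * x = x * casimir} \<and>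
        H i * x \<in> {x. casimir * x = x * casimir}" using c by auto
  qed simp
  then show ?thesis by simp
qed

lemma root_vec_diag:
  assumes "wt \<nu> v" "a < 2 * n"
  shows "root_vec a a * v = sc (ext_wt n \<nu> a) * v"
proof (cases "a < n")
  case True
  then show ?thesis using assms by (simp add: root_vec_H ext_wt_def wt_def)
next
  case False
  then have a: "a - n < n" "bar n (a - n) = a" using assms(2) by (auto simp: bar_def)
  then have "root_vec a a = - H (a - n)"
    using root_vec_bar[of "a - n" "a - n"] root_vec_H[of "a - n"] by simp
  then show ?thesis using assms a False by (simp add: ext_wt_def wt_def sc_minus)
qed

text \<open>Lifts that send \<open>v\<close> into the left ideal \<open>N\<close> are closed under
  brackets, so \<open>positive_closure\<close> passes from the simple roots to all positive
  ones.\<close>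

lemma positive_root_vec:
  assumes N: "left_ideal N" and v: "\<And>i. i < n \<Longrightarrow> e i * v \<in> N"
    and ab: "a < 2 * n" "b < 2 * n" "ht n b < ht n a"
  shows "root_vec a b * v \<in> N"
proof -
  note S = left_ideal_subsp[OF N]
  have "\<exists>y. graph (ht n a - ht n b) y (Gm n a b) \<and> y * v \<in> N"
  proof (rule positive_closure[where L = "\<lambda>l X. \<exists>y. graph l y X \<and> y * v \<in> N", OF n2 _ _ _ _ ab])
    show "\<exists>y. graph 1 y (emat n i) \<and> y * v \<in> N" if "i < n" for i
      using that v graph_e by blast
    show "\<exists>y. graph k y (fscale c X) \<and> y * v \<in> N" if "\<exists>y. graph k y X \<and> y * v \<in> N" for k c X
      using that subsp_sc[OF S] by (metis graph_scale mult.assoc)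
    show "\<exists>y. graph k y fzero \<and> y * v \<in> N" for k
      using graph_zero[of k] subsp_zero[OF S] by (intro exI[of _ 0]) simp
    show "\<exists>y. graph (k + l) y (fbr (2 * n) X Y) \<and> y * v \<in> N"
      if h: "\<exists>y. graph k y X \<and> y * v \<in> N" "\<exists>y. graph l y Y \<and> y * v \<in> N" for k l X Y
    proof -
      obtain y where y: "graph k y X" "y * v \<in> N" using h(1) by blast
      obtain z where "graph l z Y" "z * v \<in> N" using h(2) by blast
      note yz = y this
      have "cm y z * v = y * (z * v) - z * (y * v)" by (simp add: cm_def algebra_simps)
      then have "cm y z * v \<in> N" using yz left_ideal_mult[OF N] subsp_diff[OF S] by simp
      then show ?thesis using graph_cm yz by blast
    qed
  qed
  then show ?thesis using root_vec_eq ab by blast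
qed

text \<open>Modulo \<open>N\<close> all positive root vectors kill \<open>v\<close>. Where the
  positive root stands on the left, the product is reordered, and the commutator
  \<open>root_vec a a - root_vec b b\<close> contributes a scalar. Working modulo \<open>N\<close>
  covers vectors that still have to be corrected to highest weight vectors.\<close>

lemma casimir_weight:
  assumes N: "left_ideal N" and v: "wt \<nu> v" "\<And>i. i < n \<Longrightarrow> e i * v \<in> N"
  shows "casimir * v - sc (cas n \<nu>) * v \<in> N"
proof -
  note S = left_ideal_subsp[OF N]
  have "root_vec a b * root_vec b a * v - sc (cas_term n \<nu> a b) * v \<in> N" if ab: "a < 2 * n" "b < 2 * n" for a b
  proof -
    consider "a = b" | "a \<noteq> b" "b = bar n a" | "ht n a < ht n b" "b \<noteq> bar n a" | "ht n b < ht n a" "b \<noteq> bar n a"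
      using ht_eq[OF ab] by linarith
    then show ?thesis
    proof cases
      case 1
      then show ?thesis
        using root_vec_diag[OF v(1) ab(1)] subsp_zero[OF S]
        by (simp add: cas_term_def mult.assoc sc_left[of "root_vec _ _"] sc_sc)
    next
      case 2
      then show ?thesis
        using root_vec_self_bar[OF ab(1)] subsp_zero[OF S] by (simp add: cas_term_def)
    next
      case 3
      then have "cas_term n \<nu> a b = 0" by (auto simp: cas_term_def)
      then show ?thesis
        using left_ideal_mult[OF N positive_root_vec[OF N v(2) ab(2,1) 3(1)], of "root_vec a b"]
        by (simp add: mult.assoc)
    next
      case 4
      then have ne: "a \<noteq> b" "a \<noteq> bar n b" using bar_bar ab by auto
      have "cm (root_vec a b) (root_vec b a) = root_vec a a - root_vec b b"
        using cm_root_vec[OF ab ab(2,1)] 4 ne by (simp add: dl_def sc_minus)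
      then have "root_vec a b * root_vec b a = root_vec b a * root_vec a b + (root_vec a a - root_vec b b)"
        by (simp add: cm_def algebra_simps)
      then have "root_vec a b * root_vec b a * v
          = root_vec b a * (root_vec a b * v) + (root_vec a a * v - root_vec b b * v)"
        by (simp add: mult.assoc distrib_right left_diff_distrib)
      also have "root_vec a a * v - root_vec b b * v = sc (cas_term n \<nu> a b) * v"
        using root_vec_diag[OF v(1) ab(1)] root_vec_diag[OF v(1) ab(2)] 4 ne
        by (simp add: cas_term_def sc_diff left_diff_distrib)
      finally show ?thesis
        using left_ideal_mult[OF N positive_root_vec[OF N v(2) ab 4(1)], of "root_vec b a"] by simp
    qed
  qed
  then have "(\<Sum>a<2 * n. \<Sum>b<2 * n. root_vec a b * root_vec b a * v - sc (cas_term n \<nu> a b) * v) \<in> N"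
    by (intro subsp_sum[OF S]) auto
  also have "(\<Sum>a<2 * n. \<Sum>b<2 * n. root_vec a b * root_vec b a * v - sc (cas_term n \<nu> a b) * v)
      = casimir * v - sc (cas n \<nu>) * v"
    by (simp add: casimir_def sum_distrib_right sum_subtractf sc_sum flip: cas_term_sum)
  finally show ?thesis .
qed

definition highest :: "(nat \<Rightarrow> rat) \<Rightarrow> 'a \<Rightarrow> bool" where
  "highest \<nu> v \<longleftrightarrow> v \<noteq> 0 \<and> wt \<nu> v \<and> (\<forall>i<n. e i * v = 0)"

lemma left_ideal_zero: "left_ideal {0}"
  by (auto simp: left_ideal_def)

lemma highest_dominant: "highest \<nu> v \<Longrightarrow> dom_wt n \<nu>"
  unfolding dom_wt_def highest_def
  using nondominant_mem[OF left_ideal_zero, of \<nu> v] by force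

lemma highest_casimir: "highest \<nu> v \<Longrightarrow> casimir * v = sc (cas n \<nu>) * v"
  using casimir_weight[OF left_ideal_zero, of \<nu> v] by (simp add: highest_def)

lemma highest_casimir_left: "highest \<nu> v \<Longrightarrow> casimir * (p * v) = sc (cas n \<nu>) * (p * v)"
  using highest_casimir[of \<nu> v] casimir_central[of p] by (metis mult.assoc sc_left)

text \<open>The word \<open>ws\<close> certifies that \<nu> lies above \<mu>. With
  \<open>m = 1\<close> it lies strictly above, which is what allows the Casimir element to tell the
  two weights apart.\<close>

inductive_set hw_sum :: "nat \<Rightarrow> (nat \<Rightarrow> rat) \<Rightarrow> 'a set" for m \<mu> where
  hw_zero: "0 \<in> hw_sum m \<mu>"
| hw_add: "x \<in> hw_sum m \<mu> \<Longrightarrow> highest \<nu> w \<Longrightarrow> set ws \<subseteq> {..<n} \<Longrightarrow> m \<le> length ws \<Longrightarrow>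
    (\<And>k. k < n \<Longrightarrow> \<nu> k = \<mu> k + asum n ws k) \<Longrightarrow> p * w + x \<in> hw_sum m \<mu>"

lemma hw_sum_plus: "x \<in> hw_sum m \<mu> \<Longrightarrow> y \<in> hw_sum m \<mu> \<Longrightarrow> x + y \<in> hw_sum m \<mu>"
  by (induction rule: hw_sum.induct) (auto simp: add.assoc intro: hw_add)

lemma hw_sum_mult: "x \<in> hw_sum m \<mu> \<Longrightarrow> a * x \<in> hw_sum m \<mu>"
proof (induction rule: hw_sum.induct)
  case (hw_add x \<nu> w ws p)
  from hw_sum.hw_add[OF hw_add(6,2,3,4,5), of "a * p"] show ?case by (simp add: distrib_left mult.assoc)
qed (simp add: hw_zero)

lemma left_ideal_hw_sum: "left_ideal (hw_sum m \<mu>)"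
  by (auto simp: left_ideal_def hw_zero hw_sum_plus hw_sum_mult)

lemma hw_sum_mono: "x \<in> hw_sum m \<mu> \<Longrightarrow> l \<le> m \<Longrightarrow> x \<in> hw_sum l \<mu>"
proof (induction rule: hw_sum.induct)
  case (hw_add x \<nu> w ws p)
  then show ?case by (intro hw_sum.hw_add[of x l \<mu> \<nu> w ws]) auto
qed (rule hw_zero)

lemma hw_sum_step:
  assumes "x \<in> hw_sum m (\<lambda>k. \<mu> k + rootc n i k)" "i < n"
  shows "x \<in> hw_sum (Suc m) \<mu>"
  using assms(1)
proof (induction rule: hw_sum.induct)
  case (hw_add x \<nu> w ws p)
  then show ?case using assms(2) by (intro hw_sum.hw_add[of x _ \<mu> \<nu> w "i # ws"]) auto
qed (rule hw_zero)

text \<open>On the left ideal of a highest weight vector of weight \<nu> the Casimir element is the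
  scalar \<open>cas n \<nu>\<close>, which differs from \<open>cas n \<mu>\<close>; so the equation
  is solved summand by summand.\<close>

lemma hw_sum_casimir_surj:
  assumes "u \<in> hw_sum 1 \<mu>" "dom_wt n \<mu>"
  shows "\<exists>u'\<in>hw_sum 1 \<mu>. casimir * u' - sc (cas n \<mu>) * u' = u"
  using assms(1)
proof (induction rule: hw_sum.induct)
  case hw_zero
  then show ?case by (intro bexI[of _ 0] hw_sum.hw_zero) simp
next
  case (hw_add x \<nu> w ws p)
  then obtain x' where x': "x' \<in> hw_sum 1 \<mu>" "casimir * x' - sc (cas n \<mu>) * x' = x" by blast
  let ?c = "cas n \<nu> - cas n \<mu>"
  have "?c \<noteq> 0"
    using cas_strict[OF highest_dominant[OF hw_add(2)] assms(2), of ws] hw_add n2 by auto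
  then have "sc ?c * sc (inverse ?c) = 1" by (simp flip: sc_mult)
  have "casimir * (sc (inverse ?c) * p * w + x') - sc (cas n \<mu>) * (sc (inverse ?c) * p * w + x')
      = (sc ?c * sc (inverse ?c)) * p * w + x"
    unfolding distrib_left highest_casimir_left[OF hw_add(2)] x'(2)[symmetric]
    by (simp add: sc_diff algebra_simps)
  moreover have "sc (inverse ?c) * p * w + x' \<in> hw_sum 1 \<mu>"
    using hw_sum.hw_add[OF x'(1) hw_add(2,3,4,5), of "sc (inverse ?c) * p"] .
  ultimately show ?case using \<open>sc ?c * sc (inverse ?c) = 1\<close> by (intro bexI) auto
qed

text \<open>An element of the sum is killed by a product of factors \<open>casimir - c\<close> with
  all \<open>c\<close> different from \<open>cas n \<mu>\<close>, so it cannot be a nonzero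
  eigenvector for \<open>cas n \<mu>\<close>. This replaces a decomposition into a direct
  sum.\<close>

lemma hw_sum_casimir_inj:
  assumes "y \<in> hw_sum 1 \<mu>" "dom_wt n \<mu>" "casimir * y = sc (cas n \<mu>) * y"
  shows "y = 0"
proof -
  have "\<exists>S. (\<forall>c\<in>set S. c \<noteq> cas n \<mu>) \<and> fold (\<lambda>k y. casimir * y - sc k * y) S y = 0"
    using assms(1)
  proof (induction rule: hw_sum.induct)
    case hw_zero
    then show ?case by (intro exI[of _ "[]"]) simp
  next
    case (hw_add x \<nu> w ws p)
    then obtain S where S: "\<forall>c\<in>set S. c \<noteq> cas n \<mu>" "fold (\<lambda>k y. casimir * y - sc k * y) S x = 0" by blast
    have "cas n \<nu> \<noteq> cas n \<mu>"
      using cas_strict[OF highest_dominant[OF hw_add(2)] assms(2), of ws] hw_add n2 by auto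
    moreover have "fold (\<lambda>k y. casimir * y - sc k * y) (S @ [cas n \<nu>]) (p * w + x) = 0"
    proof -
      note l = linD[OF lin_fold[OF lin_mult[of casimir], of S]]
      have "fold (\<lambda>k y. casimir * y - sc k * y) S (p * w) = sc (\<Prod>j\<leftarrow>S. cas n \<nu> - j) * (p * w)"
        by (rule fold_eigenvector[OF lin_mult highest_casimir_left[OF hw_add(2)]])
      then show ?thesis
        using highest_casimir_left[OF hw_add(2), of p] S(2)
        by (simp add: l sc_left[of casimir] sc_sc mult.commute)
    qed
    ultimately show ?case using S(1) by (intro exI[of _ "S @ [cas n \<nu>]"]) auto
  qed
  then obtain S where S: "\<forall>c\<in>set S. c \<noteq> cas n \<mu>" "fold (\<lambda>k y. casimir * y - sc k * y) S y = 0" by blast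
  then show ?thesis using eigenvalue_mem[OF lin_mult assms(3) S(2)] by auto
qed

text \<open>If \<open>e\<^sub>i v\<close> lies in a sum of highest weight modules of weights above
  that of \<open>v\<close>, then \<open>v\<close> can be corrected by an element of that sum to become a Casimir
  eigenvector, and hence a highest weight vector.\<close>

lemma wt_in_hw_sum:
  assumes "wt \<mu> v" "\<And>ws. set ws \<subseteq> {..<n} \<Longrightarrow> length ws = l \<Longrightarrow> ew ws * v = 0"
  shows "v \<in> hw_sum 0 \<mu>"
  using assms
proof (induction l arbitrary: \<mu> v)
  case 0
  then show ?case using hw_zero by force
next
  case (Suc l)
  let ?N = "hw_sum 1 \<mu>"
  note N = left_ideal_hw_sum[of 1 \<mu>] and S = left_ideal_subsp[OF left_ideal_hw_sum[of 1 \<mu>]]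
  have e: "e i * v \<in> ?N" if i: "i < n" for i
  proof -
    have "e i * v \<in> hw_sum 0 (\<lambda>k. \<mu> k + rootc n i k)"
    proof (rule Suc.IH[OF wt_e[OF Suc.prems(1) i]])
      fix ws assume "set ws \<subseteq> {..<n}" "length ws = l"
      then have "ew (ws @ [i]) * v = 0" using i by (intro Suc.prems(2)) auto
      then show "ew ws * (e i * v) = 0" by (simp add: ew_def mult.assoc)
    qed
    then show ?thesis using hw_sum_step[OF _ i, of _ 0] by simp
  qed
  show ?case
  proof (cases "dom_wt n \<mu>")
    case False
    then obtain i where "i < n" "copair n \<mu> i < 0" by (auto simp: dom_wt_def not_le)
    then have "v \<in> ?N" using nondominant_mem[OF N Suc.prems(1)] e by blast
    then show ?thesis using hw_sum_mono by auto
  next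
    case True
    obtain z where z: "wt \<mu> z" "\<And>y. (\<forall>i<n. H i * y = y * H i) \<Longrightarrow> z * y = y * z"
      "\<And>x. wt \<mu> x \<Longrightarrow> z * x = x" using weight_projection[of \<mu>] by auto
    obtain u where u: "u \<in> ?N" "casimir * u - sc (cas n \<mu>) * u = casimir * v - sc (cas n \<mu>) * v"
      using hw_sum_casimir_surj[OF casimir_weight[OF N Suc.prems(1) e] True] by blast
    \<comment> \<open>\<open>u\<close> need not have weight \<mu>. Its component
      \<open>z * u\<close> has, still lies in \<open>?N\<close>, and solves the same equation
      because \<open>z\<close> commutes with \<open>casimir\<close> and fixes
      \<open>v\<close>.\<close>
    define w where "w = v - z * u"
    have zu: "z * u \<in> ?N" using left_ideal_mult[OF N u(1)] .
    have "casimir * w = sc (cas n \<mu>) * w"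
    proof -
      have "z * casimir = casimir * z" using z(2)[of casimir] casimir_central by simp
      then have zc: "z * (casimir * x) = casimir * (z * x)" for x by (simp add: mult.assoc[symmetric])
      then have "casimir * (z * u) - sc (cas n \<mu>) * (z * u) = z * (casimir * u - sc (cas n \<mu>) * u)"
        by (simp add: right_diff_distrib sc_left[of z] zc)
      also have "\<dots> = z * (casimir * v - sc (cas n \<mu>) * v)" using u by simp
      also have "\<dots> = casimir * (z * v) - sc (cas n \<mu>) * (z * v)"
        by (simp add: right_diff_distrib sc_left[of z] zc)
      finally show ?thesis using z(3)[OF Suc.prems(1)] by (simp add: w_def algebra_simps)
    qed
    \<comment> \<open>So \<open>e i * w\<close>, which lies in \<open>?N\<close>, is a Casimir
      eigenvector for a value that has no eigenvectors there; hence it vanishes.\<close>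
    then have "casimir * (e i * w) = sc (cas n \<mu>) * (e i * w)" for i
      using casimir_central[of "e i"] by (metis mult.assoc sc_left)
    moreover have "e i * w \<in> ?N" if "i < n" for i
      using e[OF that] left_ideal_mult[OF N zu] subsp_diff[OF S] by (simp add: w_def right_diff_distrib)
    ultimately have ew: "e i * w = 0" if "i < n" for i
      using hw_sum_casimir_inj[OF _ True] that by blast
    have "wt \<mu> w" using Suc.prems(1) wt_right[OF z(1)] by (auto simp: w_def wt_def right_diff_distrib)
    have "w \<in> hw_sum 0 \<mu>"
    proof (cases "w = 0")
      case False
      then have "highest \<mu> w" using ew \<open>wt \<mu> w\<close> by (simp add: highest_def)
      from hw_add[OF hw_zero[of 0 \<mu>] this, of "[]" 1] show ?thesis by simp
    qed (simp add: hw_zero)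
    then have "w + z * u \<in> hw_sum 0 \<mu>" using hw_sum_mono[OF zu, of 0] by (intro hw_sum_plus) auto
    then show ?thesis by (simp add: w_def)
  qed
qed

inductive_set hw_all :: "'a set" where
  hw_all_zero: "0 \<in> hw_all"
| hw_all_add: "x \<in> hw_all \<Longrightarrow> highest \<nu> w \<Longrightarrow> p * w + x \<in> hw_all"

lemma hw_all_plus: "x \<in> hw_all \<Longrightarrow> y \<in> hw_all \<Longrightarrow> x + y \<in> hw_all"
  by (induction rule: hw_all.induct) (auto simp: add.assoc intro: hw_all_add)

text \<open>\<open>wt_in_hw_sum\<close> is started with a length at which all words in the
  \<open>e i\<close> vanish.\<close>

theorem complete_reducibility: "x \<in> hw_all"
proof (rule wt_induct[of UNIV])
  fix \<nu> y assume "wt \<nu> y"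
  then have "y \<in> hw_sum 0 \<nu>"
    using wt_in_hw_sum[of \<nu> y "Suc (2 * (n * (n * r)))"] e_word_nilpotent by auto
  then show "y \<in> hw_all"
    by (induction rule: hw_sum.induct) (auto intro: hw_all.intros)
qed (auto intro: subspI hw_all.intros hw_all_plus)

end

section \<open>Comparison of highest weight modules\<close>

context rat_scalars
begin

definition fword :: "(nat \<Rightarrow> 'a) \<Rightarrow> nat list \<Rightarrow> 'a" where
  "fword f ws = prod_list (map f ws)"

lemma fword_simps [simp]: "fword f [] = 1" "fword f (j # ws) = f j * fword f ws"
  by (simp_all add: fword_def)

definition gen_closed :: "nat \<Rightarrow> (nat \<Rightarrow> 'a) \<Rightarrow> (nat \<Rightarrow> 'a) \<Rightarrow> (nat \<Rightarrow> 'a) \<Rightarrow> 'a set \<Rightarrow> bool" where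
  "gen_closed n e f H D \<longleftrightarrow> subsp D \<and> (\<forall>i<n. \<forall>x\<in>D. e i * x \<in> D \<and> f i * x \<in> D \<and> H i * x \<in> D)"

text \<open>The annihilators of highest weight vectors of weight \<open>\<mu>\<close> have the following properties.  The
  relations (D1)--(D3) are imposed modulo \<open>A\<close>, so that the free algebra is an admissible \<open>'a\<close>.\<close>

definition hw_annihilator ::
  "nat \<Rightarrow> (nat \<Rightarrow> 'a) \<Rightarrow> (nat \<Rightarrow> 'a) \<Rightarrow> (nat \<Rightarrow> 'a) \<Rightarrow> (nat \<Rightarrow> rat) \<Rightarrow> 'a set \<Rightarrow> bool" where
  "hw_annihilator n e f H \<mu> A \<longleftrightarrow> gen_closed n e f H A \<and>
    (\<forall>i<n. e i \<in> A \<and> H i - sc (\<mu> i) \<in> A) \<and>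
    (\<forall>i<n. \<forall>j<n. \<forall>ws. set ws \<subseteq> {..<n} \<longrightarrow>
      (e i * f j - f j * e i - (if i = j then if i + 1 < n then H i - H (i + 1) else H (n - 2) + H (n - 1) else 0))
        * fword f ws \<in> A \<and>
      (H i * f j - f j * H i + sc (rootc n j i) * f j) * fword f ws \<in> A)"

text \<open>A substitute for the triangular decomposition: this set is stable under all generators,
  so it contains everything they reach from 1.\<close>

inductive_set f_span :: "nat \<Rightarrow> (nat \<Rightarrow> 'a) \<Rightarrow> 'a set \<Rightarrow> 'a set" for n f A where
  f_span_mem: "x \<in> A \<Longrightarrow> x \<in> f_span n f A"
| f_span_word: "set ws \<subseteq> {..<n} \<Longrightarrow> fword f ws \<in> f_span n f A"
| f_span_add: "x \<in> f_span n f A \<Longrightarrow> y \<in> f_span n f A \<Longrightarrow> x + y \<in> f_span n f A"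
| f_span_sc: "x \<in> f_span n f A \<Longrightarrow> sc c * x \<in> f_span n f A"

lemma subsp_f_span: "subsp A \<Longrightarrow> subsp (f_span n f A)"
  by (intro subspI) (auto intro: f_span.intros subsp_zero)

context
  fixes n e f H \<mu> A
  assumes ann: "hw_annihilator n e f H \<mu> A" and n: "2 \<le> n"
begin

lemma ann_subsp: "subsp A"
  and ann_mult: "i < n \<Longrightarrow> x \<in> A \<Longrightarrow> e i * x \<in> A" "i < n \<Longrightarrow> x \<in> A \<Longrightarrow> f i * x \<in> A"
    "i < n \<Longrightarrow> x \<in> A \<Longrightarrow> H i * x \<in> A"
  and ann_e: "i < n \<Longrightarrow> e i \<in> A" and ann_H: "i < n \<Longrightarrow> H i - sc (\<mu> i) \<in> A"
  and ann_ef: "i < n \<Longrightarrow> j < n \<Longrightarrow> set ws \<subseteq> {..<n} \<Longrightarrow>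
      (e i * f j - f j * e i - (if i = j then if i + 1 < n then H i - H (i + 1) else H (n - 2) + H (n - 1) else 0))
        * fword f ws \<in> A"
  and ann_Hf: "i < n \<Longrightarrow> j < n \<Longrightarrow> set ws \<subseteq> {..<n} \<Longrightarrow>
      (H i * f j - f j * H i + sc (rootc n j i) * f j) * fword f ws \<in> A"
  using ann unfolding hw_annihilator_def gen_closed_def by blast+

lemma f_span_f: "x \<in> f_span n f A \<Longrightarrow> j < n \<Longrightarrow> f j * x \<in> f_span n f A"
proof (induction rule: f_span.induct)
  case (f_span_word ws)
  then show ?case using f_span.f_span_word[of "j # ws" n f A] by simp
qed (auto simp: distrib_left sc_left[of "f j"] intro: f_span.intros ann_mult)

lemma H_fword:
  assumes i: "i < n"
  shows "set ws \<subseteq> {..<n} \<Longrightarrow> H i * fword f ws - sc (\<mu> i - asum n ws i) * fword f ws \<in> A"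
proof (induction ws)
  case Nil
  then show ?case using ann_H[OF i] by simp
next
  case (Cons j ws)
  have "H i * (f j * fword f ws) - sc (\<mu> i - (rootc n j i + asum n ws i)) * (f j * fword f ws)
      = (H i * f j - f j * H i + sc (rootc n j i) * f j) * fword f ws
        + f j * (H i * fword f ws - sc (\<mu> i - asum n ws i) * fword f ws)"
    by (simp add: algebra_simps sc_add sc_diff sc_left[of "f j"])
  also have "\<dots> \<in> A" using Cons i by (intro subsp_add[OF ann_subsp] ann_Hf ann_mult) auto
  finally show ?case by simp
qed

lemma f_span_H: "x \<in> f_span n f A \<Longrightarrow> i < n \<Longrightarrow> H i * x \<in> f_span n f A"
proof (induction rule: f_span.induct)
  case (f_span_word ws)
  have "(H i * fword f ws - sc (\<mu> i - asum n ws i) * fword f ws) + sc (\<mu> i - asum n ws i) * fword f ws \<in> f_span n f A"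
    using f_span_word by (intro f_span_add f_span_mem H_fword f_span_sc f_span.f_span_word)
  then show ?case by simp
qed (auto simp: distrib_left sc_left[of "H i"] intro: f_span.intros ann_mult)

text \<open>\<open>e i\<close> is moved to the right through the word. Each commutator leaves a
  Cartan element times a shorter word, and at the end \<open>e i\<close> itself lies in
  \<open>A\<close>.\<close>

lemma f_span_e: "x \<in> f_span n f A \<Longrightarrow> i < n \<Longrightarrow> e i * x \<in> f_span n f A"
proof (induction rule: f_span.induct)
  case (f_span_word ws)
  note S = subsp_f_span[OF ann_subsp, of n f]
  show ?case using f_span_word
  proof (induction ws)
    case Nil
    then show ?case using ann_e f_span_mem by simp
  next
    case (Cons j ws)
    let ?h = "if i = j then if i + 1 < n then H i - H (i + 1) else H (n - 2) + H (n - 1) else 0"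
    have h: "?h * fword f ws \<in> f_span n f A"
      using f_span_H[OF f_span.f_span_word] Cons.prems subsp_diff[OF S] subsp_add[OF S] subsp_zero[OF S] n
      by (auto simp: left_diff_distrib distrib_right)
    have "e i * (f j * fword f ws) = ((e i * f j - f j * e i - ?h) * fword f ws + ?h * fword f ws) + f j * (e i * fword f ws)"
      by (simp only: algebra_simps)
    also have "\<dots> \<in> f_span n f A"
      using f_span_add[OF f_span_add[OF f_span_mem[OF ann_ef[of i j ws]] h] f_span_f[of "e i * fword f ws" j]] Cons
      by auto
    finally show ?case by simp
  qed
qed (auto simp: distrib_left sc_left[of "e i"] intro: f_span.intros ann_mult)

lemma gen_closed_f_span: "gen_closed n e f H (f_span n f A)"
  by (auto simp: gen_closed_def subsp_f_span ann_subsp f_span_e f_span_f f_span_H)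

end

text \<open>A product of shifted grading elements: modulo the annihilator it multiplies a word of
  length \<open>k\<close> in the \<open>f i\<close> by the product of the \<open>l - k\<close> over
  \<open>l\<close> in \<open>L\<close>, so it removes the lengths listed in
  \<open>L\<close>.\<close>

definition level :: "nat \<Rightarrow> (nat \<Rightarrow> 'a) \<Rightarrow> (nat \<Rightarrow> rat) \<Rightarrow> nat list \<Rightarrow> 'a" where
  "level n H \<mu> L = prod_list (map (\<lambda>l. (\<Sum>k<n. sc (of_nat (n - 1 - k)) * H k) - sc (height n \<mu> - of_nat l)) L)"

lemma level_closed:
  assumes "subsp B" "\<And>i x. i < n \<Longrightarrow> x \<in> B \<Longrightarrow> H i * x \<in> B" "x \<in> B"
  shows "level n H \<mu> L * x \<in> B"
proof (induction L)
  case (Cons l L)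
  let ?y = "level n H \<mu> L * x"
  have "(\<Sum>k<n. sc (of_nat (n - 1 - k)) * (H k * ?y)) - sc (height n \<mu> - of_nat l) * ?y \<in> B"
    using Cons assms by (intro subsp_diff[OF assms(1)] subsp_sum[OF assms(1)] subsp_sc[OF assms(1)]) auto
  then show ?case by (simp add: level_def left_diff_distrib sum_distrib_right mult.assoc)
qed (simp add: level_def assms)

lemma level_fword:
  assumes ann: "hw_annihilator n e f H \<mu> A" and n: "2 \<le> n" and ws: "set ws \<subseteq> {..<n}"
  shows "level n H \<mu> L * fword f ws - sc (\<Prod>l\<leftarrow>L. of_nat l - of_nat (length ws)) * fword f ws \<in> A"
proof (induction L)
  case Nil
  then show ?case using subsp_zero[OF ann_subsp[OF ann n]] by (simp add: level_def)
next
  case (Cons l L)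
  note S = ann_subsp[OF ann n]
  define R where "R = (\<Sum>k<n. sc (of_nat (n - 1 - k)) * H k)"
  define h where "h = height n \<mu> - of_nat l"
  define c :: rat where "c = (\<Prod>l\<leftarrow>L. of_nat l - of_nat (length ws))"
  define y where "y = level n H \<mu> L * fword f ws - sc c * fword f ws"
  have y: "y \<in> A" using Cons by (simp add: y_def c_def)
  have R: "R * fword f ws - sc (height n \<mu> - of_nat (length ws)) * fword f ws \<in> A"
  proof -
    have "(\<Sum>k<n. sc (of_nat (n - 1 - k)) * (H k * fword f ws - sc (\<mu> k - asum n ws k) * fword f ws)) \<in> A"
      using H_fword[OF ann n _ ws] by (intro subsp_sum[OF S] subsp_sc[OF S]) auto
    also have "(\<Sum>k<n. sc (of_nat (n - 1 - k)) * (H k * fword f ws - sc (\<mu> k - asum n ws k) * fword f ws)) =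
        R * fword f ws - sc (\<Sum>k<n. of_nat (n - 1 - k) * (\<mu> k - asum n ws k)) * fword f ws"
      unfolding R_def sc_sum sum_distrib_right sum_subtractf[symmetric]
      by (intro sum.cong refl) (simp only: right_diff_distrib sc_sc mult.assoc)
    also have "(\<Sum>k<n. of_nat (n - 1 - k) * (\<mu> k - asum n ws k)) = height n \<mu> - height n (asum n ws)"
      by (simp add: height_def right_diff_distrib sum_subtractf)
    finally show ?thesis using height_asum[OF ws n] by simp
  qed
  have "level n H \<mu> [l] * y \<in> A"
    by (rule level_closed[OF S ann_mult(3)[OF ann n] y])
  then have Ry: "(R - sc h) * y \<in> A" by (simp add: level_def R_def h_def)
  define k where "k = height n \<mu> - of_nat (length ws)"
  have "(R - sc h) * y + sc c * (R * fword f ws - sc k * fword f ws) \<in> A"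
    using R Ry by (intro subsp_add[OF S] subsp_sc[OF S]) (simp_all add: k_def)
  moreover have "(R - sc h) * y + sc c * (R * fword f ws - sc k * fword f ws)
      = (R - sc h) * (level n H \<mu> L * fword f ws) - sc ((of_nat l - of_nat (length ws)) * c) * fword f ws"
  proof -
    have "(R - sc h) * (sc c * fword f ws) = sc c * (R * fword f ws) - sc (h * c) * fword f ws"
      by (simp add: left_diff_distrib sc_left[of R] sc_sc)
    moreover have "(of_nat l - of_nat (length ws)) * c = c * k - h * c"
      by (simp add: h_def k_def algebra_simps)
    ultimately show ?thesis
      by (simp only: y_def right_diff_distrib[of _ _ "sc c * fword f ws"] right_diff_distrib[of "sc c"] sc_sc sc_diff left_diff_distrib[of "sc _" "sc _"]) simp
  qed
  ultimately show ?case by (simp add: level_def R_def h_def c_def mult.assoc)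
qed

text \<open>Provides a smallest admissible annihilator; a congruence modulo it holds modulo all
  others.\<close>

lemma hw_annihilator_INT:
  assumes "\<And>A. A \<in> \<A> \<Longrightarrow> hw_annihilator n e f H \<mu> A"
  shows "hw_annihilator n e f H \<mu> (\<Inter>\<A>)"
proof -
  have "subsp (\<Inter>\<A>)"
    using assms unfolding hw_annihilator_def gen_closed_def subsp_def by blast
  then show ?thesis
    using assms unfolding hw_annihilator_def gen_closed_def by blast
qed

text \<open>Modulo the annihilator \<open>A\<close> of a highest weight vector, \<open>p\<close> is a combination of words in
  the \<open>f\<^sub>i\<close>; the factor \<open>z\<close> removes the nonempty words.  Since \<open>z\<close> and \<open>s\<close> do not depend on \<open>A\<close>,
  this compares the action of \<open>p\<close> on different modules.\<close>

lemma highest_component: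
  assumes n: "2 \<le> n" and p: "\<And>D. 1 \<in> D \<Longrightarrow> gen_closed n e f H D \<Longrightarrow> p \<in> D"
  obtains z s N where "N \<noteq> 0"
    "\<And>B x. subsp B \<Longrightarrow> (\<And>i x. i < n \<Longrightarrow> x \<in> B \<Longrightarrow> H i * x \<in> B) \<Longrightarrow> x \<in> B \<Longrightarrow> z * x \<in> B"
    "\<And>A. hw_annihilator n e f H \<mu> A \<Longrightarrow> z - sc N \<in> A \<and> z * p - sc s \<in> A"
proof -
  define A where "A = \<Inter>{A. hw_annihilator n e f H \<mu> A}"
  have ann: "hw_annihilator n e f H \<mu> A" unfolding A_def by (rule hw_annihilator_INT) simp
  note S = ann_subsp[OF ann n]
  define Z where "Z m = level n H \<mu> [1..<Suc m]" for m
  define N :: "nat \<Rightarrow> rat" where "N m = (\<Prod>l\<leftarrow>[1..<Suc m]. of_nat l)" for m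
  have Z: "Z m * x \<in> B" if "subsp B" "\<And>i x. i < n \<Longrightarrow> x \<in> B \<Longrightarrow> H i * x \<in> B" "x \<in> B" for m B x
    unfolding Z_def by (rule level_closed[OF that])
  have ZA: "Z m * x \<in> A" if "x \<in> A" for m x using Z[OF S ann_mult(3)[OF ann n] that] .
  have "1 \<in> f_span n f A" using f_span_word[of "[]" n f A] by simp
  then have "p \<in> f_span n f A" using p gen_closed_f_span[OF ann n] by blast
  \<comment> \<open>Modulo \<open>A\<close>, \<open>Z m\<close> removes the nonempty words of length
    at most \<open>m\<close> and multiplies the empty word by \<open>N m\<close>, the factorial of
    \<open>m\<close>. Asking this for all large \<open>m\<close> makes the claim additive in
    \<open>p\<close>.\<close>
  then have "\<exists>s L. \<forall>m\<ge>L. Z m * p - sc (s * N m) \<in> A"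
  proof (induction rule: f_span.induct)
    case (f_span_mem x)
    then show ?case using ZA by (intro exI[of _ 0]) simp
  next
    case (f_span_word ws)
    show ?case
    proof (cases "ws = []")
      case True
      then show ?thesis
        using level_fword[OF ann n f_span_word] by (intro exI[of _ 1] exI[of _ 0]) (simp add: Z_def N_def)
    next
      case False
      have "Z m * fword f ws \<in> A" if "length ws \<le> m" for m
      proof -
        have "length ws \<in> set [1..<Suc m]" using that False by (cases ws) auto
        then have "(\<Prod>l\<leftarrow>[1..<Suc m]. (of_nat l - of_nat (length ws) :: rat)) = 0"
          by (force simp: prod_list_zero_iff simp del: upt_Suc)
        then show ?thesis using level_fword[OF ann n f_span_word, of "[1..<Suc m]"] unfolding Z_def
          by (simp del: prod_list_zero_iff upt_Suc)
      qed
      then show ?thesis by (intro exI[of _ 0] exI[of _ "length ws"]) auto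
    qed
  next
    case (f_span_add x y)
    then obtain s L t K where "\<forall>m\<ge>L. Z m * x - sc (s * N m) \<in> A" "\<forall>m\<ge>K. Z m * y - sc (t * N m) \<in> A"
      by auto
    then have "\<forall>m\<ge>max L K. (Z m * x - sc (s * N m)) + (Z m * y - sc (t * N m)) \<in> A"
      using subsp_add[OF S] by auto
    then show ?case
      by (intro exI[of _ "s + t"] exI[of _ "max L K"]) (simp add: distrib_left distrib_right sc_add algebra_simps)
  next
    case (f_span_sc x c)
    then obtain s L where "\<forall>m\<ge>L. Z m * x - sc (s * N m) \<in> A" by auto
    then have "\<forall>m\<ge>L. sc c * (Z m * x - sc (s * N m)) \<in> A" using subsp_sc[OF S] by auto
    then show ?case
      by (intro exI[of _ "c * s"] exI[of _ L]) (simp add: right_diff_distrib sc_left[of "Z _"] sc_mult mult.assoc)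
  qed
  then obtain s L where sL: "Z L * p - sc (s * N L) \<in> A" by blast
  have "Z L - sc (N L) \<in> A"
    using level_fword[OF ann n, of "[]" "[1..<Suc L]"] by (simp add: Z_def N_def del: upt_Suc)
  moreover have "N L \<noteq> 0" by (auto simp: N_def prod_list_zero_iff simp del: upt_Suc)
  moreover have "A \<subseteq> B" if "hw_annihilator n e f H \<mu> B" for B using that by (auto simp: A_def)
  ultimately show ?thesis using sL Z by (intro that[of "N L" "Z L" "s * N L"]) blast+
qed

end

context schur_presentation
begin

lemma highest_annihilator:
  assumes "highest \<nu> v" shows "hw_annihilator n e f H \<nu> {x. x * v = 0}"
  unfolding hw_annihilator_def gen_closed_def
proof (intro conjI allI impI ballI)
  show "subsp {x. x * v = 0}" by (intro subspI) (auto simp: distrib_right mult.assoc)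
  fix i j ws assume ij: "i < n" "j < n"
  show "(e i * f j - f j * e i - (if i = j then if i + 1 < n then H i - H (i + 1) else H (n - 2) + H (n - 1) else 0))
        * fword f ws \<in> {x. x * v = 0}"
    using D2[OF ij] by (simp add: mult.assoc)
  show "(H i * f j - f j * H i + sc (rootc n j i) * f j) * fword f ws \<in> {x. x * v = 0}"
    using D3f[OF ij] by (simp add: mult.assoc)
qed (use assms in \<open>auto simp: highest_def wt_def mult.assoc left_diff_distrib\<close>)

lemma mem_f_span:
  assumes "hw_annihilator n e f H \<nu> A" shows "x \<in> f_span n f A"
proof (rule generated)
  show "1 \<in> f_span n f A" using f_span_word[of "[]" n f A] by simp
qed (use gen_closed_f_span[OF assms n2] in \<open>auto simp: gen_closed_def\<close>)

text \<open>A longest word in the \<open>e i\<close> that does not kill \<open>u\<close> leads to a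
  vector killed by all \<open>e i\<close>; some weight component of it is nonzero.\<close>

lemma exists_highest:
  assumes "u \<noteq> 0" shows "\<exists>b \<nu>. highest \<nu> (b * u)"
proof -
  define P where "P l \<longleftrightarrow> (\<exists>ws. set ws \<subseteq> {..<n} \<and> length ws = l \<and> ew ws * u \<noteq> 0)" for l
  have b: "l \<le> 2 * (n * (n * r))" if "P l" for l
    using that e_word_nilpotent[of _ u] unfolding P_def by (auto intro: leI)
  define l where "l = (GREATEST l. P l)"
  have "P 0" using assms by (auto simp: P_def)
  then have l: "P l" "\<And>k. P k \<Longrightarrow> k \<le> l"
    unfolding l_def using GreatestI_nat[of P 0, OF _ b] Greatest_le_nat[of P, OF _ b] by auto
  then obtain ws where ws: "set ws \<subseteq> {..<n}" "length ws = l" "ew ws * u \<noteq> 0" unfolding P_def by blast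
  have top: "e i * (ew ws * u) = 0" if "i < n" for i
  proof (rule ccontr)
    assume "e i * (ew ws * u) \<noteq> 0"
    then have "P (Suc l)" unfolding P_def using ws that by (intro exI[of _ "i # ws"]) (simp add: mult.assoc)
    then show False using l(2) by fastforce
  qed
  \<comment> \<open>Weight components of the top vector must remain multiples of \<open>u\<close>
    killed by all \<open>e i\<close>, so the decomposition is made in \<open>?C\<close>.\<close>
  let ?C = "{x. (\<exists>b. x = b * u) \<and> (\<forall>i<n. e i * x = 0)}"
  let ?D = "{x. x = 0 \<or> (\<exists>b \<nu>. highest \<nu> (b * u))}"
  have "ew ws * u \<in> ?D"
  proof (rule wt_induct[of ?C])
    show "subsp ?C"
    proof (rule subspI)
      show "x + y \<in> ?C" if "x \<in> ?C" "y \<in> ?C" for x y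
        using that by (auto simp: distrib_left) (metis distrib_right)
      show "sc c * x \<in> ?C" if "x \<in> ?C" for c x
        using that by (auto simp: sc_left[of "e _"]) (metis mult.assoc)
    qed (auto intro: exI[of _ 0])
    show "H j * y \<in> ?C" if j: "j < n" and y: "y \<in> ?C" for j y
    proof -
      have "e i * (H j * y) = 0" if i: "i < n" for i
      proof -
        have "e i * H j = H j * e i - sc (rootc n i j) * e i" using D3e[OF j i] by (simp add: algebra_simps)
        then have "e i * (H j * y) = H j * (e i * y) - sc (rootc n i j) * (e i * y)"
          by (simp only: mult.assoc[symmetric] left_diff_distrib)
        then show ?thesis using y i by simp
      qed
      moreover obtain b where "y = b * u" using y by auto
      then have "H j * y = (H j * b) * u" by (simp add: mult.assoc)
      ultimately show ?thesis by blast
    qed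
    show "ew ws * u \<in> ?C" using top by auto
    show "y \<in> ?D" if "y \<in> ?C" "wt \<nu> y" for \<nu> y
      using that unfolding highest_def by blast
  qed auto
  then show ?thesis using ws(3) by auto
qed

lemma projection_other_weight:
  assumes z: "wt \<mu> z" "\<And>y. (\<forall>i<n. H i * y = y * H i) \<Longrightarrow> z * y = y * z"
    and x: "wt \<kappa> x" "k < n" "\<kappa> k \<noteq> \<mu> k"
  shows "z * x = 0"
proof -
  have "sc (\<mu> k) * (z * x) = (H k * z) * x" using z(1) x(2) by (simp add: wt_def mult.assoc)
  also have "H k * z = z * H k" using z(2)[of "H k"] D1 x(2) by simp
  also have "z * H k * x = sc (\<kappa> k) * (z * x)" using x by (simp add: wt_def mult.assoc sc_left[of z])
  finally show ?thesis using sc_eq_cancel x(3) by metis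
qed

text \<open>A highest weight vector in \<open>'a * v\<close> has the same Casimir eigenvalue as \<open>v\<close>, hence the same
  weight, hence is a multiple of \<open>v\<close>.\<close>

theorem highest_simple:
  assumes v: "highest \<nu> v" and y: "y * v \<noteq> 0"
  shows "\<exists>b. b * (y * v) = v"
proof -
  obtain b \<mu> where x: "highest \<mu> (b * (y * v))" using exists_highest[OF y] by blast
  define x where "x = b * (y * v)"
  note ann = highest_annihilator[OF v]
  have wv: "wt \<nu> v" using v by (simp add: highest_def)
  have wx: "wt \<mu> x" "x \<noteq> 0" using x by (simp_all add: highest_def x_def)
  obtain z where z: "wt \<mu> z" "\<And>y. (\<forall>i<n. H i * y = y * H i) \<Longrightarrow> z * y = y * z"
    "\<And>x. wt \<mu> x \<Longrightarrow> z * x = x" using weight_projection[of \<mu>] by auto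
  have c: "cas n \<nu> = cas n \<mu>"
  proof (rule ccontr)
    assume "cas n \<nu> \<noteq> cas n \<mu>"
    then show False
      using highest_casimir[OF x] highest_casimir_left[OF v, of "b * y"] sc_eq_cancel[of "cas n \<nu>" x "cas n \<mu>"] wx(2)
      by (simp add: x_def mult.assoc)
  qed
  have fsp: "b * y \<in> f_span n f {x. x * v = 0}" using mem_f_span[OF ann] .
  \<comment> \<open>Otherwise \<mu> differs from the weight of every word in the \<open>f i\<close>
    applied to \<open>v\<close>, and the projection \<open>z\<close> would kill
    \<open>x\<close>.\<close>
  have "\<exists>ws. set ws \<subseteq> {..<n} \<and> (\<forall>k<n. \<nu> k = \<mu> k + asum n ws k)"
  proof (rule ccontr)
    assume no: "\<not> ?thesis"
    have "q \<in> f_span n f {x. x * v = 0} \<Longrightarrow> z * (q * v) = 0" for q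
    proof (induction rule: f_span.induct)
      case (f_span_word ws)
      then obtain k where "k < n" "\<nu> k - asum n ws k \<noteq> \<mu> k" using no by fastforce
      then show ?case
        using projection_other_weight[OF z(1,2) wt_fw[OF wv f_span_word]] by (simp add: fword_def fw_def)
    qed (auto simp: distrib_left distrib_right mult.assoc sc_left[of z])
    from this[OF fsp] show False using z(3)[OF wx(1)] wx(2) by (simp add: x_def mult.assoc)
  qed
  then obtain ws where ws: "set ws \<subseteq> {..<n}" "\<And>k. k < n \<Longrightarrow> \<nu> k = \<mu> k + asum n ws k" by auto
  have "ws = []" using cas_strict[OF highest_dominant[OF v] highest_dominant[OF x] ws(2,1) n2 c] by simp
  then have same: "\<And>k. k < n \<Longrightarrow> \<nu> k = \<mu> k" using ws by simp
  \<comment> \<open>Now \<open>z\<close> projects to the weight of \<open>v\<close> itself, to which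
    only the empty word contributes; so \<open>x\<close> is a scalar multiple of
    \<open>v\<close>.\<close>
  have "q \<in> f_span n f {x. x * v = 0} \<Longrightarrow> \<exists>s. z * (q * v) = sc s * v" for q
  proof (induction rule: f_span.induct)
    case (f_span_mem x)
    then show ?case by (intro exI[of _ 0]) simp
  next
    case (f_span_word ws)
    show ?case
    proof (cases "ws = []")
      case True
      then show ?thesis using z(3)[OF wt_cong[OF wv same]] by (intro exI[of _ 1]) simp
    next
      case False
      have "\<exists>k<n. asum n ws k \<noteq> 0"
      proof (rule ccontr)
        assume "\<not> ?thesis"
        then have "height n (asum n ws) = 0" by (simp add: height_def)
        then show False using height_asum[OF f_span_word n2] False by simp
      qed
      then obtain k where "k < n" "\<nu> k - asum n ws k \<noteq> \<mu> k" using same by force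
      then have "z * (fword f ws * v) = 0"
        using projection_other_weight[OF z(1,2) wt_fw[OF wv f_span_word]] by (simp add: fword_def fw_def)
      then show ?thesis by (intro exI[of _ 0]) simp
    qed
  next
    case (f_span_add x y)
    then obtain s t where "z * (x * v) = sc s * v" "z * (y * v) = sc t * v" by auto
    then show ?case by (intro exI[of _ "s + t"]) (simp add: distrib_left distrib_right sc_add)
  next
    case (f_span_sc x c)
    then obtain s where "z * (x * v) = sc s * v" by auto
    then show ?case by (intro exI[of _ "c * s"]) (simp add: mult.assoc sc_left[of z] sc_mult)
  qed
  from this[OF fsp] obtain s where s: "x = sc s * v"
    using z(3)[OF wx(1)] by (auto simp: x_def mult.assoc)
  then have "s \<noteq> 0" using wx(2) by auto
  have "(sc (inverse s) * b) * (y * v) = sc (inverse s) * x" by (simp add: x_def mult.assoc)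
  also have "\<dots> = v" using \<open>s \<noteq> 0\<close> by (simp add: s sc_sc)
  finally show ?thesis by blast
qed

end

section \<open>The action on tensors\<close>

abbreviation gens_alg :: "nat \<Rightarrow> (rat, free_elem) module" where
  "gens_alg n \<equiv> free_algebra (chevalley_gens n)"

definition pres_rels :: "nat \<Rightarrow> nat \<Rightarrow> free_elem set" where
  "pres_rels n r = rels_D1 n \<union> rels_D2 n \<union> rels_D3 n \<union> rels_D4 n \<union> rels_D5 n \<union> rels_D6 n r \<union> rels_D7 n r"

definition pres_ideal :: "nat \<Rightarrow> nat \<Rightarrow> free_elem set" where
  "pres_ideal n r = Idl\<^bsub>gens_alg n\<^esub> (pres_rels n r)"

section \<open>The free algebra on the Chevalley generators and the ideal of relations\<close>

lemma fa_closed: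
  assumes "p \<in> carrier (free_algebra S)" "q \<in> carrier (free_algebra S)"
  shows "p + q \<in> carrier (free_algebra S)" "p * q \<in> carrier (free_algebra S)"
    "- p \<in> carrier (free_algebra S)" "p - q \<in> carrier (free_algebra S)"
proof -
  interpret ring "free_algebra S" by (rule ring_free_algebra)
  show "p + q \<in> carrier (free_algebra S)" "p * q \<in> carrier (free_algebra S)"
    using a_closed[OF assms] m_closed[OF assms] by (simp_all add: free_algebra_ops)
  have n: "- q \<in> carrier (free_algebra S)" if "q \<in> carrier (free_algebra S)" for q
    using that by (simp add: free_algebra_def)
  show "- p \<in> carrier (free_algebra S)" by (rule n[OF assms(1)])
  show "p - q \<in> carrier (free_algebra S)"
    using a_closed[OF assms(1) n[OF assms(2)]] by (simp add: free_algebra_ops)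
qed

lemma fa_zero_one: "0 \<in> carrier (free_algebra S)" "1 \<in> carrier (free_algebra S)"
proof -
  interpret ring "free_algebra S" by (rule ring_free_algebra)
  show "0 \<in> carrier (free_algebra S)" "1 \<in> carrier (free_algebra S)"
    using zero_closed one_closed by (simp_all add: free_algebra_ops)
qed

lemma const_add: "const (a + b) = const a + const b"
  by (simp add: const_def single_add)

lemma const_mult: "const (a * b) = const a * const b"
  by (simp add: const_def mult_single)

lemma const_one: "const 1 = 1"
  by (simp add: const_def)

lemma const_commute: "const c * p = p * const c" for p :: "'a free_monoid \<Rightarrow>\<^sub>0 rat"
proof (induction p rule: poly_mapping_add_induct)
  case (2 W d)
  then show ?case by (simp add: const_def mult_single mult.commute)
qed (simp_all add: distrib_left distrib_right)

interpretation free_scalars: rat_scalars "const :: rat \<Rightarrow> 'a free_monoid \<Rightarrow>\<^sub>0 rat"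
  by unfold_locales (rule const_add const_mult const_one const_commute)+

lemma of_int_const: "of_int k = (const (of_int k) :: 'a free_monoid \<Rightarrow>\<^sub>0 rat)"
  by (simp add: free_scalars.sc_of_int)

lemma of_nat_const: "of_nat k = (const (of_nat k) :: 'a free_monoid \<Rightarrow>\<^sub>0 rat)"
  by (simp add: free_scalars.sc_of_nat)

lemma fa_of_int: "of_int k \<in> carrier (free_algebra S)"
  unfolding of_int_const by (rule const_carrier)

lemma fa_sum: "(\<And>i. i \<in> I \<Longrightarrow> g i \<in> carrier (free_algebra S)) \<Longrightarrow> (\<Sum>i\<in>I. g i) \<in> carrier (free_algebra S)"
  by (induction I rule: infinite_finite_induct) (auto intro: fa_closed fa_zero_one)

lemma fa_prod_list: "(\<And>x. x \<in> set L \<Longrightarrow> x \<in> carrier (free_algebra S)) \<Longrightarrow> prod_list L \<in> carrier (free_algebra S)"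
  by (induction L) (auto intro: fa_closed fa_zero_one)

lemma fa_power: "x \<in> carrier (free_algebra S) \<Longrightarrow> x ^ k \<in> carrier (free_algebra S)"
  by (induction k) (auto intro: fa_closed fa_zero_one)

lemma gens_carrier:
  "i < n \<Longrightarrow> ge i \<in> carrier (gens_alg n)" "i < n \<Longrightarrow> gf i \<in> carrier (gens_alg n)"
  "i < n \<Longrightarrow> gH i \<in> carrier (gens_alg n)"
  by (auto intro!: var_carrier simp: chevalley_gens_def)

lemma serre_carrier:
  assumes "\<And>i. i < n \<Longrightarrow> x i \<in> carrier (gens_alg n)" "i < n" "j < n"
  shows "serre n x i j \<in> carrier (gens_alg n)"
proof -
  have s: "(-1) ^ s * of_nat k = (of_int ((-1) ^ s * int k) :: free_elem)" for s k by simp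
  show ?thesis
    unfolding serre_def Let_def s
    by (intro fa_sum fa_closed fa_of_int fa_power assms)
qed

lemma pres_rels_carrier:
  assumes "2 \<le> n" shows "pres_rels n r \<subseteq> carrier (gens_alg n)"
proof -
  note c = fa_closed gens_carrier const_carrier fa_zero_one fa_of_int
  have "rels_D1 n \<subseteq> carrier (gens_alg n)" "rels_D2 n \<subseteq> carrier (gens_alg n)" "rels_D3 n \<subseteq> carrier (gens_alg n)"
    using assms by (auto simp: rels_D1_def rels_D2_def rels_D3_def intro!: c)
  moreover have "rels_D4 n \<subseteq> carrier (gens_alg n)" "rels_D5 n \<subseteq> carrier (gens_alg n)"
    by (auto simp: rels_D4_def rels_D5_def intro!: serre_carrier c)
  moreover have "rels_D6 n r \<subseteq> carrier (gens_alg n)"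
    unfolding rels_D6_def by (auto intro!: fa_prod_list c simp del: upt_Suc of_int_diff)
  moreover have "rels_D7 n r \<subseteq> carrier (gens_alg n)"
    unfolding rels_D7_def by (auto intro!: fa_prod_list fa_sum c simp del: upt_Suc of_int_diff)
  ultimately show ?thesis by (simp add: pres_rels_def)
qed

lemma pres_ideal_ideal: "2 \<le> n \<Longrightarrow> ideal (pres_ideal n r) (gens_alg n)"
  unfolding pres_ideal_def by (rule ring.genideal_ideal[OF ring_free_algebra pres_rels_carrier])

lemma single_Word: "Poly_Mapping.single (Word (x # ws)) c = var x * Poly_Mapping.single (Word ws) c"
  by (simp add: var_def mult_single plus_free_monoid_def)

lemma sum_single: "p = (\<Sum>w\<in>Poly_Mapping.keys p. Poly_Mapping.single w (Poly_Mapping.lookup p w))"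
  by (rule poly_mapping_eqI) (simp add: lookup_sum lookup_single when_def in_keys_iff)

lemma free_algebra_induct:
  assumes p: "p \<in> carrier (free_algebra S)"
    and D: "1 \<in> D" "free_scalars.subsp D" "\<And>g x. g \<in> S \<Longrightarrow> x \<in> D \<Longrightarrow> var g * x \<in> D"
  shows "p \<in> D"
proof -
  have "Poly_Mapping.single (Word ws) c \<in> D" if "set ws \<subseteq> S" for ws c
    using that
  proof (induction ws)
    case Nil
    then show ?case using free_scalars.subsp_sc[OF D(2,1), of c] by (simp add: const_def zero_free_monoid_def)
  qed (use D(3) in \<open>auto simp: single_Word\<close>)
  then have "Poly_Mapping.single w (Poly_Mapping.lookup p w) \<in> D" if "w \<in> Poly_Mapping.keys p" for w
    using p that by (cases w) (auto simp: free_algebra_def)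
  then show ?thesis by (subst sum_single) (intro free_scalars.subsp_sum[OF D(2)])
qed

lemma gen_closed_carrier:
  assumes p: "p \<in> carrier (gens_alg n)" and D: "1 \<in> D" "free_scalars.gen_closed n ge gf gH D"
  shows "p \<in> D"
  using p D(1)
  by (rule free_algebra_induct) (use D(2) in \<open>auto simp: free_scalars.gen_closed_def chevalley_gens_def\<close>)

section \<open>Substitution of matrices for generators, and the action on tensors\<close>

definition MT :: "nat \<Rightarrow> fmat \<Rightarrow> rat mat" where
  "MT n X = mat (2 * n) (2 * n) (\<lambda>(i, j). X i j)"

lemma MT_carrier: "MT n X \<in> carrier_mat (2 * n) (2 * n)"
  by (simp add: MT_def)

lemma MT_ops:
  "MT n (fadd X Y) = MT n X + MT n Y" "MT n (fscale c X) = c \<cdot>\<^sub>m MT n X"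
  "MT n (fbr (2 * n) X Y) = MT n X * MT n Y - MT n Y * MT n X"
  by (auto intro!: eq_matI simp: MT_def fadd_def fscale_def fbr_def fmul_def scalar_prod_def lessThan_atLeast0)

definition TA :: "nat \<Rightarrow> nat \<Rightarrow> fmat \<Rightarrow> (nat list \<Rightarrow> rat) \<Rightarrow> nat list \<Rightarrow> rat" where
  "TA n r X = tensor_act n r (MT n X)"

lemma TA_add: "TA n r (fadd X Y) t = (\<lambda>w. TA n r X t w + TA n r Y t w)"
  by (simp add: TA_def MT_ops tensor_act_add[OF MT_carrier MT_carrier])

lemma TA_scale: "TA n r (fscale c X) t = (\<lambda>w. c * TA n r X t w)"
  by (simp add: TA_def MT_ops tensor_act_scale[OF MT_carrier])

lemma TA_br: "TA n r (fbr (2 * n) X Y) t = (\<lambda>w. TA n r X (TA n r Y t) w - TA n r Y (TA n r X t) w)"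
  using tensor_act_commutator[OF MT_carrier MT_carrier] by (simp add: TA_def MT_ops fun_eq_iff)

lemma TA_zero: "TA n r fzero t = (\<lambda>_. 0)"
  using TA_scale[of n r 0 fzero t] by (simp add: fscale_zero)

lemma tensor_index_nth: "w \<in> tensor_index n r \<Longrightarrow> k < r \<Longrightarrow> w ! k < 2 * n"
  unfolding tensor_index_def using nth_mem by fastforce

lemma TA_eq:
  assumes "w \<in> tensor_index n r"
  shows "TA n r X t w = (\<Sum>k<r. \<Sum>j<2 * n. X (w ! k) j * t (w[k := j]))"
  using assms tensor_index_nth[OF assms] by (simp add: TA_def tensor_act_def MT_def)

text \<open>Generators with index at least \<open>n\<close> go to the zero matrix, so that
  \<open>subst_mat\<close> sends every element into \<open>so_alg n\<close>, whatever generators it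
  involves.\<close>

definition gen_fmat :: "nat \<Rightarrow> chevalley_gen \<Rightarrow> fmat" where
  "gen_fmat n g = (case g of Gen_e i \<Rightarrow> if i < n then emat n i else fzero
    | Gen_f i \<Rightarrow> if i < n then fmatr n i else fzero | Gen_H i \<Rightarrow> if i < n then hmat n i else fzero)"

text \<open>Letterwise substitution: the algebra homomorphism that relates the presentation to the
  enveloping algebra.\<close>

definition subst_mat :: "nat \<Rightarrow> free_elem \<Rightarrow> (rat mat free_monoid \<Rightarrow>\<^sub>0 rat)" where
  "subst_mat n p = (\<Sum>w\<in>Poly_Mapping.keys p.
     Poly_Mapping.single (Word (map (\<lambda>g. MT n (gen_fmat n g)) (letters w))) (Poly_Mapping.lookup p w))"

lemma subst_mat_superset:
  assumes "finite K" "Poly_Mapping.keys p \<subseteq> K"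
  shows "subst_mat n p = (\<Sum>w\<in>K.
     Poly_Mapping.single (Word (map (\<lambda>g. MT n (gen_fmat n g)) (letters w))) (Poly_Mapping.lookup p w))"
  unfolding subst_mat_def
  by (intro sum.mono_neutral_left) (use assms in \<open>auto simp: in_keys_iff\<close>)

lemma subst_mat_add: "subst_mat n (p + q) = subst_mat n p + subst_mat n q"
  using keys_add[of p q]
  by (simp add: subst_mat_superset[of "Poly_Mapping.keys p \<union> Poly_Mapping.keys q"]
      lookup_add single_add sum.distrib)

lemma subst_mat_single: "subst_mat n (Poly_Mapping.single w c) =
    Poly_Mapping.single (Word (map (\<lambda>g. MT n (gen_fmat n g)) (letters w))) c"
  using subst_mat_superset[of "{w}" "Poly_Mapping.single w c" n] by auto

lemma subst_mat_zero: "subst_mat n 0 = 0"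
  by (simp add: subst_mat_def)

lemma subst_mat_mult: "subst_mat n (p * q) = subst_mat n p * subst_mat n q"
proof (induction p rule: poly_mapping_add_induct)
  case (2 W c)
  show ?case
  proof (induction q rule: poly_mapping_add_induct)
    case (2 V d)
    show ?case unfolding mult_single subst_mat_single plus_free_monoid_def by simp
  qed (simp_all add: subst_mat_zero subst_mat_add distrib_left)
qed (simp_all add: subst_mat_zero subst_mat_add distrib_right)

lemma subst_mat_const: "subst_mat n (const c) = const c"
  by (simp add: const_def subst_mat_single zero_free_monoid_def)

lemma subst_mat_one: "subst_mat n 1 = 1"
  using subst_mat_const[of n 1] by (simp add: const_one)

lemma subst_mat_var: "subst_mat n (var g) = var (MT n (gen_fmat n g))"
  by (simp add: var_def subst_mat_single)

lemma subst_mat_uminus: "subst_mat n (- p) = - subst_mat n p"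
  using subst_mat_add[of n p "- p"] by (simp add: subst_mat_zero eq_neg_iff_add_eq_0 add.commute)

lemma subst_mat_diff: "subst_mat n (p - q) = subst_mat n p - subst_mat n q"
  using subst_mat_add[of n p "- q"] by (simp add: subst_mat_uminus)

definition tact :: "nat \<Rightarrow> nat \<Rightarrow> free_elem \<Rightarrow> (nat list \<Rightarrow> rat) \<Rightarrow> nat list \<Rightarrow> rat" where
  "tact n r p = free_tensor_act n r (subst_mat n p)"

lemma tact_add: "tact n r (p + q) t = (\<lambda>w. tact n r p t w + tact n r q t w)"
  and tact_diff: "tact n r (p - q) t = (\<lambda>w. tact n r p t w - tact n r q t w)"
  and tact_uminus: "tact n r (- p) t = (\<lambda>w. - tact n r p t w)"
  and tact_mult: "tact n r (p * q) t = tact n r p (tact n r q t)"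
  and tact_const: "tact n r (const c) t = (\<lambda>w. c * t w)"
  and tact_one: "tact n r 1 t = t"
  and tact_zero: "tact n r 0 t = (\<lambda>_. 0)"
  and tact_zero_right: "tact n r p (\<lambda>_. 0) = (\<lambda>_. 0)"
  by (simp_all add: tact_def subst_mat_add subst_mat_diff subst_mat_uminus subst_mat_mult subst_mat_const
      subst_mat_one subst_mat_zero fta_add fta_diff fta_uminus fta_mult fta_const fta_one fta_zero
      fta_zero_right)

lemma tact_closed: "t \<in> tensors n r \<Longrightarrow> tact n r p t \<in> tensors n r"
  by (simp add: tact_def fta_closed)

lemma tact_gens:
  "i < n \<Longrightarrow> tact n r (ge i) t = TA n r (emat n i) t"
  "i < n \<Longrightarrow> tact n r (gf i) t = TA n r (fmatr n i) t"
  "i < n \<Longrightarrow> tact n r (gH i) t = TA n r (hmat n i) t"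
  by (simp_all add: tact_def subst_mat_var fta_var gen_fmat_def TA_def)

text \<open>The weight of the basis tensor indexed by \<open>w\<close>: a letter \<open>i\<close>
  counts 1 and its partner \<open>i + n\<close> counts -1 in coordinate \<open>i\<close>.\<close>

definition word_wt :: "nat \<Rightarrow> nat list \<Rightarrow> nat \<Rightarrow> rat" where
  "word_wt n w i = (\<Sum>a\<leftarrow>w. dl a i - dl a (i + n))"

lemma TA_H:
  assumes "i < n" "w \<in> tensor_index n r"
  shows "TA n r (hmat n i) t w = word_wt n w i * t w"
proof -
  have "(\<Sum>j<2 * n. hmat n i (w ! k) j * t (w[k := j])) = (dl (w ! k) i - dl (w ! k) (i + n)) * t w" if k: "k < r" for k
  proof -
    have "hmat n i p j = dl j p * (dl p i - dl p (i + n))" for p j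
      using assms(1) by (auto simp: hmat_def Gm_def bar_def dl_def)
    then have "(\<Sum>j<2 * n. hmat n i (w ! k) j * t (w[k := j])) =
        (\<Sum>j<2 * n. dl j (w ! k) * ((dl (w ! k) i - dl (w ! k) (i + n)) * t (w[k := j])))"
      by (simp add: mult.assoc)
    also have "\<dots> = (dl (w ! k) i - dl (w ! k) (i + n)) * t (w[k := w ! k])"
      by (rule sum_dl[OF tensor_index_nth[OF assms(2) k]])
    finally show ?thesis by simp
  qed
  moreover have "length w = r" using assms(2) by (simp add: tensor_index_def)
  ultimately show ?thesis
    by (simp add: TA_eq[OF assms(2)] word_wt_def sum_distrib_right sum_list_sum_nth lessThan_atLeast0)
qed

lemma word_wt_Cons: "word_wt n (a # w) i = dl a i - dl a (i + n) + word_wt n w i"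
  by (simp add: word_wt_def)

lemma word_wt_range: "word_wt n w i \<in> set (wt_list (length w))"
proof (induction w)
  case (Cons a w)
  have "dl a i - dl a (i + n) \<in> \<int>" "\<bar>dl a i - dl a (i + n)\<bar> \<le> 1" by (auto simp: dl_def)
  then show ?case using Cons
    by (auto simp: word_wt_Cons wt_list_mem intro!: Ints_add abs_triangle_ineq[THEN order_trans] add_mono)
qed (simp add: word_wt_def wt_list_mem)

text \<open>Every letter adds 1 or -1 to the signed sum, and \<open>k\<close> counts the letters
  that add 1. This is the origin of (D7).\<close>

lemma word_wt_signed:
  fixes \<sigma> :: "nat \<Rightarrow> int"
  assumes "set w \<subseteq> {..<2 * n}" "\<forall>i<n. \<sigma> i \<in> {1, - 1}"
  shows "\<exists>k\<le>length w. (\<Sum>i<n. of_int (\<sigma> i) * word_wt n w i) = 2 * of_nat k - of_nat (length w)"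
  using assms(1)
proof (induction w)
  case (Cons a w)
  then obtain k where k: "k \<le> length w" "(\<Sum>i<n. of_int (\<sigma> i) * word_wt n w i) = 2 * of_nat k - of_nat (length w)"
    by auto
  define s where "s = (\<Sum>i<n. of_int (\<sigma> i) * (dl a i - dl a (i + n)) :: rat)"
  have "s = 1 \<or> s = -1"
  proof (cases "a < n")
    case True
    then have "s = (\<Sum>i<n. dl a i * of_int (\<sigma> i))" unfolding s_def by (intro sum.cong) (auto simp: dl_def)
    also have "\<dots> = of_int (\<sigma> a)" by (rule sum_dl'[OF True])
    finally show ?thesis using assms(2) True by auto
  next
    case False
    then have an: "a - n < n" using Cons.prems by auto
    have "s = (\<Sum>i<n. dl (a - n) i * - of_int (\<sigma> i))"
      unfolding s_def using False by (intro sum.cong) (auto simp: dl_def)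
    also have "\<dots> = - of_int (\<sigma> (a - n))" by (rule sum_dl'[OF an])
    finally show ?thesis using assms(2) an by auto
  qed
  moreover have "(\<Sum>i<n. of_int (\<sigma> i) * word_wt n (a # w) i) = s + (\<Sum>i<n. of_int (\<sigma> i) * word_wt n w i)"
    by (simp add: word_wt_Cons s_def distrib_left sum.distrib)
  ultimately show ?case using k
    by (auto intro: exI[of _ "Suc k"] exI[of _ k])
qed (simp add: word_wt_def)

lemma word_tensor_wt: "w \<in> tensor_index n r \<Longrightarrow> tensor_wt n r (word_wt n w)"
  using word_wt_range[of n w] word_wt_signed[of w n] by (auto simp: tensor_wt_def tensor_index_def)

section \<open>The relations (D1) to (D7) hold on tensors\<close>

lemma simple_root_rootc:
  assumes "2 \<le> n"
  shows "simple_root n j \<in> carrier_vec n" "k < n \<Longrightarrow> simple_root n j $ k = rootc n j k"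
  using assms by (auto simp: simple_root_def rootc_def dl_def)

lemma scalar_prod_simple_root:
  assumes "2 \<le> n" "j < n" "\<mu> \<in> carrier_vec n"
  shows "\<mu> \<bullet> simple_root n j = copair n (\<lambda>k. \<mu> $ k) j"
proof -
  have d: "dim_vec (simple_root n j) = n" using simple_root_rootc(1)[OF assms(1), of j] by simp
  have "\<mu> \<bullet> simple_root n j = (\<Sum>k<n. \<mu> $ k * rootc n j k)"
    using simple_root_rootc[OF assms(1)] by (simp add: scalar_prod_def lessThan_atLeast0 d)
  then show ?thesis using copair_sum[OF assms(2,1)] by simp
qed

lemma simple_root_norm: "2 \<le> n \<Longrightarrow> j < n \<Longrightarrow> simple_root n j \<bullet> simple_root n j = 2"
proof -
  assume n: "2 \<le> n" "j < n"
  have "copair n (\<lambda>k. simple_root n j $ k) j = copair n (rootc n j) j"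
    using simple_root_rootc[OF n(1)] n by (intro copair_cong) auto
  then show ?thesis using scalar_prod_simple_root[OF n simple_root_rootc(1)[OF n(1)]] copair_root n by simp
qed

lemma cartan_entry_copair:
  assumes "2 \<le> n" "i < n" "j < n"
  shows "cartan_entry n i j = copair n (rootc n i) j"
proof -
  have "copair n (\<lambda>k. simple_root n i $ k) j = copair n (rootc n i) j"
    using simple_root_rootc[OF assms(1)] assms by (intro copair_cong) auto
  then show ?thesis
    using scalar_prod_simple_root[OF assms(1,3) simple_root_rootc(1)[OF assms(1)]] simple_root_norm[OF assms(1,2)]
    by (simp add: cartan_entry_def)
qed

text \<open>The Serre relations for matrices. Off the diagonal the Cartan integers are 0 or -1, so
  one or two brackets suffice; separate cases are due to the last node of the diagram.\<close>

lemma fbr_ee: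
  assumes "i < n" "j < n" "i \<noteq> j" "3 \<le> n"
  shows "(copair n (rootc n i) j = 0 \<and> fbr (2 * n) (emat n i) (emat n j) = fzero) \<or>
    (copair n (rootc n i) j = -1 \<and> fbr (2 * n) (emat n i) (fbr (2 * n) (emat n i) (emat n j)) = fzero)"
proof -
  define z where "z = 2 * n - 1"
  have z: "z < 2 * n" "bar n z = n - 1" "bar n (n - 1) = z" "z \<ge> n" "bar n (n - 2) \<ge> n" "bar n (n - 2) \<noteq> z"
    using assms(4) by (auto simp: z_def bar_def)
  have e: "emat n (n - 1) = Gm n (n - 2) z" "k + 1 < n \<Longrightarrow> emat n k = Gm n k (k + 1)" for k
    using assms(4) by (auto simp: emat_def z_def)
  have ne: "n - 3 \<noteq> n - 2" "n - 2 \<noteq> n - 3" using assms(4) by auto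
  consider (a) "i + 1 < n" "j + 1 < n" | (b) "i + 1 < n" "j = n - 1" | (c) "i = n - 1" "j + 1 < n"
    using assms by linarith
  then show ?thesis
  proof cases
    case a
    have br: "fbr (2 * n) (emat n i) (emat n j) =
        fadd (fscale (dl j (i + 1)) (Gm n i (j + 1))) (fscale (- dl (j + 1) i) (Gm n j (i + 1)))"
      using a by (simp add: e fbr_Gm bar_def dl_simps fscale_zero)
    consider "j = i + 1" | "i = j + 1" | "j \<noteq> i + 1" "i \<noteq> j + 1" by blast
    then show ?thesis
    proof cases
      case 1
      then have "fbr (2 * n) (emat n i) (emat n j) = Gm n i (i + 2)" using br by (simp add: dl_simps fscale_zero)
      moreover have "fbr (2 * n) (Gm n i (i + 1)) (Gm n i (i + 2)) = fzero"
        using a 1 by (simp add: fbr_Gm bar_def dl_simps fscale_zero)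
      moreover have "copair n (rootc n i) j = -1" using a 1 by (auto simp: copair_def rootc_def dl_def)
      ultimately show ?thesis using a by (simp add: e)
    next
      case 2
      then have "fbr (2 * n) (emat n i) (emat n j) = fscale (-1) (Gm n j (i + 1))" using br by (simp add: dl_simps fscale_zero)
      moreover have "fbr (2 * n) (Gm n i (i + 1)) (Gm n j (i + 1)) = fzero"
        using a 2 by (simp add: fbr_Gm bar_def dl_simps fscale_zero)
      moreover have "copair n (rootc n i) j = -1" using a 2 by (auto simp: copair_def rootc_def dl_def)
      ultimately show ?thesis using a by (simp add: e fbr_lin fscale_fzero)
    next
      case 3
      then have "fbr (2 * n) (emat n i) (emat n j) = fzero" using br by (simp add: dl_simps fscale_zero)
      moreover have "copair n (rootc n i) j = 0" using a 3 assms(3) by (auto simp: copair_def rootc_def dl_def)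
      ultimately show ?thesis by simp
    qed
  next
    case b
    have bi: "bar n i = i + n" "bar n (i + 1) = i + 1 + n" "bar n (Suc i) = Suc i + n"
      using b by (auto simp: bar_def)
    have d: "dl (n - 2) (bar n i) = 0" "dl z i = 0" "dl z (bar n (i + 1)) = dl (n - 2) i"
      "dl (n - 2) (i + 1) = dl (n - 3) i"
      using b assms(4) by (auto simp: dl_def z_def bi)
    have br: "fbr (2 * n) (emat n i) (emat n j) =
        fadd (fscale (dl (n - 3) i) (Gm n i z)) (fscale (dl (n - 2) i) (Gm n (n - 2) (bar n i)))"
      unfolding e(1)[folded b(2)] e(2)[OF b(1)]
      by (subst fbr_Gm) (use b z assms(4) in \<open>simp_all add: fscale_zero d[simplified]\<close>)
    \<comment> \<open>The last node is joined to \<open>n - 3\<close> and not to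
      \<open>n - 2\<close>: the sum of the last two simple roots is twice a coordinate, which is not
      a root.\<close>
    consider "i = n - 3" | "i = n - 2" | "i < n - 3" using b by linarith
    then show ?thesis
    proof cases
      case 1
      then have "fbr (2 * n) (emat n i) (emat n j) = Gm n i z" using br ne by (simp add: dl_simps fscale_zero)
      moreover have "fbr (2 * n) (Gm n i (i + 1)) (Gm n i z) = fzero"
      proof -
        have "dl i (i + 1) = 0" "dl i (bar n i) = 0" "dl z i = 0" "dl z (bar n (i + 1)) = 0"
          unfolding bi using 1 b assms(4) by (auto simp: dl_def z_def)
        then show ?thesis by (subst fbr_Gm) (use b z in \<open>simp_all add: fscale_zero\<close>)
      qed
      moreover have "copair n (rootc n i) j = -1" using b 1 assms(4) by (auto simp: copair_def rootc_def dl_def)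
      ultimately show ?thesis using b by (simp add: e)
    next
      case 2
      then have "fbr (2 * n) (emat n i) (emat n j) = Gm n (n - 2) (bar n (n - 2))"
        using br ne by (simp add: dl_simps fscale_zero)
      also have "\<dots> = fzero" using assms(4) by (intro Gm_self_bar) simp
      finally have "fbr (2 * n) (emat n i) (emat n j) = fzero" .
      moreover have "copair n (rootc n i) j = 0" using b 2 assms(4) by (auto simp: copair_def rootc_def dl_def)
      ultimately show ?thesis by simp
    next
      case 3
      then have "n - 3 \<noteq> i" "n - 2 \<noteq> i" by auto
      then have "fbr (2 * n) (emat n i) (emat n j) = fzero" using br by (simp add: dl_simps fscale_zero)
      moreover have "copair n (rootc n i) j = 0" using b 3 assms(4) by (auto simp: copair_def rootc_def dl_def)
      ultimately show ?thesis by simp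
    qed
  next
    case c
    have d: "dl j z = 0" "dl j (bar n (n - 2)) = 0" "dl (j + 1) (n - 1) = dl j (n - 2)" "dl (j + 1) (n - 2) = dl j (n - 3)"
    proof -
      have "j \<noteq> z" "j \<noteq> bar n (n - 2)" using c z by linarith+
      moreover have "j + 1 = n - 1 \<longleftrightarrow> j = n - 2" "j + 1 = n - 2 \<longleftrightarrow> j = n - 3" using assms(4) by linarith+
      ultimately show "dl j z = 0" "dl j (bar n (n - 2)) = 0" "dl (j + 1) (n - 1) = dl j (n - 2)" "dl (j + 1) (n - 2) = dl j (n - 3)"
        by (simp_all add: dl_def)
    qed
    have br: "fbr (2 * n) (emat n i) (emat n j) =
        fadd (fscale (- dl j (n - 3)) (Gm n j z)) (fscale (dl j (n - 2)) (Gm n j (bar n (n - 2))))"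
      unfolding e(1)[folded c(1)] e(2)[OF c(2)]
      by (subst fbr_Gm) (use c z assms(4) in \<open>simp_all add: fscale_zero d[simplified] z(2)\<close>)
    consider "j = n - 3" | "j = n - 2" | "j < n - 3" using c by linarith
    then show ?thesis
    proof cases
      case 1
      then have "fbr (2 * n) (emat n i) (emat n j) = fscale (-1) (Gm n j z)" using br ne by (simp add: dl_simps fscale_zero)
      moreover have "fbr (2 * n) (Gm n (n - 2) z) (Gm n j z) = fzero"
      proof -
        have "dl j z = 0" "dl j (bar n (n - 2)) = 0" "dl z (n - 2) = 0" "dl z (bar n z) = 0"
        proof -
          have "j \<noteq> z" "j \<noteq> bar n (n - 2)" "z \<noteq> n - 2" "z \<noteq> n - 1" using c z assms(4) by linarith+
          then show "dl j z = 0" "dl j (bar n (n - 2)) = 0" "dl z (n - 2) = 0" "dl z (bar n z) = 0"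
            by (simp_all add: dl_def z)
        qed
        then show ?thesis by (subst fbr_Gm) (use c z in \<open>simp_all add: fscale_zero\<close>)
      qed
      moreover have "copair n (rootc n i) j = -1" using c 1 assms(4) by (auto simp: copair_def rootc_def dl_def)
      ultimately show ?thesis using c(1) by (simp only: e(1) fbr_lin fscale_fzero) simp
    next
      case 2
      then have "fbr (2 * n) (emat n i) (emat n j) = Gm n (n - 2) (bar n (n - 2))"
        using br ne by (simp add: dl_simps fscale_zero)
      also have "\<dots> = fzero" using assms(4) by (intro Gm_self_bar) simp
      finally have "fbr (2 * n) (emat n i) (emat n j) = fzero" .
      moreover have "copair n (rootc n i) j = 0" using c 2 assms(4) by (auto simp: copair_def rootc_def dl_def)
      ultimately show ?thesis by simp
    next
      case 3
      then have "j \<noteq> n - 3" "j \<noteq> n - 2" by auto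
      then have "fbr (2 * n) (emat n i) (emat n j) = fzero" using br by (simp add: dl_simps fscale_zero)
      moreover have "copair n (rootc n i) j = 0" using c 3 assms(4) by (auto simp: copair_def rootc_def dl_def)
      ultimately show ?thesis by simp
    qed
  qed
qed

lemma emat_ftr: "fmatr n i = ftr (emat n i)"
  by (simp add: emat_def fmatr_def ftr)

lemma fbr_ff:
  assumes "i < n" "j < n" "i \<noteq> j" "3 \<le> n"
  shows "(copair n (rootc n i) j = 0 \<and> fbr (2 * n) (fmatr n i) (fmatr n j) = fzero) \<or>
    (copair n (rootc n i) j = -1 \<and> fbr (2 * n) (fmatr n i) (fbr (2 * n) (fmatr n i) (fmatr n j)) = fzero)"
proof -
  have 1: "fbr (2 * n) (fmatr n i) (fmatr n j) = fscale (-1) (ftr (fbr (2 * n) (emat n i) (emat n j)))"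
    unfolding emat_ftr ftr(4) by (rule fbr_skew)
  have 2: "fbr (2 * n) (fmatr n i) (fbr (2 * n) (fmatr n i) (fmatr n j)) =
      ftr (fbr (2 * n) (emat n i) (fbr (2 * n) (emat n i) (emat n j)))"
    unfolding 1 fbr_lin unfolding emat_ftr ftr(4)
    by (subst fbr_skew) (simp add: fscale_def)
  from fbr_ee[OF assms] show ?thesis
  proof (elim disjE conjE)
    assume "copair n (rootc n i) j = 0" "fbr (2 * n) (emat n i) (emat n j) = fzero"
    then show ?thesis unfolding 1 by (simp only: ftr(5) fscale_fzero) simp
  next
    assume "copair n (rootc n i) j = -1" "fbr (2 * n) (emat n i) (fbr (2 * n) (emat n i) (emat n j)) = fzero"
    then show ?thesis unfolding 2 by (simp only: ftr(5)) simp
  qed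
qed

definition acts :: "nat \<Rightarrow> nat \<Rightarrow> free_elem \<Rightarrow> fmat \<Rightarrow> bool" where
  "acts n r p X \<longleftrightarrow> (\<forall>t. tact n r p t = TA n r X t)"

lemma acts_cm: "acts n r p X \<Longrightarrow> acts n r q Y \<Longrightarrow> acts n r (cm p q) (fbr (2 * n) X Y)"
  by (simp add: acts_def cm_def tact_diff tact_mult TA_br)

lemma acts_gens: "i < n \<Longrightarrow> acts n r (ge i) (emat n i)" "i < n \<Longrightarrow> acts n r (gf i) (fmatr n i)"
  "i < n \<Longrightarrow> acts n r (gH i) (hmat n i)"
  by (simp_all add: acts_def tact_gens)

definition kills :: "nat \<Rightarrow> nat \<Rightarrow> free_elem \<Rightarrow> bool" where
  "kills n r p \<longleftrightarrow> (\<forall>t\<in>tensors n r. tact n r p t = (\<lambda>_. 0))"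

lemma acts_zero_kills: "acts n r p fzero \<Longrightarrow> kills n r p"
  by (simp add: acts_def kills_def TA_zero)

text \<open>For the Cartan integers 0 and -1 the Serre element is the commutator and the double
  commutator, respectively.\<close>

lemma kills_serre:
  assumes x: "\<And>i. i < n \<Longrightarrow> acts n r (x i) (X i)" and ij: "i < n" "j < n" "i \<noteq> j" "3 \<le> n"
    and br: "(copair n (rootc n i) j = 0 \<and> fbr (2 * n) (X i) (X j) = fzero) \<or>
      (copair n (rootc n i) j = -1 \<and> fbr (2 * n) (X i) (fbr (2 * n) (X i) (X j)) = fzero)"
  shows "kills n r (serre n x i j)"
proof -
  have c: "cartan_entry n i j = copair n (rootc n i) j" using ij by (intro cartan_entry_copair) auto
  from br show ?thesis
  proof (elim disjE conjE)
    assume a: "copair n (rootc n i) j = 0" "fbr (2 * n) (X i) (X j) = fzero"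
    have "serre n x i j = cm (x i) (x j)"
      by (simp add: serre_def c a cm_def)
    moreover have "acts n r (cm (x i) (x j)) fzero" using acts_cm[OF x[OF ij(1)] x[OF ij(2)]] a by simp
    ultimately show ?thesis using acts_zero_kills by simp
  next
    assume a: "copair n (rootc n i) j = -1" "fbr (2 * n) (X i) (fbr (2 * n) (X i) (X j)) = fzero"
    have "serre n x i j = (\<Sum>s=0..2. (-1) ^ s * of_nat (2 choose s) * x i ^ (2 - s) * x j * x i ^ s)"
      by (simp add: serre_def c a)
    also have "\<dots> = cm (x i) (cm (x i) (x j))"
      by (simp add: numeral_2_eq_2 cm_def algebra_simps mult_2)
    finally have "serre n x i j = cm (x i) (cm (x i) (x j))" .
    moreover have "acts n r (cm (x i) (cm (x i) (x j))) fzero"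
      using acts_cm[OF x[OF ij(1)] acts_cm[OF x[OF ij(1)] x[OF ij(2)]]] a by simp
    ultimately show ?thesis using acts_zero_kills by simp
  qed
qed

lemma tact_diag_prod:
  assumes "\<And>t w. t \<in> tensors n r \<Longrightarrow> w \<in> tensor_index n r \<Longrightarrow> tact n r J t w = g w * t w"
    and "t \<in> tensors n r" "w \<in> tensor_index n r"
  shows "tact n r (prod_list (map (\<lambda>k. J + of_int (c k)) L)) t w = (\<Prod>k\<leftarrow>L. g w + of_int (c k)) * t w"
  using assms(2)
proof (induction L arbitrary: t)
  case (Cons k L)
  have "tact n r (prod_list (map (\<lambda>k. J + of_int (c k)) L)) t \<in> tensors n r"
    using Cons.prems by (rule tact_closed)
  then show ?case
    using Cons assms(1,3)
    by (simp add: tact_mult tact_add of_int_const tact_const algebra_simps)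
qed (simp add: tact_one)

lemma kills_diag_prod:
  assumes "\<And>t w. t \<in> tensors n r \<Longrightarrow> w \<in> tensor_index n r \<Longrightarrow> tact n r J t w = g w * t w"
    and "\<And>w. w \<in> tensor_index n r \<Longrightarrow> \<exists>k\<in>set L. g w + of_int (c k) = 0"
  shows "kills n r (prod_list (map (\<lambda>k. J + of_int (c k)) L))"
  unfolding kills_def
proof (intro ballI ext)
  fix t w assume t: "t \<in> tensors n r"
  show "tact n r (prod_list (map (\<lambda>k. J + of_int (c k)) L)) t w = 0"
  proof (cases "w \<in> tensor_index n r")
    case True
    then have "(\<Prod>k\<leftarrow>L. g w + of_int (c k)) = 0" using assms(2)[OF True] by (force simp: prod_list_zero_iff)
    then show ?thesis using tact_diag_prod[OF assms(1) t True, of c L] by simp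
  next
    case False
    then show ?thesis using tact_closed[OF t] by (auto simp: tensors_def)
  qed
qed

lemma tact_sum: "tact n r (\<Sum>i\<in>I. p i) t = (\<lambda>w. \<Sum>i\<in>I. tact n r (p i) t w)"
  by (induction I rule: infinite_finite_induct) (simp_all add: tact_zero tact_add)

text \<open>(D1) to (D5) become matrix identities, since brackets of matrices act on tensors as
  commutators. (D6) and (D7) follow from the weights of the basis tensors, on which the
  \<open>H i\<close> are diagonal.\<close>

lemma kills_pres_rels:
  assumes n: "3 \<le> n" and p: "p \<in> pres_rels n r"
  shows "kills n r p"
proof -
  have n2: "2 \<le> n" using n by simp
  have root: "unit_vec n i \<bullet> simple_root n j = rootc n j i" if "i < n" for i j
    using that simple_root_rootc[OF n2] by (simp add: scalar_prod_left_unit)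
  have D1: "kills n r (gH i * gH j - gH j * gH i)" if "i < n" "j < n" for i j
    using acts_zero_kills[of n r "cm (gH i) (gH j)"] acts_cm[OF acts_gens(3) acts_gens(3), of i n j r] that
    by (simp add: fbr_hh cm_def)
  have hh: "acts n r (if i + 1 < n then gH i - gH (i + 1) else gH (n - 2) + gH (n - 1)) (hhmat n i)" if "i < n" for i
    using that n by (auto simp: acts_def hhmat_def tact_diff tact_add tact_gens TA_add TA_scale)
  have D2: "kills n r (ge i * gf j - gf j * ge i - (if i = j then if i + 1 < n then gH i - gH (i + 1) else gH (n - 2) + gH (n - 1) else 0))"
    if "i < n" "j < n" for i j
    using acts_cm[OF acts_gens(1) acts_gens(2), of i n j r] hh[OF that(1)] that fbr_ef[OF that n]
    by (cases "i = j") (simp_all add: kills_def acts_def cm_def tact_diff tact_zero TA_zero)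
  have D3: "kills n r (gH i * ge j - ge j * gH i - const (rootc n j i) * ge j)"
      "kills n r (gH i * gf j - gf j * gH i + const (rootc n j i) * gf j)" if "i < n" "j < n" for i j
    using acts_cm[OF acts_gens(3) acts_gens(1), of i n j r] acts_cm[OF acts_gens(3) acts_gens(2), of i n j r]
      that fbr_he[OF that n] fbr_hf[OF that n]
    by (simp_all add: kills_def acts_def cm_def tact_diff tact_add tact_mult[of n r "const _"] tact_const tact_gens TA_scale)
  have D6: "kills n r (prod_list (map (\<lambda>k. gH i + of_int (int r - int k)) [0..<2 * r + 1]))" if i: "i < n" for i
  proof (rule kills_diag_prod[where g = "\<lambda>w. word_wt n w i"])
    show "tact n r (gH i) t w = word_wt n w i * t w" if "w \<in> tensor_index n r" for t w
      using TA_H[OF i that] i by (simp add: tact_gens)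
    fix w assume w: "w \<in> tensor_index n r"
    then have "word_wt n w i \<in> set (wt_list r)" using word_wt_range[of n w i] by (simp add: tensor_index_def)
    then show "\<exists>k\<in>set [0..<2 * r + 1]. word_wt n w i + of_int (int r - int k) = 0"
      by (auto simp: wt_list_def simp del: upt_Suc)
  qed
  have D7: "kills n r (prod_list (map (\<lambda>k. (\<Sum>i<n. of_int (\<sigma> i) * gH i) + of_int (int r - 2 * int k)) [0..<r + 1]))"
    if \<sigma>: "\<forall>i<n. \<sigma> i \<in> {1, - 1}" for \<sigma> :: "nat \<Rightarrow> int"
  proof (rule kills_diag_prod[where g = "\<lambda>w. \<Sum>i<n. of_int (\<sigma> i) * word_wt n w i"])
    show "tact n r (\<Sum>i<n. of_int (\<sigma> i) * gH i) t w = (\<Sum>i<n. of_int (\<sigma> i) * word_wt n w i) * t w"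
      if "w \<in> tensor_index n r" for t w
      unfolding tact_sum sum_distrib_right of_int_const tact_mult tact_const
      by (intro sum.cong refl) (use TA_H[OF _ that] in \<open>simp add: tact_gens\<close>)
    fix w assume w: "w \<in> tensor_index n r"
    obtain k where "k \<le> r" "(\<Sum>i<n. of_int (\<sigma> i) * word_wt n w i) = 2 * of_nat k - of_nat r"
      using word_tensor_wt[OF w] \<sigma> by (auto simp: tensor_wt_def)
    then show "\<exists>k\<in>set [0..<r + 1]. (\<Sum>i<n. of_int (\<sigma> i) * word_wt n w i) + of_int (int r - 2 * int k) = 0"
      by (intro bexI[of _ k]) auto
  qed
  have D4: "kills n r (serre n ge i j)" "kills n r (serre n gf i j)" if "i < n" "j < n" "i \<noteq> j" for i j
    using kills_serre[OF acts_gens(1) that n fbr_ee[OF that n]] kills_serre[OF acts_gens(2) that n fbr_ff[OF that n]] by auto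
  show ?thesis
    using p unfolding pres_rels_def
  proof (elim UnE)
    assume "p \<in> rels_D2 n"
    then consider i j where "i < n - 1" "j < n" "p = ge i * gf j - gf j * ge i - (if i = j then gH i - gH (i + 1) else 0)"
      | i j where "i = n - 1" "j < n" "p = ge i * gf j - gf j * ge i - (if i = j then gH (n - 2) + gH (n - 1) else 0)"
      unfolding rels_D2_def by blast
    then show ?thesis
    proof cases
      case (1 i j)
      then have "i < n" "i + 1 < n" by auto
      then show ?thesis using D2[of i j] 1 by (cases "i = j") simp_all
    next
      case (2 i j)
      then have "i < n" "\<not> i + 1 < n" using n by auto
      then show ?thesis using D2[of i j] 2 by (cases "i = j") simp_all
    qed
  next
    assume "p \<in> rels_D3 n"
    then show ?thesis unfolding rels_D3_def using D3 root by auto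
  next
    assume "p \<in> rels_D7 n r"
    then show ?thesis unfolding rels_D7_def using D7 by blast
  next
    assume "p \<in> rels_D6 n r"
    then show ?thesis unfolding rels_D6_def using D6 by blast
  qed (use D1 D4 in \<open>auto simp: rels_D1_def rels_D4_def rels_D5_def\<close>)
qed

lemma kills_ideal: "ideal {p \<in> carrier (gens_alg n). kills n r p} (gens_alg n)"
proof (rule idealI)
  interpret ring "gens_alg n" by (rule ring_free_algebra)
  show "ring (gens_alg n)" by (rule ring_free_algebra)
  show "subgroup {p \<in> carrier (gens_alg n). kills n r p} (add_monoid (gens_alg n))"
  proof (rule group.subgroupI)
    show "Group.group (add_monoid (gens_alg n))" by (rule a_group)
    show "{p \<in> carrier (gens_alg n). kills n r p} \<noteq> {}"
      using fa_zero_one(1) by (auto simp: kills_def tact_zero intro!: exI[of _ 0])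
    fix p assume p: "p \<in> {p \<in> carrier (gens_alg n). kills n r p}"
    then have "- p = \<ominus>\<^bsub>gens_alg n\<^esub> p"
      by (intro minus_equality[symmetric]) (auto simp: free_algebra_ops fa_closed)
    then have "inv\<^bsub>add_monoid (gens_alg n)\<^esub> p = - p" by (simp add: a_inv_def)
    then show "inv\<^bsub>add_monoid (gens_alg n)\<^esub> p \<in> {p \<in> carrier (gens_alg n). kills n r p}"
      using p fa_closed(3)[of p, OF _ fa_zero_one(1)] by (simp add: kills_def tact_uminus)
  next
    fix p q assume "p \<in> {p \<in> carrier (gens_alg n). kills n r p}" "q \<in> {p \<in> carrier (gens_alg n). kills n r p}"
    then show "p \<otimes>\<^bsub>add_monoid (gens_alg n)\<^esub> q \<in> {p \<in> carrier (gens_alg n). kills n r p}"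
      by (auto simp: free_algebra_ops fa_closed kills_def tact_add)
  qed auto
next
  fix p q assume "p \<in> {p \<in> carrier (gens_alg n). kills n r p}" and "q \<in> carrier (gens_alg n)"
  then show "q \<otimes>\<^bsub>gens_alg n\<^esub> p \<in> {p \<in> carrier (gens_alg n). kills n r p}"
    and "p \<otimes>\<^bsub>gens_alg n\<^esub> q \<in> {p \<in> carrier (gens_alg n). kills n r p}"
    by (auto simp: free_algebra_ops fa_closed kills_def tact_mult tact_zero_right tact_closed)
qed

lemma pres_ideal_kills:
  assumes "3 \<le> n" "p \<in> pres_ideal n r" shows "kills n r p"
proof -
  have "pres_rels n r \<subseteq> {p \<in> carrier (gens_alg n). kills n r p}"
    using pres_rels_carrier[of n r] kills_pres_rels[OF assms(1)] assms(1) by auto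
  then have "pres_ideal n r \<subseteq> {p \<in> carrier (gens_alg n). kills n r p}"
    unfolding pres_ideal_def by (rule ring.genideal_minimal[OF ring_free_algebra kills_ideal])
  then show ?thesis using assms(2) by auto
qed

text \<open>Nonzero tensors exist, so 1 does not kill them all. This gives
  \<open>0 \<noteq> 1\<close> when the presented algebra is made an instance of
  \<open>ring_1\<close>.\<close>

lemma one_notin_pres_ideal:
  assumes "3 \<le> n" shows "1 \<notin> pres_ideal n r"
proof
  assume "1 \<in> pres_ideal n r"
  then have k: "kills n r 1" by (rule pres_ideal_kills[OF assms])
  let ?w = "replicate r 0" and ?t = "\<lambda>w. if w = replicate r 0 then 1 else 0 :: rat"
  have "?t \<in> tensors n r" using assms by (auto simp: tensors_def tensor_index_def)
  then have "tact n r 1 ?t = (\<lambda>_. 0)" using k unfolding kills_def by blast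
  from fun_cong[OF this, of ?w] show False by (simp add: tact_one)
qed

section \<open>Structure of the presented algebra\<close>

lemma fa_uminus: "p \<in> carrier (free_algebra S) \<Longrightarrow> - p \<in> carrier (free_algebra S)"
  using fa_closed(3) by blast

lemma fa_ideal:
  assumes "ideal I (free_algebra S)"
  shows "I \<subseteq> carrier (free_algebra S)" "0 \<in> I" "x \<in> I \<Longrightarrow> y \<in> I \<Longrightarrow> x + y \<in> I"
    "x \<in> I \<Longrightarrow> - x \<in> I" "x \<in> I \<Longrightarrow> y \<in> I \<Longrightarrow> x - y \<in> I"
    "p \<in> carrier (free_algebra S) \<Longrightarrow> x \<in> I \<Longrightarrow> p * x \<in> I"
    "p \<in> carrier (free_algebra S) \<Longrightarrow> x \<in> I \<Longrightarrow> x * p \<in> I"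
proof -
  interpret ideal I "free_algebra S" by fact
  show "I \<subseteq> carrier (free_algebra S)" by (rule a_subset)
  show "0 \<in> I" using additive_subgroup.zero_closed[OF is_additive_subgroup] by (simp add: free_algebra_ops)
  show a: "x + y \<in> I" if "x \<in> I" "y \<in> I" for x y using additive_subgroup.a_closed[OF is_additive_subgroup that] by (simp add: free_algebra_ops)
  show l: "p * x \<in> I" if "p \<in> carrier (free_algebra S)" "x \<in> I" for p x
    using I_l_closed[OF that(2,1)] by (simp add: free_algebra_ops)
  show "x * p \<in> I" if "p \<in> carrier (free_algebra S)" "x \<in> I" for p x
    using I_r_closed[OF that(2,1)] by (simp add: free_algebra_ops)
  show m: "- x \<in> I" if "x \<in> I" for x
    using l[OF fa_uminus[OF fa_zero_one(2)] that] by simp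
  show "x - y \<in> I" if "x \<in> I" "y \<in> I" for x y using a[OF that(1) m[OF that(2)]] by simp
qed

lemma fa_coset: "I +>\<^bsub>free_algebra S\<^esub> p = (\<lambda>i. i + p) ` I"
  by (auto simp: a_r_coset_def' free_algebra_ops)

lemma fa_coset_eq:
  assumes I: "ideal I (free_algebra S)"
  shows "I +>\<^bsub>free_algebra S\<^esub> p = I +>\<^bsub>free_algebra S\<^esub> q \<longleftrightarrow> p - q \<in> I"
proof
  assume "I +>\<^bsub>free_algebra S\<^esub> p = I +>\<^bsub>free_algebra S\<^esub> q"
  then have "0 + p \<in> (\<lambda>i. i + q) ` I" using fa_ideal(2)[OF I] unfolding fa_coset by blast
  then show "p - q \<in> I" by auto
next
  assume d: "p - q \<in> I"
  have "i + p = (i + (p - q)) + q" "i + q = (i - (p - q)) + p" for i by simp_all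
  then show "I +>\<^bsub>free_algebra S\<^esub> p = I +>\<^bsub>free_algebra S\<^esub> q"
    unfolding fa_coset using fa_ideal(3,5)[OF I] d by blast
qed

text \<open>The notion \<open>highest\<close>, written for representatives in the free algebra so
  that it makes sense for all \<open>n\<close> and \<open>r\<close> at once.\<close>

definition pres_highest :: "nat \<Rightarrow> nat \<Rightarrow> (nat \<Rightarrow> rat) \<Rightarrow> free_elem \<Rightarrow> bool" where
  "pres_highest n r \<nu> w \<longleftrightarrow> w \<in> carrier (gens_alg n) \<and> w \<notin> pres_ideal n r \<and>
    (\<forall>i<n. gH i * w - const (\<nu> i) * w \<in> pres_ideal n r \<and> ge i * w \<in> pres_ideal n r)"

text \<open>Complete reducibility of the left regular module of the presented algebra, and simplicity of
  its highest weight submodules.\<close>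

definition pres_reducible :: "nat \<Rightarrow> nat \<Rightarrow> bool" where
  "pres_reducible n r \<longleftrightarrow>
    (\<forall>D. pres_ideal n r \<subseteq> D \<longrightarrow>
       (\<forall>x\<in>D. \<forall>\<nu> w. \<forall>p\<in>carrier (gens_alg n). pres_highest n r \<nu> w \<longrightarrow> p * w + x \<in> D) \<longrightarrow> 1 \<in> D) \<and>
    (\<forall>\<nu> v. \<forall>y\<in>carrier (gens_alg n). pres_highest n r \<nu> v \<longrightarrow> y * v \<notin> pres_ideal n r \<longrightarrow>
       (\<exists>b\<in>carrier (gens_alg n). b * (y * v) - v \<in> pres_ideal n r)) \<and>
    (\<forall>\<nu> v. pres_highest n r \<nu> v \<longrightarrow> dom_wt n \<nu> \<and> tensor_wt n r \<nu>)"

text \<open>To apply the results on \<^locale>\<open>schur_presentation\<close> the presented algebra has to be a type,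
  which cannot depend on \<open>n\<close> and \<open>r\<close>.  It suffices to treat a single pair: one that is a
  counterexample to \<^const>\<open>pres_reducible\<close> if there is any.\<close>

definition worst :: "nat \<times> nat" where
  "worst = (SOME nr. 3 \<le> fst nr \<and>
     ((\<exists>n r. 3 \<le> n \<and> \<not> pres_reducible n r) \<longrightarrow> \<not> pres_reducible (fst nr) (snd nr)))"

definition wn :: nat where "wn = fst worst"
definition wr :: nat where "wr = snd worst"

lemma worst: "3 \<le> wn" "3 \<le> n \<Longrightarrow> \<not> pres_reducible n r \<Longrightarrow> \<not> pres_reducible wn wr"
proof -
  have "\<exists>nr. 3 \<le> fst nr \<and> ((\<exists>n r. 3 \<le> n \<and> \<not> pres_reducible n r) \<longrightarrow> \<not> pres_reducible (fst nr) (snd nr))"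
  proof (cases "\<exists>n r. 3 \<le> n \<and> \<not> pres_reducible n r")
    case True
    then obtain n r where "3 \<le> n" "\<not> pres_reducible n r" by blast
    then show ?thesis by (intro exI[of _ "(n, r)"]) simp
  next
    case False
    then show ?thesis by (intro exI[of _ "(3, 1)"]) auto
  qed
  from someI_ex[OF this] show "3 \<le> wn" "3 \<le> n \<Longrightarrow> \<not> pres_reducible n r \<Longrightarrow> \<not> pres_reducible wn wr"
    unfolding wn_def wr_def worst_def by blast+
qed

section \<open>The presented algebra as a type\<close>

abbreviation wF :: "free_elem set" where "wF \<equiv> carrier (gens_alg wn)"
abbreviation wI :: "free_elem set" where "wI \<equiv> pres_ideal wn wr"

lemma wI: "ideal wI (gens_alg wn)"
  using worst(1) by (intro pres_ideal_ideal) simp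

typedef pres = "(\<lambda>p. wI +>\<^bsub>gens_alg wn\<^esub> p) ` wF"
  using fa_zero_one(1) by blast

definition cl :: "free_elem \<Rightarrow> pres" where "cl p = Abs_pres (wI +>\<^bsub>gens_alg wn\<^esub> p)"

lemma cl_eq: "p \<in> wF \<Longrightarrow> q \<in> wF \<Longrightarrow> cl p = cl q \<longleftrightarrow> p - q \<in> wI"
  unfolding fa_coset_eq[OF wI, symmetric] cl_def by (rule Abs_pres_inject) auto

lemma cl_cases: obtains p where "p \<in> wF" "x = cl p"
  by (cases x rule: Abs_pres_cases) (auto simp: cl_def)

definition rp :: "pres \<Rightarrow> free_elem" where "rp x = (SOME p. p \<in> wF \<and> cl p = x)"

lemma rp: "rp x \<in> wF" "cl (rp x) = x"
proof -
  have "\<exists>p. p \<in> wF \<and> cl p = x" using cl_cases[of x] by blast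
  from someI_ex[OF this] show "rp x \<in> wF" "cl (rp x) = x" unfolding rp_def by blast+
qed

lemma rp_cl: "p \<in> wF \<Longrightarrow> rp (cl p) - p \<in> wI"
  using cl_eq[OF rp(1), of p "cl p"] rp(2)[of "cl p"] by simp

instantiation pres :: ring_1
begin

definition zero_pres where "0 = cl 0"
definition one_pres where "1 = cl 1"
definition plus_pres where "x + y = cl (rp x + rp y)"
definition uminus_pres where "- x = cl (- rp x)"
definition minus_pres where "x - y = cl (rp x - rp y)"
definition times_pres where "x * y = cl (rp x * rp y)"

lemma cl_add: "p \<in> wF \<Longrightarrow> q \<in> wF \<Longrightarrow> cl p + cl q = cl (p + q)"
proof -
  assume pq: "p \<in> wF" "q \<in> wF"
  have "(rp (cl p) + rp (cl q)) - (p + q) = (rp (cl p) - p) + (rp (cl q) - q)" by simp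
  also have "\<dots> \<in> wI" using rp_cl pq by (intro fa_ideal(3)[OF wI])
  finally show ?thesis unfolding plus_pres_def using pq rp(1) by (subst cl_eq) (auto intro: fa_closed)
qed

lemma cl_diff: "p \<in> wF \<Longrightarrow> q \<in> wF \<Longrightarrow> cl p - cl q = cl (p - q)"
proof -
  assume pq: "p \<in> wF" "q \<in> wF"
  have "(rp (cl p) - rp (cl q)) - (p - q) = (rp (cl p) - p) - (rp (cl q) - q)" by simp
  also have "\<dots> \<in> wI" by (rule fa_ideal(5)[OF wI rp_cl[OF pq(1)] rp_cl[OF pq(2)]])
  finally show ?thesis unfolding minus_pres_def using pq rp(1) by (subst cl_eq) (auto intro: fa_closed)
qed

lemma cl_uminus: "p \<in> wF \<Longrightarrow> - cl p = cl (- p)"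
proof -
  assume p: "p \<in> wF"
  have "(- rp (cl p)) - (- p) = - (rp (cl p) - p)" by simp
  also have "\<dots> \<in> wI" using rp_cl p by (intro fa_ideal(4)[OF wI])
  finally show ?thesis unfolding uminus_pres_def using p rp(1) by (subst cl_eq) (auto intro: fa_uminus)
qed

lemma cl_mult: "p \<in> wF \<Longrightarrow> q \<in> wF \<Longrightarrow> cl p * cl q = cl (p * q)"
proof -
  assume pq: "p \<in> wF" "q \<in> wF"
  have "rp (cl p) * rp (cl q) - p * q = rp (cl p) * (rp (cl q) - q) + (rp (cl p) - p) * q"
    by (simp add: algebra_simps)
  also have "\<dots> \<in> wI" using rp_cl pq rp(1) by (intro fa_ideal(3,6,7)[OF wI])
  finally show ?thesis unfolding times_pres_def using pq rp(1) by (subst cl_eq) (auto intro: fa_closed)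
qed

instance
proof
  fix a b c :: pres
  obtain p q s where pqs: "p \<in> wF" "q \<in> wF" "s \<in> wF" "a = cl p" "b = cl q" "c = cl s"
    using cl_cases by metis
  note ops = cl_add cl_diff cl_uminus cl_mult zero_pres_def one_pres_def fa_closed fa_uminus fa_zero_one algebra_simps pqs
  show "a + b + c = a + (b + c)" "a + b = b + a" "0 + a = a" "- a + a = 0" "a - b = a + - b"
    "a * b * c = a * (b * c)" "1 * a = a" "a * 1 = a" "(a + b) * c = a * c + b * c" "a * (b + c) = a * b + a * c"
    by (simp_all add: ops)
  show "(0 :: pres) \<noteq> 1"
    using one_notin_pres_ideal[OF worst(1), of wr] cl_eq[OF fa_zero_one(2) fa_zero_one(1)]
    by (auto simp: zero_pres_def one_pres_def)
qed

end

lemma cl_zero: "p \<in> wF \<Longrightarrow> cl p = 0 \<longleftrightarrow> p \<in> wI"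
  using cl_eq[OF _ fa_zero_one(1)] by (simp add: zero_pres_def)

lemma cl_sum: "(\<And>i. i \<in> A \<Longrightarrow> g i \<in> wF) \<Longrightarrow> cl (\<Sum>i\<in>A. g i) = (\<Sum>i\<in>A. cl (g i))"
proof (induction A rule: infinite_finite_induct)
  case (insert i A)
  then have "sum g A \<in> wF" by (intro fa_sum) auto
  then show ?case using insert by (simp add: cl_add[symmetric])
qed (simp_all add: zero_pres_def)

lemma cl_prod_list: "(\<And>k. k \<in> set L \<Longrightarrow> g k \<in> wF) \<Longrightarrow> cl (prod_list (map g L)) = prod_list (map (\<lambda>k. cl (g k)) L)"
proof (induction L)
  case (Cons k L)
  then have "prod_list (map g L) \<in> wF" by (intro fa_prod_list) auto
  then show ?case using Cons by (simp flip: cl_mult)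
qed (simp add: one_pres_def)

lemma cl_of_int: "cl (of_int k) = of_int k"
proof -
  have n: "of_nat m \<in> wF" "cl (of_nat m) = of_nat m" for m
  proof -
    show c: "of_nat m \<in> wF" for m unfolding of_nat_const by (rule const_carrier)
    show "cl (of_nat m) = of_nat m"
      by (induction m) (simp_all add: zero_pres_def one_pres_def cl_add[symmetric] fa_zero_one c)
  qed
  show ?thesis by (cases k rule: int_cases2) (simp_all add: n flip: cl_uminus)
qed

abbreviation psc :: "rat \<Rightarrow> pres" where "psc c \<equiv> cl (const c)"

lemma cl_rel: "p \<in> pres_rels wn wr \<Longrightarrow> cl p = 0"
proof -
  assume p: "p \<in> pres_rels wn wr"
  have "pres_rels wn wr \<subseteq> wF" using worst(1) by (intro pres_rels_carrier) simp
  moreover from this have "pres_rels wn wr \<subseteq> wI"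
    unfolding pres_ideal_def by (rule ring.genideal_self[OF ring_free_algebra])
  ultimately show ?thesis using p cl_zero by blast
qed

lemma pres_D2_mem:
  assumes "i < n" "j < n"
  shows "ge i * gf j - gf j * ge i -
    (if i = j then if i + 1 < n then gH i - gH (i + 1) else gH (n - 2) + gH (n - 1) else 0) \<in> rels_D2 n"
proof (cases "i + 1 < n")
  case True
  then have "i < n - 1" by simp
  then show ?thesis using True assms unfolding rels_D2_def by (simp only: if_True) blast
next
  case False
  then have "i = n - 1" using assms by simp
  then show ?thesis using False assms unfolding rels_D2_def by (simp only: if_False) blast
qed

lemma pres_D3_mem:
  assumes "2 \<le> n" "i < n" "j < n"
  shows "gH i * ge j - ge j * gH i - const (rootc n j i) * ge j \<in> rels_D3 n"
    "gH i * gf j - gf j * gH i + const (rootc n j i) * gf j \<in> rels_D3 n"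
proof -
  have "unit_vec n i \<bullet> simple_root n j = rootc n j i"
    using assms simple_root_rootc[OF assms(1)] by (simp add: scalar_prod_left_unit)
  note root = this[symmetric]
  show "gH i * ge j - ge j * gH i - const (rootc n j i) * ge j \<in> rels_D3 n"
    unfolding rels_D3_def root using assms(2,3) by blast
  show "gH i * gf j - gf j * gH i + const (rootc n j i) * gf j \<in> rels_D3 n"
    unfolding rels_D3_def root using assms(2,3) by blast
qed

lemma cl_gen_closed:
  assumes "1 \<in> D" "0 \<in> D" "\<And>x y. x \<in> D \<Longrightarrow> y \<in> D \<Longrightarrow> x + y \<in> D" "\<And>c x. x \<in> D \<Longrightarrow> psc c * x \<in> D"
    and "\<And>i x. i < wn \<Longrightarrow> x \<in> D \<Longrightarrow> cl (ge i) * x \<in> D \<and> cl (gf i) * x \<in> D \<and> cl (gH i) * x \<in> D"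
  shows "x \<in> D"
proof -
  obtain p where p: "p \<in> wF" "x = cl p" by (rule cl_cases)
  let ?D = "{p \<in> wF. cl p \<in> D}"
  have "p \<in> ?D"
  proof (rule gen_closed_carrier[OF p(1)])
    show "1 \<in> ?D" using assms(1) by (simp add: fa_zero_one one_pres_def)
    have "free_scalars.subsp ?D"
      using assms(2-4) by (intro free_scalars.subspI)
        (auto simp: fa_zero_one zero_pres_def fa_closed const_carrier simp flip: cl_add cl_mult)
    then show "free_scalars.gen_closed wn ge gf gH ?D"
      using assms(5) by (auto simp: free_scalars.gen_closed_def gens_carrier fa_closed simp flip: cl_mult)
  qed
  then show ?thesis using p by simp
qed

interpretation W: schur_presentation psc wn "\<lambda>i. cl (ge i)" "\<lambda>i. cl (gf i)" "\<lambda>i. cl (gH i)" wr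
proof -
  note c = gens_carrier[of _ wn] const_carrier fa_closed fa_zero_one fa_of_int
  have n2: "2 \<le> wn" using worst(1) by simp
  have hom: "cl (p + q) = cl p + cl q" "cl (p - q) = cl p - cl q" "cl (p * q) = cl p * cl q"
    if "p \<in> wF" "q \<in> wF" for p q using that by (simp_all add: cl_add cl_diff cl_mult)
  interpret rat_scalars psc
  proof
    show "psc (a + b) = psc a + psc b" "psc (a * b) = psc a * psc b" "psc 1 = 1" for a b
      by (simp_all add: const_add const_mult const_one hom const_carrier one_pres_def)
    show "psc a * x = x * psc a" for a x
      by (rule cl_cases[of x]) (simp add: cl_mult const_carrier const_commute)
  qed
  show "schur_presentation psc wn (\<lambda>i. cl (ge i)) (\<lambda>i. cl (gf i)) (\<lambda>i. cl (gH i)) wr"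
  proof
    show "3 \<le> wn" by (rule worst)
    fix i j assume ij: "i < wn" "j < wn"
    have "gH i * gH j - gH j * gH i \<in> pres_rels wn wr"
      using ij by (auto simp: pres_rels_def rels_D1_def)
    from cl_rel[OF this] show "cl (gH i) * cl (gH j) = cl (gH j) * cl (gH i)"
      using ij by (simp add: hom c)
    let ?h = "if i = j then if i + 1 < wn then gH i - gH (i + 1) else gH (wn - 2) + gH (wn - 1) else 0"
    have h: "?h \<in> wF" "cl ?h = (if i = j then if i + 1 < wn then cl (gH i) - cl (gH (i + 1)) else cl (gH (wn - 2)) + cl (gH (wn - 1)) else 0)"
      using ij n2 by (simp_all add: hom c zero_pres_def)
    have "ge i * gf j - gf j * ge i - ?h \<in> pres_rels wn wr"
      using pres_D2_mem[OF ij] unfolding pres_rels_def by blast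
    from cl_rel[OF this] show "cl (ge i) * cl (gf j) - cl (gf j) * cl (ge i) =
        (if i = j then if i + 1 < wn then cl (gH i) - cl (gH (i + 1)) else cl (gH (wn - 2)) + cl (gH (wn - 1)) else 0)"
      unfolding h(2)[symmetric] using ij h(1) by (simp only: hom c) simp
    have "gH i * ge j - ge j * gH i - const (rootc wn j i) * ge j \<in> pres_rels wn wr"
      "gH i * gf j - gf j * gH i + const (rootc wn j i) * gf j \<in> pres_rels wn wr"
      using pres_D3_mem[OF n2 ij] unfolding pres_rels_def by blast+
    from cl_rel[OF this(1)] cl_rel[OF this(2)]
    show "cl (gH i) * cl (ge j) - cl (ge j) * cl (gH i) = psc (rootc wn j i) * cl (ge j)"
      "cl (gH i) * cl (gf j) - cl (gf j) * cl (gH i) = - (psc (rootc wn j i) * cl (gf j))"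
      using ij by (simp_all add: hom c eq_neg_iff_add_eq_0)
  next
    fix i assume i: "i < wn"
    let ?g = "\<lambda>k. gH i + of_int (int wr - int k)"
    have "prod_list (map ?g [0..<2 * wr + 1]) \<in> pres_rels wn wr"
      using i unfolding pres_rels_def rels_D6_def by blast
    from cl_rel[OF this] show "prod_list (map (\<lambda>k. cl (gH i) + of_int (int wr - int k)) [0..<2 * wr + 1]) = 0"
      using i by (subst (asm) cl_prod_list) (simp_all add: hom c cl_of_int del: of_int_diff upt_Suc)
  next
    fix \<sigma> :: "nat \<Rightarrow> int" assume \<sigma>: "\<And>i. i < wn \<Longrightarrow> \<sigma> i \<in> {1, - 1}"
    let ?J = "\<Sum>i<wn. of_int (\<sigma> i) * gH i"
    let ?g = "\<lambda>k. ?J + of_int (int wr - 2 * int k)"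
    have t: "of_int (\<sigma> i) * gH i \<in> wF" if "i < wn" for i using that by (intro c)
    have J1: "?J \<in> wF" by (intro fa_sum t) auto
    have J2: "cl ?J = (\<Sum>i<wn. of_int (\<sigma> i) * cl (gH i))"
      using t by (subst cl_sum) (auto simp: hom c cl_of_int)
    note J = J1 J2
    have "prod_list (map ?g [0..<wr + 1]) \<in> pres_rels wn wr"
      using \<sigma> unfolding pres_rels_def rels_D7_def by blast
    from cl_rel[OF this] show "prod_list (map (\<lambda>k. (\<Sum>i<wn. of_int (\<sigma> i) * cl (gH i)) + of_int (int wr - 2 * int k)) [0..<wr + 1]) = 0"
      unfolding J(2)[symmetric]
      by (subst (asm) cl_prod_list) (simp_all add: hom c cl_of_int J(1) del: of_int_diff upt_Suc)
  next
    fix D x assume D: "1 \<in> D" "subsp D" "\<And>i x. i < wn \<Longrightarrow> x \<in> D \<Longrightarrow>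
      cl (ge i) * x \<in> D \<and> cl (gf i) * x \<in> D \<and> cl (gH i) * x \<in> D"
    show "x \<in> D" by (rule cl_gen_closed) (use D subspD[OF D(2)] in auto)
  qed
qed

lemma cl_highest: "w \<in> wF \<Longrightarrow> W.highest \<nu> (cl w) \<longleftrightarrow> pres_highest wn wr \<nu> w"
proof -
  assume w: "w \<in> wF"
  have "cl (gH i) * cl w = psc (\<nu> i) * cl w \<longleftrightarrow> gH i * w - const (\<nu> i) * w \<in> wI"
    "cl (ge i) * cl w = 0 \<longleftrightarrow> ge i * w \<in> wI" if "i < wn" for i
    using w that by (simp_all add: cl_mult cl_eq cl_zero gens_carrier const_carrier fa_closed)
  then show ?thesis
    using w by (auto simp: W.highest_def W.wt_def pres_highest_def cl_zero)
qed

text \<open>Pulls the induction over \<open>W.hw_all\<close> back to arbitrary representatives in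
  the free algebra; \<open>wI \<subseteq> D\<close> absorbs the choice of representative.\<close>

lemma hw_all_induct_carrier:
  assumes D: "wI \<subseteq> D" "\<And>x \<nu> w p. x \<in> D \<Longrightarrow> p \<in> wF \<Longrightarrow> pres_highest wn wr \<nu> w \<Longrightarrow> p * w + x \<in> D"
    and x: "x \<in> W.hw_all"
  shows "q \<in> wF \<Longrightarrow> cl q = x \<Longrightarrow> q \<in> D"
  using x
proof (induction arbitrary: q rule: W.hw_all.induct)
  case hw_all_zero
  then show ?case using cl_zero D(1) by blast
next
  case (hw_all_add x \<nu> w p)
  have w: "pres_highest wn wr \<nu> (rp w)" using cl_highest[OF rp(1), of \<nu> w] hw_all_add(2) by (simp add: rp)
  have pw: "rp p * rp w \<in> wF" by (intro fa_closed rp)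
  have "cl (rp p * rp w) = p * w" by (simp add: rp flip: cl_mult)
  then have "cl (q - rp p * rp w) = x" using hw_all_add(4,5) pw by (simp flip: cl_diff)
  then have "q - rp p * rp w \<in> D" using hw_all_add(3,4) pw by (simp add: fa_closed)
  from D(2)[OF this rp(1) w, of p] show ?case by simp
qed

lemma pres_reducible_worst: "pres_reducible wn wr"
  unfolding pres_reducible_def
proof (intro conjI allI impI ballI)
  fix D assume D: "wI \<subseteq> D" "\<forall>x\<in>D. \<forall>\<nu> w. \<forall>p\<in>wF. pres_highest wn wr \<nu> w \<longrightarrow> p * w + x \<in> D"
  show "1 \<in> D"
    by (rule hw_all_induct_carrier[OF D(1) _ W.complete_reducibility fa_zero_one(2) refl]) (use D(2) in blast)
next
  fix \<nu> v y assume a: "y \<in> wF" "pres_highest wn wr \<nu> v" "y * v \<notin> wI"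
  have v: "v \<in> wF" using a by (simp add: pres_highest_def)
  have "cl y * cl v \<noteq> 0" using a v by (simp add: cl_mult cl_zero fa_closed)
  then obtain b where b: "b * (cl y * cl v) = cl v" using W.highest_simple cl_highest[OF v] a by blast
  have "cl (rp b * (y * v)) = b * (cl y * cl v)" using a v rp by (simp add: fa_closed flip: cl_mult)
  then have "rp b * (y * v) - v \<in> wI" using b a v rp by (subst cl_eq[symmetric]) (auto intro: fa_closed)
  then show "\<exists>b\<in>wF. b * (y * v) - v \<in> wI" using rp by blast
next
  fix \<nu> v assume "pres_highest wn wr \<nu> v"
  then have h: "W.highest \<nu> (cl v)" using cl_highest by (simp add: pres_highest_def)
  then show "dom_wt wn \<nu>" by (rule W.highest_dominant)
  show "tensor_wt wn wr \<nu>" using h W.wt_tensor_wt by (auto simp: W.highest_def)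
qed

theorem pres_reducible: "3 \<le> n \<Longrightarrow> pres_reducible n r"
  using worst(2) pres_reducible_worst by blast

section \<open>Highest weight vectors among tensors\<close>

definition has_highest :: "nat \<Rightarrow> nat \<Rightarrow> (nat \<Rightarrow> rat) \<Rightarrow> bool" where
  "has_highest n r \<nu> \<longleftrightarrow> (\<exists>t\<in>tensors n r. t \<noteq> (\<lambda>_. 0) \<and>
    (\<forall>i<n. TA n r (emat n i) t = (\<lambda>_. 0) \<and> TA n r (hmat n i) t = (\<lambda>w. \<nu> i * t w)))"

lemma has_highest_cong: "has_highest n r \<nu> \<Longrightarrow> (\<And>i. i < n \<Longrightarrow> \<nu> i = \<mu> i) \<Longrightarrow> has_highest n r \<mu>"
  unfolding has_highest_def by (metis (no_types, lifting))

lemma TA_closed: "TA n r X t \<in> tensors n r"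
  by (simp add: TA_def tensor_act_closed)

section \<open>Products of highest weight vectors\<close>

definition tprod :: "nat \<Rightarrow> (nat list \<Rightarrow> rat) \<Rightarrow> (nat list \<Rightarrow> rat) \<Rightarrow> nat list \<Rightarrow> rat" where
  "tprod a t s = (\<lambda>w. t (take a w) * s (drop a w))"

lemma tensor_index_split:
  "w \<in> tensor_index n (a + b) \<longleftrightarrow> take a w \<in> tensor_index n a \<and> drop a w \<in> tensor_index n b"
proof -
  have "set w = set (take a w) \<union> set (drop a w)" by (metis append_take_drop_id set_append)
  then show ?thesis by (auto simp: tensor_index_def)
qed

lemma tprod_closed: "t \<in> tensors n a \<Longrightarrow> s \<in> tensors n b \<Longrightarrow> tprod a t s \<in> tensors n (a + b)"
  by (auto simp: tensors_def tprod_def tensor_index_split)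

lemma TA_tprod:
  assumes t: "t \<in> tensors n a" and s: "s \<in> tensors n b"
  shows "TA n (a + b) X (tprod a t s) = (\<lambda>w. tprod a (TA n a X t) s w + tprod a t (TA n b X s) w)"
proof
  fix w
  show "TA n (a + b) X (tprod a t s) w = tprod a (TA n a X t) s w + tprod a t (TA n b X s) w"
  proof (cases "w \<in> tensor_index n (a + b)")
    case True
    then have ix: "take a w \<in> tensor_index n a" "drop a w \<in> tensor_index n b" and len: "length w = a + b"
      using tensor_index_split by (auto simp: tensor_index_def)
    let ?f = "\<lambda>k. \<Sum>j<2 * n. X (w ! k) j * tprod a t s (w[k := j])"
    have "TA n (a + b) X (tprod a t s) w = sum ?f {0..<a} + sum ?f {a..<a + b}"
      using True by (simp add: TA_eq lessThan_atLeast0 sum.atLeastLessThan_concat)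
    also have "sum ?f {a..<a + b} = (\<Sum>k=0..<b. ?f (k + a))"
      using sum.shift_bounds_nat_ivl[of ?f 0 a b] by (simp add: add.commute)
    also have "sum ?f {0..<a} = TA n a X t (take a w) * s (drop a w)"
      unfolding TA_eq[OF ix(1)] lessThan_atLeast0 sum_distrib_right
      by (intro sum.cong refl) (simp add: tprod_def take_update_swap mult.assoc)
    also have "(\<Sum>k=0..<b. ?f (k + a)) = t (take a w) * TA n b X s (drop a w)"
      unfolding TA_eq[OF ix(2)] lessThan_atLeast0 sum_distrib_left
      by (intro sum.cong refl) (simp add: tprod_def drop_update_swap len add.commute mult.left_commute)
    finally show ?thesis by (simp add: tprod_def)
  next
    case False
    then have z: "u w = 0" if "u \<in> tensors n (a + b)" for u using that by (auto simp: tensors_def)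
    show ?thesis
      using z[OF TA_closed, of X "tprod a t s"] z[OF tprod_closed[OF TA_closed s], of X t]
        z[OF tprod_closed[OF t TA_closed], of X s] by simp
  qed
qed

lemma has_highest_add:
  assumes "has_highest n a \<nu>" "has_highest n b \<mu>"
  shows "has_highest n (a + b) (\<lambda>i. \<nu> i + \<mu> i)"
proof -
  obtain t where t: "t \<in> tensors n a" "t \<noteq> (\<lambda>_. 0)"
    "\<And>i. i < n \<Longrightarrow> TA n a (emat n i) t = (\<lambda>_. 0)" "\<And>i. i < n \<Longrightarrow> TA n a (hmat n i) t = (\<lambda>w. \<nu> i * t w)"
    using assms(1) unfolding has_highest_def by blast
  obtain s where s: "s \<in> tensors n b" "s \<noteq> (\<lambda>_. 0)"
    "\<And>i. i < n \<Longrightarrow> TA n b (emat n i) s = (\<lambda>_. 0)" "\<And>i. i < n \<Longrightarrow> TA n b (hmat n i) s = (\<lambda>w. \<mu> i * s w)"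
    using assms(2) unfolding has_highest_def by blast
  obtain v w where vw: "t v \<noteq> 0" "s w \<noteq> 0" using t(2) s(2) by (auto simp: fun_eq_iff)
  then have "length v = a" using t(1) by (auto simp: tensors_def tensor_index_def)
  then have "tprod a t s (v @ w) \<noteq> 0" using vw by (simp add: tprod_def)
  then have "tprod a t s \<noteq> (\<lambda>_. 0)" by auto
  then show ?thesis
    unfolding has_highest_def
    by (intro bexI[of _ "tprod a t s"] conjI)
       (auto simp: TA_tprod[OF t(1) s(1)] t s tprod_closed, simp_all add: tprod_def algebra_simps)
qed

lemma has_highest_zero: "has_highest n 0 (\<lambda>_. 0)"
proof -
  let ?t = "\<lambda>w. if w = [] then 1 else 0 :: rat"
  have "?t \<in> tensors n 0" by (simp add: tensors_def tensor_index_def)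
  moreover have "?t \<noteq> (\<lambda>_. 0)" by (auto simp: fun_eq_iff)
  moreover have "TA n 0 X ?t = (\<lambda>_. 0)" for X by (rule ext) (simp add: TA_def tensor_act_def)
  ultimately show ?thesis unfolding has_highest_def by (intro bexI[of _ ?t]) simp_all
qed

section \<open>Volume forms and the invariant quadratic tensor\<close>

definition alt_mat :: "nat \<Rightarrow> (nat \<Rightarrow> nat) \<Rightarrow> nat list \<Rightarrow> rat mat" where
  "alt_mat k s w = mat k k (\<lambda>(a, c). dl (w ! a) (s c))"

text \<open>The coordinates of the wedge product of the basis vectors
  \<open>s 0, ..., s (k - 1)\<close>: expanding the determinant of deltas gives the antisymmetrized
  tensor.\<close>

definition alt :: "nat \<Rightarrow> nat \<Rightarrow> (nat \<Rightarrow> nat) \<Rightarrow> nat list \<Rightarrow> rat" where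
  "alt n k s w = (if w \<in> tensor_index n k then det (alt_mat k s w) else 0)"

text \<open>The volume form of a subspace invariant under \<open>X\<close> is multiplied by the trace of \<open>X\<close> on the
  subspace.\<close>

lemma TA_alt:
  assumes s: "inj_on s {..<k}" "\<And>c. c < k \<Longrightarrow> s c < 2 * n"
    and X: "\<And>p c. p < 2 * n \<Longrightarrow> c < k \<Longrightarrow> X p (s c) \<noteq> 0 \<Longrightarrow> p \<in> s ` {..<k}"
  shows "TA n k X (alt n k s) = (\<lambda>w. (\<Sum>c<k. X (s c) (s c)) * alt n k s w)"
proof
  fix w
  show "TA n k X (alt n k s) w = (\<Sum>c<k. X (s c) (s c)) * alt n k s w"
  proof (cases "w \<in> tensor_index n k")
    case False
    then show ?thesis using TA_closed[of n k X "alt n k s"] by (auto simp: alt_def tensors_def)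
  next
    case True
    then have len: "length w = k" by (simp add: tensor_index_def)
    define A where "A = alt_mat k s w"
    have A: "A \<in> carrier_mat k k" by (simp add: A_def alt_mat_def)
    have upd: "w[a := j] \<in> tensor_index n k" if "j < 2 * n" for a j
      using True set_update_subset_insert[of w a j] that by (auto simp: tensor_index_def)
    \<comment> \<open>Replacing letter \<open>a\<close> changes only row \<open>a\<close> of the
      matrix, so the cofactors along this row stay the same in the Laplace expansion.\<close>
    have row: "(\<Sum>j<2 * n. X (w ! a) j * alt n k s (w[a := j])) = (\<Sum>c<k. X (w ! a) (s c) * cofactor A a c)"
      if a: "a < k" for a
    proof -
      have "alt n k s (w[a := j]) = (\<Sum>c<k. dl j (s c) * cofactor A a c)" if j: "j < 2 * n" for j
      proof -
        let ?B = "alt_mat k s (w[a := j])"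
        have "det ?B = (\<Sum>c<k. ?B $$ (a, c) * cofactor ?B a c)"
          by (rule laplace_expansion_row[OF _ a]) (simp add: alt_mat_def)
        also have "\<dots> = (\<Sum>c<k. dl j (s c) * cofactor A a c)"
        proof (intro sum.cong refl)
          fix c assume c: "c \<in> {..<k}"
          have "mat_delete ?B a c = mat_delete A a c"
            by (rule eq_matI) (auto simp: mat_delete_def A_def alt_mat_def len)
          then show "?B $$ (a, c) * cofactor ?B a c = dl j (s c) * cofactor A a c"
            using a c len by (simp add: cofactor_def alt_mat_def)
        qed
        finally show ?thesis using upd[OF j] by (simp add: alt_def)
      qed
      then have "(\<Sum>j<2 * n. X (w ! a) j * alt n k s (w[a := j])) =
          (\<Sum>j<2 * n. \<Sum>c<k. dl j (s c) * (X (w ! a) j * cofactor A a c))"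
        by (intro sum.cong refl) (simp add: sum_distrib_left mult_ac)
      also have "\<dots> = (\<Sum>c<k. \<Sum>j<2 * n. dl j (s c) * (X (w ! a) j * cofactor A a c))"
        by (rule sum.swap)
      also have "\<dots> = (\<Sum>c<k. X (w ! a) (s c) * cofactor A a c)"
        by (intro sum.cong refl sum_dl s) simp
      finally show ?thesis .
    qed
    \<comment> \<open>Invariance of the subspace: if \<open>w ! a\<close> is not among the values of
      \<open>s\<close>, both sides vanish.\<close>
    have entry: "X (w ! a) (s c) = (\<Sum>d<k. A $$ (a, d) * X (s d) (s c))" if a: "a < k" and c: "c < k" for a c
    proof (cases "w ! a \<in> s ` {..<k}")
      case True
      then obtain d where d: "d < k" "w ! a = s d" by auto
      have "(\<Sum>i<k. A $$ (a, i) * X (s i) (s c)) = (\<Sum>i<k. dl d i * X (s i) (s c))"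
        using d a inj_onD[OF s(1)] by (intro sum.cong refl) (auto simp: A_def alt_mat_def dl_def)
      then show ?thesis using sum_dl'[OF d(1)] d(2) by simp
    next
      case False
      then have "A $$ (a, d) = 0" if "d < k" for d using that a by (auto simp: A_def alt_mat_def dl_def)
      moreover have "X (w ! a) (s c) = 0" using X[OF tensor_index_nth[OF \<open>w \<in> _\<close> a] c] False by blast
      ultimately show ?thesis by simp
    qed
    \<comment> \<open>The adjugate identity reduces the double sum over \<open>c\<close> and
      \<open>d\<close> to its diagonal, which leaves the trace.\<close>
    have adj: "(\<Sum>a<k. cofactor A a c * A $$ (a, d)) = dl c d * det A" if cd: "c < k" "d < k" for c d
    proof -
      have "(adj_mat A * A) $$ (c, d) = (\<Sum>a<k. cofactor A a c * A $$ (a, d))"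
        using A adj_mat(1)[OF A] cd by (simp add: scalar_prod_def adj_mat_def lessThan_atLeast0)
      moreover have "(adj_mat A * A) $$ (c, d) = dl c d * det A" using adj_mat(3)[OF A] cd by (simp add: dl_def)
      ultimately show ?thesis by simp
    qed
    have "TA n k X (alt n k s) w = (\<Sum>a<k. \<Sum>c<k. X (w ! a) (s c) * cofactor A a c)"
      using True row by (simp add: TA_eq)
    also have "\<dots> = (\<Sum>a<k. \<Sum>c<k. \<Sum>d<k. X (s d) (s c) * (cofactor A a c * A $$ (a, d)))"
      by (intro sum.cong refl) (simp add: entry sum_distrib_right sum_distrib_left mult_ac)
    also have "\<dots> = (\<Sum>c<k. \<Sum>d<k. \<Sum>a<k. X (s d) (s c) * (cofactor A a c * A $$ (a, d)))"
      by (subst sum.swap) (intro sum.cong refl sum.swap)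
    also have "\<dots> = (\<Sum>c<k. \<Sum>d<k. dl c d * (X (s d) (s c) * det A))"
    proof (intro sum.cong refl)
      fix c d assume "c \<in> {..<k}" "d \<in> {..<k}"
      then show "(\<Sum>a<k. X (s d) (s c) * (cofactor A a c * A $$ (a, d))) = dl c d * (X (s d) (s c) * det A)"
        using adj[of c d] by (simp add: sum_distrib_left[symmetric])
    qed
    also have "\<dots> = (\<Sum>c<k. X (s c) (s c) * det A)"
      by (intro sum.cong refl sum_dl') simp
    finally show ?thesis using True by (simp add: alt_def A_def sum_distrib_right)
  qed
qed

lemma alt_nonzero:
  assumes "inj_on s {..<k}" "\<And>c. c < k \<Longrightarrow> s c < 2 * n"
  shows "alt n k s \<noteq> (\<lambda>_. 0)"
proof -
  have "alt_mat k s (map s [0..<k]) = 1\<^sub>m k"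
    using inj_onD[OF assms(1)] by (intro eq_matI) (auto simp: alt_mat_def dl_def)
  moreover have "map s [0..<k] \<in> tensor_index n k" using assms(2) by (auto simp: tensor_index_def)
  ultimately have "alt n k s (map s [0..<k]) = 1" by (simp add: alt_def)
  then show ?thesis by auto
qed

text \<open>The matrices \<open>emat n i\<close> have zero diagonal, so the trace in
  \<open>TA_alt\<close> vanishes for them; for \<open>hmat n i\<close> it is the weight.\<close>

lemma has_highest_alt:
  assumes s: "inj_on s {..<k}" "\<And>c. c < k \<Longrightarrow> s c < 2 * n"
    and e: "\<And>i p c. i < n \<Longrightarrow> p < 2 * n \<Longrightarrow> c < k \<Longrightarrow> emat n i p (s c) \<noteq> 0 \<Longrightarrow> p \<in> s ` {..<k}"
    and n: "3 \<le> n"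
  shows "has_highest n k (\<lambda>i. \<Sum>c<k. dl (s c) i - dl (s c) (i + n))"
proof -
  have h: "hmat n i p q = dl q p * (dl p i - dl p (i + n))" if "i < n" for i p q
    using that by (auto simp: hmat_def Gm_def bar_def dl_def)
  have "emat n i p p = 0" if "i < n" for i p
    using that n by (auto simp: emat_def Gm_def dl_def bar_def)
  then have "TA n k (emat n i) (alt n k s) = (\<lambda>_. 0)" if "i < n" for i
    using that by (subst TA_alt[OF s e]) auto
  moreover have "TA n k (hmat n i) (alt n k s) = (\<lambda>w. (\<Sum>c<k. dl (s c) i - dl (s c) (i + n)) * alt n k s w)"
    if "i < n" for i
  proof -
    have "p \<in> s ` {..<k}" if "c < k" "hmat n i p (s c) \<noteq> 0" for p c
      using that h[OF \<open>i < n\<close>, of p "s c"] by (cases "s c = p") (auto simp: dl_def)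
    then show ?thesis using h[OF that] by (subst TA_alt[OF s]) (auto simp: dl_def intro!: sum.cong)
  qed
  moreover have "alt n k s \<in> tensors n k" by (auto simp: alt_def tensors_def)
  ultimately show ?thesis
    unfolding has_highest_def using alt_nonzero[OF s] by (intro bexI[of _ "alt n k s"]) auto
qed

text \<open>The first \<open>k\<close> basis vectors span a subspace stable under all
  \<open>emat n i\<close>.\<close>

lemma has_highest_fundamental:
  assumes "3 \<le> n" "k \<le> n"
  shows "has_highest n k (\<lambda>i. if i < k then 1 else 0)"
proof -
  have "has_highest n k (\<lambda>i. \<Sum>c<k. dl (id c) i - dl (id c) (i + n))"
  proof (rule has_highest_alt)
    fix i p c assume *: "i < n" "p < 2 * n" "c < k" "emat n i p (id c) \<noteq> 0"
    have "c \<noteq> 2 * n - 1" "c \<noteq> bar n (n - 2)" "c \<noteq> bar n i"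
      using * assms by (auto simp: bar_def)
    then show "p \<in> id ` {..<k}"
      using * assms by (auto simp: emat_def Gm_def dl_def split: if_splits)
  qed (use assms in auto)
  then show ?thesis
  proof (rule has_highest_cong)
    fix i assume i: "i < n"
    have "(\<Sum>c<k. dl (id c) i - dl (id c) (i + n)) = (\<Sum>c<k. dl i c * 1)"
      using assms(2) by (intro sum.cong refl) (auto simp: dl_def)
    also have "\<dots> = (if i < k then 1 else 0)"
      using sum_dl'[of i k "\<lambda>_. 1"] by (auto simp: dl_def)
    finally show "(\<Sum>c<k. dl (id c) i - dl (id c) (i + n)) = (if i < k then 1 else 0)" .
  qed
qed

text \<open>The other half-dimensional isotropic subspace, in which the basis vector
  \<open>n - 1\<close> is replaced by its partner \<open>2 * n - 1\<close>. It accounts for dominant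
  weights with negative last coordinate.\<close>

lemma has_highest_fundamental':
  assumes n: "3 \<le> n"
  shows "has_highest n n (\<lambda>i. if i < n - 1 then 1 else - 1)"
proof -
  let ?s = "\<lambda>c. if c < n - 1 then c else 2 * n - 1"
  have im: "?s ` {..<n} = insert (2 * n - 1) {..<n - 1}"
  proof -
    have "{..<n} = insert (n - 1) {..<n - 1}" using n by auto
    moreover have "?s ` {..<n - 1} = (\<lambda>c. c) ` {..<n - 1}" by (intro image_cong refl) simp
    ultimately show ?thesis by (simp only: image_insert image_ident less_irrefl if_False)
  qed
  have "has_highest n n (\<lambda>i. \<Sum>c<n. dl (?s c) i - dl (?s c) (i + n))"
  proof (rule has_highest_alt)
    show "inj_on ?s {..<n}" using n by (auto simp: inj_on_def)
    fix i p c assume *: "i < n" "p < 2 * n" "c < n" "emat n i p (?s c) \<noteq> 0"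
    define q where "q = ?s c"
    have eq: "emat n i p q \<noteq> 0" using *(4) unfolding q_def .
    have q: "q < n - 1 \<or> q = 2 * n - 1" using * by (auto simp: q_def)
    have "p < n - 1"
    proof (cases "i + 1 < n")
      case True
      then have "q \<noteq> bar n i" using q n by (auto simp: bar_def)
      then have "q = i + 1" "p = i" using eq True by (auto simp: emat_def Gm_def dl_def split: if_splits)
      then show ?thesis using True by simp
    next
      case False
      have "q \<noteq> bar n (n - 2)" using q n by (auto simp: bar_def)
      then have "p = n - 2" using eq False by (auto simp: emat_def Gm_def dl_def split: if_splits)
      then show ?thesis using n by simp
    qed
    then show "p \<in> ?s ` {..<n}" unfolding im by simp
  qed (use n in auto)
  then show ?thesis
  proof (rule has_highest_cong)
    fix i assume i: "i < n"
    have "(\<Sum>c<n. dl (?s c) i - dl (?s c) (i + n)) = (\<Sum>c<n. dl i c * (if c < n - 1 then 1 else - 1))"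
    proof (intro sum.cong refl)
      fix c assume "c \<in> {..<n}"
      then show "dl (?s c) i - dl (?s c) (i + n) = dl i c * (if c < n - 1 then 1 else - 1)"
        using i n by (auto simp: dl_def)
    qed
    also have "\<dots> = (if i < n - 1 then 1 else - 1)" by (rule sum_dl'[OF i])
    finally show "(\<Sum>c<n. dl (?s c) i - dl (?s c) (i + n)) = (if i < n - 1 then 1 else - 1)" .
  qed
qed

lemma Gm_skew:
  assumes "a < 2 * n" "b < 2 * n" "p < 2 * n" "q < 2 * n"
  shows "Gm n a b p q = - Gm n a b (bar n q) (bar n p)"
proof -
  have "dl (bar n q) a = dl q (bar n a)" "dl (bar n p) b = dl p (bar n b)"
    "dl (bar n q) (bar n b) = dl q b" "dl (bar n p) (bar n a) = dl p a"
    using assms bar_swap bar_eq_iff by (auto simp: dl_def)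
  then show ?thesis by (simp add: Gm_def)
qed

text \<open>The sum of all products of a basis vector with its partner, dual to the bilinear form.
  It is killed because the matrices are skew for the form, and it fills two tensor factors without
  changing the weight.\<close>

lemma has_highest_invariant:
  assumes n: "3 \<le> n" shows "has_highest n 2 (\<lambda>_. 0)"
proof -
  let ?t = "\<lambda>w. if w \<in> tensor_index n 2 \<and> w ! 1 = bar n (w ! 0) then 1 else 0 :: rat"
  have "TA n 2 (Gm n a b) ?t w = 0" if ab: "a < 2 * n" "b < 2 * n" for a b w
  proof (cases "w \<in> tensor_index n 2")
    case False
    then show ?thesis using TA_closed[of n 2 "Gm n a b" ?t] by (auto simp: tensors_def)
  next
    case True
    then obtain p q where w: "w = [p, q]" "p < 2 * n" "q < 2 * n"
      by (auto simp: tensor_index_def numeral_2_eq_2 length_Suc_conv)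
    have "TA n 2 (Gm n a b) ?t w = (\<Sum>j<2 * n. Gm n a b p j * ?t [j, q]) + (\<Sum>j<2 * n. Gm n a b q j * ?t [p, j])"
      using True by (simp add: TA_eq w numeral_2_eq_2)
    also have "(\<Sum>j<2 * n. Gm n a b p j * ?t [j, q]) = (\<Sum>j<2 * n. dl j (bar n q) * Gm n a b p j)"
      using w bar_swap[of _ n q] by (intro sum.cong refl) (auto simp: tensor_index_def dl_def bar_bar)
    also have "\<dots> = Gm n a b p (bar n q)" by (intro sum_dl bar_lt w)
    also have "(\<Sum>j<2 * n. Gm n a b q j * ?t [p, j]) = (\<Sum>j<2 * n. dl j (bar n p) * Gm n a b q j)"
      using w by (intro sum.cong refl) (auto simp: tensor_index_def dl_def)
    also have "\<dots> = Gm n a b q (bar n p)" by (intro sum_dl bar_lt w)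
    also have "Gm n a b q (bar n p) = - Gm n a b p (bar n q)"
      using Gm_skew[OF ab w(3) bar_lt[OF w(2)]] w by (simp add: bar_bar)
    finally show ?thesis by simp
  qed
  then have "TA n 2 (emat n i) ?t = (\<lambda>_. 0)" "TA n 2 (hmat n i) ?t = (\<lambda>_. 0)" if "i < n" for i
    using that n by (auto simp: emat_def hmat_def fun_eq_iff)
  moreover have "?t \<in> tensors n 2" by (auto simp: tensors_def)
  moreover have "?t [0, n] = 1" using n by (simp add: tensor_index_def bar_def)
  then have "?t \<noteq> (\<lambda>_. 0)" by (metis zero_neq_one)
  ultimately show ?thesis unfolding has_highest_def by (intro bexI[of _ ?t]) auto
qed

text \<open>Dominance in coordinates: they decrease, and up to index \<open>n - 2\<close> each of
  them bounds the absolute values of itself and all later ones. The excepted case is the last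
  coordinate itself, which may be negative.\<close>

lemma dominant_chain:
  assumes "dom_wt n \<nu>" "j \<le> k" "k < n" "2 \<le> n"
  shows "\<nu> k \<le> \<nu> j" "\<bar>\<nu> k\<bar> \<le> \<nu> j \<or> (j = k \<and> k = n - 1)"
proof -
  have step: "\<nu> (Suc i) \<le> \<nu> i" if "Suc i < n" for i
    using assms(1) that unfolding dom_wt_def copair_def by (metis Suc_eq_plus1 Suc_lessD diff_ge_0_iff_ge)
  have mono: "i \<le> l \<Longrightarrow> l < n \<Longrightarrow> \<nu> l \<le> \<nu> i" for i l
  proof (induction rule: dec_induct)
    case (step m)
    then show ?case using \<open>\<And>i. Suc i < n \<Longrightarrow> _\<close>[of m] by simp
  qed simp
  show "\<nu> k \<le> \<nu> j" using mono assms by blast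
  have last: "\<nu> (n - 2) + \<nu> (n - 1) \<ge> 0"
    using assms(1,4) unfolding dom_wt_def copair_def by (auto dest: spec[of _ "n - 1"])
  have "\<nu> (n - 1) \<le> \<nu> (n - 2)" by (rule mono) (use assms(4) in auto)
  then have pos: "\<nu> (n - 2) \<ge> 0" using last by linarith
  show "\<bar>\<nu> k\<bar> \<le> \<nu> j \<or> (j = k \<and> k = n - 1)"
  proof (cases "k = n - 1")
    case True
    show ?thesis
    proof (cases "j = k")
      case False
      then have "\<nu> (n - 2) \<le> \<nu> j" using mono[of j "n - 2"] True assms by simp
      then show ?thesis using last mono[of j k] assms True by auto
    qed (use True in simp)
  next
    case False
    then have "k \<le> n - 2" "n - 2 < n" using assms by linarith+
    then have "\<nu> k \<ge> 0" using mono[of k "n - 2"] pos by simp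
    then show ?thesis using mono[of j k] assms by auto
  qed
qed

text \<open>Induction on the sum of the absolute values: the weight \<omega> of a volume form on the
  support of \<nu> is split off. This lowers each nonzero coordinate by 1 in absolute value and uses
  up as many tensor factors as there are such coordinates.\<close>

lemma has_highest_exact:
  assumes n: "3 \<le> n"
  shows "dom_wt n \<nu> \<Longrightarrow> (\<And>i. i < n \<Longrightarrow> \<nu> i \<in> \<int>) \<Longrightarrow> (\<Sum>i<n. \<bar>\<nu> i\<bar>) = of_nat N \<Longrightarrow> has_highest n N \<nu>"
proof (induction N arbitrary: \<nu> rule: less_induct)
  case (less N)
  note dom = less.prems(1) and int = less.prems(2)
  have n2: "2 \<le> n" using n by simp
  show ?case
  proof (cases "\<nu> 0 = 0")
    case True
    have z: "\<nu> i = 0" if "i < n" for i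
      using dominant_chain(2)[OF dom, of 0 i] that True n by auto
    then have "N = 0" using less.prems(3) by simp
    then show ?thesis using has_highest_cong[OF has_highest_zero] z by metis
  next
    case False
    \<comment> \<open>By dominance the nonzero coordinates form an initial segment, and
      \<open>k\<close> is its length.\<close>
    define k where "k = (LEAST k. k = n \<or> \<nu> k = 0)"
    have k: "k = n \<or> \<nu> k = 0" unfolding k_def by (rule LeastI[of _ n]) simp
    have kn: "k \<le> n" unfolding k_def by (rule Least_le) simp
    have below: "\<nu> j \<noteq> 0" if "j < k" for j using not_less_Least[of j] that unfolding k_def by blast
    have k0: "0 < k" using False k n by (cases k) auto
    have above: "\<nu> j = 0" if "k \<le> j" "j < n" for j
      using dominant_chain(2)[OF dom that n2] k that by auto
    have ge1: "\<nu> j \<ge> 1" if "j < k" "j < n - 1 \<or> \<nu> j > 0" for j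
    proof -
      have "\<nu> j \<ge> 0" using dominant_chain(2)[OF dom order.refl _ n2, of j] that kn by auto
      then have "\<nu> j > 0" using below[OF that(1)] by simp
      moreover have "\<nu> j \<in> \<int>" using int that(1) kn by simp
      ultimately show ?thesis by (auto elim!: Ints_cases)
    qed
    have cop: "copair n \<nu> i \<ge> 0" if "i < n" for i using dom that by (simp add: dom_wt_def)
    \<comment> \<open>The last coordinate of \<omega> has to follow the sign of that of \<nu>; this
      decides which of the two half-dimensional subspaces is used.\<close>
    define \<omega> where "\<omega> = (\<lambda>i. if k = n \<and> \<nu> (n - 1) < 0 then (if i < n - 1 then 1 else - 1) else (if i < k then 1 else 0) :: rat)"
    have \<omega>: "has_highest n k \<omega>"
    proof (cases "k = n \<and> \<nu> (n - 1) < 0")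
      case True
      then have "\<omega> = (\<lambda>i. if i < n - 1 then 1 else - 1)" by (simp add: \<omega>_def)
      then show ?thesis using has_highest_fundamental'[OF n] True by simp
    next
      case False
      then have "\<omega> = (\<lambda>i. if i < k then 1 else 0)" unfolding \<omega>_def by (simp only: if_False)
      then show ?thesis using has_highest_fundamental[OF n kn] by simp
    qed
    define \<mu> where "\<mu> i = \<nu> i - \<omega> i" for i
    have last: "\<nu> (n - 1) \<le> -1" if "k = n" "\<nu> (n - 1) < 0"
      using that int[of "n - 1"] n by (auto elim!: Ints_cases)
    have abs: "\<bar>\<mu> i\<bar> = \<bar>\<nu> i\<bar> - \<bar>\<omega> i\<bar>" "\<bar>\<omega> i\<bar> = (if i < k then 1 else 0)" if i: "i < n" for i
    proof -
      show "\<bar>\<omega> i\<bar> = (if i < k then 1 else 0)" using i by (auto simp: \<omega>_def)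
      consider "k \<le> i" | "i < k" "i = n - 1" "\<nu> (n - 1) < 0" | "i < k" "i < n - 1 \<or> \<nu> i > 0"
        using i below[of i] by (cases "i = n - 1"; force)
      then show "\<bar>\<mu> i\<bar> = \<bar>\<nu> i\<bar> - \<bar>\<omega> i\<bar>"
      proof cases
        case 1
        then show ?thesis using above i by (auto simp: \<mu>_def \<omega>_def)
      next
        case 2
        then have "k = n" using kn by simp
        then show ?thesis using 2 last by (auto simp: \<mu>_def \<omega>_def)
      next
        case 3
        then have "i < n - 1 \<or> \<not> \<nu> (n - 1) < 0" using i by (cases "i = n - 1") auto
        then have "\<omega> i = 1" using 3 by (auto simp: \<omega>_def)
        then show ?thesis using ge1[OF 3] by (simp add: \<mu>_def)
      qed
    qed
    have "(\<Sum>i<n. \<bar>\<omega> i\<bar>) = of_nat k"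
    proof -
      have "(\<Sum>i<n. \<bar>\<omega> i\<bar>) = (\<Sum>i<k. \<bar>\<omega> i\<bar>)"
        using kn abs(2) by (intro sum.mono_neutral_right) auto
      also have "\<dots> = (\<Sum>i<k. 1)" using kn abs(2) by (intro sum.cong refl) auto
      finally show ?thesis by simp
    qed
    then have sum: "(\<Sum>i<n. \<bar>\<mu> i\<bar>) = of_nat N - of_nat k"
      using less.prems(3) by (simp add: abs(1) sum_subtractf)
    moreover have "(\<Sum>i<n. \<bar>\<mu> i\<bar>) \<ge> 0" by (rule sum_nonneg) simp
    ultimately have "k \<le> N" by simp
    have "has_highest n (N - k) \<mu>"
    proof (rule less.IH)
      show "N - k < N" using k0 \<open>k \<le> N\<close> by simp
      show "\<mu> i \<in> \<int>" if "i < n" for i using int[OF that] by (auto simp: \<mu>_def \<omega>_def)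
      show "(\<Sum>i<n. \<bar>\<mu> i\<bar>) = of_nat (N - k)" using sum \<open>k \<le> N\<close> by (simp add: of_nat_diff)
      \<comment> \<open>Subtracting \<omega> lowers a pairing only at the end of the support. The
        nonzero coordinates involved there are integers, hence at least 1 in absolute value, and
        this leaves enough room.\<close>
      show "dom_wt n \<mu>"
        unfolding dom_wt_def
      proof (intro allI impI)
        fix i assume i: "i < n"
        show "0 \<le> copair n \<mu> i"
        proof (cases "k = n \<and> \<nu> (n - 1) < 0")
          case True
          then have "\<nu> (n - 2) \<ge> 1" "\<nu> (n - 1) \<le> - 1" using ge1[of "n - 2"] last diff_less_mono2[of 1 2 n] n by auto
          consider "i + 2 < n" | "i = n - 2" "i + 1 = n - 1" "i + 1 < n" | "i = n - 1" "\<not> i + 1 < n"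
            using i n by linarith
          then show ?thesis
          proof cases
            case 1
            then show ?thesis using cop[OF i] True by (simp add: copair_def \<mu>_def \<omega>_def)
          next
            case 2
            have "copair n \<mu> i = \<mu> (n - 2) - \<mu> (n - 1)" using 2 unfolding copair_def by metis
            moreover have "\<mu> (n - 2) = \<nu> (n - 2) - 1" "\<mu> (n - 1) = \<nu> (n - 1) + 1"
              using True 2 by (auto simp: \<mu>_def \<omega>_def)
            ultimately show ?thesis using \<open>\<nu> (n - 2) \<ge> 1\<close> \<open>\<nu> (n - 1) \<le> - 1\<close> by simp
          next
            case 3
            have "\<mu> (n - 2) = \<nu> (n - 2) - 1" "\<mu> (n - 1) = \<nu> (n - 1) + 1"
              using True n by (auto simp: \<mu>_def \<omega>_def)
            then show ?thesis using 3 cop[OF i] by (simp add: copair_def)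
          qed
        next
          case False
          show ?thesis
          proof (cases "i + 1 < n")
            case True
            show ?thesis
            proof (cases "i + 1 = k")
              case eq: True
              then have "\<nu> i \<ge> 1" "\<nu> (i + 1) = 0" using ge1[of i] above[of "i + 1"] True less_diff_conv[of i n 1] by auto
              then show ?thesis using True False eq by (auto simp: copair_def \<mu>_def \<omega>_def)
            next
              case ne: False
              then show ?thesis using cop[OF i] True False by (auto simp: copair_def \<mu>_def \<omega>_def)
            qed
          next
            case last: False
            consider "k = n" | "k = n - 1" | "k < n - 1" using kn by linarith
            then show ?thesis
            proof cases
              case 1
              then have "\<nu> (n - 1) > 0" using False below[of "n - 1"] n by force
              then have "\<nu> (n - 1) \<ge> 1" "\<nu> (n - 2) \<ge> 1" using ge1[of "n - 1"] ge1[of "n - 2"] diff_less_mono2[of 1 2 n] 1 n by auto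
              then show ?thesis using last False 1 n by (auto simp: copair_def \<mu>_def \<omega>_def)
            next
              case 2
              then have "\<nu> (n - 1) = 0" "\<nu> (n - 2) \<ge> 1" using above[of "n - 1"] ge1[of "n - 2"] diff_less_mono2[of 1 2 n] n by auto
              then show ?thesis using last False 2 n by (auto simp: copair_def \<mu>_def \<omega>_def)
            next
              case 3
              then show ?thesis using last False cop[OF i] n by (auto simp: copair_def \<mu>_def \<omega>_def)
            qed
          qed
        qed
      qed
    qed
    from has_highest_add[OF \<omega> this] have "has_highest n N (\<lambda>i. \<omega> i + \<mu> i)" using \<open>k \<le> N\<close> by simp
    then show ?thesis by (simp add: \<mu>_def)
  qed
qed

text \<open>With the signs of \<nu> in (D7), the sum of the absolute values is
  \<open>2 * k - r\<close>: at most \<open>r\<close> and of the same parity. The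
  \<open>2 * (r - k)\<close> remaining factors are filled with \<open>r - k\<close> copies of the
  invariant tensor.\<close>

theorem has_highest_dominant:
  assumes n: "3 \<le> n" and dom: "dom_wt n \<nu>" and wt: "tensor_wt n r \<nu>"
  shows "has_highest n r \<nu>"
proof -
  define \<sigma> :: "nat \<Rightarrow> int" where "\<sigma> i = (if \<nu> i < 0 then - 1 else 1)" for i
  have "(\<Sum>i<n. of_int (\<sigma> i) * \<nu> i) = (\<Sum>i<n. \<bar>\<nu> i\<bar>)" by (intro sum.cong) (auto simp: \<sigma>_def)
  moreover have "\<forall>i<n. \<sigma> i \<in> {1, - 1}" by (simp add: \<sigma>_def)
  ultimately obtain k where k: "k \<le> r" "(\<Sum>i<n. \<bar>\<nu> i\<bar>) = 2 * of_nat k - of_nat r"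
    using wt unfolding tensor_wt_def by metis
  have "(\<Sum>i<n. \<bar>\<nu> i\<bar>) \<ge> 0" by (rule sum_nonneg) simp
  then have "of_nat r \<le> (of_nat (2 * k) :: rat)" using k(2) by simp
  then have r: "r \<le> 2 * k" unfolding of_nat_le_iff .
  then have "(\<Sum>i<n. \<bar>\<nu> i\<bar>) = of_nat (2 * k - r)" using k(2) by (simp add: of_nat_diff)
  then have base: "has_highest n (2 * k - r) \<nu>"
    using has_highest_exact[OF n dom] wt by (auto simp: tensor_wt_def wt_list_mem)
  have "has_highest n (2 * k - r + 2 * m) \<nu>" for m
  proof (induction m)
    case (Suc m)
    from has_highest_add[OF Suc has_highest_invariant[OF n]] show ?case by (simp add: ac_simps)
  qed (use base in simp)
  moreover have "2 * k - r + 2 * (r - k) = r" using k(1) r by arith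
  ultimately show ?thesis by metis
qed

section \<open>The enveloping algebra\<close>

lemma quot_free_algebra:
  assumes I: "ideal I (free_algebra S)"
  defines "cs \<equiv> \<lambda>p. I +>\<^bsub>free_algebra S\<^esub> p" and "Q \<equiv> quot_alg (free_algebra S) I"
  shows "carrier Q = cs ` carrier (free_algebra S)" "\<one>\<^bsub>Q\<^esub> = cs 1" "\<zero>\<^bsub>Q\<^esub> = cs 0"
    "p \<in> carrier (free_algebra S) \<Longrightarrow> q \<in> carrier (free_algebra S) \<Longrightarrow> cs p \<oplus>\<^bsub>Q\<^esub> cs q = cs (p + q)"
    "p \<in> carrier (free_algebra S) \<Longrightarrow> q \<in> carrier (free_algebra S) \<Longrightarrow> cs p \<otimes>\<^bsub>Q\<^esub> cs q = cs (p * q)"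
    "p \<in> carrier (free_algebra S) \<Longrightarrow> c \<odot>\<^bsub>Q\<^esub> cs p = cs (const c * p)"
proof -
  interpret I: ideal I "free_algebra S" by (rule I)
  show "carrier Q = cs ` carrier (free_algebra S)"
    by (auto simp: Q_def cs_def quot_alg_def FactRing_def A_RCOSETS_def')
  show "\<one>\<^bsub>Q\<^esub> = cs 1"
    by (simp add: Q_def cs_def quot_alg_def FactRing_def free_algebra_ops)
  have "cs 0 = I" by (simp add: cs_def fa_coset)
  then show "\<zero>\<^bsub>Q\<^esub> = cs 0"
    by (simp add: Q_def cs_def quot_alg_def FactRing_def)
  show "cs p \<oplus>\<^bsub>Q\<^esub> cs q = cs (p + q)" "cs p \<otimes>\<^bsub>Q\<^esub> cs q = cs (p * q)"
    if "p \<in> carrier (free_algebra S)" "q \<in> carrier (free_algebra S)" for p q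
    using I.a_rcos_sum[OF that] I.rcoset_mult_add[OF that]
    by (simp_all add: Q_def cs_def quot_alg_def FactRing_def free_algebra_ops)
  show "c \<odot>\<^bsub>Q\<^esub> cs p = cs (const c * p)" if p: "p \<in> carrier (free_algebra S)" for p
  proof -
    \<comment> \<open>The scalar multiple in \<open>quot_alg\<close> is a union over
      representatives; all sets in this union coincide.\<close>
    have 1: "cs (const c * x) = cs (const c * p)" if x: "x \<in> cs p" for x
    proof -
      have "x - p \<in> I" using x by (auto simp: cs_def fa_coset)
      from fa_ideal(6)[OF I const_carrier this, of c] have "const c * x - const c * p \<in> I" by (simp add: right_diff_distrib)
      then show ?thesis unfolding cs_def by (simp add: fa_coset_eq[OF I])
    qed
    have "p \<in> cs p" using fa_ideal(2)[OF I] unfolding cs_def fa_coset by force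
    then have "(\<Union>x\<in>cs p. cs (const c * x)) = cs (const c * p)" by (rule UN_constant_eq) (intro ballI 1)
    then show ?thesis by (simp add: Q_def quot_alg_def free_algebra_ops cs_def)
  qed
qed

abbreviation so_alg :: "nat \<Rightarrow> (rat, rat mat free_monoid \<Rightarrow>\<^sub>0 rat) module" where
  "so_alg n \<equiv> free_algebra (so_even n)"

abbreviation so_ideal :: "nat \<Rightarrow> (rat mat free_monoid \<Rightarrow>\<^sub>0 rat) set" where
  "so_ideal n \<equiv> Idl\<^bsub>so_alg n\<^esub> (uea_rels (so_even n))"

definition ucl :: "nat \<Rightarrow> (rat mat free_monoid \<Rightarrow>\<^sub>0 rat) \<Rightarrow> uea_elem" where
  "ucl n p = so_ideal n +>\<^bsub>so_alg n\<^esub> p"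

lemma ucl_ops:
  shows "carrier (uea n) = ucl n ` carrier (so_alg n)" "\<one>\<^bsub>uea n\<^esub> = ucl n 1" "\<zero>\<^bsub>uea n\<^esub> = ucl n 0"
    "p \<in> carrier (so_alg n) \<Longrightarrow> q \<in> carrier (so_alg n) \<Longrightarrow> ucl n p \<oplus>\<^bsub>uea n\<^esub> ucl n q = ucl n (p + q)"
    "p \<in> carrier (so_alg n) \<Longrightarrow> q \<in> carrier (so_alg n) \<Longrightarrow> ucl n p \<otimes>\<^bsub>uea n\<^esub> ucl n q = ucl n (p * q)"
    "p \<in> carrier (so_alg n) \<Longrightarrow> c \<odot>\<^bsub>uea n\<^esub> ucl n p = ucl n (const c * p)"
  using quot_free_algebra[OF uea_ideal] unfolding uea_def presented_algebra_def ucl_def by metis+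

lemma ucl_eq: "ucl n p = ucl n q \<longleftrightarrow> p - q \<in> so_ideal n"
  unfolding ucl_def by (rule fa_coset_eq[OF uea_ideal])

lemma so_ideal_rels: "p \<in> uea_rels (so_even n) \<Longrightarrow> p \<in> so_ideal n"
  using ring.genideal_self[OF ring_free_algebra uea_rels_carrier] by blast

section \<open>Entries of matrices in \<open>so_even n\<close> and a spanning set\<close>

lemma so_form_index:
  assumes "w \<in> carrier_vec (2 * n)" "a < 2 * n"
  shows "(so_form n *\<^sub>v w) $ a = w $ bar n a"
proof -
  have "(so_form n *\<^sub>v w) $ a = (\<Sum>b<2 * n. so_form n $$ (a, b) * w $ b)"
    using assms by (simp add: so_form_def scalar_prod_def lessThan_atLeast0)
  also have "\<dots> = (\<Sum>b<2 * n. dl b (bar n a) * w $ b)"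
    using assms(2) by (intro sum.cong refl) (auto simp: so_form_def bar_def dl_def)
  finally show ?thesis using sum_dl[OF bar_lt[OF assms(2)]] by simp
qed

lemma so_even_pairing:
  assumes X: "X \<in> carrier_mat (2 * n) (2 * n)" and v: "v \<in> carrier_vec (2 * n)" and w: "w \<in> carrier_vec (2 * n)"
  shows "(X *\<^sub>v v) \<bullet> (so_form n *\<^sub>v w) + v \<bullet> (so_form n *\<^sub>v (X *\<^sub>v w)) =
    (\<Sum>q<2 * n. \<Sum>p<2 * n. v $ q * w $ p * (X $$ (bar n p, q) + X $$ (bar n q, p)))"
proof -
  have S: "dim_row (so_form n) = 2 * n" by (simp add: so_form_def)
  have Xu: "(X *\<^sub>v u) $ a = (\<Sum>b<2 * n. X $$ (a, b) * u $ b)" if "a < 2 * n" "u \<in> carrier_vec (2 * n)" for u a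
    using that X by (simp add: scalar_prod_def lessThan_atLeast0)
  have Xw: "X *\<^sub>v w \<in> carrier_vec (2 * n)" using X w by (rule mult_mat_vec_carrier)
  have bb: "bij_betw (bar n) {..<2 * n} {..<2 * n}"
    by (rule bij_betw_byWitness[where f' = "bar n"]) (auto simp: bar_bar bar_lt)
  have "(X *\<^sub>v v) \<bullet> (so_form n *\<^sub>v w) = (\<Sum>a<2 * n. (X *\<^sub>v v) $ a * w $ bar n a)"
    using w X by (simp add: scalar_prod_def lessThan_atLeast0 S so_form_index del: index_mult_mat_vec)
  also have "\<dots> = (\<Sum>p<2 * n. (X *\<^sub>v v) $ bar n p * w $ bar n (bar n p))"
    by (rule sum.reindex_bij_betw[OF bb, symmetric])
  also have "\<dots> = (\<Sum>p<2 * n. \<Sum>q<2 * n. v $ q * w $ p * X $$ (bar n p, q))"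
    by (intro sum.cong refl) (simp add: bar_bar Xu[OF bar_lt v] sum_distrib_right sum_distrib_left mult_ac del: index_mult_mat_vec)
  also have "\<dots> = (\<Sum>q<2 * n. \<Sum>p<2 * n. v $ q * w $ p * X $$ (bar n p, q))" by (rule sum.swap)
  finally have 1: "(X *\<^sub>v v) \<bullet> (so_form n *\<^sub>v w) = \<dots>" .
  have "v \<bullet> (so_form n *\<^sub>v (X *\<^sub>v w)) = (\<Sum>q<2 * n. v $ q * (X *\<^sub>v w) $ bar n q)"
    using so_form_index[OF Xw] by (simp add: scalar_prod_def lessThan_atLeast0 S del: index_mult_mat_vec)
  also have "\<dots> = (\<Sum>q<2 * n. \<Sum>p<2 * n. v $ q * w $ p * X $$ (bar n q, p))"
    by (intro sum.cong refl) (simp add: Xu[OF bar_lt w] sum_distrib_left mult_ac del: index_mult_mat_vec)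
  finally show ?thesis unfolding 1 by (simp add: sum.distrib distrib_left)
qed

text \<open>Testing invariance on the unit vectors \<open>q\<close> and \<open>bar n p\<close>
  isolates one equation between two entries; conversely the pairing is a combination of such
  equations.\<close>

lemma so_even_iff:
  "X \<in> so_even n \<longleftrightarrow> X \<in> carrier_mat (2 * n) (2 * n) \<and>
    (\<forall>p<2 * n. \<forall>q<2 * n. X $$ (p, q) = - X $$ (bar n q, bar n p))"
proof (cases "X \<in> carrier_mat (2 * n) (2 * n)")
  case X: True
  have "(\<forall>p<2 * n. \<forall>q<2 * n. X $$ (p, q) = - X $$ (bar n q, bar n p))"
    if so: "X \<in> so_even n"
  proof (intro allI impI)
    fix p q assume pq: "p < 2 * n" "q < 2 * n"
    let ?v = "unit_vec (2 * n) q" and ?w = "unit_vec (2 * n) (bar n p)"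
    have "(X *\<^sub>v ?v) \<bullet> (so_form n *\<^sub>v ?w) + ?v \<bullet> (so_form n *\<^sub>v (X *\<^sub>v ?w)) = 0"
      using so unit_vec_carrier unfolding so_even_def by blast
    then have "0 = (\<Sum>b<2 * n. \<Sum>a<2 * n. ?v $ b * ?w $ a * (X $$ (bar n a, b) + X $$ (bar n b, a)))"
      using so_even_pairing[OF X, of ?v ?w] by simp
    also have "\<dots> = (\<Sum>b<2 * n. dl b q * (\<Sum>a<2 * n. dl a (bar n p) * (X $$ (bar n a, b) + X $$ (bar n b, a))))"
      using pq bar_lt[OF pq(1)] unfolding sum_distrib_left by (intro sum.cong refl) (auto simp: dl_def)
    also have "\<dots> = X $$ (bar n (bar n p), q) + X $$ (bar n q, bar n p)"
      unfolding sum_dl[OF pq(2)] sum_dl[OF bar_lt[OF pq(1)]] ..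
    finally show "X $$ (p, q) = - X $$ (bar n q, bar n p)" using pq by (simp add: bar_bar)
  qed
  moreover have "X \<in> so_even n"
    if sk: "\<And>p q. p < 2 * n \<Longrightarrow> q < 2 * n \<Longrightarrow> X $$ (p, q) = - X $$ (bar n q, bar n p)"
    unfolding so_even_def
  proof (intro CollectI conjI ballI X)
    fix v w :: "rat vec" assume vw: "v \<in> carrier_vec (2 * n)" "w \<in> carrier_vec (2 * n)"
    have "X $$ (bar n p, q) + X $$ (bar n q, p) = 0" if "p < 2 * n" "q < 2 * n" for p q
      using sk[OF bar_lt[OF that(1)] that(2)] that by (simp add: bar_bar)
    then show "(X *\<^sub>v v) \<bullet> (so_form n *\<^sub>v w) + v \<bullet> (so_form n *\<^sub>v (X *\<^sub>v w)) = 0"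
      unfolding so_even_pairing[OF X vw] by (intro sum.neutral ballI) simp
  qed
  ultimately show ?thesis using X by blast
qed (auto simp: so_even_def)

lemma so_even_Gm: "a < 2 * n \<Longrightarrow> b < 2 * n \<Longrightarrow> MT n (Gm n a b) \<in> so_even n"
proof -
  assume ab: "a < 2 * n" "b < 2 * n"
  show ?thesis
    using Gm_skew[OF ab] by (simp add: so_even_iff MT_def bar_lt)
qed

text \<open>\<open>Q\<close> is required only for the pairs with a nonzero entry of
  \<open>X\<close>, so that a positive root vector involves only matrices \<open>Gm n a b\<close> of
  positive degree.\<close>

lemma so_even_span:
  assumes X: "X \<in> so_even n"
    and Gm: "\<And>a b. a < 2 * n \<Longrightarrow> b < 2 * n \<Longrightarrow> X $$ (a, b) \<noteq> 0 \<Longrightarrow> Q (Gm n a b)"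
    and Q: "Q fzero" "\<And>Y Z. Q Y \<Longrightarrow> Q Z \<Longrightarrow> Q (fadd Y Z)" "\<And>c Y. Q Y \<Longrightarrow> Q (fscale c Y)"
  obtains Y where "X = MT n Y" "Q Y"
proof -
  have sum: "Q (\<lambda>p q. \<Sum>i\<in>I. Y i p q)" if "finite I" "\<And>i. i \<in> I \<Longrightarrow> Q (Y i)" for I :: "nat set" and Y
    using that
  proof (induction I rule: finite_induct)
    case empty
    then show ?case using Q(1) by (simp add: fzero_def)
  next
    case (insert i I)
    then have "Q (fadd (Y i) (\<lambda>p q. \<Sum>i\<in>I. Y i p q))" by (intro Q(2)) auto
    then show ?case using insert by (simp add: fadd_def)
  qed
  \<comment> \<open>By skewness each entry is met twice, from \<open>(a, b)\<close> and from the
    partner pair; hence the division by 2.\<close>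
  define Y where "Y = (\<lambda>p q. \<Sum>a<2 * n. \<Sum>b<2 * n. fscale (X $$ (a, b) / 2) (Gm n a b) p q)"
  have "Q (fscale (X $$ (a, b) / 2) (Gm n a b))" if "a < 2 * n" "b < 2 * n" for a b
    using Q(3)[OF Gm[OF that]] Q(1) by (cases "X $$ (a, b) = 0") (auto simp: fscale_zero)
  then have "Q (\<lambda>p q. \<Sum>b<2 * n. fscale (X $$ (a, b) / 2) (Gm n a b) p q)" if "a < 2 * n" for a
    using sum[of "{..<2 * n}" "\<lambda>b. fscale (X $$ (a, b) / 2) (Gm n a b)"] that by simp
  then have "Q Y"
    unfolding Y_def using sum[of "{..<2 * n}" "\<lambda>a p q. \<Sum>b<2 * n. fscale (X $$ (a, b) / 2) (Gm n a b) p q"] by simp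
  moreover have "X $$ (p, q) = Y p q" if pq: "p < 2 * n" "q < 2 * n" for p q
  proof -
    have dl: "dl p (bar n b) = dl b (bar n p)" "dl q (bar n b) = dl b (bar n q)" if "b < 2 * n" for b
      using bar_swap[OF pq(1) that] bar_swap[OF pq(2) that] by (auto simp: dl_def)
    have "Y p q = (\<Sum>a<2 * n. dl p a * (\<Sum>b<2 * n. dl q b * (X $$ (a, b) / 2)))
        - (\<Sum>a<2 * n. dl a (bar n q) * (\<Sum>b<2 * n. dl b (bar n p) * (X $$ (a, b) / 2)))"
      unfolding Y_def sum_distrib_left sum_subtractf[symmetric]
      by (intro sum.cong refl) (simp add: fscale_def Gm_def dl algebra_simps)
    also have "\<dots> = X $$ (p, q) / 2 - X $$ (bar n q, bar n p) / 2"
      unfolding sum_dl'[OF pq(1)] sum_dl'[OF pq(2)] sum_dl[OF bar_lt[OF pq(1)]] sum_dl[OF bar_lt[OF pq(2)]] ..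
    also have "X $$ (bar n q, bar n p) = - X $$ (p, q)" using X pq unfolding so_even_iff by fastforce
    finally show ?thesis by simp
  qed
  then have "X = MT n Y" using X by (intro eq_matI) (auto simp: so_even_def MT_def)
  ultimately show ?thesis using that by blast
qed

lemma MT_zero: "MT n fzero = 0\<^sub>m (2 * n) (2 * n)"
  by (rule eq_matI) (simp_all add: MT_def fzero_def)

lemma so_even_MT:
  "MT n X \<in> so_even n \<Longrightarrow> MT n Y \<in> so_even n \<Longrightarrow> MT n (fadd X Y) \<in> so_even n"
  "MT n X \<in> so_even n \<Longrightarrow> MT n (fscale c X) \<in> so_even n"
  "MT n X \<in> so_even n \<Longrightarrow> MT n Y \<in> so_even n \<Longrightarrow> MT n (fbr (2 * n) X Y) \<in> so_even n"
  "MT n fzero \<in> so_even n"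
proof -
  note c = so_even_closed[of "MT n X" n "MT n Y"]
  show "MT n X \<in> so_even n \<Longrightarrow> MT n Y \<in> so_even n \<Longrightarrow> MT n (fadd X Y) \<in> so_even n"
    "MT n X \<in> so_even n \<Longrightarrow> MT n (fscale c X) \<in> so_even n"
    "MT n X \<in> so_even n \<Longrightarrow> MT n Y \<in> so_even n \<Longrightarrow> MT n (fbr (2 * n) X Y) \<in> so_even n"
    using so_even_closed by (simp_all add: MT_ops)
  show "MT n fzero \<in> so_even n" by (simp add: so_even_iff MT_zero bar_lt)
qed

lemma gen_fmat_so: "3 \<le> n \<Longrightarrow> MT n (gen_fmat n g) \<in> so_even n"
  by (cases g) (auto simp: gen_fmat_def emat_def fmatr_def hmat_def so_even_MT(4) intro!: so_even_Gm)

lemma subst_mat_carrier: "3 \<le> n \<Longrightarrow> subst_mat n p \<in> carrier (so_alg n)"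
proof (induction p rule: poly_mapping_add_induct)
  case (2 W c)
  then show ?case using gen_fmat_so by (auto simp: subst_mat_single free_algebra_def)
qed (simp_all add: subst_mat_zero subst_mat_add fa_zero_one fa_closed)

section \<open>The map from the free algebra onto the enveloping algebra\<close>

definition usub :: "nat \<Rightarrow> free_elem \<Rightarrow> uea_elem" where
  "usub n p = ucl n (subst_mat n p)"

lemma usub_ops:
  assumes "3 \<le> n"
  shows "usub n p \<in> carrier (uea n)" "usub n p \<oplus>\<^bsub>uea n\<^esub> usub n q = usub n (p + q)"
    "usub n p \<otimes>\<^bsub>uea n\<^esub> usub n q = usub n (p * q)" "\<one>\<^bsub>uea n\<^esub> = usub n 1" "\<zero>\<^bsub>uea n\<^esub> = usub n 0"
    "c \<odot>\<^bsub>uea n\<^esub> usub n p = usub n (const c * p)"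
  using ucl_ops subst_mat_carrier[OF assms]
  by (simp_all add: usub_def subst_mat_add subst_mat_mult subst_mat_one subst_mat_zero subst_mat_const)

lemma so_ideal_closed:
  "x \<in> so_ideal n \<Longrightarrow> y \<in> so_ideal n \<Longrightarrow> x + y \<in> so_ideal n"
  "x \<in> so_ideal n \<Longrightarrow> y \<in> so_ideal n \<Longrightarrow> x - y \<in> so_ideal n"
  "x \<in> so_ideal n \<Longrightarrow> - x \<in> so_ideal n" "0 \<in> so_ideal n"
  "p \<in> carrier (so_alg n) \<Longrightarrow> x \<in> so_ideal n \<Longrightarrow> p * x \<in> so_ideal n"
  "p \<in> carrier (so_alg n) \<Longrightarrow> x \<in> so_ideal n \<Longrightarrow> x * p \<in> so_ideal n"
  by (fact fa_ideal[OF uea_ideal])+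

lemma var_MT_rels:
  assumes X: "MT n X \<in> so_even n"
  shows "MT n Y \<in> so_even n \<Longrightarrow> var (MT n (fadd X Y)) - (var (MT n X) + var (MT n Y)) \<in> so_ideal n"
    "var (MT n (fscale c X)) - const c * var (MT n X) \<in> so_ideal n"
    "MT n Y \<in> so_even n \<Longrightarrow> var (MT n X) * var (MT n Y) - var (MT n Y) * var (MT n X) - var (MT n (fbr (2 * n) X Y)) \<in> so_ideal n"
    "var (MT n fzero) \<in> so_ideal n"
proof -
  have s: "var (MT n (fscale c X)) - const c * var (MT n X) \<in> so_ideal n" if "MT n X \<in> so_even n" for c X
    unfolding MT_ops by (rule so_ideal_rels) (unfold uea_rels_def, use that in blast)
  show "var (MT n (fscale c X)) - const c * var (MT n X) \<in> so_ideal n" by (rule s[OF X])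
  show "var (MT n (fadd X Y)) - (var (MT n X) + var (MT n Y)) \<in> so_ideal n" if "MT n Y \<in> so_even n"
    unfolding MT_ops by (rule so_ideal_rels) (unfold uea_rels_def, use X that in blast)
  show "var (MT n X) * var (MT n Y) - var (MT n Y) * var (MT n X) - var (MT n (fbr (2 * n) X Y)) \<in> so_ideal n"
    if "MT n Y \<in> so_even n"
    unfolding MT_ops by (rule so_ideal_rels) (unfold uea_rels_def, use X that in blast)
  show "var (MT n fzero) \<in> so_ideal n"
    using s[OF so_even_MT(4), of 0] by (simp add: fscale_zero)
qed

lemma subst_mat_gens:
  "i < n \<Longrightarrow> subst_mat n (ge i) = var (MT n (emat n i))"
  "i < n \<Longrightarrow> subst_mat n (gf i) = var (MT n (fmatr n i))"
  "i < n \<Longrightarrow> subst_mat n (gH i) = var (MT n (hmat n i))"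
  by (simp_all add: subst_mat_var gen_fmat_def)

lemma gens_so:
  assumes "3 \<le> n" "i < n"
  shows "MT n (emat n i) \<in> so_even n" "MT n (fmatr n i) \<in> so_even n" "MT n (hmat n i) \<in> so_even n"
  using gen_fmat_so[OF assms(1), of "Gen_e i"] gen_fmat_so[OF assms(1), of "Gen_f i"]
    gen_fmat_so[OF assms(1), of "Gen_H i"] assms(2) by (simp_all add: gen_fmat_def)

text \<open>These are the relations that \<open>hw_annihilator\<close> asks for. Modulo the defining
  ideal \<open>var\<close> is linear and respects brackets, so they follow from the matrix
  identities.\<close>

lemma subst_mat_D2_D3:
  assumes n: "3 \<le> n" and ij: "i < n" "j < n"
  shows "subst_mat n (ge i * gf j - gf j * ge i -
      (if i = j then if i + 1 < n then gH i - gH (i + 1) else gH (n - 2) + gH (n - 1) else 0)) \<in> so_ideal n" (is ?D2)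
    "subst_mat n (gH i * gf j - gf j * gH i + const (rootc n j i) * gf j) \<in> so_ideal n" (is ?D3)
proof -
  note so = gens_so[OF n] and I = so_ideal_closed
  let ?v = "\<lambda>X. var (MT n X)"
  let ?h = "if i + 1 < n then gH i - gH (i + 1) else gH (n - 2) + gH (n - 1)"
  have neg: "?v (fscale (-1) X) + ?v X \<in> so_ideal n" if "MT n X \<in> so_even n" for X
    using var_MT_rels(2)[OF that, of "-1"] by (simp add: free_scalars.sc_minus)
  have hh: "?v (hhmat n i) - subst_mat n ?h \<in> so_ideal n"
  proof (cases "i + 1 < n")
    case True
    then have "(?v (fadd (hmat n i) (fscale (-1) (hmat n (i + 1)))) - (?v (hmat n i) + ?v (fscale (-1) (hmat n (i + 1)))))
        + (?v (fscale (-1) (hmat n (i + 1))) + ?v (hmat n (i + 1))) \<in> so_ideal n"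
      by (intro I(1) neg var_MT_rels(1) so so_even_MT(2)) auto
    then show ?thesis using True by (simp add: hhmat_def subst_mat_diff subst_mat_gens algebra_simps)
  next
    case False
    then show ?thesis
      using var_MT_rels(1)[OF so(3) so(3), of "n - 2" "n - 1"] n by (simp add: hhmat_def subst_mat_add subst_mat_gens algebra_simps)
  qed
  have br: "?v (emat n i) * ?v (fmatr n j) - ?v (fmatr n j) * ?v (emat n i) - ?v (if i = j then hhmat n i else fzero) \<in> so_ideal n"
    using var_MT_rels(3)[OF so(1)[OF ij(1)] so(2)[OF ij(2)]] unfolding fbr_ef[OF ij n] .
  have tr: "a - c \<in> so_ideal n" if "a - b \<in> so_ideal n" "b - c \<in> so_ideal n" for a b c
    using I(1)[OF that] by simp
  have eq: "subst_mat n (ge i * gf j - gf j * ge i - x) =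
      ?v (emat n i) * ?v (fmatr n j) - ?v (fmatr n j) * ?v (emat n i) - subst_mat n x" for x
    using ij by (simp add: subst_mat_diff subst_mat_mult subst_mat_gens)
  show ?D2
  proof (cases "i = j")
    case True
    show ?thesis unfolding eq if_P[OF True] by (rule tr[OF br[unfolded if_P[OF True]] hh])
  next
    case False
    have "?v fzero - 0 \<in> so_ideal n" using var_MT_rels(4)[OF so_even_MT(4)] by simp
    then show ?thesis
      unfolding eq if_not_P[OF False] subst_mat_zero by (rule tr[OF br[unfolded if_not_P[OF False]]])
  qed
  have "?v (hmat n i) * ?v (fmatr n j) - ?v (fmatr n j) * ?v (hmat n i) - ?v (fscale (- rootc n j i) (fmatr n j)) \<in> so_ideal n"
    using var_MT_rels(3)[OF so(3)[OF ij(1)] so(2)[OF ij(2)]] unfolding fbr_hf[OF ij n] .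
  from I(1)[OF this var_MT_rels(2)[OF so(2)[OF ij(2)], of "- rootc n j i"]] ij
  show ?D3 by (simp add: subst_mat_diff subst_mat_add subst_mat_mult subst_mat_const subst_mat_gens free_scalars.sc_minus algebra_simps)
qed

text \<open>The elements congruent to an image form a subalgebra \<open>D\<close>. The matrices
  whose \<open>var\<close> lies in \<open>D\<close> form a Lie algebra with the Chevalley
  generators, so \<open>lie_closure\<close> and \<open>so_even_span\<close> put all of
  \<open>so_even n\<close> into it.\<close>

lemma usub_surj:
  assumes n: "3 \<le> n" and u: "u \<in> carrier (uea n)"
  obtains p where "p \<in> carrier (gens_alg n)" "u = usub n p"
proof -
  note I = so_ideal_closed and S = subst_mat_carrier[OF n]
  define D where "D = {a \<in> carrier (so_alg n). \<exists>p\<in>carrier (gens_alg n). a - subst_mat n p \<in> so_ideal n}"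
  have D_subst: "subst_mat n p \<in> D" if "p \<in> carrier (gens_alg n)" for p
    using that S[of p] I(4) unfolding D_def by (intro CollectI conjI bexI[of _ p]) auto
  have D_add: "a + b \<in> D" if "a \<in> D" "b \<in> D" for a b
  proof -
    obtain p q where *: "p \<in> carrier (gens_alg n)" "a - subst_mat n p \<in> so_ideal n"
      "q \<in> carrier (gens_alg n)" "b - subst_mat n q \<in> so_ideal n" using \<open>a \<in> D\<close> \<open>b \<in> D\<close> by (auto simp: D_def)
    have "a + b - subst_mat n (p + q) \<in> so_ideal n"
      using I(1)[OF *(2,4)] by (simp add: subst_mat_add algebra_simps)
    moreover have "a + b \<in> carrier (so_alg n)" using that by (simp add: D_def fa_closed)
    ultimately show ?thesis using fa_closed(1)[OF *(1,3)] unfolding D_def by blast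
  qed
  have D_mult: "a * b \<in> D" if ab: "a \<in> D" "b \<in> D" for a b
  proof -
    obtain p q where *: "p \<in> carrier (gens_alg n)" "a - subst_mat n p \<in> so_ideal n"
      "q \<in> carrier (gens_alg n)" "b - subst_mat n q \<in> so_ideal n" using ab by (auto simp: D_def)
    have "(a - subst_mat n p) * b + subst_mat n p * (b - subst_mat n q) \<in> so_ideal n"
      using ab * by (intro I(1) I(5,6) S) (auto simp: D_def)
    then have "a * b - subst_mat n (p * q) \<in> so_ideal n" by (simp add: subst_mat_mult algebra_simps)
    moreover have "a * b \<in> carrier (so_alg n)" using ab by (simp add: D_def fa_closed)
    ultimately show ?thesis using fa_closed(2)[OF *(1,3)] unfolding D_def by blast
  qed
  have D_const: "const c \<in> D" for c
    using D_subst[OF const_carrier, of c] by (simp add: subst_mat_const)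
  have D_subsp: "free_scalars.subsp D"
    using D_const[of 0] by (intro free_scalars.subspI D_add D_mult D_const) auto
  have D_cong: "a \<in> D" if "b \<in> D" "a - b \<in> so_ideal n" for a b
  proof -
    have "a - b \<in> carrier (so_alg n)" "a - b - subst_mat n 0 \<in> so_ideal n"
      using that(2) fa_ideal(1)[OF uea_ideal] subst_mat_zero[of n] by auto
    then have "a - b \<in> D" unfolding D_def using fa_zero_one(1) by blast
    from D_add[OF this that(1)] show ?thesis by simp
  qed
  define Q where "Q X \<longleftrightarrow> MT n X \<in> so_even n \<and> var (MT n X) \<in> D" for X
  have Q_add: "Q (fadd X Y)" if "Q X" "Q Y" for X Y
    using that D_cong[OF D_add var_MT_rels(1)] so_even_MT(1) unfolding Q_def by blast
  have Q_scale: "Q (fscale c X)" if "Q X" for c X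
    using that D_cong[OF D_mult[OF D_const] var_MT_rels(2)] so_even_MT(2) unfolding Q_def by blast
  have Q_zero: "Q fzero"
    using so_even_MT(4) D_cong[OF D_const[of 0], of "var (MT n fzero)"] var_MT_rels(4)[OF so_even_MT(4)]
    by (simp add: Q_def)
  have Q_br: "Q (fbr (2 * n) X Y)" if "Q X" "Q Y" for X Y
  proof -
    have so: "MT n X \<in> so_even n" "MT n Y \<in> so_even n" and d: "var (MT n X) \<in> D" "var (MT n Y) \<in> D"
      using that by (auto simp: Q_def)
    have "var (MT n (fbr (2 * n) X Y)) - (var (MT n X) * var (MT n Y) - var (MT n Y) * var (MT n X)) \<in> so_ideal n"
      using I(3)[OF var_MT_rels(3)[OF so]] by (simp add: algebra_simps)
    from D_cong[OF free_scalars.subsp_diff[OF D_subsp D_mult[OF d] D_mult[OF d(2,1)]] this]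
    show ?thesis using so_even_MT(3)[OF so] by (simp add: Q_def)
  qed
  have Q_gens: "Q (emat n i)" "Q (fmatr n i)" "Q (hmat n i)" if "i < n" for i
    using gens_so[OF n that] D_subst[OF gens_carrier(1)[OF that]] D_subst[OF gens_carrier(2)[OF that]]
      D_subst[OF gens_carrier(3)[OF that]] that by (simp_all add: Q_def subst_mat_gens)
  have Q_Gm: "Q (Gm n a b)" if "a < 2 * n" "b < 2 * n" for a b
    by (rule lie_closure[where L = "\<lambda>_. Q"]) (use n that Q_gens Q_br Q_scale Q_zero in auto)
  have D_var: "var X \<in> D" if X: "X \<in> so_even n" for X
  proof (rule so_even_span[OF X])
    show "Q (Gm n a b)" if "a < 2 * n" "b < 2 * n" for a b by (rule Q_Gm[OF that])
    show "var X \<in> D" if "X = MT n Y" "Q Y" for Y using that by (simp add: Q_def)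
  qed (fact Q_zero Q_add Q_scale)+
  obtain a where a: "a \<in> carrier (so_alg n)" "u = ucl n a" using u ucl_ops(1) by blast
  have "a \<in> D"
    using a(1) D_const[of 1, unfolded const_one] D_subsp by (rule free_algebra_induct) (intro D_mult D_var)
  then obtain p where p: "p \<in> carrier (gens_alg n)" "a - subst_mat n p \<in> so_ideal n" by (auto simp: D_def)
  then have "u = usub n p" by (simp add: a(2) usub_def ucl_eq)
  with p(1) show ?thesis by (rule that)
qed

lemma cartan_H_MT: "i < n \<Longrightarrow> cartan_H n i = MT n (hmat n i)"
  by (rule eq_matI) (auto simp: cartan_H_def mat_unit_def MT_def hmat_def Gm_def dl_def bar_def)

lemma uea_incl_gens:
  "i < n \<Longrightarrow> uea_incl n (cartan_H n i) = usub n (gH i)" "i < n \<Longrightarrow> uea_incl n (MT n (emat n i)) = usub n (ge i)"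
  by (simp_all add: uea_incl_def usub_def ucl_def cartan_H_MT subst_mat_gens)

lemma emat_positive:
  assumes n: "3 \<le> n" and i: "i < n"
  shows "MT n (emat n i) \<in> positive_root_vectors n"
proof -
  have n2: "2 \<le> n" using n by simp
  have "simple_root n i \<noteq> 0\<^sub>v n"
    using simple_root_norm[OF n2 i] simple_root_rootc(1)[OF n2, of i] by (metis scalar_prod_left_zero zero_neq_numeral)
  moreover have "dominance_le n (0\<^sub>v n) (simple_root n i)"
    unfolding dominance_le_def using i
    by (intro exI[of _ "\<lambda>j. if j = i then 1 else 0"]) (simp add: if_distrib[of "\<lambda>c. of_nat c * _"] cong: if_cong)
  moreover have "MT n (emat n i) \<in> root_space n (simple_root n i)"
    using gens_so(1)[OF assms] fbr_he[OF _ i n] simple_root_rootc(2)[OF n2]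
    by (simp add: root_space_def cartan_H_MT flip: MT_ops)
  ultimately show ?thesis using simple_root_rootc(1)[OF n2] unfolding positive_root_vectors_def by blast
qed

section \<open>Modules over the enveloping algebra\<close>

lemma left_module_zero:
  assumes "left_module R M" "a \<in> carrier R" "v \<in> carrier M"
  shows "\<zero>\<^bsub>R\<^esub> \<odot>\<^bsub>M\<^esub> v = \<zero>\<^bsub>M\<^esub>" "a \<odot>\<^bsub>M\<^esub> \<zero>\<^bsub>M\<^esub> = \<zero>\<^bsub>M\<^esub>" "(\<ominus>\<^bsub>R\<^esub> a) \<odot>\<^bsub>M\<^esub> v = \<ominus>\<^bsub>M\<^esub> (a \<odot>\<^bsub>M\<^esub> v)"
proof -
  interpret left_module R M by (rule assms(1))
  show z: "\<zero>\<^bsub>R\<^esub> \<odot>\<^bsub>M\<^esub> v = \<zero>\<^bsub>M\<^esub>"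
    using smult_l_distr[of "\<zero>\<^bsub>R\<^esub>" "\<zero>\<^bsub>R\<^esub>" v] assms by simp
  show "a \<odot>\<^bsub>M\<^esub> \<zero>\<^bsub>M\<^esub> = \<zero>\<^bsub>M\<^esub>"
    using smult_r_distr[of a "\<zero>\<^bsub>M\<^esub>" "\<zero>\<^bsub>M\<^esub>"] assms by simp
  show "(\<ominus>\<^bsub>R\<^esub> a) \<odot>\<^bsub>M\<^esub> v = \<ominus>\<^bsub>M\<^esub> (a \<odot>\<^bsub>M\<^esub> v)"
    using smult_l_distr[of "\<ominus>\<^bsub>R\<^esub> a" a v] z R.l_neg[of a] assms
    by (intro M.minus_equality[symmetric]) auto
qed

lemma rep_kernel_ideal:
  assumes "left_module R M" shows "ideal (rep_kernel R M) R"
proof (rule idealI)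
  interpret left_module R M by (rule assms)
  have z: "\<zero>\<^bsub>R\<^esub> \<odot>\<^bsub>M\<^esub> v = \<zero>\<^bsub>M\<^esub>" if "v \<in> carrier M" for v
    using left_module_zero(1)[OF assms R.zero_closed that] .
  have z2: "a \<odot>\<^bsub>M\<^esub> \<zero>\<^bsub>M\<^esub> = \<zero>\<^bsub>M\<^esub>" if "a \<in> carrier R" for a
    using left_module_zero(2)[OF assms that M.zero_closed] .
  have z3: "(\<ominus>\<^bsub>R\<^esub> a) \<odot>\<^bsub>M\<^esub> v = \<ominus>\<^bsub>M\<^esub> (a \<odot>\<^bsub>M\<^esub> v)" if "a \<in> carrier R" "v \<in> carrier M" for a v
    by (rule left_module_zero(3)[OF assms that])
  show "ring R" by (rule R.ring_axioms)
  show "subgroup (rep_kernel R M) (add_monoid R)"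
    by (rule group.subgroupI[OF R.a_group])
       (auto simp: rep_kernel_def z z3 smult_l_distr a_inv_def[symmetric] intro!: exI[of _ "\<zero>\<^bsub>R\<^esub>"])
  fix a x assume "a \<in> rep_kernel R M" "x \<in> carrier R"
  then show "x \<otimes>\<^bsub>R\<^esub> a \<in> rep_kernel R M" "a \<otimes>\<^bsub>R\<^esub> x \<in> rep_kernel R M"
    by (auto simp: rep_kernel_def smult_assoc1 z2)
qed

lemma cyclic_submodule:
  assumes "left_module R M" "v \<in> carrier M"
  shows "submodule ((\<lambda>a. a \<odot>\<^bsub>M\<^esub> v) ` carrier R) R M"
proof -
  interpret left_module R M by (rule assms)
  show ?thesis
  proof (intro submodule.intro submodule_axioms.intro group.subgroupI)
    show "Group.group (add_monoid M)" by (rule M.a_group)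
    show "inv\<^bsub>add_monoid M\<^esub> x \<in> (\<lambda>a. a \<odot>\<^bsub>M\<^esub> v) ` carrier R"
      if "x \<in> (\<lambda>a. a \<odot>\<^bsub>M\<^esub> v) ` carrier R" for x
      using that assms by (auto simp flip: a_inv_def left_module_zero(3)[OF assms(1) _ assms(2)])
  qed (use assms(2) in \<open>auto simp flip: smult_l_distr smult_assoc1\<close>)
qed

lemma usub_act:
  assumes "3 \<le> n" "left_module (uea n) M" "v \<in> carrier M"
  shows "usub n p \<odot>\<^bsub>M\<^esub> v \<in> carrier M"
    "usub n (p + q) \<odot>\<^bsub>M\<^esub> v = usub n p \<odot>\<^bsub>M\<^esub> v \<oplus>\<^bsub>M\<^esub> usub n q \<odot>\<^bsub>M\<^esub> v"
    "usub n (p * q) \<odot>\<^bsub>M\<^esub> v = usub n p \<odot>\<^bsub>M\<^esub> (usub n q \<odot>\<^bsub>M\<^esub> v)"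
    "usub n 1 \<odot>\<^bsub>M\<^esub> v = v" "usub n 0 \<odot>\<^bsub>M\<^esub> v = \<zero>\<^bsub>M\<^esub>" "usub n p \<odot>\<^bsub>M\<^esub> \<zero>\<^bsub>M\<^esub> = \<zero>\<^bsub>M\<^esub>"
    "usub n (p - q) \<odot>\<^bsub>M\<^esub> v = \<zero>\<^bsub>M\<^esub> \<longleftrightarrow> usub n p \<odot>\<^bsub>M\<^esub> v = usub n q \<odot>\<^bsub>M\<^esub> v"
proof -
  interpret left_module "uea n" M by (rule assms)
  note u = usub_ops[OF assms(1)] and c = smult_closed[OF usub_ops(1)[OF assms(1)] assms(3)]
  show "usub n p \<odot>\<^bsub>M\<^esub> v \<in> carrier M" by (rule c)
  show add: "usub n (p + q) \<odot>\<^bsub>M\<^esub> v = usub n p \<odot>\<^bsub>M\<^esub> v \<oplus>\<^bsub>M\<^esub> usub n q \<odot>\<^bsub>M\<^esub> v" for p q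
    using smult_l_distr[OF u(1) u(1) assms(3)] by (simp only: u(2))
  show "usub n (p * q) \<odot>\<^bsub>M\<^esub> v = usub n p \<odot>\<^bsub>M\<^esub> (usub n q \<odot>\<^bsub>M\<^esub> v)"
    using smult_assoc1[OF u(1) u(1) assms(3)] by (simp only: u(3))
  show "usub n 1 \<odot>\<^bsub>M\<^esub> v = v" using smult_one[OF assms(3)] by (simp only: u(4))
  show "usub n 0 \<odot>\<^bsub>M\<^esub> v = \<zero>\<^bsub>M\<^esub>" using left_module_zero(1)[OF assms(2) u(1) assms(3)] by (simp only: u(5))
  show "usub n p \<odot>\<^bsub>M\<^esub> \<zero>\<^bsub>M\<^esub> = \<zero>\<^bsub>M\<^esub>" by (rule left_module_zero(2)[OF assms(2) u(1) assms(3)])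
  have "usub n p \<odot>\<^bsub>M\<^esub> v = usub n (p - q) \<odot>\<^bsub>M\<^esub> v \<oplus>\<^bsub>M\<^esub> usub n q \<odot>\<^bsub>M\<^esub> v"
    using add[of "p - q" q] by simp
  then show "usub n (p - q) \<odot>\<^bsub>M\<^esub> v = \<zero>\<^bsub>M\<^esub> \<longleftrightarrow> usub n p \<odot>\<^bsub>M\<^esub> v = usub n q \<odot>\<^bsub>M\<^esub> v"
    using c M.add.l_cancel_one' M.add.r_cancel_one by metis
qed

lemma hw_annihilator_module:
  assumes n: "3 \<le> n" and M: "left_module (uea n) M" and v: "v \<in> carrier M"
    and e: "\<And>i. i < n \<Longrightarrow> usub n (ge i) \<odot>\<^bsub>M\<^esub> v = \<zero>\<^bsub>M\<^esub>"
    and H: "\<And>i. i < n \<Longrightarrow> usub n (gH i) \<odot>\<^bsub>M\<^esub> v = usub n (const (\<mu> i)) \<odot>\<^bsub>M\<^esub> v"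
  shows "free_scalars.hw_annihilator n ge gf gH \<mu> {q. usub n q \<odot>\<^bsub>M\<^esub> v = \<zero>\<^bsub>M\<^esub>}"
proof -
  interpret left_module "uea n" M by (rule M)
  note a = usub_act[OF n M v]
  have rel: "usub n (p * q) \<odot>\<^bsub>M\<^esub> v = \<zero>\<^bsub>M\<^esub>" if "subst_mat n p \<in> so_ideal n" for p q
  proof -
    have "usub n p = usub n 0" using that by (simp add: usub_def ucl_eq subst_mat_zero)
    then show ?thesis using usub_act(5)[OF n M a(1)] by (simp only: a(3))
  qed
  have "free_scalars.gen_closed n ge gf gH {q. usub n q \<odot>\<^bsub>M\<^esub> v = \<zero>\<^bsub>M\<^esub>}"
    unfolding free_scalars.gen_closed_def by (auto intro!: free_scalars.subspI simp: a)
  then show ?thesis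
    unfolding free_scalars.hw_annihilator_def mem_Collect_eq a(7)
    using e H rel subst_mat_D2_D3[OF n] by auto
qed

section \<open>Comparison of kernels\<close>

lemma tensor_power_act:
  assumes "3 \<le> n" "t \<in> tensors n r"
  shows "usub n p \<odot>\<^bsub>tensor_power n r\<^esub> t = tact n r p t"
proof -
  have s: "subst_mat n p \<in> usub n p"
    using fa_ideal(2)[OF uea_ideal] unfolding usub_def ucl_def fa_coset by force
  have "free_tensor_act n r q t = free_tensor_act n r (subst_mat n p) t" if "q \<in> usub n p" for q
    by (rule free_tensor_act_coset[OF usub_ops(1)[OF assms(1)] that s]) (use assms(2) in \<open>simp add: tensors_carrier\<close>)
  then have "the_elem ((\<lambda>q. free_tensor_act n r q t) ` usub n p) = free_tensor_act n r (subst_mat n p) t"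
    using s by (intro the_elem_image_unique) blast+
  then show ?thesis by (simp add: tensor_power_def tact_def)
qed

lemma tensor_power_ops:
  "\<zero>\<^bsub>tensor_power n r\<^esub> = (\<lambda>_. 0)" "s \<oplus>\<^bsub>tensor_power n r\<^esub> t = (\<lambda>w. s w + t w)"
  by (simp_all add: tensor_power_def)

lemma hw_annihilator_tensor:
  assumes n: "3 \<le> n" and t: "t \<in> tensors n r"
    and hw: "\<And>i. i < n \<Longrightarrow> TA n r (emat n i) t = (\<lambda>_. 0) \<and> TA n r (hmat n i) t = (\<lambda>w. \<nu> i * t w)"
  shows "free_scalars.hw_annihilator n ge gf gH \<nu> {q. tact n r q t = (\<lambda>_. 0)}"
  using hw_annihilator_module[OF n tensor_power_left_module, of t r \<nu>] hw t
  by (simp add: tensors_carrier tensor_power_act[OF n t] tensor_power_ops tact_gens tact_const)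

lemma pres_ideal_closed:
  assumes "3 \<le> n"
  shows "0 \<in> pres_ideal n r" "x \<in> pres_ideal n r \<Longrightarrow> y \<in> pres_ideal n r \<Longrightarrow> x + y \<in> pres_ideal n r"
    "x \<in> pres_ideal n r \<Longrightarrow> y \<in> pres_ideal n r \<Longrightarrow> x - y \<in> pres_ideal n r"
    "p \<in> carrier (gens_alg n) \<Longrightarrow> x \<in> pres_ideal n r \<Longrightarrow> p * x \<in> pres_ideal n r"
    "p \<in> carrier (gens_alg n) \<Longrightarrow> x \<in> pres_ideal n r \<Longrightarrow> x * p \<in> pres_ideal n r"
    "pres_ideal n r \<subseteq> carrier (gens_alg n)"
  using fa_ideal[OF pres_ideal_ideal[of n r]] assms by auto

lemma fword_carrier: "set ws \<subseteq> {..<n} \<Longrightarrow> free_scalars.fword gf ws \<in> carrier (gens_alg n)"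
  by (induction ws) (auto simp: fa_zero_one intro!: fa_closed gens_carrier)

text \<open>Counterpart of \<open>highest_annihilator\<close> on representatives, valid for all
  \<open>n\<close> and \<open>r\<close>. The words in the \<open>f i\<close> in the definition are
  elements of the free algebra on the correct generators, so the relations may be multiplied by
  them.\<close>

lemma hw_annihilator_pres:
  assumes n: "3 \<le> n" and w: "pres_highest n r \<nu> w"
  shows "free_scalars.hw_annihilator n ge gf gH \<nu> {q \<in> carrier (gens_alg n). q * w \<in> pres_ideal n r}"
proof -
  note I = pres_ideal_closed[where r = r, OF n]
  have wF: "w \<in> carrier (gens_alg n)" using w by (simp add: pres_highest_def)
  note c = gens_carrier[of _ n] const_carrier fa_closed fa_zero_one
  have rel: "p * q \<in> carrier (gens_alg n) \<and> p * q * w \<in> pres_ideal n r"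
    if "p \<in> pres_rels n r" "q \<in> carrier (gens_alg n)" for p q
  proof -
    have "p \<in> pres_ideal n r"
      using that(1) ring.genideal_self[OF ring_free_algebra pres_rels_carrier, of n r] n unfolding pres_ideal_def by auto
    then show ?thesis using I(5)[OF fa_closed(2)[OF that(2) wF]] I(6) fa_closed(2)[OF _ that(2)] by (auto simp: mult.assoc)
  qed
  have G: "free_scalars.gen_closed n ge gf gH {q \<in> carrier (gens_alg n). q * w \<in> pres_ideal n r}"
    unfolding free_scalars.gen_closed_def
  proof (intro conjI free_scalars.subspI allI impI ballI)
    fix q assume "q \<in> {q \<in> carrier (gens_alg n). q * w \<in> pres_ideal n r}"
    then have q: "q \<in> carrier (gens_alg n)" "q * w \<in> pres_ideal n r" by auto
    have m: "p * q \<in> {q \<in> carrier (gens_alg n). q * w \<in> pres_ideal n r}" if "p \<in> carrier (gens_alg n)" for p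
      using I(4)[OF that q(2)] fa_closed(2)[OF that q(1)] by (simp add: mult.assoc)
    show "const x * q \<in> {q \<in> carrier (gens_alg n). q * w \<in> pres_ideal n r}" for x by (rule m[OF const_carrier])
    show "ge i * q \<in> {q \<in> carrier (gens_alg n). q * w \<in> pres_ideal n r}"
      "gf i * q \<in> {q \<in> carrier (gens_alg n). q * w \<in> pres_ideal n r}"
      "gH i * q \<in> {q \<in> carrier (gens_alg n). q * w \<in> pres_ideal n r}" if "i < n" for i
      by (rule m, rule gens_carrier[OF that])+
  next
    fix p q assume "p \<in> {q \<in> carrier (gens_alg n). q * w \<in> pres_ideal n r}" "q \<in> {q \<in> carrier (gens_alg n). q * w \<in> pres_ideal n r}"
    then show "p + q \<in> {q \<in> carrier (gens_alg n). q * w \<in> pres_ideal n r}"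
      using I(2) fa_closed(1) by (auto simp: distrib_right)
  qed (use I(1) fa_zero_one in auto)
  have E: "ge i \<in> {q \<in> carrier (gens_alg n). q * w \<in> pres_ideal n r}"
      "gH i - const (\<nu> i) \<in> {q \<in> carrier (gens_alg n). q * w \<in> pres_ideal n r}" if "i < n" for i
    using w that c(1,3)[OF that] fa_closed(4)[OF c(3)[OF that] const_carrier]
    by (auto simp: pres_highest_def left_diff_distrib)
  have D: "ge i * gf j - gf j * ge i -
      (if i = j then if i + 1 < n then gH i - gH (i + 1) else gH (n - 2) + gH (n - 1) else 0) \<in> pres_rels n r"
    "gH i * gf j - gf j * gH i + const (rootc n j i) * gf j \<in> pres_rels n r" if "i < n" "j < n" for i j
    using pres_D2_mem[OF that] pres_D3_mem(2)[OF _ that] n unfolding pres_rels_def by auto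
  have rel': "p * q \<in> {q \<in> carrier (gens_alg n). q * w \<in> pres_ideal n r}"
    if "p \<in> pres_rels n r" "q \<in> carrier (gens_alg n)" for p q using rel[OF that] by simp
  show ?thesis
    unfolding free_scalars.hw_annihilator_def
    by (intro conjI allI impI G E rel'[OF D(1) fword_carrier] rel'[OF D(2) fword_carrier])
qed

lemma highest_component_carrier:
  assumes n: "3 \<le> n" and p: "p \<in> carrier (gens_alg n)"
  shows "\<exists>z s N. N \<noteq> 0 \<and> (\<forall>x\<in>pres_ideal n r. z * x \<in> pres_ideal n r) \<and>
    (\<forall>A. free_scalars.hw_annihilator n ge gf gH \<mu> A \<longrightarrow> z - const N \<in> A \<and> z * p - const s \<in> A)"
proof (rule free_scalars.highest_component[where n = n and e = ge and f = gf and H = gH and p = p and \<mu> = \<mu>])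
  show "2 \<le> n" using n by simp
  show "p \<in> D" if "1 \<in> D" "free_scalars.gen_closed n ge gf gH D" for D by (rule gen_closed_carrier[OF p that])
next
  fix z s N
  assume N: "N \<noteq> 0"
    and B: "\<And>B x. free_scalars.subsp B \<Longrightarrow> (\<And>i x. i < n \<Longrightarrow> x \<in> B \<Longrightarrow> gH i * x \<in> B) \<Longrightarrow> x \<in> B \<Longrightarrow> z * x \<in> B"
    and A: "\<And>A. free_scalars.hw_annihilator n ge gf gH \<mu> A \<Longrightarrow> z - const N \<in> A \<and> z * p - const s \<in> A"
  note I = pres_ideal_closed[where r = r, OF n]
  have "free_scalars.subsp (pres_ideal n r)"
    using I by (intro free_scalars.subspI) (auto simp: const_carrier)
  then have "z * x \<in> pres_ideal n r" if "x \<in> pres_ideal n r" for x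
    by (rule B) (use that I(4) gens_carrier(3) in auto)
  with N A show ?thesis by (intro exI[of _ z] exI[of _ s] exI[of _ N]) simp
qed

text \<open>Tensors form a faithful module of the presented algebra. By complete reducibility it
  suffices to show that \<open>p\<close> kills each left ideal generated by a highest weight vector,
  and there simplicity and the comparison with a tensor of equal highest weight apply.\<close>

theorem pres_ideal_iff_kills:
  assumes n: "3 \<le> n" and p: "p \<in> carrier (gens_alg n)"
  shows "p \<in> pres_ideal n r \<longleftrightarrow> kills n r p"
proof
  show "p \<in> pres_ideal n r \<Longrightarrow> kills n r p" by (rule pres_ideal_kills[OF n])
  assume k: "kills n r p"
  note I = pres_ideal_closed[where r = r, OF n]
  note R = pres_reducible[OF n, of r, unfolded pres_reducible_def]
  have main: "p * q * w \<in> pres_ideal n r" if q: "q \<in> carrier (gens_alg n)" and w: "pres_highest n r \<nu> w" for q w \<nu>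
  proof (rule ccontr)
    assume nz: "p * q * w \<notin> pres_ideal n r"
    obtain b where b: "b \<in> carrier (gens_alg n)" "b * (p * q * w) - w \<in> pres_ideal n r"
      using R w nz fa_closed(2)[OF p q] by meson
    \<comment> \<open>By simplicity \<open>p\<close> is turned into an element that still kills all
      tensors but fixes \<open>w\<close> modulo the ideal.\<close>
    define x where "x = b * (p * q)"
    have x: "x \<in> carrier (gens_alg n)" "x * w - w \<in> pres_ideal n r"
      using b fa_closed(2)[OF b(1) fa_closed(2)[OF p q]] by (simp_all add: x_def mult.assoc)
    have xk: "tact n r x t = (\<lambda>_. 0)" if "t \<in> tensors n r" for t
      using k tact_closed[OF that] by (simp add: x_def tact_mult kills_def tact_zero_right)
    have "has_highest n r \<nu>" using has_highest_dominant[OF n] R w by blast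
    then obtain t where t: "t \<in> tensors n r" "t \<noteq> (\<lambda>_. 0)"
      "\<And>i. i < n \<Longrightarrow> TA n r (emat n i) t = (\<lambda>_. 0) \<and> TA n r (hmat n i) t = (\<lambda>w. \<nu> i * t w)"
      unfolding has_highest_def by blast
    obtain z s N where z: "N \<noteq> 0" "\<forall>x\<in>pres_ideal n r. z * x \<in> pres_ideal n r"
      "\<And>A. free_scalars.hw_annihilator n ge gf gH \<nu> A \<Longrightarrow> z - const N \<in> A \<and> z * x - const s \<in> A"
      using highest_component_carrier[OF n x(1), of r \<nu>] by blast
    have "tact n r (z * x - const s) t = (\<lambda>_. 0)"
      using z(3)[OF hw_annihilator_tensor[OF n t(1,3)]] by blast
    \<comment> \<open>\<open>x\<close> kills \<open>t\<close>, whereas \<open>z * x\<close> acts on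
      \<open>t\<close> by \<open>s\<close>.\<close>
    then have "s = 0"
      using t(2) xk[OF t(1)] by (auto simp: tact_diff tact_mult tact_const tact_zero_right fun_eq_iff)
    then have zx: "(z - const N) * w \<in> pres_ideal n r" "z * x * w \<in> pres_ideal n r"
      using z(3)[OF hw_annihilator_pres[OF n w]] by simp_all
    \<comment> \<open>Modulo the ideal \<open>z * x * w\<close> is 0, while \<open>x\<close> fixes
      \<open>w\<close> and \<open>z\<close> acts on it by \<open>N\<close>; so \<open>N\<close>
      times \<open>w\<close> is 0.\<close>
    have "z * (x * w - w) \<in> pres_ideal n r" using z(2) x(2) by blast
    from I(3)[OF I(3)[OF zx(2) this] zx(1)] have "const N * w \<in> pres_ideal n r" by (simp add: algebra_simps)
    from I(4)[OF const_carrier this, of "1 / N"] have "w \<in> pres_ideal n r"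
      using z(1) by (simp add: free_scalars.sc_sc)
    then show False using w by (simp add: pres_highest_def)
  qed
  define D where "D = {x. p * x \<in> pres_ideal n r}"
  have "1 \<in> D"
  proof -
    have a: "pres_ideal n r \<subseteq> D" using I(4)[OF p] by (auto simp: D_def)
    have b: "\<forall>x\<in>D. \<forall>\<nu> w. \<forall>q\<in>carrier (gens_alg n). pres_highest n r \<nu> w \<longrightarrow> q * w + x \<in> D"
      using I(2)[OF main] by (simp add: D_def distrib_left mult.assoc)
    show ?thesis by (rule conjunct1[OF R, THEN spec, THEN mp, THEN mp, OF a b])
  qed
  then show "p \<in> pres_ideal n r" by (simp add: D_def)
qed

lemma usub_rep_kernel:
  assumes n: "3 \<le> n" and p: "p \<in> carrier (gens_alg n)"
  shows "usub n p \<in> rep_kernel (uea n) (tensor_power n r) \<longleftrightarrow> p \<in> pres_ideal n r"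
  unfolding pres_ideal_iff_kills[OF assms] rep_kernel_def kills_def
  using usub_ops(1)[OF n] tensor_power_act[OF n] by (simp add: tensors_carrier tensor_power_ops)

lemma tensor_power_weight:
  assumes n: "3 \<le> n"
  shows "weight_vector n (tensor_power n r) \<mu> t \<longleftrightarrow>
    t \<in> tensors n r \<and> t \<noteq> (\<lambda>_. 0) \<and> (\<forall>i<n. TA n r (hmat n i) t = (\<lambda>w. \<mu> $ i * t w))"
proof -
  have "(\<mu> $ i) \<odot>\<^bsub>uea n\<^esub> \<one>\<^bsub>uea n\<^esub> = usub n (const (\<mu> $ i))" for i
    using usub_ops(4,6)[OF n] by simp
  then show ?thesis
    by (auto simp: weight_vector_def tensors_carrier uea_incl_gens tensor_power_ops tensor_power_act[OF n] tact_gens tact_const)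
qed

lemma tensor_wt_cong: "(\<And>i. i < n \<Longrightarrow> \<nu> i = \<mu> i) \<Longrightarrow> tensor_wt n r \<nu> = tensor_wt n r \<mu>"
proof -
  assume eq: "\<And>i. i < n \<Longrightarrow> \<nu> i = \<mu> i"
  then have "(\<Sum>i<n. of_int (\<sigma> i) * \<nu> i) = (\<Sum>i<n. of_int (\<sigma> i) * \<mu> i)" for \<sigma> :: "nat \<Rightarrow> int"
    by (intro sum.cong) auto
  then show ?thesis using eq by (simp add: tensor_wt_def)
qed

lemma dominant_integral_iff:
  assumes n: "3 \<le> n" and \<mu>: "\<mu> \<in> carrier_vec n"
  shows "dominant_integral n \<mu> \<longleftrightarrow> (\<forall>i<n. copair n (\<lambda>i. \<mu> $ i) i \<in> \<nat>)"
proof -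
  have "2 * (\<mu> \<bullet> simple_root n i) / (simple_root n i \<bullet> simple_root n i) = copair n (\<lambda>i. \<mu> $ i) i" if "i < n" for i
    using scalar_prod_simple_root[OF _ that \<mu>] simple_root_norm[OF _ that] n by simp
  then show ?thesis using \<mu> by (auto simp: dominant_integral_def)
qed

text \<open>The weight of a tensor is that of any word in its support, so it meets the conditions of
  (D6) and (D7); a dominant one is then the weight of some highest weight vector.\<close>

lemma tensor_dominant_weightsD:
  assumes n: "3 \<le> n" and \<mu>: "\<mu> \<in> tensor_dominant_weights n r"
  shows "has_highest n r (\<lambda>i. \<mu> $ i)"
proof (rule has_highest_dominant[OF n])
  obtain t where d: "dominant_integral n \<mu>" and t: "weight_vector n (tensor_power n r) \<mu> t"
    using \<mu> by (auto simp: tensor_dominant_weights_def)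
  have "\<mu> \<in> carrier_vec n" using d by (simp add: dominant_integral_def)
  then show "dom_wt n (\<lambda>i. \<mu> $ i)"
    using d dominant_integral_iff[OF n] by (auto simp: dom_wt_def elim!: Nats_cases)
  obtain w where w: "t w \<noteq> 0" "w \<in> tensor_index n r"
    using t unfolding tensor_power_weight[OF n] by (auto simp: tensors_def fun_eq_iff)
  have "\<mu> $ i = word_wt n w i" if "i < n" for i
    using t TA_H[OF that w(2), of t] w(1) that unfolding tensor_power_weight[OF n] by auto
  then show "tensor_wt n r (\<lambda>i. \<mu> $ i)" using word_tensor_wt[OF w(2)] tensor_wt_cong by blast
qed

lemma tensor_dominant_weightsI:
  assumes n: "3 \<le> n" and \<nu>: "dom_wt n \<nu>" "tensor_wt n r \<nu>"
    and t: "weight_vector n (tensor_power n r) (vec n \<nu>) t"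
  shows "vec n \<nu> \<in> tensor_dominant_weights n r"
proof -
  have int: "\<nu> i \<in> \<int>" if "i < n" for i using \<nu>(2) that by (simp add: tensor_wt_def wt_list_mem)
  have "copair n (\<lambda>i. vec n \<nu> $ i) i \<in> \<nat>" if i: "i < n" for i
  proof -
    have "copair n (\<lambda>i. vec n \<nu> $ i) i = copair n \<nu> i" using i by (intro copair_cong) auto
    moreover have "copair n \<nu> i \<in> \<int>" "copair n \<nu> i \<ge> 0"
      using int \<nu>(1) n i by (auto simp: copair_def dom_wt_def)
    ultimately show ?thesis by (simp add: Nats_altdef2)
  qed
  then have "dominant_integral n (vec n \<nu>)" using dominant_integral_iff[OF n] by simp
  then show ?thesis using t by (auto simp: tensor_dominant_weights_def)
qed

lemma simple_module_generated:
  assumes "simple_module R M" "x \<in> carrier M" "x \<noteq> \<zero>\<^bsub>M\<^esub>" "v \<in> carrier M"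
  obtains a where "a \<in> carrier R" "v = a \<odot>\<^bsub>M\<^esub> x"
proof -
  have M: "left_module R M" using assms(1) by (simp add: simple_module_def)
  interpret left_module R M by (rule M)
  have "x = \<one>\<^bsub>R\<^esub> \<odot>\<^bsub>M\<^esub> x" using assms(2) by simp
  then have "x \<in> (\<lambda>a. a \<odot>\<^bsub>M\<^esub> x) ` carrier R" by blast
  then have "(\<lambda>a. a \<odot>\<^bsub>M\<^esub> x) ` carrier R = carrier M"
    using assms(1,3) cyclic_submodule[OF M assms(2)] unfolding simple_module_def by blast
  then show ?thesis using assms(4) that by blast
qed

text \<open>The comparison of \<open>pres_ideal_iff_kills\<close> once more, with an arbitrary
  simple module in place of a left ideal of the presented algebra.\<close>

lemma rep_kernel_subset:
  assumes n: "3 \<le> n"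
  shows "rep_kernel (uea n) (tensor_power n r) \<subseteq> schur_ideal n (tensor_dominant_weights n r)"
proof
  fix u assume u: "u \<in> rep_kernel (uea n) (tensor_power n r)"
  have "u \<in> rep_kernel (uea n) M"
    if \<mu>: "\<mu> \<in> tensor_dominant_weights n r" and hw: "simple_of_highest_weight n M \<mu>"
    for M :: "(uea_elem, uea_elem set) module" and \<mu>
  proof (rule ccontr)
    assume no: "u \<notin> rep_kernel (uea n) M"
    have simp: "simple_module (uea n) M" and M: "left_module (uea n) M"
      using hw by (simp_all add: simple_of_highest_weight_def simple_module_def)
    interpret left_module "uea n" M by (rule M)
    interpret K: ideal "rep_kernel (uea n) (tensor_power n r)" "uea n" by (rule rep_kernel_ideal[OF tensor_power_left_module])
    obtain v where v: "weight_vector n M \<mu> v" and pos: "\<And>X. X \<in> positive_root_vectors n \<Longrightarrow> uea_incl n X \<odot>\<^bsub>M\<^esub> v = \<zero>\<^bsub>M\<^esub>"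
      using hw by (auto simp: simple_of_highest_weight_def)
    have vM: "v \<in> carrier M" "v \<noteq> \<zero>\<^bsub>M\<^esub>" using v by (auto simp: weight_vector_def)
    have uc: "u \<in> carrier (uea n)" using u unfolding rep_kernel_def by blast
    obtain m where m: "m \<in> carrier M" "u \<odot>\<^bsub>M\<^esub> m \<noteq> \<zero>\<^bsub>M\<^esub>" using no uc unfolding rep_kernel_def by blast
    obtain a where a: "a \<in> carrier (uea n)" "m = a \<odot>\<^bsub>M\<^esub> v" using simple_module_generated[OF simp vM m(1)] by blast
    obtain b where b: "b \<in> carrier (uea n)" "v = b \<odot>\<^bsub>M\<^esub> (u \<odot>\<^bsub>M\<^esub> m)"
      using simple_module_generated[OF simp _ m(2) vM(1)] m(1) uc by blast
    \<comment> \<open>As \<open>M\<close> is simple, a nonzero action of \<open>u\<close> can be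
      completed on both sides to an element that fixes \<open>v\<close> and still kills all
      tensors.\<close>
    have "b \<otimes>\<^bsub>uea n\<^esub> u \<otimes>\<^bsub>uea n\<^esub> a \<in> rep_kernel (uea n) (tensor_power n r)"
      by (intro K.I_r_closed K.I_l_closed u a b)
    moreover have "(b \<otimes>\<^bsub>uea n\<^esub> u \<otimes>\<^bsub>uea n\<^esub> a) \<odot>\<^bsub>M\<^esub> v = v"
      using smult_assoc1[OF R.m_closed[OF b(1) uc] a(1) vM(1)] smult_assoc1[OF b(1) uc m(1)]
      by (simp only: a(2)[symmetric] b(2)[symmetric])
    moreover obtain x where x: "x \<in> carrier (gens_alg n)" "b \<otimes>\<^bsub>uea n\<^esub> u \<otimes>\<^bsub>uea n\<^esub> a = usub n x"
      using usub_surj[OF n] a b uc R.m_closed by metis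
    ultimately have xk: "usub n x \<in> rep_kernel (uea n) (tensor_power n r)" and xv: "usub n x \<odot>\<^bsub>M\<^esub> v = v" by simp_all
    obtain t where t: "t \<in> tensors n r" "t \<noteq> (\<lambda>_. 0)"
      "\<And>i. i < n \<Longrightarrow> TA n r (emat n i) t = (\<lambda>_. 0) \<and> TA n r (hmat n i) t = (\<lambda>w. \<mu> $ i * t w)"
      using tensor_dominant_weightsD[OF n \<mu>] unfolding has_highest_def by blast
    obtain z s N where z: "N \<noteq> 0"
      "\<And>A. free_scalars.hw_annihilator n ge gf gH (\<lambda>i. \<mu> $ i) A \<Longrightarrow> z - const N \<in> A \<and> z * x - const s \<in> A"
      using highest_component_carrier[OF n x(1), of r "\<lambda>i. \<mu> $ i"] by blast
    have "tact n r x t = (\<lambda>_. 0)"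
      using xk t(1) unfolding usub_rep_kernel[OF n x(1)] pres_ideal_iff_kills[OF n x(1)] kills_def by blast
    then have "tact n r (z * x - const s) t = (\<lambda>w. - (s * t w))"
      by (simp add: tact_diff tact_mult tact_const tact_zero_right)
    moreover have "tact n r (z * x - const s) t = (\<lambda>_. 0)"
      using z(2)[OF hw_annihilator_tensor[OF n t(1,3)]] by blast
    ultimately have s: "s = 0" using t(2) by (auto simp: fun_eq_iff)
    have "free_scalars.hw_annihilator n ge gf gH (\<lambda>i. \<mu> $ i) {q. usub n q \<odot>\<^bsub>M\<^esub> v = \<zero>\<^bsub>M\<^esub>}"
    proof (rule hw_annihilator_module[OF n M vM(1)])
      show "usub n (ge i) \<odot>\<^bsub>M\<^esub> v = \<zero>\<^bsub>M\<^esub>" if "i < n" for i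
        using pos[OF emat_positive[OF n that]] that by (simp add: uea_incl_gens)
      show "usub n (gH i) \<odot>\<^bsub>M\<^esub> v = usub n (const (\<mu> $ i)) \<odot>\<^bsub>M\<^esub> v" if "i < n" for i
        using v that usub_ops(4,6)[OF n] by (simp add: weight_vector_def uea_incl_gens)
    qed
    from z(2)[OF this] have zv: "usub n z \<odot>\<^bsub>M\<^esub> v = usub n (const N) \<odot>\<^bsub>M\<^esub> v"
      "usub n (z * x) \<odot>\<^bsub>M\<^esub> v = \<zero>\<^bsub>M\<^esub>"
      using usub_act(5,7)[OF n M vM(1)] s by auto
    have "usub n (const N) \<odot>\<^bsub>M\<^esub> v = \<zero>\<^bsub>M\<^esub>"
      using zv xv usub_act(3)[OF n M vM(1)] by simp
    then have "usub n (const (1 / N) * const N) \<odot>\<^bsub>M\<^esub> v = \<zero>\<^bsub>M\<^esub>"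
      using usub_act(3,6)[OF n M vM(1)] by simp
    then have "usub n 1 \<odot>\<^bsub>M\<^esub> v = \<zero>\<^bsub>M\<^esub>" using z(1) by (simp flip: const_mult add: const_one)
    then show False using usub_act(4)[OF n M vM(1)] vM by simp
  qed
  then show "u \<in> schur_ideal n (tensor_dominant_weights n r)"
    using u unfolding schur_ideal_def rep_kernel_def by blast
qed

section \<open>All positive root vectors kill a highest weight vector\<close>

lemma MT_fbr_hmat:
  assumes i: "i < n" and pq: "p < 2 * n" "q < 2 * n"
  shows "fbr (2 * n) (hmat n i) X p q = (dl p i - dl p (i + n) - (dl q i - dl q (i + n))) * X p q"
proof -
  have h: "hmat n i a b = dl a b * (dl b i - dl b (i + n))" for a b
    using i by (auto simp: hmat_def Gm_def bar_def dl_def)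
  have "fmul (2 * n) (hmat n i) X p q = (\<Sum>s<2 * n. dl p s * ((dl s i - dl s (i + n)) * X s q))"
    by (simp add: fmul_def h mult.assoc)
  also have "\<dots> = (dl p i - dl p (i + n)) * X p q" by (rule sum_dl'[OF pq(1)])
  finally have 1: "fmul (2 * n) (hmat n i) X p q = (dl p i - dl p (i + n)) * X p q" .
  have "fmul (2 * n) X (hmat n i) p q = (\<Sum>s<2 * n. dl s q * (X p s * (dl q i - dl q (i + n))))"
    by (simp add: fmul_def h mult_ac)
  also have "\<dots> = X p q * (dl q i - dl q (i + n))" by (rule sum_dl[OF pq(2)])
  finally show ?thesis unfolding fbr_def 1 by (simp add: algebra_simps)
qed

lemma height_index: "a < 2 * n \<Longrightarrow> height n (\<lambda>i. dl a i - dl a (i + n)) = of_int (ht n a)"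
proof -
  assume a: "a < 2 * n"
  show ?thesis
  proof (cases "a < n")
    case True
    have "height n (\<lambda>i. dl a i - dl a (i + n)) = (\<Sum>k<n. dl a k * of_nat (n - 1 - k))"
      unfolding height_def using True by (intro sum.cong refl) (simp add: dl_def)
    also have "\<dots> = of_nat (n - 1 - a)" by (rule sum_dl'[OF True])
    finally show ?thesis using True by (simp add: ht_def of_nat_diff)
  next
    case False
    then have b: "a - n < n" using a by simp
    have "height n (\<lambda>i. dl a i - dl a (i + n)) = (\<Sum>k<n. dl (a - n) k * - of_nat (n - 1 - k))"
      unfolding height_def using False by (intro sum.cong refl) (auto simp: dl_def)
    also have "\<dots> = - of_nat (n - 1 - (a - n))" by (rule sum_dl'[OF b])
    finally show ?thesis using False b by (simp add: ht_def of_nat_diff)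
  qed
qed

text \<open>A nonzero entry at \<open>(a, b)\<close> forces the root to be the difference of the
  weights of the basis vectors \<open>a\<close> and \<open>b\<close>, of height
  \<open>ht n a - ht n b\<close>; a nonzero nonnegative combination of simple roots has positive
  height.\<close>

lemma positive_root_height:
  assumes n: "3 \<le> n" and X: "X \<in> positive_root_vectors n"
    and ab: "a < 2 * n" "b < 2 * n" "X $$ (a, b) \<noteq> 0"
  shows "ht n b < ht n a"
proof -
  have n2: "2 \<le> n" using n by simp
  obtain \<beta> c where \<beta>: "\<beta> \<in> carrier_vec n" "\<beta> \<noteq> 0\<^sub>v n" "X \<in> root_space n \<beta>"
    and c0: "\<forall>k<n. \<beta> $ k - 0\<^sub>v n $ k = (\<Sum>i<n. of_nat (c i) * simple_root n i $ k)"
    using X unfolding positive_root_vectors_def dominance_le_def by blast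
  have c: "\<beta> $ k = (\<Sum>i<n. of_nat (c i) * rootc n i k)" if "k < n" for k
    using c0 that simple_root_rootc(2)[OF n2 that] by simp
  have Xc: "X \<in> carrier_mat (2 * n) (2 * n)" using \<beta>(3) by (simp add: root_space_def so_even_def)
  define x where "x = (\<lambda>p q. X $$ (p, q))"
  have MX: "X = MT n x" using Xc by (intro eq_matI) (auto simp: MT_def x_def)
  have \<beta>ab: "\<beta> $ i = dl a i - dl a (i + n) - (dl b i - dl b (i + n))" if i: "i < n" for i
  proof -
    have "cartan_H n i * X - X * cartan_H n i = \<beta> $ i \<cdot>\<^sub>m X" using \<beta>(3) i by (simp add: root_space_def)
    then have "MT n (fbr (2 * n) (hmat n i) x) = MT n (fscale (\<beta> $ i) x)"
      unfolding MX cartan_H_MT[OF i] MT_ops .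
    from arg_cong[OF this, of "\<lambda>M. M $$ (a, b)"] have "fbr (2 * n) (hmat n i) x a b = fscale (\<beta> $ i) x a b"
      using ab by (simp add: MT_def)
    then show ?thesis using ab by (simp add: MT_fbr_hmat[OF i ab(1,2)] fscale_def x_def)
  qed
  have "height n (\<lambda>k. \<beta> $ k) = (\<Sum>k<n. \<Sum>i<n. of_nat (c i) * (of_nat (n - 1 - k) * rootc n i k))"
    unfolding height_def by (intro sum.cong refl) (simp add: c sum_distrib_left mult_ac)
  also have "\<dots> = (\<Sum>i<n. of_nat (c i) * height n (rootc n i))"
    by (subst sum.swap) (simp add: height_def sum_distrib_left)
  also have "\<dots> = (\<Sum>i<n. of_nat (c i))" using height_root n2 by simp
  finally have 1: "height n (\<lambda>k. \<beta> $ k) = (\<Sum>i<n. of_nat (c i))" .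
  have "height n (\<lambda>k. \<beta> $ k) = height n (\<lambda>i. dl a i - dl a (i + n)) - height n (\<lambda>i. dl b i - dl b (i + n))"
    unfolding height_def sum_subtractf[symmetric] by (intro sum.cong refl) (simp add: \<beta>ab right_diff_distrib)
  then have 2: "of_int (ht n a) - of_int (ht n b) = (\<Sum>i<n. of_nat (c i) :: rat)"
    using 1 height_index ab by simp
  have "\<exists>i<n. c i \<noteq> 0"
  proof (rule ccontr)
    assume "\<not> (\<exists>i<n. c i \<noteq> 0)"
    then have "\<beta> $ k = 0" if "k < n" for k using c[OF that] by simp
    then have "\<beta> = 0\<^sub>v n" using \<beta>(1) by (intro eq_vecI) auto
    then show False using \<beta>(2) by simp
  qed
  then obtain i where "i < n" "c i \<noteq> 0" by blast
  then have "(\<Sum>i<n. of_nat (c i) :: rat) > 0" by (intro sum_pos2[of "{..<n}" i]) auto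
  then show ?thesis using 2 by simp
qed

text \<open>Highest weight modules are defined by all positive root vectors, while the presented
  algebra speaks only of the \<open>e i\<close>. The matrices whose image kills \<open>v\<close> are
  closed under brackets, so \<open>positive_closure\<close> and \<open>so_even_span\<close> close
  the gap.\<close>

lemma positive_root_vectors_kill:
  assumes n: "3 \<le> n" and M: "left_module (uea n) M" and v: "v \<in> carrier M"
    and e: "\<And>i. i < n \<Longrightarrow> usub n (ge i) \<odot>\<^bsub>M\<^esub> v = \<zero>\<^bsub>M\<^esub>"
    and X: "X \<in> positive_root_vectors n"
  shows "uea_incl n X \<odot>\<^bsub>M\<^esub> v = \<zero>\<^bsub>M\<^esub>"
proof -
  interpret left_module "uea n" M by (rule M)
  define Q where "Q X \<longleftrightarrow> MT n X \<in> so_even n \<and>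
    (\<exists>p. usub n p = uea_incl n (MT n X) \<and> usub n p \<odot>\<^bsub>M\<^esub> v = \<zero>\<^bsub>M\<^esub>)" for X
  note a = usub_act[OF n M v] and a0 = usub_act(6)[OF n M v]
  note so = so_ideal_closed
  have eqv: "usub n p = uea_incl n (MT n X) \<longleftrightarrow> subst_mat n p - var (MT n X) \<in> so_ideal n" for p X
    unfolding uea_incl_def usub_def ucl_def[symmetric] by (rule ucl_eq)
  have QI: "Q X" if "MT n X \<in> so_even n" "subst_mat n p - var (MT n X) \<in> so_ideal n" "usub n p \<odot>\<^bsub>M\<^esub> v = \<zero>\<^bsub>M\<^esub>" for X p
    unfolding Q_def eqv using that by blast
  have QE: "\<exists>p. MT n X \<in> so_even n \<and> subst_mat n p - var (MT n X) \<in> so_ideal n \<and> usub n p \<odot>\<^bsub>M\<^esub> v = \<zero>\<^bsub>M\<^esub>" if "Q X" for X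
    using that unfolding Q_def eqv by blast
  have tr: "x - z \<in> so_ideal n" if "x - y \<in> so_ideal n" "z - y \<in> so_ideal n" for x y z
    using so(2)[OF that] by simp
  have Q_add: "Q (fadd X Y)" if XY: "Q X" "Q Y" for X Y
  proof -
    obtain p q where p: "MT n X \<in> so_even n" "subst_mat n p - var (MT n X) \<in> so_ideal n" "usub n p \<odot>\<^bsub>M\<^esub> v = \<zero>\<^bsub>M\<^esub>"
      and q: "MT n Y \<in> so_even n" "subst_mat n q - var (MT n Y) \<in> so_ideal n" "usub n q \<odot>\<^bsub>M\<^esub> v = \<zero>\<^bsub>M\<^esub>"
      using QE[OF XY(1)] QE[OF XY(2)] by metis
    show ?thesis
    proof (rule QI[OF so_even_MT(1)[OF p(1) q(1)], of "p + q"])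
      have "subst_mat n (p + q) - (var (MT n X) + var (MT n Y)) \<in> so_ideal n"
        using so(1)[OF p(2) q(2)] by (simp add: subst_mat_add algebra_simps)
      from tr[OF this var_MT_rels(1)[OF p(1) q(1)]] show "subst_mat n (p + q) - var (MT n (fadd X Y)) \<in> so_ideal n" .
      show "usub n (p + q) \<odot>\<^bsub>M\<^esub> v = \<zero>\<^bsub>M\<^esub>" using p(3) q(3) by (simp add: a(2))
    qed
  qed
  have Q_scale: "Q (fscale c X)" if XQ: "Q X" for c X
  proof -
    obtain p where p: "MT n X \<in> so_even n" "subst_mat n p - var (MT n X) \<in> so_ideal n" "usub n p \<odot>\<^bsub>M\<^esub> v = \<zero>\<^bsub>M\<^esub>"
      using QE[OF XQ] by metis
    show ?thesis
    proof (rule QI[OF so_even_MT(2)[OF p(1)], of "const c * p"])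
      have "subst_mat n (const c * p) - const c * var (MT n X) \<in> so_ideal n"
        using so(5)[OF const_carrier p(2), of c] by (simp add: subst_mat_mult subst_mat_const algebra_simps)
      from tr[OF this var_MT_rels(2)[OF p(1)]] show "subst_mat n (const c * p) - var (MT n (fscale c X)) \<in> so_ideal n" .
      show "usub n (const c * p) \<odot>\<^bsub>M\<^esub> v = \<zero>\<^bsub>M\<^esub>" using p(3) a0 by (simp add: a(3))
    qed
  qed
  have Q_zero: "Q fzero"
    using var_MT_rels(4)[OF so_even_MT(4)] so(3) by (intro QI[of _ 0] so_even_MT(4)) (auto simp: subst_mat_zero a(5))
  have Q_br: "Q (fbr (2 * n) X Y)" if XY: "Q X" "Q Y" for X Y
  proof -
    obtain p q where p: "MT n X \<in> so_even n" "subst_mat n p - var (MT n X) \<in> so_ideal n" "usub n p \<odot>\<^bsub>M\<^esub> v = \<zero>\<^bsub>M\<^esub>"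
      and q: "MT n Y \<in> so_even n" "subst_mat n q - var (MT n Y) \<in> so_ideal n" "usub n q \<odot>\<^bsub>M\<^esub> v = \<zero>\<^bsub>M\<^esub>"
      using QE[OF XY(1)] QE[OF XY(2)] by metis
    let ?X = "var (MT n X)" and ?Y = "var (MT n Y)" and ?p = "subst_mat n p" and ?q = "subst_mat n q"
    note S = subst_mat_carrier[OF n] and V = var_carrier
    show ?thesis
    proof (rule QI[OF so_even_MT(3)[OF p(1) q(1)], of "p * q - q * p"])
      have "?p * (?q - ?Y) + (?p - ?X) * ?Y - (?q * (?p - ?X) + (?q - ?Y) * ?X) \<in> so_ideal n"
        by (intro so(1,2) so(5)[OF S p(2)] so(5)[OF S q(2)] so(6)[OF V[OF q(1)] p(2)] so(6)[OF V[OF p(1)] q(2)])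
      then have "subst_mat n (p * q - q * p) - (?X * ?Y - ?Y * ?X) \<in> so_ideal n"
        by (simp add: subst_mat_diff subst_mat_mult algebra_simps)
      from so(1)[OF this var_MT_rels(3)[OF p(1) q(1)]]
      show "subst_mat n (p * q - q * p) - var (MT n (fbr (2 * n) X Y)) \<in> so_ideal n" by simp
      show "usub n (p * q - q * p) \<odot>\<^bsub>M\<^esub> v = \<zero>\<^bsub>M\<^esub>"
        unfolding a(7) a(3) p(3) q(3) a0 ..
    qed
  qed
  have Q_e: "Q (emat n i)" if "i < n" for i
    using e[OF that] gens_so(1)[OF n that] so(4) that by (intro QI[of _ "ge i"]) (auto simp: subst_mat_gens)
  have Q_Gm: "Q (Gm n a b)" if "a < 2 * n" "b < 2 * n" "X $$ (a, b) \<noteq> 0" for a b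
    by (rule positive_closure[where L = "\<lambda>_. Q"])
       (use n that Q_e Q_br Q_scale Q_zero positive_root_height[OF n X that] in auto)
  have "X \<in> so_even n" using X by (auto simp: positive_root_vectors_def root_space_def)
  then show ?thesis
  proof (rule so_even_span)
    show "Q (Gm n a b)" if "a < 2 * n" "b < 2 * n" "X $$ (a, b) \<noteq> 0" for a b by (rule Q_Gm[OF that])
    show "uea_incl n X \<odot>\<^bsub>M\<^esub> v = \<zero>\<^bsub>M\<^esub>" if "X = MT n Y" "Q Y" for Y
      using that by (auto simp: Q_def)
  qed (fact Q_zero Q_add Q_scale)+
qed

section \<open>Simple submodules of the tensor power and the second inclusion\<close>

lemma submodule_left_module:
  assumes "left_module R M" "submodule N R M"
  shows "left_module R (M\<lparr>carrier := N\<rparr>)"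
proof -
  interpret left_module R M by (rule assms(1))
  interpret N: submodule N R M by (rule assms(2))
  have sub: "N \<subseteq> carrier M" using N.subset by simp
  have ab: "abelian_group (M\<lparr>carrier := N\<rparr>)"
  proof (rule abelian_groupI)
    fix x assume x: "x \<in> carrier (M\<lparr>carrier := N\<rparr>)"
    then have "\<ominus>\<^bsub>M\<^esub> x \<in> N" "\<ominus>\<^bsub>M\<^esub> x \<oplus>\<^bsub>M\<^esub> x = \<zero>\<^bsub>M\<^esub>"
      using N.m_inv_closed[of x] M.l_neg[OF subsetD[OF sub]] by (simp_all add: a_inv_def)
    then show "\<exists>y\<in>carrier (M\<lparr>carrier := N\<rparr>). y \<oplus>\<^bsub>M\<lparr>carrier := N\<rparr>\<^esub> x = \<zero>\<^bsub>M\<lparr>carrier := N\<rparr>\<^esub>" by auto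
  next
    fix x y z assume "x \<in> carrier (M\<lparr>carrier := N\<rparr>)" "y \<in> carrier (M\<lparr>carrier := N\<rparr>)" "z \<in> carrier (M\<lparr>carrier := N\<rparr>)"
    then have "x \<in> carrier M" "y \<in> carrier M" "z \<in> carrier M" using sub by auto
    then show "x \<oplus>\<^bsub>M\<lparr>carrier := N\<rparr>\<^esub> y \<oplus>\<^bsub>M\<lparr>carrier := N\<rparr>\<^esub> z =
        x \<oplus>\<^bsub>M\<lparr>carrier := N\<rparr>\<^esub> (y \<oplus>\<^bsub>M\<lparr>carrier := N\<rparr>\<^esub> z)"
      by (simp add: M.a_assoc)
  next
    fix x y assume "x \<in> carrier (M\<lparr>carrier := N\<rparr>)" "y \<in> carrier (M\<lparr>carrier := N\<rparr>)"
    then have "x \<in> carrier M" "y \<in> carrier M" using sub by auto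
    then show "x \<oplus>\<^bsub>M\<lparr>carrier := N\<rparr>\<^esub> y = y \<oplus>\<^bsub>M\<lparr>carrier := N\<rparr>\<^esub> x" by (simp add: M.a_comm)
  next
    fix x assume "x \<in> carrier (M\<lparr>carrier := N\<rparr>)"
    then have "x \<in> carrier M" using sub by auto
    then show "\<zero>\<^bsub>M\<lparr>carrier := N\<rparr>\<^esub> \<oplus>\<^bsub>M\<lparr>carrier := N\<rparr>\<^esub> x = x" by simp
  qed (use N.m_closed N.one_closed in auto)
  show ?thesis
  proof (intro left_module.intro R.ring_axioms ab left_module_axioms.intro)
    fix a x assume "a \<in> carrier R" "x \<in> carrier (M\<lparr>carrier := N\<rparr>)"
    then show "a \<odot>\<^bsub>M\<lparr>carrier := N\<rparr>\<^esub> x \<in> carrier (M\<lparr>carrier := N\<rparr>)" using N.smult_closed by simp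
  qed (use smult_l_distr smult_r_distr smult_assoc1 sub in \<open>simp_all add: subsetD\<close>)
qed

lemma submodule_restrict:
  assumes "left_module R M" "submodule N R M" "submodule S R (M\<lparr>carrier := N\<rparr>)"
  shows "S \<subseteq> N" "\<zero>\<^bsub>M\<^esub> \<in> S" "a \<in> carrier R \<Longrightarrow> x \<in> S \<Longrightarrow> a \<odot>\<^bsub>M\<^esub> x \<in> S"
proof -
  interpret S: submodule S R "M\<lparr>carrier := N\<rparr>" by (rule assms(3))
  show "S \<subseteq> N" "\<zero>\<^bsub>M\<^esub> \<in> S" using S.subset S.one_closed by auto
  show "a \<in> carrier R \<Longrightarrow> x \<in> S \<Longrightarrow> a \<odot>\<^bsub>M\<^esub> x \<in> S" using S.smult_closed by simp
qed

text \<open>Applied to a tensor, a highest weight element \<open>w\<close> of the presented algebra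
  gives 0 or a highest weight vector, and the submodule generated by the latter is simple because
  the left ideal of \<open>w\<close> is.\<close>

lemma schur_ideal_kills:
  assumes n: "3 \<le> n" and u: "u \<in> schur_ideal n (tensor_dominant_weights n r)"
    and t: "t \<in> tensors n r" and w: "pres_highest n r \<nu> w" and q: "q \<in> carrier (gens_alg n)"
  shows "u \<odot>\<^bsub>tensor_power n r\<^esub> (tact n r q (tact n r w t)) = (\<lambda>_. 0)"
proof -
  let ?M = "tensor_power n r"
  interpret left_module "uea n" ?M by (rule tensor_power_left_module)
  note M = tensor_power_left_module[of n r] and act = tensor_power_act[OF n]
  note R = pres_reducible[OF n, of r, unfolded pres_reducible_def]
  have uc: "u \<in> carrier (uea n)" using u unfolding schur_ideal_def by blast
  define s where "s = tact n r w t"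
  have s: "s \<in> tensors n r" using t by (simp add: s_def tact_closed)
  have wF: "w \<in> carrier (gens_alg n)" using w by (simp add: pres_highest_def)
  have kill: "tact n r x t = (\<lambda>_. 0)" if "x \<in> pres_ideal n r" for x
    using pres_ideal_kills[OF n that] t by (simp add: kills_def)
  have es: "TA n r (emat n i) s = (\<lambda>_. 0)" if "i < n" for i
  proof -
    have "ge i * w \<in> pres_ideal n r" using w that by (simp add: pres_highest_def)
    from kill[OF this] show ?thesis by (simp add: s_def tact_mult tact_gens that)
  qed
  have Hs: "TA n r (hmat n i) s = (\<lambda>w. \<nu> i * s w)" if "i < n" for i
  proof -
    have "gH i * w - const (\<nu> i) * w \<in> pres_ideal n r" using w that by (simp add: pres_highest_def)
    from kill[OF this] show ?thesis by (simp add: s_def tact_diff tact_mult tact_const tact_gens that fun_eq_iff)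
  qed
  show ?thesis
  proof (cases "s = (\<lambda>_. 0)")
    case True
    have "u \<odot>\<^bsub>?M\<^esub> \<zero>\<^bsub>?M\<^esub> = \<zero>\<^bsub>?M\<^esub>" by (rule left_module_zero(2)[OF M uc M.zero_closed])
    then show ?thesis using True by (simp add: s_def[symmetric] tact_zero_right tensor_power_ops)
  next
    case False
    have sM: "s \<in> carrier ?M" using s by (simp add: tensors_carrier)
    define N where "N = (\<lambda>a. a \<odot>\<^bsub>?M\<^esub> s) ` carrier (uea n)"
    have N: "submodule N (uea n) ?M" unfolding N_def by (rule cyclic_submodule[OF M sM])
    have tactN: "tact n r p s \<in> N" for p
      unfolding N_def act[OF s, symmetric] using usub_ops(1)[OF n] by blast
    have sN: "s \<in> N" using tactN[of 1] by (simp add: tact_one)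
    let ?N = "?M\<lparr>carrier := N\<rparr>"
    have NM: "left_module (uea n) ?N" by (rule submodule_left_module[OF M N])
    have "simple_module (uea n) ?N"
      unfolding simple_module_def
    proof (intro conjI allI impI NM)
      show "carrier ?N \<noteq> {\<zero>\<^bsub>?N\<^esub>}" using sN False by (auto simp: tensor_power_ops)
      fix S assume S: "submodule S (uea n) ?N"
      note S = submodule_restrict[OF M N S]
      show "S = {\<zero>\<^bsub>?N\<^esub>} \<or> S = carrier ?N"
      proof (cases "S \<subseteq> {\<zero>\<^bsub>?M\<^esub>}")
        case True
        then show ?thesis using S(2) by auto
      next
        case nz: False
        then obtain x where x: "x \<in> S" "x \<noteq> \<zero>\<^bsub>?M\<^esub>" by blast
        then obtain a where a: "a \<in> carrier (uea n)" "x = a \<odot>\<^bsub>?M\<^esub> s" using S(1) unfolding N_def by blast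
        obtain y where y: "y \<in> carrier (gens_alg n)" "a = usub n y" using usub_surj[OF n a(1)] by blast
        have xt: "x = tact n r (y * w) t" unfolding a(2) y(2) act[OF s] by (simp add: tact_mult s_def)
        then have "y * w \<notin> pres_ideal n r" using kill x(2) by (auto simp: tensor_power_ops)
        \<comment> \<open>Simplicity in the presented algebra leads from \<open>y * w\<close> back
          to \<open>w\<close>; applied to \<open>t\<close>, this leads from \<open>x\<close> back to
          the generator \<open>s\<close>.\<close>
        then obtain b where b: "b \<in> carrier (gens_alg n)" "b * (y * w) - w \<in> pres_ideal n r"
          using R y(1) w by meson
        have "tact n r b x = s"
          using kill[OF b(2)] by (simp add: xt s_def tact_diff tact_mult fun_eq_iff)
        moreover have "x \<in> tensors n r" by (simp add: xt tact_closed t)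
        ultimately have "usub n b \<odot>\<^bsub>?M\<^esub> x = s" by (simp add: act)
        then have sS: "s \<in> S" using S(3)[OF usub_ops(1)[OF n] x(1)] by metis
        have "N \<subseteq> S" unfolding N_def using S(3)[OF _ sS] by blast
        then show ?thesis using S(1) by auto
      qed
    qed
    moreover have wv: "weight_vector n ?M (vec n \<nu>) s"
      unfolding tensor_power_weight[OF n] using s False Hs by simp
    then have "weight_vector n ?N (vec n \<nu>) s" using sN by (simp add: weight_vector_def)
    moreover have "uea_incl n X \<odot>\<^bsub>?N\<^esub> s = \<zero>\<^bsub>?N\<^esub>" if "X \<in> positive_root_vectors n" for X
      using positive_root_vectors_kill[OF n M sM _ that] es by (simp add: act[OF s] tact_gens tensor_power_ops)
    ultimately have "simple_of_highest_weight n ?N (vec n \<nu>)"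
      unfolding simple_of_highest_weight_def by blast
    moreover have "vec n \<nu> \<in> tensor_dominant_weights n r"
      using tensor_dominant_weightsI[OF n _ _ wv] R w by blast
    \<comment> \<open>\<open>?N\<close> consists of tensors and not of elements of the type over
      which \<open>schur_ideal\<close> quantifies; \<open>schur_ideal_annihilates\<close> bridges
      this.\<close>
    ultimately have "u \<in> rep_kernel (uea n) ?N" using schur_ideal_annihilates[OF u] by blast
    then have "u \<odot>\<^bsub>?M\<^esub> x = \<zero>\<^bsub>?M\<^esub>" if "x \<in> N" for x using that by (simp add: rep_kernel_def)
    then show ?thesis using tactN[of q] by (simp add: s_def tensor_power_ops)
  qed
qed

lemma schur_ideal_eq:
  assumes n: "3 \<le> n"
  shows "rep_kernel (uea n) (tensor_power n r) = schur_ideal n (tensor_dominant_weights n r)"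
proof (rule antisym[OF rep_kernel_subset[OF n]], rule subsetI)
  let ?M = "tensor_power n r"
  interpret left_module "uea n" ?M by (rule tensor_power_left_module)
  note R = pres_reducible[OF n, of r, unfolded pres_reducible_def]
  fix u assume u: "u \<in> schur_ideal n (tensor_dominant_weights n r)"
  then have uc: "u \<in> carrier (uea n)" unfolding schur_ideal_def by blast
  have "u \<odot>\<^bsub>?M\<^esub> t = (\<lambda>_. 0)" if t: "t \<in> tensors n r" for t
  proof -
    \<comment> \<open>Modulo the ideal of relations, 1 is a sum of multiples of highest weight
      elements; \<open>D\<close> is chosen so that \<open>u\<close> is seen to kill each summand
      applied to \<open>t\<close>.\<close>
    define D where "D = {x. u \<odot>\<^bsub>?M\<^esub> (tact n r x t) = (\<lambda>_. 0)}"
    have u0: "u \<odot>\<^bsub>?M\<^esub> (\<lambda>_. 0) = (\<lambda>_. 0)"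
      using left_module_zero(2)[OF tensor_power_left_module uc M.zero_closed] by (simp add: tensor_power_ops)
    have a: "pres_ideal n r \<subseteq> D"
      using pres_ideal_kills[OF n] t u0 by (auto simp: D_def kills_def)
    have b: "\<forall>x\<in>D. \<forall>\<nu> w. \<forall>q\<in>carrier (gens_alg n). pres_highest n r \<nu> w \<longrightarrow> q * w + x \<in> D"
    proof (intro ballI allI impI)
      fix x \<nu> w q assume x: "x \<in> D" and q: "q \<in> carrier (gens_alg n)" and w: "pres_highest n r \<nu> w"
      have "tact n r (q * w + x) t = tact n r (q * w) t \<oplus>\<^bsub>?M\<^esub> tact n r x t"
        by (simp add: tact_add tensor_power_ops)
      moreover have "tact n r p t \<in> carrier ?M" for p by (simp add: tensors_carrier tact_closed t)
      ultimately have "u \<odot>\<^bsub>?M\<^esub> tact n r (q * w + x) t =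
          u \<odot>\<^bsub>?M\<^esub> tact n r (q * w) t \<oplus>\<^bsub>?M\<^esub> u \<odot>\<^bsub>?M\<^esub> tact n r x t"
        using smult_r_distr[OF uc] by simp
      then show "q * w + x \<in> D"
        using schur_ideal_kills[OF n u t w q] x by (simp add: D_def tact_mult tensor_power_ops)
    qed
    have "1 \<in> D" by (rule conjunct1[OF R, THEN spec, THEN mp, THEN mp, OF a b])
    then show ?thesis by (simp add: D_def tact_one)
  qed
  then show "u \<in> rep_kernel (uea n) ?M"
    using uc by (simp add: rep_kernel_def tensors_carrier tensor_power_ops)
qed

text \<open>Both algebras are quotients of \<open>gens_alg n\<close>, one through
  \<open>usub\<close> and one directly. The first claim identifies the ideal of the former with the
  kernel of the action on tensors, whose preimage under \<open>usub\<close> is the ideal of the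
  relations.\<close>

theorem theorem2p3p1:
  fixes n r :: nat
  assumes "n \<ge> 3" and "r \<ge> 1"
  shows "rep_kernel (uea n) (tensor_power n r) = schur_ideal n (tensor_dominant_weights n r) \<and>
         alg_iso (gen_schur_algebra n (tensor_dominant_weights n r)) (type_D_presentation n r) \<noteq> {}"
proof
  define J where "J = schur_ideal n (tensor_dominant_weights n r)"
  show J: "rep_kernel (uea n) (tensor_power n r) = schur_ideal n (tensor_dominant_weights n r)"
    by (rule schur_ideal_eq[OF assms(1)])
  have idJ: "ideal J (uea n)"
    using rep_kernel_ideal[OF tensor_power_left_module] unfolding J_def J[symmetric] .
  interpret J: ideal J "uea n" by (rule idJ)
  let ?F = "carrier (gens_alg n)" and ?I = "pres_ideal n r"
    and ?G = "gen_schur_algebra n (tensor_dominant_weights n r)" and ?P = "type_D_presentation n r"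
  note u = usub_ops[OF assms(1)] and I = pres_ideal_closed[OF assms(1)]
  define \<Phi> where "\<Phi> p = J +>\<^bsub>uea n\<^esub> usub n p" for p
  define cs where "cs p = ?I +>\<^bsub>gens_alg n\<^esub> p" for p
  have idI: "ideal ?I (gens_alg n)" using assms(1) by (intro pres_ideal_ideal) simp
  have P: "?P = quot_alg (gens_alg n) ?I"
    by (simp add: type_D_presentation_def presented_algebra_def pres_ideal_def pres_rels_def)
  note Q = quot_free_algebra[OF idI, folded cs_def P]
  have G: "?G = quot_alg (uea n) J" by (simp add: gen_schur_algebra_def J_def)
  have \<Phi>_eq: "\<Phi> p = \<Phi> q \<longleftrightarrow> p - q \<in> ?I" if "p \<in> ?F" "q \<in> ?F" for p q
  proof -
    have "\<ominus>\<^bsub>uea n\<^esub> usub n q = usub n (- q)"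
      using u by (intro J.minus_equality) simp_all
    then have "usub n p \<ominus>\<^bsub>uea n\<^esub> usub n q = usub n (p - q)"
      unfolding a_minus_def by (simp add: u(2))
    then have "\<Phi> p = \<Phi> q \<longleftrightarrow> usub n (p - q) \<in> J"
      unfolding \<Phi>_def using J.quotient_eq_iff_same_a_r_cos[OF idJ u(1) u(1), of p q] by simp
    also have "\<dots> \<longleftrightarrow> p - q \<in> ?I"
      unfolding J_def J[symmetric] by (rule usub_rep_kernel[OF assms(1) fa_closed(4)[OF that]])
    finally show ?thesis .
  qed
  have cs_eq: "cs p = cs q \<longleftrightarrow> p - q \<in> ?I" for p q unfolding cs_def by (rule fa_coset_eq[OF idI])
  have \<Phi>_carrier: "carrier ?G = \<Phi> ` ?F"
  proof
    show "\<Phi> ` ?F \<subseteq> carrier ?G"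
      using u(1) by (auto simp: G \<Phi>_def quot_alg_def FactRing_def A_RCOSETS_def')
    show "carrier ?G \<subseteq> \<Phi> ` ?F"
    proof
      fix X assume "X \<in> carrier ?G"
      then obtain x where x: "x \<in> carrier (uea n)" "X = J +>\<^bsub>uea n\<^esub> x"
        by (auto simp: G quot_alg_def FactRing_def A_RCOSETS_def')
      obtain p where "p \<in> ?F" "x = usub n p" using usub_surj[OF assms(1) x(1)] by blast
      then show "X \<in> \<Phi> ` ?F" using x(2) by (simp add: \<Phi>_def)
    qed
  qed
  have \<Phi>_add: "\<Phi> p \<oplus>\<^bsub>?G\<^esub> \<Phi> q = \<Phi> (p + q)" and \<Phi>_mult: "\<Phi> p \<otimes>\<^bsub>?G\<^esub> \<Phi> q = \<Phi> (p * q)" for p q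
    using J.a_rcos_sum[OF u(1) u(1), of p q] J.rcoset_mult_add[OF u(1) u(1), of p q]
    by (simp_all add: G \<Phi>_def quot_alg_def FactRing_def u(2,3))
  have \<Phi>_one: "\<one>\<^bsub>?G\<^esub> = \<Phi> 1" by (simp add: G \<Phi>_def quot_alg_def FactRing_def u(4))
  have \<Phi>_smult: "c \<odot>\<^bsub>?G\<^esub> \<Phi> p = \<Phi> (const c * p)" if p: "p \<in> ?F" for c p
  proof -
    have 1: "J +>\<^bsub>uea n\<^esub> (c \<odot>\<^bsub>uea n\<^esub> x) = \<Phi> (const c * p)" if x: "x \<in> \<Phi> p" for x
    proof -
      have "x \<in> carrier (uea n)" using x J.a_r_coset_subset_G[OF J.a_subset u(1)] unfolding \<Phi>_def by blast
      then obtain q where q: "q \<in> ?F" "x = usub n q" using usub_surj[OF assms(1)] by blast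
      have "\<Phi> q = \<Phi> p"
        using J.a_repr_independence[OF x[unfolded \<Phi>_def] u(1)] additive_subgroup.a_subgroup[OF J.is_additive_subgroup]
        by (simp add: \<Phi>_def q(2))
      then have "q - p \<in> ?I" using \<Phi>_eq q(1) p by simp
      from I(4)[OF const_carrier this, of c] have "const c * q - const c * p \<in> ?I" by (simp add: right_diff_distrib)
      then have "\<Phi> (const c * q) = \<Phi> (const c * p)"
        by (subst \<Phi>_eq) (auto intro!: fa_closed const_carrier q p)
      then show ?thesis by (simp add: \<Phi>_def q(2) u(6))
    qed
    have "usub n p \<in> \<Phi> p" unfolding \<Phi>_def by (rule J.a_rcos_self[OF u(1)])
    then have "(\<Union>x\<in>\<Phi> p. J +>\<^bsub>uea n\<^esub> (c \<odot>\<^bsub>uea n\<^esub> x)) = \<Phi> (const c * p)"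
      by (rule UN_constant_eq) (intro ballI 1)
    then show ?thesis by (simp add: G quot_alg_def)
  qed
  \<comment> \<open>The choice of \<open>p\<close> does not matter, since \<open>\<Phi>\<close> and
    \<open>cs\<close> identify the same pairs of elements.\<close>
  define h where "h X = cs (SOME p. p \<in> ?F \<and> \<Phi> p = X)" for X
  have h: "h (\<Phi> p) = cs p" if p: "p \<in> ?F" for p
  proof -
    have "\<exists>q. q \<in> ?F \<and> \<Phi> q = \<Phi> p" using p by blast
    from someI_ex[OF this] show ?thesis unfolding h_def cs_eq using \<Phi>_eq[OF _ p] by blast
  qed
  have "h \<in> ring_iso ?G ?P"
  proof (rule ring_iso_memI)
    show "bij_betw h (carrier ?G) (carrier ?P)"
      unfolding bij_betw_def
    proof
      show "inj_on h (carrier ?G)"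
        unfolding \<Phi>_carrier by (auto simp: inj_on_def h cs_eq \<Phi>_eq)
      have "h ` \<Phi> ` ?F = cs ` ?F" unfolding image_image by (intro image_cong refl h)
      then show "h ` carrier ?G = carrier ?P" unfolding \<Phi>_carrier Q(1) .
    qed
    show "h \<one>\<^bsub>?G\<^esub> = \<one>\<^bsub>?P\<^esub>" unfolding \<Phi>_one Q(2) by (rule h[OF fa_zero_one(2)])
    fix X assume "X \<in> carrier ?G"
    then obtain p where p: "p \<in> ?F" "X = \<Phi> p" unfolding \<Phi>_carrier by blast
    then show "h X \<in> carrier ?P" unfolding Q(1) by (simp add: h)
    fix Y assume "Y \<in> carrier ?G"
    then obtain q where q: "q \<in> ?F" "Y = \<Phi> q" unfolding \<Phi>_carrier by blast
    show "h (X \<otimes>\<^bsub>?G\<^esub> Y) = h X \<otimes>\<^bsub>?P\<^esub> h Y" "h (X \<oplus>\<^bsub>?G\<^esub> Y) = h X \<oplus>\<^bsub>?P\<^esub> h Y"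
      unfolding p(2) q(2) \<Phi>_mult \<Phi>_add h[OF p(1)] h[OF q(1)] Q(4,5)[OF p(1) q(1)]
      by (intro h fa_closed p q)+
  qed
  moreover have "h (c \<odot>\<^bsub>?G\<^esub> X) = c \<odot>\<^bsub>?P\<^esub> h X" if X: "X \<in> carrier ?G" for c X
  proof -
    obtain p where p: "p \<in> ?F" "X = \<Phi> p" using X unfolding \<Phi>_carrier by blast
    show ?thesis
      unfolding p(2) \<Phi>_smult[OF p(1)] h[OF p(1)] Q(6)[OF p(1)] by (intro h fa_closed const_carrier p)
  qed
  ultimately show "alg_iso ?G ?P \<noteq> {}" unfolding alg_iso_def by blast
qed

end
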